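(* Let $k$ be a field of characteristic zero and let $(A,x)$ be a pair consisting either of a discrete valuation ring $A$ with uniformizing parameter $x$ and residue field $k$, or of the polynomial ring $A=k[x]$ and its variable $x$. Every morphism of Danielewski-Fieseler surfaces with base $(A,x)$ factors into a finite sequence of fibered modifications followed by an open embedding.
   Context: Let $X=\mathrm{Spec}(A)$, $x_0=\mathrm{div}(x)$, $X_*=X\setminus\{x_0\}=\mathrm{Spec}(A_x)$. A Danielewski-Fieseler surface (DFS) with base $(A,x)$ is an integral affine $X$-scheme $\pi:S\to X$ of finite type such that $S|_{X_*}\simeq\mathbb{A}^1_{X_*}$ and the scheme-theoretic fiber $\pi^{-1}(x_0)$ is nonempty and reduced, consisting of a disjoint union of curves isomorphic to $\mathbb{A}^1_k$. A morphism of DFS's is a birational $X$-morphism $\beta:S'\to S$ restricting to an $X_*$-isomorphism $S'|_{X_*}\to S|_{X_*}$. Trees. A (rooted) tree $\Gamma$ is a nonempty finite poset with a unique minimal element $e_0$ such that $(\downarrow e)_\Gamma=\{e'\in\Gamma: e'\le e\}$ is a chain for every $e$. An element $e$ is at level $m$ if $\mathrm{Card}((\downarrow e)_\Gamma)=m+1$. Leaves are the maximal elements, $L(\Gamma)$ is the set of leaves; the set $\mathrm{Ch}_\Gamma(e)$ of children of a non-leaf $e$ is the set of minimal elements of $\{e'>e\}$. A maximal subtree is a subset $\{e'\ge e\}$ for some $e\in\Gamma$. The first common ancestor of $e,e'\in\Gamma\setminus\{e_0\}$ is the maximal element of $((\downarrow e)_\Gamma\setminus\{e\})\cap((\downarrow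 e')_\Gamma\setminus\{e'\})$. A morphism of trees is an order-preserving map $\tau:\Gamma'\to\Gamma$ mapping maximal chains onto maximal chains and such that each nonempty fiber $\tau^{-1}(\tau(e'))$ is $\{e'\}$ or a maximal subtree of $\Gamma'$. Labelled trees. An $(A,x)$-labelled tree is $\gamma=(\Gamma,\sigma)$ with $\Gamma$ a tree with leaves $e_1,\dots,e_n$ at levels $m_1,\dots,m_n$ and $\sigma\in A^n$ such that $\sigma_j-\sigma_i\in x^{d_{ij}}A\setminus x^{d_{ij}+1}A$ for $i\ne j$, $d_{ij}<\min(m_i,m_j)$ being the level of the first common ancestor of $e_i,e_j$. A morphism of labelled trees $(\Gamma',\sigma')\to(\Gamma,\sigma)$ is a morphism of trees $\tau$ such that $\sigma'_i-\sigma_{j(i)}\in x^{m_{j(i)}}A$ whenever $\tau(e'_i)=e_{j(i)}$ for a leaf $e'_i$ of $\Gamma'$. DFS of a labelled tree. $S(\gamma)$ is the DFS obtained by gluing $n$ copies $\mathrm{Spec}(A[T_i])$ over $X_*$ by $A_x[T_i]\to A_x[T_j]$, $T_i\mapsto x^{-m_i}(\sigma_j-\sigma_i)+x^{m_j-m_i}T_j$. A morphism of labelled trees $\tau:\gamma'\to\gamma$ defines a morphism of DFS's $\beta_\tau:S(\gamma')\to S(\gamma)$ given on charts $\mathrm{Spec}(A[T'_i])\to\mathrm{Spec}(A[T_{j(i)}])$ by $T_{j(i)}\mapsto x^{-m_{j(i)}}(\sigma'_i-\sigma_{j(i)})+x^{m'_i-m_{j(i)}}T'_i$, where $m'_i$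 is the level of $e'_i$. Fibered modifications. Let $\gamma'=(\Gamma',\sigma')$ be a labelled tree and $e'\in\Gamma'\setminus L(\Gamma')$ with $\mathrm{Ch}_{\Gamma'}(e')\subset L(\Gamma')$. A blow-down of the leaves at $e'$ is a morphism of labelled trees $\tau_{e'}:\gamma'\to\gamma$ where $\gamma$ has underlying tree $\Gamma'\setminus\mathrm{Ch}_{\Gamma'}(e')$ and $\tau_{e'}$ is the identity on $\Gamma'\setminus\mathrm{Ch}_{\Gamma'}(e')$ and maps $\mathrm{Ch}_{\Gamma'}(e')$ to $e'$. A morphism of DFS's $\beta:S'\to S$ is a fibered modification if there exist such a blow-down $\tau_{e'}:\gamma'\to\gamma$ and isomorphisms $\phi':S'\to S(\gamma')$, $\phi:S\to S(\gamma)$ with $\phi\circ\beta=\beta_{\tau_{e'}}\circ\phi'$. *)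

theory Defs
  imports
    "HOL-Analysis.Abstract_Topology"
    "HOL-Algebra.QuotRing"
    "HOL-Algebra.Generated_Rings"
    "HOL-Algebra.Ring_Divisibility"
    "HOL-Algebra.UnivPoly"
begin

section \<open>Localization and prime spectra\<close>

definition loc_rel :: "('r, 'm) ring_scheme \<Rightarrow> 'r set \<Rightarrow> (('r \<times> 'r) \<times> ('r \<times> 'r)) set" where
  "loc_rel R M = {((r, s), (r', s')). r \<in> carrier R \<and> r' \<in> carrier R \<and> s \<in> M \<and> s' \<in> M \<and>
     (\<exists>t\<in>M. t \<otimes>\<^bsub>R\<^esub> (r \<otimes>\<^bsub>R\<^esub> s' \<ominus>\<^bsub>R\<^esub> r' \<otimes>\<^bsub>R\<^esub> s) = \<zero>\<^bsub>R\<^esub>)}"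

definition loc_frac :: "('r, 'm) ring_scheme \<Rightarrow> 'r set \<Rightarrow> 'r \<Rightarrow> 'r \<Rightarrow> ('r \<times> 'r) set" where
  "loc_frac R M r s = loc_rel R M `` {(r, s)}"

definition loc_ring :: "('r, 'm) ring_scheme \<Rightarrow> 'r set \<Rightarrow> ('r \<times> 'r) set ring" where
  "loc_ring R M =
    \<lparr> carrier = (carrier R \<times> M) // loc_rel R M,
      monoid.mult = (\<lambda>p q. \<Union>(r, s)\<in>p. \<Union>(r', s')\<in>q. loc_frac R M (r \<otimes>\<^bsub>R\<^esub> r') (s \<otimes>\<^bsub>R\<^esub> s')),
      one = loc_frac R M \<one>\<^bsub>R\<^esub> \<one>\<^bsub>R\<^esub>,
      zero = loc_frac R M \<zero>\<^bsub>R\<^esub> \<one>\<^bsub>R\<^esub>,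
      add = (\<lambda>p q. \<Union>(r, s)\<in>p. \<Union>(r', s')\<in>q.
               loc_frac R M (r \<otimes>\<^bsub>R\<^esub> s' \<oplus>\<^bsub>R\<^esub> r' \<otimes>\<^bsub>R\<^esub> s) (s \<otimes>\<^bsub>R\<^esub> s')) \<rparr>"

text \<open>The map of localizations \<open>r/s \<mapsto> f(r)/f(s)\<close> induced by a ring homomorphism \<open>f\<close> into \<open>R\<close>
  that sends denominators into \<open>M\<close>.  As in the operations above, the members of the union all
  coincide.\<close>
definition loc_map :: "('t, 'm) ring_scheme \<Rightarrow> 't set \<Rightarrow> ('r \<Rightarrow> 't) \<Rightarrow>
    ('r \<times> 'r) set \<Rightarrow> ('t \<times> 't) set" where
  "loc_map R M f c = (\<Union>(r, s)\<in>c. loc_frac R M (f r) (f s))"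

definition powers :: "('r, 'm) ring_scheme \<Rightarrow> 'r \<Rightarrow> 'r set" where
  "powers R x = {x [^]\<^bsub>R\<^esub> n | n :: nat. True}"

definition prime_spec :: "('r, 'm) ring_scheme \<Rightarrow> 'r set set" where
  "prime_spec R = {P. primeideal P R}"

definition zariski :: "('r, 'm) ring_scheme \<Rightarrow> 'r set topology" where
  "zariski R = topology (\<lambda>U. \<exists>E \<subseteq> carrier R. U = {P \<in> prime_spec R. \<not> E \<subseteq> P})"

lemma istopology_zariski:
  "istopology (\<lambda>U. \<exists>E \<subseteq> carrier R. U = {P \<in> prime_spec R. \<not> E \<subseteq> P})"
  unfolding istopology_def
proof (intro conjI allI impI)
  fix U V
  assume "\<exists>E\<subseteq>carrier R. U = {P \<in> prime_spec R. \<not> E \<subseteq> P}"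
    and "\<exists>E\<subseteq>carrier R. V = {P \<in> prime_spec R. \<not> E \<subseteq> P}"
  then obtain E F where E: "E \<subseteq> carrier R" "U = {P \<in> prime_spec R. \<not> E \<subseteq> P}"
    and F: "F \<subseteq> carrier R" "V = {P \<in> prime_spec R. \<not> F \<subseteq> P}" by blast
  let ?G = "{r \<in> carrier R. \<exists>a\<in>E. \<exists>b\<in>F. r = a \<otimes>\<^bsub>R\<^esub> b}"
  have "U \<inter> V = {P \<in> prime_spec R. \<not> ?G \<subseteq> P}" (is "_ = ?W")
  proof (intro Set.set_eqI iffI)
    fix P assume "P \<in> U \<inter> V"
    then obtain a b where ab: "a \<in> E" "a \<notin> P" "b \<in> F" "b \<notin> P" and P: "P \<in> prime_spec R"
      using E F by blast
    then interpret primeideal P R by (simp add: prime_spec_def)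
    have "a \<in> carrier R" "b \<in> carrier R" using ab E F by auto
    then have "a \<otimes>\<^bsub>R\<^esub> b \<notin> P" "a \<otimes>\<^bsub>R\<^esub> b \<in> ?G" using I_prime ab by auto
    then show "P \<in> ?W" using P by auto
  next
    fix P assume P: "P \<in> ?W"
    then interpret primeideal P R by (simp add: prime_spec_def)
    from P obtain a b where "a \<in> E" "b \<in> F" "a \<otimes>\<^bsub>R\<^esub> b \<notin> P" by blast
    moreover from this E F have "a \<in> carrier R" "b \<in> carrier R" by auto
    ultimately have "a \<notin> P" "b \<notin> P" using I_l_closed I_r_closed by metis+
    moreover have "P \<in> prime_spec R" using P by simp
    ultimately show "P \<in> U \<inter> V" using \<open>a \<in> E\<close> \<open>b \<in> F\<close> E F by auto
  qed
  then show "\<exists>E\<subseteq>carrier R. U \<inter> V = {P \<in> prime_spec R. \<not> E \<subseteq> P}"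
    by (intro exI[of _ ?G]) simp
next
  fix K assume "\<forall>U\<in>K. \<exists>E\<subseteq>carrier R. U = {P \<in> prime_spec R. \<not> E \<subseteq> P}"
  from bchoice[OF this] obtain E
    where E: "\<forall>U\<in>K. E U \<subseteq> carrier R \<and> U = {P \<in> prime_spec R. \<not> E U \<subseteq> P}" by blast
  have "P \<in> \<Union> K \<longleftrightarrow> P \<in> prime_spec R \<and> \<not> (\<Union>U\<in>K. E U) \<subseteq> P" for P
  proof -
    have "P \<in> \<Union> K \<longleftrightarrow> (\<exists>U\<in>K. P \<in> {P \<in> prime_spec R. \<not> E U \<subseteq> P})"
      unfolding Union_iff using E by (intro bex_cong) auto
    also have "\<dots> \<longleftrightarrow> P \<in> prime_spec R \<and> \<not> (\<Union>U\<in>K. E U) \<subseteq> P"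
      by (simp only: mem_Collect_eq UN_subset_iff) blast
    finally show ?thesis .
  qed
  then have "\<Union> K = {P \<in> prime_spec R. \<not> (\<Union>U\<in>K. E U) \<subseteq> P}" by (simp add: Set.set_eq_iff)
  moreover have "(\<Union>U\<in>K. E U) \<subseteq> carrier R" using E by (simp add: UN_subset_iff)
  ultimately show "\<exists>E\<subseteq>carrier R. \<Union> K = {P \<in> prime_spec R. \<not> E \<subseteq> P}"
    by (intro exI[of _ "\<Union>U\<in>K. E U"]) simp
qed

lemma openin_zariski:
  "openin (zariski R) U \<longleftrightarrow> (\<exists>E \<subseteq> carrier R. U = {P \<in> prime_spec R. \<not> E \<subseteq> P})"
  unfolding zariski_def using istopology_zariski[of R] by (simp add: topology_inverse')

definition comap :: "('b, 'm) ring_scheme \<Rightarrow> ('b \<Rightarrow> 'c) \<Rightarrow> 'c set \<Rightarrow> 'b set" where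
  "comap B f Q = {b \<in> carrier B. f b \<in> Q}"

definition stalk :: "('b, 'm) ring_scheme \<Rightarrow> 'b set \<Rightarrow> ('b \<times> 'b) set ring" where
  "stalk B P = loc_ring B (carrier B - P)"

definition stalk_iso :: "('b, 'm) ring_scheme \<Rightarrow> ('c, 'n) ring_scheme \<Rightarrow> ('b \<Rightarrow> 'c) \<Rightarrow> 'c set \<Rightarrow> bool" where
  "stalk_iso B C f Q \<longleftrightarrow>
     loc_map C (carrier C - Q) f \<in> ring_iso (stalk B (comap B f Q)) (stalk C Q)"

text \<open>Open immersion of locally ringed spaces, for the morphism \<open>Spec C \<rightarrow> Spec B\<close> with
  comorphism \<open>f : B \<rightarrow> C\<close>: a homeomorphism onto an open subset inducing isomorphisms of all
  local rings.\<close>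
definition open_immersion :: "('b, 'm) ring_scheme \<Rightarrow> ('c, 'n) ring_scheme \<Rightarrow> ('b \<Rightarrow> 'c) \<Rightarrow> bool" where
  "open_immersion B C f \<longleftrightarrow>
     f \<in> ring_hom B C \<and>
     embedding_map (zariski C) (zariski B) (comap B f) \<and>
     openin (zariski B) (comap B f ` prime_spec C) \<and>
     (\<forall>Q \<in> prime_spec C. stalk_iso B C f Q)"

section \<open>Affine schemes over an affine base\<close>

text \<open>An affine scheme \<open>S\<close> over \<open>Spec A\<close> is recorded by its coordinate ring together with the
  comorphism of its structure morphism \<open>S \<rightarrow> Spec A\<close>.  A morphism \<open>S' \<rightarrow> S\<close> is recorded by its
  comorphism, a map \<open>Coord S \<rightarrow> Coord S'\<close>; arguments are ordered geometrically, source first.\<close>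
record ('a, 'b, 'm) aff_scheme =
  Coord :: "('b, 'm) ring_scheme"
  str :: "'a \<Rightarrow> 'b"

type_synonym ('a, 'b) aff = "('a, 'b, unit) aff_scheme"

definition affine_over :: "('a, 'k) ring_scheme \<Rightarrow> ('a, 'b, 'm) aff_scheme \<Rightarrow> bool" where
  "affine_over A S \<longleftrightarrow> cring (Coord S) \<and> str S \<in> ring_hom A (Coord S)"

definition morphism_over :: "('a, 'k) ring_scheme \<Rightarrow> ('a, 'c, 'n) aff_scheme \<Rightarrow>
    ('a, 'b, 'm) aff_scheme \<Rightarrow> ('b \<Rightarrow> 'c) \<Rightarrow> bool" where
  "morphism_over A S' S f \<longleftrightarrow>
     f \<in> ring_hom (Coord S) (Coord S') \<and> (\<forall>a \<in> carrier A. f (str S a) = str S' a)"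

definition isomorphism_over :: "('a, 'k) ring_scheme \<Rightarrow> ('a, 'c, 'n) aff_scheme \<Rightarrow>
    ('a, 'b, 'm) aff_scheme \<Rightarrow> ('b \<Rightarrow> 'c) \<Rightarrow> bool" where
  "isomorphism_over A S' S f \<longleftrightarrow>
     morphism_over A S' S f \<and> f \<in> ring_iso (Coord S) (Coord S')"

definition isomorphic_over :: "('a, 'k) ring_scheme \<Rightarrow> ('a, 'c, 'n) aff_scheme \<Rightarrow>
    ('a, 'b, 'm) aff_scheme \<Rightarrow> bool" where
  "isomorphic_over A S' S \<longleftrightarrow> (\<exists>f. isomorphism_over A S' S f)"

definition finite_type :: "('a, 'k) ring_scheme \<Rightarrow> ('a, 'b, 'm) aff_scheme \<Rightarrow> bool" where
  "finite_type A S \<longleftrightarrow> (\<exists>F. finite F \<and> F \<subseteq> carrier (Coord S) \<and>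
     generate_ring (Coord S) (str S ` carrier A \<union> F) = carrier (Coord S))"

definition integral_scheme :: "('a, 'b, 'm) aff_scheme \<Rightarrow> bool" where
  "integral_scheme S \<longleftrightarrow> domain (Coord S)"

definition nonempty_scheme :: "('a, 'b, 'm) aff_scheme \<Rightarrow> bool" where
  "nonempty_scheme S \<longleftrightarrow> prime_spec (Coord S) \<noteq> {}"

definition reduced_scheme :: "('a, 'b, 'm) aff_scheme \<Rightarrow> bool" where
  "reduced_scheme S \<longleftrightarrow>
     (\<forall>b \<in> carrier (Coord S). \<forall>n::nat. b [^]\<^bsub>Coord S\<^esub> n = \<zero>\<^bsub>Coord S\<^esub> \<longrightarrow> b = \<zero>\<^bsub>Coord S\<^esub>)"

definition affine_line :: "('a, 'k) ring_scheme \<Rightarrow>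
    ('a, nat \<Rightarrow> 'a, \<lparr>smult :: 'a \<Rightarrow> (nat \<Rightarrow> 'a) \<Rightarrow> nat \<Rightarrow> 'a,
       monom :: 'a \<Rightarrow> nat \<Rightarrow> nat \<Rightarrow> 'a, coeff :: (nat \<Rightarrow> 'a) \<Rightarrow> nat \<Rightarrow> 'a\<rparr>) aff_scheme" where
  "affine_line R = \<lparr> Coord = UP R, str = (\<lambda>a. up_ring.monom (UP R) a 0) \<rparr>"

text \<open>A finite disjoint union of affine schemes is the spectrum of the product ring.\<close>
definition disjoint_union :: "nat \<Rightarrow> (nat \<Rightarrow> ('a, 'b, 'm) aff_scheme) \<Rightarrow> ('a, nat \<Rightarrow> 'b) aff" where
  "disjoint_union n C =
    \<lparr> Coord =
        \<lparr> carrier = (\<Pi>\<^sub>E i\<in>{..<n}. carrier (Coord (C i))),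
          monoid.mult = (\<lambda>u v. \<lambda>i\<in>{..<n}. u i \<otimes>\<^bsub>Coord (C i)\<^esub> v i),
          one = (\<lambda>i\<in>{..<n}. \<one>\<^bsub>Coord (C i)\<^esub>),
          zero = (\<lambda>i\<in>{..<n}. \<zero>\<^bsub>Coord (C i)\<^esub>),
          add = (\<lambda>u v. \<lambda>i\<in>{..<n}. u i \<oplus>\<^bsub>Coord (C i)\<^esub> v i) \<rparr>,
      str = (\<lambda>a. \<lambda>i\<in>{..<n}. str (C i) a) \<rparr>"

section \<open>Danielewski-Fieseler surfaces\<close>

definition discrete_valuation_ring :: "('a, 'm) ring_scheme \<Rightarrow> bool" where
  "discrete_valuation_ring A \<longleftrightarrow>
     principal_domain A \<and> \<not> field A \<and> (\<exists>!I. maximalideal I A)"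

definition uniformizing_parameter :: "('a, 'm) ring_scheme \<Rightarrow> 'a \<Rightarrow> bool" where
  "uniformizing_parameter A x \<longleftrightarrow> x \<in> carrier A \<and> maximalideal (PIdl\<^bsub>A\<^esub> x) A"

definition field_char_zero :: "('k, 'm) ring_scheme \<Rightarrow> bool" where
  "field_char_zero k \<longleftrightarrow> field k \<and> (\<forall>n::nat. n > 0 \<longrightarrow> [n] \<cdot>\<^bsub>k\<^esub> \<one>\<^bsub>k\<^esub> \<noteq> \<zero>\<^bsub>k\<^esub>)"

definition base_pair :: "('k, 'm) ring_scheme \<Rightarrow> ('a, 'n) ring_scheme \<Rightarrow> 'a \<Rightarrow> bool" where
  "base_pair k A x \<longleftrightarrow>
     (discrete_valuation_ring A \<and> uniformizing_parameter A x \<and> (A Quot (PIdl\<^bsub>A\<^esub> x)) \<simeq> k) \<or>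
     (cring A \<and> (\<exists>h \<in> ring_iso (UP k) A. h (up_ring.monom (UP k) \<one>\<^bsub>k\<^esub> 1) = x))"

text \<open>The ring \<open>A\<^sub>x\<close>, so that \<open>X\<^sub>* = Spec A\<^sub>x\<close>, and the restriction of an \<open>X\<close>-scheme to \<open>X\<^sub>*\<close>.\<close>
abbreviation loc_at :: "('r, 'm) ring_scheme \<Rightarrow> 'r \<Rightarrow> ('r \<times> 'r) set ring" where
  "loc_at R x \<equiv> loc_ring R (powers R x)"

definition restriction :: "'a \<Rightarrow> ('a, 'b, 'm) aff_scheme \<Rightarrow> (('a \<times> 'a) set, ('b \<times> 'b) set) aff" where
  "restriction x S =
    \<lparr> Coord = loc_at (Coord S) (str S x),
      str = loc_map (Coord S) (powers (Coord S) (str S x)) (str S) \<rparr>"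

text \<open>The scheme-theoretic fiber over \<open>x\<^sub>0 = Spec (A/xA)\<close>, namely \<open>Spec (B/xB)\<close>, with its
  structure of a scheme over the residue field \<open>A/xA\<close>.\<close>
definition special_fiber :: "'a \<Rightarrow> ('a, 'b, 'm) aff_scheme \<Rightarrow> ('a set, 'b set) aff" where
  "special_fiber x S =
    \<lparr> Coord = Coord S Quot (PIdl\<^bsub>Coord S\<^esub> (str S x)),
      str = (\<lambda>c. the_elem ((\<lambda>a. (PIdl\<^bsub>Coord S\<^esub> (str S x)) +>\<^bsub>Coord S\<^esub> str S a) ` c)) \<rparr>"

definition DFS :: "('a, 'k) ring_scheme \<Rightarrow> 'a \<Rightarrow> ('a, 'b, 'm) aff_scheme \<Rightarrow> bool" where
  "DFS A x S \<longleftrightarrow>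
     affine_over A S \<and> integral_scheme S \<and> finite_type A S \<and>
     isomorphic_over (loc_at A x) (restriction x S) (affine_line (loc_at A x)) \<and>
     nonempty_scheme (special_fiber x S) \<and> reduced_scheme (special_fiber x S) \<and>
     (\<exists>n. isomorphic_over (A Quot (PIdl\<^bsub>A\<^esub> x)) (special_fiber x S)
            (disjoint_union n (\<lambda>_. affine_line (A Quot (PIdl\<^bsub>A\<^esub> x)))))"

text \<open>For integral schemes: the generic point (the zero ideal) maps to the generic point, and the
  induced map of function fields is an isomorphism.\<close>
definition birational :: "('a, 'c, 'n) aff_scheme \<Rightarrow> ('a, 'b, 'm) aff_scheme \<Rightarrow> ('b \<Rightarrow> 'c) \<Rightarrow> bool" where
  "birational S' S f \<longleftrightarrow>
     comap (Coord S) f {\<zero>\<^bsub>Coord S'\<^esub>} = {\<zero>\<^bsub>Coord S\<^esub>} \<and>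
     stalk_iso (Coord S) (Coord S') f {\<zero>\<^bsub>Coord S'\<^esub>}"

definition DFS_morphism :: "('a, 'k) ring_scheme \<Rightarrow> 'a \<Rightarrow> ('a, 'c, 'n) aff_scheme \<Rightarrow>
    ('a, 'b, 'm) aff_scheme \<Rightarrow> ('b \<Rightarrow> 'c) \<Rightarrow> bool" where
  "DFS_morphism A x S' S f \<longleftrightarrow>
     DFS A x S' \<and> DFS A x S \<and> morphism_over A S' S f \<and> birational S' S f \<and>
     isomorphism_over (loc_at A x) (restriction x S') (restriction x S)
       (loc_map (Coord S') (powers (Coord S') (str S' x)) f)"

definition open_embedding :: "('a, 'c, 'n) aff_scheme \<Rightarrow> ('a, 'b, 'm) aff_scheme \<Rightarrow> ('b \<Rightarrow> 'c) \<Rightarrow> bool" where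
  "open_embedding S' S f \<longleftrightarrow> open_immersion (Coord S) (Coord S') f"

section \<open>Trees\<close>

text \<open>A finite poset is given by its reflexive order relation \<open>\<Gamma>\<close>, with underlying set
  \<open>Field \<Gamma>\<close>; then \<open>under \<Gamma> e\<close> is the down-set and \<open>above \<Gamma> e\<close> the up-set of \<open>e\<close>.\<close>

definition rooted_tree :: "'e rel \<Rightarrow> bool" where
  "rooted_tree \<Gamma> \<longleftrightarrow> finite (Field \<Gamma>) \<and> Field \<Gamma> \<noteq> {} \<and> Partial_order \<Gamma> \<and>
     (\<exists>!e. e \<in> Field \<Gamma> \<and> underS \<Gamma> e = {}) \<and>
     (\<forall>e \<in> Field \<Gamma>. under \<Gamma> e \<in> Chains \<Gamma>)"

definition level :: "'e rel \<Rightarrow> 'e \<Rightarrow> nat" where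
  "level \<Gamma> e = card (under \<Gamma> e) - 1"

definition leaves :: "'e rel \<Rightarrow> 'e set" where
  "leaves \<Gamma> = {e \<in> Field \<Gamma>. aboveS \<Gamma> e = {}}"

definition children :: "'e rel \<Rightarrow> 'e \<Rightarrow> 'e set" where
  "children \<Gamma> e = {c \<in> aboveS \<Gamma> e. \<forall>c' \<in> aboveS \<Gamma> e. (c', c) \<in> \<Gamma> \<longrightarrow> c' = c}"

definition maximal_subtree :: "'e rel \<Rightarrow> 'e set \<Rightarrow> bool" where
  "maximal_subtree \<Gamma> M \<longleftrightarrow> (\<exists>e \<in> Field \<Gamma>. M = above \<Gamma> e)"

definition first_common_ancestor :: "'e rel \<Rightarrow> 'e \<Rightarrow> 'e \<Rightarrow> 'e" where
  "first_common_ancestor \<Gamma> e e' =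
     (THE a. a \<in> underS \<Gamma> e \<inter> underS \<Gamma> e' \<and>
        (\<forall>b \<in> underS \<Gamma> e \<inter> underS \<Gamma> e'. (a, b) \<in> \<Gamma> \<longrightarrow> b = a))"

definition maximal_chain :: "'e rel \<Rightarrow> 'e set \<Rightarrow> bool" where
  "maximal_chain \<Gamma> C \<longleftrightarrow> C \<in> Chains \<Gamma> \<and> (\<forall>C' \<in> Chains \<Gamma>. C \<subseteq> C' \<longrightarrow> C' = C)"

definition tree_morphism :: "'e rel \<Rightarrow> 'f rel \<Rightarrow> ('e \<Rightarrow> 'f) \<Rightarrow> bool" where
  "tree_morphism \<Gamma>' \<Gamma> \<tau> \<longleftrightarrow>
     \<tau> ` Field \<Gamma>' \<subseteq> Field \<Gamma> \<and>
     (\<forall>e e'. (e, e') \<in> \<Gamma>' \<longrightarrow> (\<tau> e, \<tau> e') \<in> \<Gamma>) \<and>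
     (\<forall>C. maximal_chain \<Gamma>' C \<longrightarrow> maximal_chain \<Gamma> (\<tau> ` C)) \<and>
     (\<forall>e' \<in> Field \<Gamma>'. let F = {e \<in> Field \<Gamma>'. \<tau> e = \<tau> e'} in F = {e'} \<or> maximal_subtree \<Gamma>' F)"

section \<open>Labelled trees and their surfaces\<close>

text \<open>The leaves serve as their own index set, so a label \<open>\<sigma>\<close> is a function on nodes of which only
  the values at leaves matter.\<close>
type_synonym ('e, 'a) ltree = "'e rel \<times> ('e \<Rightarrow> 'a)"

definition labelled_tree :: "('a, 'k) ring_scheme \<Rightarrow> 'a \<Rightarrow> ('e, 'a) ltree \<Rightarrow> bool" where
  "labelled_tree A x = (\<lambda>(\<Gamma>, \<sigma>).
     rooted_tree \<Gamma> \<and> \<sigma> ` leaves \<Gamma> \<subseteq> carrier A \<and>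
     (\<forall>i \<in> leaves \<Gamma>. \<forall>j \<in> leaves \<Gamma>. i \<noteq> j \<longrightarrow>
        (let d = level \<Gamma> (first_common_ancestor \<Gamma> i j) in
         \<sigma> j \<ominus>\<^bsub>A\<^esub> \<sigma> i \<in> (PIdl\<^bsub>A\<^esub> (x [^]\<^bsub>A\<^esub> d)) - (PIdl\<^bsub>A\<^esub> (x [^]\<^bsub>A\<^esub> (d + 1))))))"

definition ltree_morphism :: "('a, 'k) ring_scheme \<Rightarrow> 'a \<Rightarrow> ('e, 'a) ltree \<Rightarrow> ('f, 'a) ltree \<Rightarrow>
    ('e \<Rightarrow> 'f) \<Rightarrow> bool" where
  "ltree_morphism A x = (\<lambda>(\<Gamma>', \<sigma>') (\<Gamma>, \<sigma>) \<tau>.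
     labelled_tree A x (\<Gamma>', \<sigma>') \<and> labelled_tree A x (\<Gamma>, \<sigma>) \<and> tree_morphism \<Gamma>' \<Gamma> \<tau> \<and>
     (\<forall>i \<in> leaves \<Gamma>'. \<tau> i \<in> leaves \<Gamma> \<longrightarrow>
        \<sigma>' i \<ominus>\<^bsub>A\<^esub> \<sigma> (\<tau> i) \<in> PIdl\<^bsub>A\<^esub> (x [^]\<^bsub>A\<^esub> level \<Gamma> (\<tau> i))))"

text \<open>The coefficientwise map \<open>A[T] \<rightarrow> A\<^sub>x[T]\<close>.\<close>
definition loc_poly :: "('a, 'k) ring_scheme \<Rightarrow> 'a \<Rightarrow> (nat \<Rightarrow> 'a) \<Rightarrow> nat \<Rightarrow> ('a \<times> 'a) set" where
  "loc_poly A x p = (\<lambda>n. loc_frac A (powers A x) (up_ring.coeff (UP A) p n) \<one>\<^bsub>A\<^esub>)"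

text \<open>The homomorphism \<open>A\<^sub>x[T] \<rightarrow> A\<^sub>x[T']\<close> of \<open>A\<^sub>x\<close>-algebras with
  \<open>T \<mapsto> x\<^sup>-\<^sup>m (s' - s) + x\<^sup>m\<^sup>'\<^sup>-\<^sup>m T'\<close>.\<close>
definition chart_trans :: "('a, 'k) ring_scheme \<Rightarrow> 'a \<Rightarrow> nat \<Rightarrow> 'a \<Rightarrow> nat \<Rightarrow> 'a \<Rightarrow>
    (nat \<Rightarrow> ('a \<times> 'a) set) \<Rightarrow> nat \<Rightarrow> ('a \<times> 'a) set" where
  "chart_trans A x m s m' s' =
    (let Ax = loc_at A x; P = UP Ax in
     eval Ax P (\<lambda>a. up_ring.monom P a 0)
       (up_ring.monom P (loc_frac A (powers A x) (s' \<ominus>\<^bsub>A\<^esub> s) (x [^]\<^bsub>A\<^esub> m)) 0 \<oplus>\<^bsub>P\<^esub>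
        up_ring.monom P (loc_frac A (powers A x) (x [^]\<^bsub>A\<^esub> m') (x [^]\<^bsub>A\<^esub> m)) 1))"

text \<open>\<open>glued_surface A x \<gamma> G \<iota>\<close>: the affine \<open>X\<close>-scheme \<open>G\<close>, with the charts
  \<open>\<iota> i : Spec A[T\<^sub>i] \<rightarrow> G\<close> (\<open>i\<close> a leaf), is the surface \<open>S(\<gamma>)\<close> obtained by gluing.
  As usual this means: the charts are open immersions that cover \<open>G\<close>, distinct charts
  overlap exactly in their parts over \<open>X\<^sub>*\<close> (primes not containing \<open>x\<close>), and there
  they are identified by the transition isomorphisms.  This determines \<open>(G, \<iota>)\<close> up to a unique
  isomorphism compatible with the charts.\<close>
definition glued_surface :: "('a, 'k) ring_scheme \<Rightarrow> 'a \<Rightarrow> ('e, 'a) ltree \<Rightarrow>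
    ('a, 'b, 'm) aff_scheme \<Rightarrow> ('e \<Rightarrow> 'b \<Rightarrow> nat \<Rightarrow> 'a) \<Rightarrow> bool" where
  "glued_surface A x = (\<lambda>(\<Gamma>, \<sigma>) G \<iota>.
     affine_over A G \<and>
     (\<forall>i \<in> leaves \<Gamma>. morphism_over A (affine_line A) G (\<iota> i) \<and>
        open_embedding (affine_line A) G (\<iota> i)) \<and>
     (\<Union>i \<in> leaves \<Gamma>. comap (Coord G) (\<iota> i) ` prime_spec (UP A)) = prime_spec (Coord G) \<and>
     (\<forall>i \<in> leaves \<Gamma>. \<forall>j \<in> leaves \<Gamma>. i \<noteq> j \<longrightarrow>
        comap (Coord G) (\<iota> i) ` prime_spec (UP A) \<inter> comap (Coord G) (\<iota> j) ` prime_spec (UP A) =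
          comap (Coord G) (\<iota> i) ` {Q \<in> prime_spec (UP A). str (affine_line A) x \<notin> Q} \<and>
        (\<forall>g \<in> carrier (Coord G).
           chart_trans A x (level \<Gamma> i) (\<sigma> i) (level \<Gamma> j) (\<sigma> j) (loc_poly A x (\<iota> i g)) =
             loc_poly A x (\<iota> j g))))"

text \<open>\<open>\<beta>\<^sub>\<tau>\<close> with comorphism \<open>b\<close>.  On charts the comorphism \<open>A[T\<^sub>j] \<rightarrow> A[T'\<^sub>i]\<close>, \<open>j = \<tau> i\<close>, has the
  stated formula; since \<open>A[T'\<^sub>i] \<rightarrow> A\<^sub>x[T'\<^sub>i]\<close> is injective, it is compared in \<open>A\<^sub>x[T'\<^sub>i]\<close>.\<close>
definition induced_morphism :: "('a, 'k) ring_scheme \<Rightarrow> 'a \<Rightarrow> ('e, 'a) ltree \<Rightarrow> ('f, 'a) ltree \<Rightarrow>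
    ('e \<Rightarrow> 'f) \<Rightarrow> ('a, 'c, 'n) aff_scheme \<Rightarrow> ('e \<Rightarrow> 'c \<Rightarrow> nat \<Rightarrow> 'a) \<Rightarrow>
    ('a, 'b, 'm) aff_scheme \<Rightarrow> ('f \<Rightarrow> 'b \<Rightarrow> nat \<Rightarrow> 'a) \<Rightarrow> ('b \<Rightarrow> 'c) \<Rightarrow> bool" where
  "induced_morphism A x = (\<lambda>(\<Gamma>', \<sigma>') (\<Gamma>, \<sigma>) \<tau> G' \<iota>' G \<iota> b.
     morphism_over A G' G b \<and>
     (\<forall>i \<in> leaves \<Gamma>'. \<forall>g \<in> carrier (Coord G).
        loc_poly A x (\<iota>' i (b g)) =
          chart_trans A x (level \<Gamma> (\<tau> i)) (\<sigma> (\<tau> i)) (level \<Gamma>' i) (\<sigma>' i)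
            (loc_poly A x (\<iota> (\<tau> i) g))))"

section \<open>Fibered modifications\<close>

definition blow_down :: "('a, 'k) ring_scheme \<Rightarrow> 'a \<Rightarrow> ('e, 'a) ltree \<Rightarrow> ('e, 'a) ltree \<Rightarrow> 'e \<Rightarrow>
    ('e \<Rightarrow> 'e) \<Rightarrow> bool" where
  "blow_down A x = (\<lambda>(\<Gamma>', \<sigma>') (\<Gamma>, \<sigma>) e \<tau>.
     e \<in> Field \<Gamma>' - leaves \<Gamma>' \<and> children \<Gamma>' e \<subseteq> leaves \<Gamma>' \<and>
     \<Gamma> = Restr \<Gamma>' (Field \<Gamma>' - children \<Gamma>' e) \<and>
     (\<forall>c \<in> Field \<Gamma>'. \<tau> c = (if c \<in> children \<Gamma>' e then e else c)) \<and>
     ltree_morphism A x (\<Gamma>', \<sigma>') (\<Gamma>, \<sigma>) \<tau>)"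

text \<open>Since trees are finite, nodes may be taken to be natural numbers; and since \<open>S(\<gamma>)\<close> is
  isomorphic to \<open>S\<close>, its coordinate ring may be taken on the same type as that of \<open>S\<close>
  (likewise for \<open>\<gamma>'\<close>, \<open>S'\<close>).\<close>
definition fibered_modification :: "('a, 'k) ring_scheme \<Rightarrow> 'a \<Rightarrow> ('a, 'c) aff \<Rightarrow>
    ('a, 'b) aff \<Rightarrow> ('b \<Rightarrow> 'c) \<Rightarrow> bool" where
  "fibered_modification A x S' S f \<longleftrightarrow>
     DFS_morphism A x S' S f \<and>
     (\<exists>(\<gamma>' :: (nat, 'a) ltree) \<gamma> e \<tau> (G' :: ('a, 'c) aff) \<iota>' (G :: ('a, 'b) aff) \<iota> b \<phi>' \<phi>.
        blow_down A x \<gamma>' \<gamma> e \<tau> \<and>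
        glued_surface A x \<gamma>' G' \<iota>' \<and> glued_surface A x \<gamma> G \<iota> \<and>
        induced_morphism A x \<gamma>' \<gamma> \<tau> G' \<iota>' G \<iota> b \<and>
        isomorphism_over A S' G' \<phi>' \<and> isomorphism_over A S G \<phi> \<and>
        (\<forall>g \<in> carrier (Coord G). f (\<phi> g) = \<phi>' (b g)))"

text \<open>\<open>fibered_modifications A x S' S f\<close>: the morphism \<open>S' \<rightarrow> S\<close> with comorphism \<open>f\<close> is a composite
  \<open>S' = S\<^sub>0 \<rightarrow> S\<^sub>1 \<rightarrow> \<dots> \<rightarrow> S\<^sub>n = S\<close> of \<open>n \<ge> 0\<close> fibered modifications.  All coordinate rings live on
  one type: comorphisms of morphisms of surfaces are injective, so each ring embeds into that
  of \<open>S'\<close>.\<close>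
inductive fibered_modifications :: "('a, 'k) ring_scheme \<Rightarrow> 'a \<Rightarrow> ('a, 'c) aff \<Rightarrow>
    ('a, 'c) aff \<Rightarrow> ('c \<Rightarrow> 'c) \<Rightarrow> bool"
  for A :: "('a, 'k) ring_scheme" and x :: 'a and S' :: "('a, 'c) aff" where
  none: "fibered_modifications A x S' S' id"
| step: "fibered_modifications A x S' S\<^sub>1 f \<Longrightarrow> fibered_modification A x S\<^sub>1 S\<^sub>2 g \<Longrightarrow>
    fibered_modifications A x S' S\<^sub>2 (f \<circ> g)"

end

theory Submission
  imports Defs "HOL-Algebra.Subrings"
begin

text \<open>Let \<open>B\<close> be the coordinate ring of a Danielewski-Fieseler surface, embedded in \<open>A\<^sub>x[T]\<close> by its
  trivialization over \<open>X\<^sub>*\<close>.  A disc \<open>D = s + x\<^sup>m A\<close> has the ring \<open>R D = A[x\<^sup>-\<^sup>m (T - s)]\<close>, and \<open>B\<close> is the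
  intersection of the rings of a finite family of pairwise disjoint discs, one for each component of
  the fiber over \<open>x\<^sub>0\<close>.  The discs containing a member of the family form its labelled tree, and the
  surface of that tree is the given one.  A morphism \<open>S' \<rightarrow> S\<close> becomes an inclusion of intersections, so
  every disc of \<open>S'\<close> lies in a disc of \<open>S\<close>.  Dropping the discs of \<open>S\<close> that contain none of \<open>S'\<close> is an
  open embedding.  What remains is reached from the discs of \<open>S'\<close> by repeatedly replacing all the
  discs of maximal level inside a common parent disc by that parent, and each such step is a fibered
  modification.\<close>

section \<open>Localizations of domains\<close>

text \<open>The obstacle is that an intersection of disc rings is hard to control: neither
  \<open>\<tau> D\<close> nor an element that is 1 on one fiber component and 0 on the others is
  visibly in it. \<open>density\<close> overcomes this: \<open>B F\<close> maps onto the product of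
  all reductions modulo \<open>x\<close>. From it follow the shape of the special fiber, finite
  generation, the open charts, and the fact that an inclusion of rings forces an inclusion of discs.
  It is proved by induction along the same merging of siblings that later gives the fibered
  modifications. Conversely, the disc of a fiber component is found by inverting a lift of its
  idempotent and improving the coordinate \<open>T\<close> digit by digit in powers of
  \<open>x\<close>; a nonconstant function on the component forces the process to stop. All this
  happens in the locale \<open>disc_system\<close>, whose axioms \<open>R_gen\<close> and
  \<open>P_gen\<close> are Horner induction. The trivialization of \<open>S'\<close> serves for
  \<open>S\<close> too, rescaled so that \<open>T\<close> lies in both rings. The rings of all
  intermediate surfaces are subrings of that of \<open>S'\<close>, with the identity as
  comorphism.\<close>

locale frac = R?: domain R for R (structure) +
  fixes M
  assumes M_sub: "M \<subseteq> carrier R" and M_one: "\<one> \<in> M"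
    and M_mult: "\<And>s t. s \<in> M \<Longrightarrow> t \<in> M \<Longrightarrow> s \<otimes> t \<in> M" and M_zero: "\<zero> \<notin> M"
begin

abbreviation fr where "fr \<equiv> loc_frac R M"
abbreviation L where "L \<equiv> loc_ring R M"

lemma M_closed [simp, intro]: "s \<in> M \<Longrightarrow> s \<in> carrier R"
  using M_sub by auto

lemma M_nz: "s \<in> M \<Longrightarrow> s \<noteq> \<zero>"
  using M_zero by auto

text \<open>In a domain the auxiliary factor \<open>t\<close>, nonzero because
  \<open>\<zero>\<close> is outside \<open>M\<close>, cancels; from here on fractions are compared
  by cross multiplication.\<close>

lemma loc_rel_iff:
  "((r, s), (r', s')) \<in> loc_rel R M \<longleftrightarrow>
     r \<in> carrier R \<and> r' \<in> carrier R \<and> s \<in> M \<and> s' \<in> M \<and> r \<otimes> s' = r' \<otimes> s"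
proof -
  have "(\<exists>t\<in>M. t \<otimes> (r \<otimes> s' \<ominus> r' \<otimes> s) = \<zero>) \<longleftrightarrow> r \<otimes> s' = r' \<otimes> s"
    if "r \<in> carrier R" "r' \<in> carrier R" "s \<in> M" "s' \<in> M"
  proof
    assume "\<exists>t\<in>M. t \<otimes> (r \<otimes> s' \<ominus> r' \<otimes> s) = \<zero>"
    then obtain t where "t \<in> M" "t \<otimes> (r \<otimes> s' \<ominus> r' \<otimes> s) = \<zero>" by blast
    then have "r \<otimes> s' \<ominus> r' \<otimes> s = \<zero>"
      using that M_nz integral_iff by auto
    then show "r \<otimes> s' = r' \<otimes> s" using that by auto
  next
    assume "r \<otimes> s' = r' \<otimes> s"
    then have "\<one> \<otimes> (r \<otimes> s' \<ominus> r' \<otimes> s) = \<zero>" using that by (simp add: r_right_minus_eq)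
    then show "\<exists>t\<in>M. t \<otimes> (r \<otimes> s' \<ominus> r' \<otimes> s) = \<zero>" using M_one by blast
  qed
  then show ?thesis unfolding loc_rel_def by auto
qed

lemma frac_cancel:
  assumes "r \<in> carrier R" "r' \<in> carrier R" "r'' \<in> carrier R" "s \<in> M" "s' \<in> M" "s'' \<in> M"
    "r \<otimes> s' = r' \<otimes> s" "r' \<otimes> s'' = r'' \<otimes> s'"
  shows "r \<otimes> s'' = r'' \<otimes> s"
proof -
  note cl = assms(1-6)
  have "s' \<otimes> (r \<otimes> s'') = (r \<otimes> s') \<otimes> s''" using cl by (simp add: m_ac)
  also have "\<dots> = (r' \<otimes> s'') \<otimes> s" unfolding assms(7) using cl by (simp add: m_ac)
  also have "\<dots> = s' \<otimes> (r'' \<otimes> s)" unfolding assms(8) using cl by (simp add: m_ac)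
  finally show ?thesis using assms M_nz m_lcancel by simp
qed

lemma equiv_loc_rel: "equiv (carrier R \<times> M) (loc_rel R M)"
proof (rule equivI)
  show "loc_rel R M \<subseteq> (carrier R \<times> M) \<times> (carrier R \<times> M)"
    unfolding loc_rel_def by auto
  show "refl_on (carrier R \<times> M) (loc_rel R M)"
    unfolding refl_on_def by (auto simp: loc_rel_iff)
  show "sym (loc_rel R M)" unfolding sym_def by (auto simp: loc_rel_iff)
  show "trans (loc_rel R M)"
    by (rule transI) (auto simp: loc_rel_iff intro: frac_cancel)
qed

lemma frac_eq_iff [simp]:
  assumes "r \<in> carrier R" "r' \<in> carrier R" "s \<in> M" "s' \<in> M"
  shows "fr r s = fr r' s' \<longleftrightarrow> r \<otimes> s' = r' \<otimes> s"
proof -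
  have "fr r s = fr r' s' \<longleftrightarrow> ((r, s), (r', s')) \<in> loc_rel R M"
    unfolding loc_frac_def using eq_equiv_class_iff[OF equiv_loc_rel] assms by auto
  then show ?thesis using assms by (simp add: loc_rel_iff)
qed

lemma mem_frac:
  "p \<in> fr r s \<longleftrightarrow> (\<exists>r' s'. p = (r', s') \<and> r \<in> carrier R \<and> r' \<in> carrier R \<and> s \<in> M \<and> s' \<in> M \<and> r \<otimes> s' = r' \<otimes> s)"
  unfolding loc_frac_def by (cases p) (auto simp: loc_rel_iff)

lemma frac_repr: "r \<in> carrier R \<Longrightarrow> s \<in> M \<Longrightarrow> (r, s) \<in> fr r s"
  by (simp add: mem_frac)

text \<open>The operations of \<open>loc_ring\<close> and \<open>loc_map\<close> are unions over all
  representatives; once the members agree, the union collapses to the value at one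
  representative.\<close>

lemma UN_frac:
  assumes "r \<in> carrier R" "s \<in> M"
    and "\<And>r' s'. r' \<in> carrier R \<Longrightarrow> s' \<in> M \<Longrightarrow> r \<otimes> s' = r' \<otimes> s \<Longrightarrow> g r' s' = g r s"
  shows "(\<Union>(r', s')\<in>fr r s. g r' s') = g r s"
proof -
  have "(r, s) \<in> fr r s" using assms frac_repr by simp
  moreover have "(case p of (r', s') \<Rightarrow> g r' s') = g r s" if "p \<in> fr r s" for p
  proof -
    from that obtain r' s' where "p = (r', s')" "r' \<in> carrier R" "s' \<in> M" "r \<otimes> s' = r' \<otimes> s"
      unfolding mem_frac by blast
    then show ?thesis using assms(3)[of r' s'] by simp
  qed
  ultimately have "(\<Union>(r', s')\<in>fr r s. g r' s') = (\<Union>_\<in>fr r s. g r s)" by (intro SUP_cong refl)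
  also have "\<dots> = g r s" using \<open>(r, s) \<in> fr r s\<close> by (intro SUP_const) blast
  finally show ?thesis .
qed

lemma frac_closed [simp, intro]: "r \<in> carrier R \<Longrightarrow> s \<in> M \<Longrightarrow> fr r s \<in> carrier L"
  unfolding loc_ring_def loc_frac_def by (auto intro: quotientI)

lemma frac_cases [elim?]:
  assumes "p \<in> carrier L"
  obtains r s where "r \<in> carrier R" "s \<in> M" "p = fr r s"
  using assms unfolding loc_ring_def loc_frac_def by (auto elim!: quotientE)

lemma frac_mult [simp]:
  assumes "r \<in> carrier R" "s \<in> M" "r' \<in> carrier R" "s' \<in> M"
  shows "fr r s \<otimes>\<^bsub>L\<^esub> fr r' s' = fr (r \<otimes> r') (s \<otimes> s')"
proof -
  have *: "(r1 \<otimes> r2) \<otimes> (s \<otimes> s') = (r \<otimes> r') \<otimes> (s1 \<otimes> s2)"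
    if "r1 \<in> carrier R" "s1 \<in> M" "r \<otimes> s1 = r1 \<otimes> s" "r2 \<in> carrier R" "s2 \<in> M" "r' \<otimes> s2 = r2 \<otimes> s'"
    for r1 s1 r2 s2
  proof -
    note cl = that(1,2,4,5) assms
    have "(r1 \<otimes> r2) \<otimes> (s \<otimes> s') = (r1 \<otimes> s) \<otimes> (r2 \<otimes> s')" using cl by (simp add: m_ac)
    also have "\<dots> = (r \<otimes> s1) \<otimes> (r' \<otimes> s2)" using that by simp
    also have "\<dots> = (r \<otimes> r') \<otimes> (s1 \<otimes> s2)" using cl by (simp add: m_ac)
    finally show ?thesis .
  qed
  have "fr r s \<otimes>\<^bsub>L\<^esub> fr r' s' = (\<Union>(r1, s1)\<in>fr r s. \<Union>(r2, s2)\<in>fr r' s'. fr (r1 \<otimes> r2) (s1 \<otimes> s2))"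
    unfolding loc_ring_def by simp
  also have "\<dots> = (\<Union>(r1, s1)\<in>fr r s. fr (r1 \<otimes> r') (s1 \<otimes> s'))"
  proof (intro SUP_cong refl)
    fix p assume "p \<in> fr r s"
    then obtain r1 s1 where p: "p = (r1, s1)" "r1 \<in> carrier R" "s1 \<in> M" by (auto simp: mem_frac)
    have "(\<Union>(r2, s2)\<in>fr r' s'. fr (r1 \<otimes> r2) (s1 \<otimes> s2)) = fr (r1 \<otimes> r') (s1 \<otimes> s')"
    proof (rule UN_frac)
      fix r2 s2 assume a: "r2 \<in> carrier R" "s2 \<in> M" "r' \<otimes> s2 = r2 \<otimes> s'"
      have "(r1 \<otimes> r2) \<otimes> (s1 \<otimes> s') = r1 \<otimes> s1 \<otimes> (r2 \<otimes> s')" using p a(1,2) assms by (simp add: m_ac)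
      also have "\<dots> = r1 \<otimes> s1 \<otimes> (r' \<otimes> s2)" using a by simp
      also have "\<dots> = (r1 \<otimes> r') \<otimes> (s1 \<otimes> s2)" using p a(1,2) assms by (simp add: m_ac)
      finally show "fr (r1 \<otimes> r2) (s1 \<otimes> s2) = fr (r1 \<otimes> r') (s1 \<otimes> s')"
        using a p assms by (simp add: M_mult)
    qed (use assms in auto)
    then show "(case p of (r1, s1) \<Rightarrow> \<Union>(r2, s2)\<in>fr r' s'. fr (r1 \<otimes> r2) (s1 \<otimes> s2)) =
      (case p of (r1, s1) \<Rightarrow> fr (r1 \<otimes> r') (s1 \<otimes> s'))" using p by simp
  qed
  also have "\<dots> = fr (r \<otimes> r') (s \<otimes> s')"
  proof (rule UN_frac)
    fix r1 s1 assume "r1 \<in> carrier R" "s1 \<in> M" "r \<otimes> s1 = r1 \<otimes> s"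
    then show "fr (r1 \<otimes> r') (s1 \<otimes> s') = fr (r \<otimes> r') (s \<otimes> s')"
      using *[of r1 s1 r' s'] assms by (simp add: M_mult)
  qed (use assms in auto)
  finally show ?thesis .
qed

lemma frac_add [simp]:
  assumes "r \<in> carrier R" "s \<in> M" "r' \<in> carrier R" "s' \<in> M"
  shows "fr r s \<oplus>\<^bsub>L\<^esub> fr r' s' = fr (r \<otimes> s' \<oplus> r' \<otimes> s) (s \<otimes> s')"
proof -
  have *: "(r1 \<otimes> s2 \<oplus> r2 \<otimes> s1) \<otimes> (s \<otimes> s') = (r \<otimes> s' \<oplus> r' \<otimes> s) \<otimes> (s1 \<otimes> s2)"
    if "r1 \<in> carrier R" "s1 \<in> M" "r \<otimes> s1 = r1 \<otimes> s" "r2 \<in> carrier R" "s2 \<in> M" "r' \<otimes> s2 = r2 \<otimes> s'"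
    for r1 s1 r2 s2
  proof -
    note cl = that(1,2,4,5) assms
    have "(r1 \<otimes> s2 \<oplus> r2 \<otimes> s1) \<otimes> (s \<otimes> s') = (r1 \<otimes> s) \<otimes> (s2 \<otimes> s') \<oplus> (r2 \<otimes> s') \<otimes> (s1 \<otimes> s)"
      using cl by (simp add: m_ac l_distr r_distr)
    also have "\<dots> = (r \<otimes> s1) \<otimes> (s2 \<otimes> s') \<oplus> (r' \<otimes> s2) \<otimes> (s1 \<otimes> s)" using that by simp
    also have "\<dots> = (r \<otimes> s' \<oplus> r' \<otimes> s) \<otimes> (s1 \<otimes> s2)" using cl by (simp add: m_ac l_distr r_distr)
    finally show ?thesis .
  qed
  have "fr r s \<oplus>\<^bsub>L\<^esub> fr r' s' = (\<Union>(r1, s1)\<in>fr r s. \<Union>(r2, s2)\<in>fr r' s'. fr (r1 \<otimes> s2 \<oplus> r2 \<otimes> s1) (s1 \<otimes> s2))"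
    unfolding loc_ring_def by simp
  also have "\<dots> = (\<Union>(r1, s1)\<in>fr r s. fr (r \<otimes> s' \<oplus> r' \<otimes> s) (s \<otimes> s'))"
  proof (intro SUP_cong refl)
    fix p assume "p \<in> fr r s"
    then obtain r1 s1 where p: "p = (r1, s1)" "r1 \<in> carrier R" "s1 \<in> M" "r \<otimes> s1 = r1 \<otimes> s"
      by (auto simp: mem_frac)
    have "(\<Union>(r2, s2)\<in>fr r' s'. fr (r1 \<otimes> s2 \<oplus> r2 \<otimes> s1) (s1 \<otimes> s2)) = fr (r1 \<otimes> s' \<oplus> r' \<otimes> s1) (s1 \<otimes> s')"
    proof (rule UN_frac)
      fix r2 s2 assume a: "r2 \<in> carrier R" "s2 \<in> M" "r' \<otimes> s2 = r2 \<otimes> s'"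
      \<comment> \<open>Both fractions equal the sum of \<open>r/s\<close> and \<open>r'/s'\<close>
        by \<open>*\<close>, so they are compared through it.\<close>
      show "fr (r1 \<otimes> s2 \<oplus> r2 \<otimes> s1) (s1 \<otimes> s2) = fr (r1 \<otimes> s' \<oplus> r' \<otimes> s1) (s1 \<otimes> s')"
        using *[OF p(2-4) a] *[OF p(2-4) assms(3,4)] a p assms
          frac_cancel[of "r1 \<otimes> s2 \<oplus> r2 \<otimes> s1" "r \<otimes> s' \<oplus> r' \<otimes> s" "r1 \<otimes> s' \<oplus> r' \<otimes> s1" "s1 \<otimes> s2" "s \<otimes> s'" "s1 \<otimes> s'"]
        by (simp add: M_mult)
    qed (use assms in auto)
    also have "\<dots> = fr (r \<otimes> s' \<oplus> r' \<otimes> s) (s \<otimes> s')"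
      using *[OF p(2-4) assms(3,4)] p assms by (simp add: M_mult)
    finally show "(case p of (r1, s1) \<Rightarrow> \<Union>(r2, s2)\<in>fr r' s'. fr (r1 \<otimes> s2 \<oplus> r2 \<otimes> s1) (s1 \<otimes> s2)) =
      (case p of (r1, s1) \<Rightarrow> fr (r \<otimes> s' \<oplus> r' \<otimes> s) (s \<otimes> s'))" using p by simp
  qed
  also have "\<dots> = fr (r \<otimes> s' \<oplus> r' \<otimes> s) (s \<otimes> s')"
    by (rule UN_frac) (use assms in auto)
  finally show ?thesis .
qed

lemma loc_one: "\<one>\<^bsub>L\<^esub> = fr \<one> \<one>" and loc_zero: "\<zero>\<^bsub>L\<^esub> = fr \<zero> \<one>"
  unfolding loc_ring_def by simp_all

lemma loc_cring: "cring L"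
proof (rule cringI)
  show "abelian_group L"
  proof (rule abelian_groupI)
    fix p q r assume "p \<in> carrier L" "q \<in> carrier L" "r \<in> carrier L"
    then show "p \<oplus>\<^bsub>L\<^esub> q \<oplus>\<^bsub>L\<^esub> r = p \<oplus>\<^bsub>L\<^esub> (q \<oplus>\<^bsub>L\<^esub> r)"
      by (elim frac_cases) (simp add: M_mult m_ac l_distr r_distr a_ac)
  next
    fix p q assume "p \<in> carrier L" "q \<in> carrier L"
    then show "p \<oplus>\<^bsub>L\<^esub> q = q \<oplus>\<^bsub>L\<^esub> p"
      by (elim frac_cases) (simp add: M_mult m_ac l_distr r_distr a_ac)
    from \<open>p \<in> carrier L\<close> \<open>q \<in> carrier L\<close> show "p \<oplus>\<^bsub>L\<^esub> q \<in> carrier L"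
      by (elim frac_cases) (simp add: M_mult)
  next
    fix p assume "p \<in> carrier L"
    then show "\<zero>\<^bsub>L\<^esub> \<oplus>\<^bsub>L\<^esub> p = p"
      by (elim frac_cases) (simp add: M_mult M_one loc_zero)
    from \<open>p \<in> carrier L\<close> obtain r s where rs: "r \<in> carrier R" "s \<in> M" "p = fr r s"
      by (elim frac_cases)
    have "fr (\<ominus> r) s \<oplus>\<^bsub>L\<^esub> p = \<zero>\<^bsub>L\<^esub>"
      using rs by (simp add: loc_zero M_mult M_one l_minus l_neg)
    then show "\<exists>y\<in>carrier L. y \<oplus>\<^bsub>L\<^esub> p = \<zero>\<^bsub>L\<^esub>" using rs by blast
  qed (simp add: loc_zero M_one)
  show "Group.comm_monoid L"
  proof (rule Group.comm_monoidI)
    fix p q r assume "p \<in> carrier L" "q \<in> carrier L" "r \<in> carrier L"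
    then show "p \<otimes>\<^bsub>L\<^esub> q \<otimes>\<^bsub>L\<^esub> r = p \<otimes>\<^bsub>L\<^esub> (q \<otimes>\<^bsub>L\<^esub> r)"
      by (elim frac_cases) (simp add: M_mult m_ac l_distr a_ac)
  next
    fix p q assume "p \<in> carrier L" "q \<in> carrier L"
    then show "p \<otimes>\<^bsub>L\<^esub> q = q \<otimes>\<^bsub>L\<^esub> p"
      by (elim frac_cases) (simp add: M_mult m_ac)
    from \<open>p \<in> carrier L\<close> \<open>q \<in> carrier L\<close> show "p \<otimes>\<^bsub>L\<^esub> q \<in> carrier L"
      by (elim frac_cases) (simp add: M_mult)
  next
    fix p assume "p \<in> carrier L"
    then show "\<one>\<^bsub>L\<^esub> \<otimes>\<^bsub>L\<^esub> p = p"
      by (elim frac_cases) (simp add: M_mult M_one loc_one)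
  qed (simp add: loc_one M_one)
  fix p q r assume "p \<in> carrier L" "q \<in> carrier L" "r \<in> carrier L"
  then show "(p \<oplus>\<^bsub>L\<^esub> q) \<otimes>\<^bsub>L\<^esub> r = p \<otimes>\<^bsub>L\<^esub> r \<oplus>\<^bsub>L\<^esub> q \<otimes>\<^bsub>L\<^esub> r"
    by (elim frac_cases) (simp add: M_mult m_ac l_distr r_distr a_ac)
qed

lemma frac_eq_zero_iff: "r \<in> carrier R \<Longrightarrow> s \<in> M \<Longrightarrow> fr r s = \<zero>\<^bsub>L\<^esub> \<longleftrightarrow> r = \<zero>"
  by (simp add: loc_zero M_one)

lemma loc_domain: "domain L"
proof -
  interpret L: cring L by (rule loc_cring)
  show ?thesis
  proof
    show "\<one>\<^bsub>L\<^esub> \<noteq> \<zero>\<^bsub>L\<^esub>" by (simp add: loc_one frac_eq_zero_iff M_one)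
    fix p q assume "p \<otimes>\<^bsub>L\<^esub> q = \<zero>\<^bsub>L\<^esub>" "p \<in> carrier L" "q \<in> carrier L"
    then show "p = \<zero>\<^bsub>L\<^esub> \<or> q = \<zero>\<^bsub>L\<^esub>"
      by (elim frac_cases) (auto simp: frac_eq_zero_iff M_mult integral_iff)
  qed
qed

lemma frac_hom: "(\<lambda>r. fr r \<one>) \<in> ring_hom R L"
  by (rule ring_hom_memI) (auto simp: loc_one M_one)

lemma frac_inj: "inj_on (\<lambda>r. fr r \<one>) (carrier R)"
  by (rule inj_onI) (auto simp: M_one)

end

lemma (in domain) frac_powers:
  assumes "x \<in> carrier R" "x \<noteq> \<zero>"
  shows "frac R (powers R x)"
proof
  show "\<one> \<in> powers R x" unfolding powers_def by (auto intro!: exI[of _ "0::nat"])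
  fix s t assume "s \<in> powers R x" "t \<in> powers R x"
  then show "s \<otimes> t \<in> powers R x"
    unfolding powers_def using assms by (auto simp: nat_pow_mult)
next
  have "x [^] (n::nat) \<noteq> \<zero>" for n
    by (induct n) (use assms in \<open>auto simp: integral_iff\<close>)
  then show "\<zero> \<notin> powers R x" unfolding powers_def by auto metis
qed (use assms in \<open>auto simp: powers_def\<close>)

lemma (in domain) frac_prime:
  assumes "primeideal Q R" shows "frac R (carrier R - Q)"
proof -
  interpret Q: primeideal Q R by fact
  show ?thesis
    by standard (use Q.I_prime Q.one_imp_carrier Q.I_notcarr in auto)
qed

lemma loc_map_frac:
  assumes "frac B N" "frac C M" "f \<in> ring_hom B C" "f ` N \<subseteq> M" "r \<in> carrier B" "s \<in> N"
  shows "loc_map C M f (loc_frac B N r s) = loc_frac C M (f r) (f s)"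
proof -
  interpret B: frac B N by fact
  interpret C: frac C M by fact
  show ?thesis unfolding loc_map_def
  proof (rule B.UN_frac)
    fix r' s' assume a: "r' \<in> carrier B" "s' \<in> N" "r \<otimes>\<^bsub>B\<^esub> s' = r' \<otimes>\<^bsub>B\<^esub> s"
    have "f r \<otimes>\<^bsub>C\<^esub> f s' = f r' \<otimes>\<^bsub>C\<^esub> f s"
      using a assms(3,5,6) by (metis B.M_closed ring_hom_mult)
    moreover have "f s \<in> M" "f s' \<in> M" "f r \<in> carrier C" "f r' \<in> carrier C"
      using a assms by (auto simp: ring_hom_closed)
    ultimately show "loc_frac C M (f r') (f s') = loc_frac C M (f r) (f s)" by simp
  qed (use assms in auto)
qed

lemma loc_map_hom:
  assumes "frac B N" "frac C M" "f \<in> ring_hom B C" "f ` N \<subseteq> M"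
  shows "loc_map C M f \<in> ring_hom (loc_ring B N) (loc_ring C M)"
proof -
  interpret B: frac B N by fact
  interpret C: frac C M by fact
  note lm [simp] = loc_map_frac[OF assms]
  have cl [simp]: "r \<in> carrier B \<Longrightarrow> f r \<in> carrier C" "s \<in> N \<Longrightarrow> f s \<in> M" for r s
    using assms by (auto simp: ring_hom_closed)
  show ?thesis
  proof (rule ring_hom_memI)
    fix p assume "p \<in> carrier (loc_ring B N)"
    then show "loc_map C M f p \<in> carrier (loc_ring C M)" by (elim B.frac_cases) simp
  next
    fix p q assume "p \<in> carrier (loc_ring B N)" "q \<in> carrier (loc_ring B N)"
    then show "loc_map C M f (p \<otimes>\<^bsub>loc_ring B N\<^esub> q) =
        loc_map C M f p \<otimes>\<^bsub>loc_ring C M\<^esub> loc_map C M f q"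
      and "loc_map C M f (p \<oplus>\<^bsub>loc_ring B N\<^esub> q) =
        loc_map C M f p \<oplus>\<^bsub>loc_ring C M\<^esub> loc_map C M f q"
      by (elim B.frac_cases; simp add: B.M_mult C.M_mult ring_hom_mult[OF assms(3)] ring_hom_add[OF assms(3)])+
  next
    show "loc_map C M f \<one>\<^bsub>loc_ring B N\<^esub> = \<one>\<^bsub>loc_ring C M\<^esub>"
      by (simp add: B.loc_one C.loc_one ring_hom_one[OF assms(3)] B.M_one)
  qed
qed

text \<open>Injectivity of \<open>f\<close> passes to fractions by cross multiplication; the last
  assumption rewrites each \<open>c/s\<close> as \<open>f b / f t\<close>, which is
  surjectivity.\<close>

lemma loc_map_iso:
  assumes "frac B N" "frac C M" "f \<in> ring_hom B C" "f ` N \<subseteq> M" "inj_on f (carrier B)"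
    and "\<And>c s. c \<in> carrier C \<Longrightarrow> s \<in> M \<Longrightarrow> \<exists>b\<in>carrier B. \<exists>t\<in>N. c \<otimes>\<^bsub>C\<^esub> f t = f b \<otimes>\<^bsub>C\<^esub> s"
  shows "loc_map C M f \<in> ring_iso (loc_ring B N) (loc_ring C M)"
proof -
  interpret B: frac B N by fact
  interpret C: frac C M by fact
  note lm [simp] = loc_map_frac[OF assms(1-4)]
  have cl [simp]: "r \<in> carrier B \<Longrightarrow> f r \<in> carrier C" "s \<in> N \<Longrightarrow> f s \<in> M" for r s
    using assms by (auto simp: ring_hom_closed)
  have "inj_on (loc_map C M f) (carrier (loc_ring B N))"
  proof (rule inj_onI)
    fix p q assume pq: "p \<in> carrier (loc_ring B N)" "q \<in> carrier (loc_ring B N)"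
      "loc_map C M f p = loc_map C M f q"
    obtain r s where rs: "r \<in> carrier B" "s \<in> N" "p = loc_frac B N r s"
      using pq(1) by (rule B.frac_cases)
    obtain r' s' where rs': "r' \<in> carrier B" "s' \<in> N" "q = loc_frac B N r' s'"
      using pq(2) by (rule B.frac_cases)
    have "f (r \<otimes>\<^bsub>B\<^esub> s') = f (r' \<otimes>\<^bsub>B\<^esub> s)"
      using pq(3) rs rs' by (simp add: ring_hom_mult[OF assms(3)])
    then show "p = q" using rs rs' inj_onD[OF assms(5)] by simp
  qed
  moreover have "p \<in> loc_map C M f ` carrier (loc_ring B N)" if "p \<in> carrier (loc_ring C M)" for p
    using that
  proof (elim C.frac_cases)
    fix c s assume cs: "c \<in> carrier C" "s \<in> M" "p = loc_frac C M c s"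
    then obtain b t where bt: "b \<in> carrier B" "t \<in> N" "c \<otimes>\<^bsub>C\<^esub> f t = f b \<otimes>\<^bsub>C\<^esub> s"
      using assms(6) by blast
    then have "p = loc_map C M f (loc_frac B N b t)" using cs by simp
    then show ?thesis using bt by blast
  qed
  ultimately show ?thesis
    using loc_map_hom[OF assms(1-4)] ring_hom_closed[OF loc_map_hom[OF assms(1-4)]]
    unfolding ring_iso_def bij_betw_def by blast
qed

section \<open>Polynomial rings\<close>

lemma (in UP_ring) bound_up:
  assumes "p \<in> carrier P" shows "\<exists>n. bound \<zero> n (coeff P p)"
  using assms by (auto simp: UP_def P_def)

text \<open>Horner's scheme: a polynomial is its constant term plus the variable times the
  polynomial with coefficients shifted down by one. The inner induction is on an index from which on
  all coefficients vanish.\<close>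

lemma (in UP_cring) UP_Horner_induct [consumes 1, case_names zero step]:
  assumes "p \<in> carrier P" and "Q \<zero>\<^bsub>P\<^esub>"
    and step: "\<And>a q. a \<in> carrier R \<Longrightarrow> q \<in> carrier P \<Longrightarrow> Q q \<Longrightarrow>
      Q (monom P a 0 \<oplus>\<^bsub>P\<^esub> monom P \<one> 1 \<otimes>\<^bsub>P\<^esub> q)"
  shows "Q p"
proof -
  have "Q p" if "p \<in> carrier P" "\<And>i. i \<ge> n \<Longrightarrow> coeff P p i = \<zero>" for n p
    using that
  proof (induct n arbitrary: p)
    case 0
    then have "p = \<zero>\<^bsub>P\<^esub>" by (intro up_eqI) simp_all
    then show ?case using assms(2) by simp
  next
    case (Suc n)
    define q where "q = (\<lambda>i. coeff P p (Suc i))"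
    have q: "q \<in> up R"
    proof (rule mem_upI)
      show "\<exists>k. bound \<zero> k q" unfolding q_def
        by (intro exI[of _ n] bound.intro) (use Suc.prems(2) in auto)
    qed (simp add: q_def Suc.prems)
    then have qP: "q \<in> carrier P" by (simp add: UP_def P_def)
    have cq: "coeff P q i = coeff P p (Suc i)" for i
      using q by (simp add: UP_def P_def q_def)
    have "p = monom P (coeff P p 0) 0 \<oplus>\<^bsub>P\<^esub> monom P \<one> 1 \<otimes>\<^bsub>P\<^esub> q"
    proof (rule up_eqI)
      fix i
      show "coeff P p i = coeff P (monom P (coeff P p 0) 0 \<oplus>\<^bsub>P\<^esub> monom P \<one> 1 \<otimes>\<^bsub>P\<^esub> q) i"
      proof (cases i)
        case 0
        then show ?thesis using qP Suc.prems by simp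
      next
        case (Suc j)
        have "coeff P (monom P \<one> 1 \<otimes>\<^bsub>P\<^esub> q) (j + 1) = \<one> \<otimes> coeff P q j"
          by (rule coeff_monom_mult) (use qP in auto)
        then have "coeff P (monom P \<one> 1 \<otimes>\<^bsub>P\<^esub> q) i = coeff P p i"
          using Suc qP Suc.prems cq \<open>p \<in> carrier P\<close> by (simp del: coeff_mult)
        then show ?thesis using Suc qP \<open>p \<in> carrier P\<close> by (simp del: coeff_mult)
      qed
    qed (use qP Suc.prems in auto)
    moreover have "Q q"
      by (rule Suc.hyps[OF qP]) (use cq Suc.prems in auto)
    ultimately show ?case using step[OF _ qP, of "coeff P p 0"] Suc.prems by simp
  qed
  moreover obtain n where "bound \<zero> n (coeff P p)"
    using bound_up[OF assms(1)] by blast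
  then have "coeff P p i = \<zero>" if "i \<ge> Suc n" for i
    using that by (intro bound.bound[of \<zero> n]) auto
  ultimately show ?thesis using assms(1) by blast
qed

lemma (in UP_cring) hom_eq_on_UP:
  assumes S: "cring S" "\<Phi> \<in> ring_hom P S" "\<Psi> \<in> ring_hom P S"
    and "\<And>a. a \<in> carrier R \<Longrightarrow> \<Phi> (monom P a 0) = \<Psi> (monom P a 0)"
    and "\<Phi> (monom P \<one> 1) = \<Psi> (monom P \<one> 1)"
    and "p \<in> carrier P"
  shows "\<Phi> p = \<Psi> p"
  using assms(6)
proof (induct rule: UP_Horner_induct)
  case zero
  interpret \<Phi>: ring_hom_cring P S \<Phi> by (rule UnivPoly.ring_hom_cringI[OF P.is_cring S(1,2)])
  interpret \<Psi>: ring_hom_cring P S \<Psi> by (rule UnivPoly.ring_hom_cringI[OF P.is_cring S(1,3)])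
  show ?case by simp
next
  case (step a q)
  then show ?case
    using assms(4)[of a] assms(5) by (simp add: ring_hom_add[OF S(2)] ring_hom_add[OF S(3)] ring_hom_mult[OF S(2)] ring_hom_mult[OF S(3)] del: One_nat_def)
qed

text \<open>Needed for two coefficient maps: the localization of \<open>A[T]\<close> at
  \<open>x\<close> and the reduction of \<open>A[T]\<close> modulo \<open>x\<close>.\<close>

definition up_map :: "('a, 'm) ring_scheme \<Rightarrow> ('a \<Rightarrow> 'b) \<Rightarrow> (nat \<Rightarrow> 'a) \<Rightarrow> nat \<Rightarrow> 'b" where
  "up_map R f p = (\<lambda>n. f (up_ring.coeff (UP R) p n))"

locale up_functor = ring_hom_cring R S f for R S f
begin

sublocale UR: UP_cring R "UP R" by unfold_locales simp
sublocale US: UP_cring S "UP S" by unfold_locales simp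

lemma up_map_closed [simp]: "p \<in> carrier (UP R) \<Longrightarrow> up_map R f p \<in> carrier (UP S)"
proof -
  assume p: "p \<in> carrier (UP R)"
  obtain n where n: "bound \<zero>\<^bsub>R\<^esub> n (coeff (UP R) p)" using UR.bound_up[OF p] by blast
  have "up_map R f p \<in> up S"
  proof (rule mem_upI)
    show "up_map R f p n \<in> carrier S" for n using p by (simp add: up_map_def)
    have "bound \<zero>\<^bsub>S\<^esub> n (up_map R f p)" using n by (auto simp: up_map_def bound_def)
    then show "\<exists>n. bound \<zero>\<^bsub>S\<^esub> n (up_map R f p)" ..
  qed
  then show ?thesis by (simp add: UP_def)
qed

lemma coeff_up_map [simp]:
  "p \<in> carrier (UP R) \<Longrightarrow> coeff (UP S) (up_map R f p) n = f (coeff (UP R) p n)"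
proof -
  assume p: "p \<in> carrier (UP R)"
  then have "up_map R f p \<in> up S" using up_map_closed by (simp add: UP_def)
  then show ?thesis by (simp add: UP_def up_map_def)
qed

lemma up_map_monom [simp]: "a \<in> carrier R \<Longrightarrow> up_map R f (monom (UP R) a n) = monom (UP S) (f a) n"
  by (rule US.up_eqI) auto

lemma up_map_hom: "up_map R f \<in> ring_hom (UP R) (UP S)"
proof (rule ring_hom_memI)
  fix p q assume pq: "p \<in> carrier (UP R)" "q \<in> carrier (UP R)"
  show "up_map R f (p \<otimes>\<^bsub>UP R\<^esub> q) = up_map R f p \<otimes>\<^bsub>UP S\<^esub> up_map R f q"
  proof (rule US.up_eqI)
    fix n
    have "f (\<Oplus>\<^bsub>R\<^esub>i\<in>{..n}. coeff (UP R) p i \<otimes>\<^bsub>R\<^esub> coeff (UP R) q (n - i))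
      = (\<Oplus>\<^bsub>S\<^esub>i\<in>{..n}. f (coeff (UP R) p i) \<otimes>\<^bsub>S\<^esub> f (coeff (UP R) q (n - i)))"
      using pq by (subst hom_finsum) (auto intro!: S.finsum_cong' simp: Pi_def)
    then show "coeff (UP S) (up_map R f (p \<otimes>\<^bsub>UP R\<^esub> q)) n = coeff (UP S) (up_map R f p \<otimes>\<^bsub>UP S\<^esub> up_map R f q) n"
      using pq by simp
  qed (use pq in auto)
  show "up_map R f (p \<oplus>\<^bsub>UP R\<^esub> q) = up_map R f p \<oplus>\<^bsub>UP S\<^esub> up_map R f q"
    by (rule US.up_eqI) (use pq in auto)
next
  show "up_map R f \<one>\<^bsub>UP R\<^esub> = \<one>\<^bsub>UP S\<^esub>"
    by (rule US.up_eqI) auto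
qed simp

lemma up_map_inj: 
  assumes "inj_on f (carrier R)"
  shows "inj_on (up_map R f) (carrier (UP R))"
proof (rule inj_onI)
  fix p q assume pq: "p \<in> carrier (UP R)" "q \<in> carrier (UP R)" "up_map R f p = up_map R f q"
  show "p = q"
  proof (rule UR.up_eqI)
    fix n
    have "f (coeff (UP R) p n) = f (coeff (UP R) q n)"
      using pq coeff_up_map by metis
    then show "coeff (UP R) p n = coeff (UP R) q n"
      using pq inj_onD[OF assms] by simp
  qed (use pq in auto)
qed

lemma up_map_zero_iff:
  assumes "p \<in> carrier (UP R)"
  shows "up_map R f p = \<zero>\<^bsub>UP S\<^esub> \<longleftrightarrow> (\<forall>n. f (coeff (UP R) p n) = \<zero>\<^bsub>S\<^esub>)"
proof
  assume "up_map R f p = \<zero>\<^bsub>UP S\<^esub>"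
  then show "\<forall>n. f (coeff (UP R) p n) = \<zero>\<^bsub>S\<^esub>" using assms coeff_up_map US.coeff_zero by metis
next
  assume "\<forall>n. f (coeff (UP R) p n) = \<zero>\<^bsub>S\<^esub>"
  then show "up_map R f p = \<zero>\<^bsub>UP S\<^esub>" using assms by (intro US.up_eqI) auto
qed

end

lemma (in UP_domain) UP_unit_const:
  assumes "p \<in> carrier P" "q \<in> carrier P" "p \<otimes>\<^bsub>P\<^esub> q = \<one>\<^bsub>P\<^esub>"
  shows "\<exists>a\<in>carrier R. p = monom P a 0"
proof -
  have "p \<noteq> \<zero>\<^bsub>P\<^esub>" "q \<noteq> \<zero>\<^bsub>P\<^esub>" using assms by auto
  then have "deg R p + deg R q = 0" using deg_mult[of p q] assms by simp
  then have "p = monom P (coeff P p 0) 0" using deg_zero_impl_monom assms(1) by simp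
  then show ?thesis using assms(1) coeff_closed by blast
qed

text \<open>Quotients of the coefficients are chosen one by one; since \<open>x\<close> can be
  cancelled, the quotient of a zero coefficient is zero, so the chosen sequence still has finite
  support.\<close>

lemma (in UP_cring) UP_smult_mem:
  assumes "p \<in> carrier P" "x \<in> carrier R" "\<And>n. \<exists>a\<in>carrier R. coeff P p n = x \<otimes> a"
    and x: "\<And>a b. a \<in> carrier R \<Longrightarrow> b \<in> carrier R \<Longrightarrow> x \<otimes> a = x \<otimes> b \<Longrightarrow> a = b"
  shows "\<exists>q\<in>carrier P. p = monom P x 0 \<otimes>\<^bsub>P\<^esub> q"
proof -
  have "\<forall>n. \<exists>a. a \<in> carrier R \<and> coeff P p n = x \<otimes> a" using assms(3) by blast
  from choice[OF this] obtain q where q: "\<And>n. q n \<in> carrier R" "\<And>n. coeff P p n = x \<otimes> q n"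
    by blast
  obtain n where n: "bound \<zero> n (coeff P p)" using bound_up[OF assms(1)] by blast
  have "q \<in> up R"
  proof (rule mem_upI)
    have "bound \<zero> n q"
    proof
      fix m assume "n < m"
      then have "coeff P p m = \<zero>" using n by (rule bound.bound[rotated])
      then have "x \<otimes> q m = x \<otimes> \<zero>" using assms(2) by (simp flip: q(2))
      then show "q m = \<zero>" by (rule x[OF q(1) R.zero_closed])
    qed
    then show "\<exists>n. bound \<zero> n q" ..
  qed (rule q(1))
  then have qP: "q \<in> carrier P" "\<And>n. coeff P q n = q n" by (simp_all add: UP_def P_def)
  have "p = x \<odot>\<^bsub>P\<^esub> q"
    by (rule up_eqI) (use q qP assms(1,2) in auto)
  then show ?thesis using monom_mult_is_smult[OF assms(2) qP(1)] qP(1) by metis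
qed

section \<open>Open immersions\<close>

lemma comap_primeideal:
  assumes "cring B" "cring C" "f \<in> ring_hom B C" "primeideal Q C"
  shows "primeideal (comap B f Q) B"
proof -
  interpret B: cring B by fact
  interpret C: cring C by fact
  interpret f: ring_hom_cring B C f by (rule UnivPoly.ring_hom_cringI) fact+
  interpret Q: primeideal Q C by fact
  show ?thesis
  proof (rule primeidealI)
    show "ideal (comap B f Q) B"
      unfolding comap_def by (rule f.ring.ideal_vimage[OF Q.is_ideal])
    have "f \<one>\<^bsub>B\<^esub> \<notin> Q" using Q.I_notcarr Q.one_imp_carrier by auto
    then show "carrier B \<noteq> comap B f Q" unfolding comap_def by blast
    fix a b assume "a \<in> carrier B" "b \<in> carrier B" "a \<otimes>\<^bsub>B\<^esub> b \<in> comap B f Q"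
    then show "a \<in> comap B f Q \<or> b \<in> comap B f Q"
      using Q.I_prime[of "f a" "f b"] unfolding comap_def by auto
  qed fact
qed

lemma topspace_zariski: "topspace (zariski R) = prime_spec R"
proof
  show "topspace (zariski R) \<subseteq> prime_spec R"
    using openin_zariski[of R "topspace (zariski R)"] by auto
  have "prime_spec R = {P \<in> prime_spec R. \<not> carrier R \<subseteq> P}"
  proof -
    have "\<not> carrier R \<subseteq> P" if "P \<in> prime_spec R" for P
    proof -
      interpret primeideal P R using that by (simp add: prime_spec_def)
      show ?thesis using I_notcarr a_subset by blast
    qed
    then show ?thesis by blast
  qed
  then have "openin (zariski R) (prime_spec R)" unfolding openin_zariski by blast
  then show "prime_spec R \<subseteq> topspace (zariski R)" by (rule openin_subset)
qed

text \<open>An algebraic form of an open immersion: \<open>denom\<close> says that \<open>B\<close>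
  and \<open>C\<close> become equal after inverting any \<open>u\<close> in \<open>E\<close>. If
  moreover no prime of \<open>C\<close> contains the image of all of \<open>E\<close>, then
  \<open>Spec C\<close> is the open set where some member of \<open>E\<close> does not
  vanish.\<close>

locale localizing_hom = B: domain B + C: domain C
  for B :: "('b, 'm) ring_scheme" and C :: "('c, 'n) ring_scheme" +
  fixes f :: "'b \<Rightarrow> 'c" and E :: "'b set"
  assumes f_hom: "f \<in> ring_hom B C" and f_inj: "inj_on f (carrier B)" and E_sub: "E \<subseteq> carrier B"
    and denom: "\<And>u c. u \<in> E \<Longrightarrow> c \<in> carrier C \<Longrightarrow>
      \<exists>n::nat. \<exists>b\<in>carrier B. f u [^]\<^bsub>C\<^esub> n \<otimes>\<^bsub>C\<^esub> c = f b"
begin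

sublocale f: ring_hom_cring B C f
  by (rule UnivPoly.ring_hom_cringI[OF B.is_cring C.is_cring f_hom])

lemma E_closed [simp]: "u \<in> E \<Longrightarrow> u \<in> carrier B"
  using E_sub by auto

text \<open>The prime of \<open>C\<close> over \<open>P\<close>: the extension of \<open>P\<close>
  to the common localization at \<open>u\<close>, pulled back to \<open>C\<close>.\<close>

definition ext :: "'b \<Rightarrow> 'b set \<Rightarrow> 'c set" where
  "ext u P = {c \<in> carrier C. \<exists>n::nat. \<exists>b\<in>P. f u [^]\<^bsub>C\<^esub> n \<otimes>\<^bsub>C\<^esub> c = f b}"

lemma pow_notin_prime:
  assumes "primeideal P B" "u \<in> carrier B" "u \<notin> P" shows "u [^]\<^bsub>B\<^esub> (n::nat) \<notin> P"
proof (induct n)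
  interpret P: primeideal P B by fact
  case 0
  then show ?case using P.I_notcarr P.one_imp_carrier by auto
next
  interpret P: primeideal P B by fact
  case (Suc n)
  then show ?case using P.I_prime[of "u [^]\<^bsub>B\<^esub> n" u] assms by auto
qed

text \<open>Any way of clearing the denominator decides membership: two of them differ by powers of
  \<open>u\<close>, and these lie outside \<open>P\<close>.\<close>

lemma mem_ext_iff:
  assumes "primeideal P B" "u \<in> E" "u \<notin> P" "c \<in> carrier C" "b \<in> carrier B"
    and eq: "f u [^]\<^bsub>C\<^esub> (n::nat) \<otimes>\<^bsub>C\<^esub> c = f b"
  shows "c \<in> ext u P \<longleftrightarrow> b \<in> P"
proof
  interpret P: primeideal P B by fact
  have u: "u \<in> carrier B" using assms by simp
  assume "c \<in> ext u P"
  then obtain m :: nat and b' where b': "b' \<in> P" "f u [^]\<^bsub>C\<^esub> m \<otimes>\<^bsub>C\<^esub> c = f b'"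
    unfolding ext_def by blast
  have b'B: "b' \<in> carrier B" using b' P.a_subset by auto
  have "f (u [^]\<^bsub>B\<^esub> m \<otimes>\<^bsub>B\<^esub> b) = f u [^]\<^bsub>C\<^esub> m \<otimes>\<^bsub>C\<^esub> (f u [^]\<^bsub>C\<^esub> n \<otimes>\<^bsub>C\<^esub> c)"
    using u assms(5) eq by simp
  also have "\<dots> = f u [^]\<^bsub>C\<^esub> n \<otimes>\<^bsub>C\<^esub> (f u [^]\<^bsub>C\<^esub> m \<otimes>\<^bsub>C\<^esub> c)"
    using u assms(4) by (simp add: C.m_lcomm)
  also have "\<dots> = f (u [^]\<^bsub>B\<^esub> n \<otimes>\<^bsub>B\<^esub> b')" using u b'B b' by simp
  finally have "u [^]\<^bsub>B\<^esub> m \<otimes>\<^bsub>B\<^esub> b = u [^]\<^bsub>B\<^esub> n \<otimes>\<^bsub>B\<^esub> b'"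
    by (rule inj_onD[OF f_inj]) (use u b'B assms(5) in auto)
  then have "u [^]\<^bsub>B\<^esub> m \<otimes>\<^bsub>B\<^esub> b \<in> P" using P.I_l_closed[OF b'(1), of "u [^]\<^bsub>B\<^esub> n"] u by simp
  then show "b \<in> P"
    using P.I_prime[of "u [^]\<^bsub>B\<^esub> m" b] pow_notin_prime[OF assms(1) u assms(3)] u assms(5) by auto
next
  assume "b \<in> P"
  then show "c \<in> ext u P" unfolding ext_def using assms by blast
qed

lemma primeideal_ext:
  assumes P: "primeideal P B" and u: "u \<in> E" "u \<notin> P"
  shows "primeideal (ext u P) C"
proof -
  interpret P: primeideal P B by fact
  note mem = mem_ext_iff[OF P u]
  have uB: "u \<in> carrier B" using u by simp
  have one: "\<one>\<^bsub>C\<^esub> \<notin> ext u P"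
    using mem[of "\<one>\<^bsub>C\<^esub>" "\<one>\<^bsub>B\<^esub>" 0] P.I_notcarr P.one_imp_carrier by auto
  \<comment> \<open>One equivalence serves twice: for absorption in the ideal property and for
    primality.\<close>
  have mult: "c \<otimes>\<^bsub>C\<^esub> d \<in> ext u P \<longleftrightarrow> c \<in> ext u P \<or> d \<in> ext u P"
    if cd: "c \<in> carrier C" "d \<in> carrier C" for c d
  proof -
    obtain n :: nat and b where b: "b \<in> carrier B" "f u [^]\<^bsub>C\<^esub> n \<otimes>\<^bsub>C\<^esub> c = f b"
      using denom u cd by blast
    obtain m :: nat and b' where b': "b' \<in> carrier B" "f u [^]\<^bsub>C\<^esub> m \<otimes>\<^bsub>C\<^esub> d = f b'"
      using denom u cd by blast
    have "f u [^]\<^bsub>C\<^esub> (n + m) \<otimes>\<^bsub>C\<^esub> (c \<otimes>\<^bsub>C\<^esub> d) = (f u [^]\<^bsub>C\<^esub> n \<otimes>\<^bsub>C\<^esub> c) \<otimes>\<^bsub>C\<^esub> (f u [^]\<^bsub>C\<^esub> m \<otimes>\<^bsub>C\<^esub> d)"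
      using uB cd by (simp add: C.m_ac flip: C.nat_pow_mult)
    also have "\<dots> = f (b \<otimes>\<^bsub>B\<^esub> b')" using b b' by simp
    finally have "c \<otimes>\<^bsub>C\<^esub> d \<in> ext u P \<longleftrightarrow> b \<otimes>\<^bsub>B\<^esub> b' \<in> P" by (rule mem[rotated 2]) (use cd b b' in auto)
    also have "\<dots> \<longleftrightarrow> b \<in> P \<or> b' \<in> P"
      using P.I_prime[OF b(1) b'(1)] P.I_l_closed P.I_r_closed b b' by blast
    also have "\<dots> \<longleftrightarrow> c \<in> ext u P \<or> d \<in> ext u P"
      using mem[OF cd(1) b] mem[OF cd(2) b'] by simp
    finally show ?thesis .
  qed
  have add: "c \<oplus>\<^bsub>C\<^esub> d \<in> ext u P" if cd: "c \<in> ext u P" "d \<in> ext u P" for c d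
  proof -
    obtain n :: nat and b where b: "b \<in> P" "f u [^]\<^bsub>C\<^esub> n \<otimes>\<^bsub>C\<^esub> c = f b" and c: "c \<in> carrier C"
      using cd unfolding ext_def by blast
    obtain m :: nat and b' where b': "b' \<in> P" "f u [^]\<^bsub>C\<^esub> m \<otimes>\<^bsub>C\<^esub> d = f b'" and d: "d \<in> carrier C"
      using cd unfolding ext_def by blast
    have bB: "b \<in> carrier B" "b' \<in> carrier B" using b b' P.a_subset by auto
    have "f u [^]\<^bsub>C\<^esub> (n + m) \<otimes>\<^bsub>C\<^esub> (c \<oplus>\<^bsub>C\<^esub> d) =
        f u [^]\<^bsub>C\<^esub> m \<otimes>\<^bsub>C\<^esub> (f u [^]\<^bsub>C\<^esub> n \<otimes>\<^bsub>C\<^esub> c) \<oplus>\<^bsub>C\<^esub> f u [^]\<^bsub>C\<^esub> n \<otimes>\<^bsub>C\<^esub> (f u [^]\<^bsub>C\<^esub> m \<otimes>\<^bsub>C\<^esub> d)"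
      using uB c d by (simp add: C.m_ac C.l_distr C.r_distr flip: C.nat_pow_mult)
    also have "\<dots> = f (u [^]\<^bsub>B\<^esub> m \<otimes>\<^bsub>B\<^esub> b \<oplus>\<^bsub>B\<^esub> u [^]\<^bsub>B\<^esub> n \<otimes>\<^bsub>B\<^esub> b')"
      using b b' bB uB by simp
    finally have "f u [^]\<^bsub>C\<^esub> (n + m) \<otimes>\<^bsub>C\<^esub> (c \<oplus>\<^bsub>C\<^esub> d) = \<dots>" .
    moreover have "u [^]\<^bsub>B\<^esub> m \<otimes>\<^bsub>B\<^esub> b \<oplus>\<^bsub>B\<^esub> u [^]\<^bsub>B\<^esub> n \<otimes>\<^bsub>B\<^esub> b' \<in> P"
      using b b' uB by (auto intro!: P.a_closed P.I_l_closed)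
    ultimately show ?thesis unfolding ext_def using c d by blast
  qed
  have sub: "ext u P \<subseteq> carrier C" unfolding ext_def by blast
  have ideal: "ideal (ext u P) C"
  proof (rule idealI)
    show "subgroup (ext u P) (add_monoid C)"
    proof (rule C.add.subgroupI)
      show "ext u P \<noteq> {}" 
        using mem[of "\<zero>\<^bsub>C\<^esub>" "\<zero>\<^bsub>B\<^esub>" 0] P.zero_closed by auto
      fix c assume c: "c \<in> ext u P"
      then have cC: "c \<in> carrier C" using sub by auto
      then have "\<ominus>\<^bsub>C\<^esub> \<one>\<^bsub>C\<^esub> \<otimes>\<^bsub>C\<^esub> c \<in> ext u P" using mult[of "\<ominus>\<^bsub>C\<^esub> \<one>\<^bsub>C\<^esub>" c] c by simp
      then show "\<ominus>\<^bsub>C\<^esub> c \<in> ext u P" using cC by (simp add: C.l_minus)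
    qed (fact sub, fact add)
    fix c d assume "c \<in> ext u P" "d \<in> carrier C"
    moreover from this have "c \<in> carrier C" using sub by auto
    ultimately show "d \<otimes>\<^bsub>C\<^esub> c \<in> ext u P" "c \<otimes>\<^bsub>C\<^esub> d \<in> ext u P"
      using mult[of d c] mult[of c d] by simp_all
  qed (rule C.ring_axioms)
  show ?thesis
  proof (rule primeidealI[OF ideal C.is_cring])
    show "carrier C \<noteq> ext u P" using one by blast
    fix c d assume "c \<in> carrier C" "d \<in> carrier C" "c \<otimes>\<^bsub>C\<^esub> d \<in> ext u P"
    then show "c \<in> ext u P \<or> d \<in> ext u P" using mult[of c d] by simp
  qed
qed

lemma comap_ext:
  assumes P: "primeideal P B" and u: "u \<in> E" "u \<notin> P"
  shows "comap B f (ext u P) = P"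
proof -
  interpret P: primeideal P B by fact
  have "f b \<in> ext u P \<longleftrightarrow> b \<in> P" if "b \<in> carrier B" for b
    by (rule mem_ext_iff[OF P u, where n = 0]) (use that in auto)
  then show ?thesis unfolding comap_def using P.a_subset by auto
qed

lemma mem_prime_iff:
  assumes "primeideal Q C" "u \<in> E" "f u \<notin> Q" "c \<in> carrier C" "f u [^]\<^bsub>C\<^esub> (n::nat) \<otimes>\<^bsub>C\<^esub> c = f b"
  shows "c \<in> Q \<longleftrightarrow> f b \<in> Q"
proof -
  interpret Q: primeideal Q C by fact
  have "f u [^]\<^bsub>C\<^esub> n \<notin> Q"
  proof (induct n)
    case 0 show ?case using Q.I_notcarr Q.one_imp_carrier by auto
  next
    case (Suc n) then show ?case using Q.I_prime[of "f u [^]\<^bsub>C\<^esub> n" "f u"] assms by auto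
  qed
  then show ?thesis using Q.I_prime[of "f u [^]\<^bsub>C\<^esub> n" c] assms Q.I_l_closed[of c "f u [^]\<^bsub>C\<^esub> n"]
    by (metis E_closed C.nat_pow_closed f.hom_closed)
qed

text \<open>A fraction \<open>c/s\<close> over \<open>C\<close> is rewritten over \<open>B\<close>
  by clearing the denominators of \<open>c\<close> and of \<open>s\<close> with powers of
  \<open>u\<close>, which stay outside \<open>Q\<close>.\<close>

lemma stalk_isoI:
  assumes Q: "primeideal Q C" and u: "u \<in> E" "f u \<notin> Q"
  shows "stalk_iso B C f Q"
proof -
  have P: "primeideal (comap B f Q) B"
    by (rule comap_primeideal[OF B.is_cring C.is_cring f_hom Q])
  interpret Q: primeideal Q C by fact
  have uB: "u \<in> carrier B" using u by simp
  show ?thesis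
    unfolding stalk_iso_def stalk_def
  proof (rule loc_map_iso)
    show "frac B (carrier B - comap B f Q)" by (rule B.frac_prime[OF P])
    show "frac C (carrier C - Q)" by (rule C.frac_prime[OF Q])
    show "f ` (carrier B - comap B f Q) \<subseteq> carrier C - Q" unfolding comap_def by auto
    fix c s assume cs: "c \<in> carrier C" "s \<in> carrier C - Q"
    obtain n :: nat and b where b: "b \<in> carrier B" "f u [^]\<^bsub>C\<^esub> n \<otimes>\<^bsub>C\<^esub> c = f b"
      using denom u cs by blast
    obtain m :: nat and t where t: "t \<in> carrier B" "f u [^]\<^bsub>C\<^esub> m \<otimes>\<^bsub>C\<^esub> s = f t"
      using denom u cs by blast
    have "f t \<notin> Q" using mem_prime_iff[OF Q u _ t(2)] cs by auto
    moreover have "f (u [^]\<^bsub>B\<^esub> n) \<notin> Q"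
      using mem_prime_iff[OF Q u, of "\<one>\<^bsub>C\<^esub>" n "u [^]\<^bsub>B\<^esub> n"] uB Q.I_notcarr Q.one_imp_carrier by auto
    ultimately have "f (u [^]\<^bsub>B\<^esub> n \<otimes>\<^bsub>B\<^esub> t) \<notin> Q"
      using Q.I_prime[of "f (u [^]\<^bsub>B\<^esub> n)" "f t"] uB t(1) by auto
    then have tt: "u [^]\<^bsub>B\<^esub> n \<otimes>\<^bsub>B\<^esub> t \<in> carrier B - comap B f Q"
      using uB t unfolding comap_def by auto
    have "c \<otimes>\<^bsub>C\<^esub> f (u [^]\<^bsub>B\<^esub> n \<otimes>\<^bsub>B\<^esub> t) = c \<otimes>\<^bsub>C\<^esub> (f u [^]\<^bsub>C\<^esub> n \<otimes>\<^bsub>C\<^esub> (f u [^]\<^bsub>C\<^esub> m \<otimes>\<^bsub>C\<^esub> s))"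
      using uB t by simp
    also have "\<dots> = f u [^]\<^bsub>C\<^esub> m \<otimes>\<^bsub>C\<^esub> (f u [^]\<^bsub>C\<^esub> n \<otimes>\<^bsub>C\<^esub> c) \<otimes>\<^bsub>C\<^esub> s"
      using uB cs by (simp add: C.m_ac)
    also have "\<dots> = f (u [^]\<^bsub>B\<^esub> m \<otimes>\<^bsub>B\<^esub> b) \<otimes>\<^bsub>C\<^esub> s" using uB b by simp
    finally show "\<exists>b\<in>carrier B. \<exists>t\<in>carrier B - comap B f Q. c \<otimes>\<^bsub>C\<^esub> f t = f b \<otimes>\<^bsub>C\<^esub> s"
      using tt uB b by (metis B.m_closed B.nat_pow_closed)
  qed (use f_hom f_inj in auto)
qed

text \<open>Surjectivity onto the open set is \<open>comap_ext\<close>. Injectivity and openness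
  come from testing membership in a prime of \<open>C\<close> on numerators in \<open>B\<close>, by
  \<open>mem_prime_iff\<close>.\<close>

theorem open_immersion_localizing:
  assumes cover: "\<And>Q. primeideal Q C \<Longrightarrow> \<exists>u\<in>E. f u \<notin> Q"
  shows "open_immersion B C f"
    and "comap B f ` prime_spec C = {P \<in> prime_spec B. \<not> E \<subseteq> P}"
proof -
  have maps: "comap B f Q \<in> prime_spec B" "\<not> E \<subseteq> comap B f Q" if "Q \<in> prime_spec C" for Q
  proof -
    have Q: "primeideal Q C" using that by (simp add: prime_spec_def)
    then show "comap B f Q \<in> prime_spec B"
      using comap_primeideal[OF B.is_cring C.is_cring f_hom] by (simp add: prime_spec_def)
    obtain u where "u \<in> E" "f u \<notin> Q" using cover[OF Q] by blast
    then show "\<not> E \<subseteq> comap B f Q" unfolding comap_def by blast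
  qed
  have onto: "\<exists>Q\<in>prime_spec C. comap B f Q = P" if "P \<in> prime_spec B" "\<not> E \<subseteq> P" for P
  proof -
    from that obtain u where u: "u \<in> E" "u \<notin> P" by blast
    have P: "primeideal P B" using that by (simp add: prime_spec_def)
    show ?thesis
      using primeideal_ext[OF P u] comap_ext[OF P u] by (auto simp: prime_spec_def)
  qed
  show img: "comap B f ` prime_spec C = {P \<in> prime_spec B. \<not> E \<subseteq> P}"
    using maps onto by blast
  have contr: "Q \<subseteq> Q'" if Q: "primeideal Q C" "primeideal Q' C" "comap B f Q = comap B f Q'" for Q Q'
  proof
    interpret Q: primeideal Q C by fact
    fix c assume c: "c \<in> Q"
    then have cC: "c \<in> carrier C" using Q.a_subset by auto
    obtain u where u: "u \<in> E" "f u \<notin> Q" using cover[OF Q(1)] by blast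
    then have u': "f u \<notin> Q'" using Q(3) unfolding comap_def using E_closed by blast
    obtain n :: nat and b where b: "b \<in> carrier B" "f u [^]\<^bsub>C\<^esub> n \<otimes>\<^bsub>C\<^esub> c = f b"
      using denom u cC by blast
    have "f b \<in> Q" using mem_prime_iff[OF Q(1) u cC b(2)] c by simp
    then have "f b \<in> Q'" using Q(3) b unfolding comap_def by blast
    then show "c \<in> Q'" using mem_prime_iff[OF Q(2) u(1) u' cC b(2)] by simp
  qed
  have inj: "inj_on (comap B f) (topspace (zariski C))"
    unfolding topspace_zariski prime_spec_def
    by (rule inj_onI) (simp add: contr subset_antisym)
  have cont: "continuous_map (zariski C) (zariski B) (comap B f)"
    unfolding continuous_map_def topspace_zariski
  proof (intro conjI allI impI)
    show "comap B f \<in> prime_spec C \<rightarrow> prime_spec B" using maps(1) by (rule Pi_I)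
    fix U assume "openin (zariski B) U"
    then obtain F where F: "F \<subseteq> carrier B" "U = {P \<in> prime_spec B. \<not> F \<subseteq> P}"
      unfolding openin_zariski by blast
    have "comap B f Q \<in> U \<longleftrightarrow> \<not> f ` F \<subseteq> Q" if "Q \<in> prime_spec C" for Q
      unfolding F(2) using F(1) maps(1)[OF that] by (auto simp: comap_def)
    then have "{Q \<in> prime_spec C. comap B f Q \<in> U} = {Q \<in> prime_spec C. \<not> f ` F \<subseteq> Q}"
      by blast
    then show "openin (zariski C) {Q \<in> prime_spec C. comap B f Q \<in> U}"
      unfolding openin_zariski using F by (intro exI[of _ "f ` F"]) auto
  qed
  have opn: "open_map (zariski C) (zariski B) (comap B f)"
    unfolding open_map_def
  proof (intro allI impI)
    fix V assume "openin (zariski C) V"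
    then obtain F where F: "F \<subseteq> carrier C" "V = {Q \<in> prime_spec C. \<not> F \<subseteq> Q}"
      unfolding openin_zariski by blast
    \<comment> \<open>The factor \<open>u\<close> in each generator records that \<open>u\<close>
      itself avoids the prime; only then does \<open>b\<close> outside the prime say something about
      \<open>c\<close>.\<close>
    let ?G = "{u \<otimes>\<^bsub>B\<^esub> b |u b. u \<in> E \<and> b \<in> carrier B \<and> (\<exists>c\<in>F. \<exists>n::nat. f u [^]\<^bsub>C\<^esub> n \<otimes>\<^bsub>C\<^esub> c = f b)}"
    have "comap B f ` V = {P \<in> prime_spec B. \<not> ?G \<subseteq> P}"
    proof (intro Set.set_eqI iffI)
      fix P assume "P \<in> comap B f ` V"
      then obtain Q where Q: "Q \<in> prime_spec C" "\<not> F \<subseteq> Q" "P = comap B f Q" using F by blast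
      have pQ: "primeideal Q C" and pP: "primeideal P B"
        using Q(1) maps(1)[OF Q(1)] unfolding Q(3) by (simp_all add: prime_spec_def)
      obtain c where c: "c \<in> F" "c \<notin> Q" using Q by blast
      then have cC: "c \<in> carrier C" using F by blast
      obtain u where u: "u \<in> E" "f u \<notin> Q" using cover[OF pQ] by blast
      obtain n :: nat and b where b: "b \<in> carrier B" "f u [^]\<^bsub>C\<^esub> n \<otimes>\<^bsub>C\<^esub> c = f b"
        using denom u cC by blast
      have "f b \<notin> Q" using mem_prime_iff[OF pQ u cC b(2)] c by simp
      then have "u \<otimes>\<^bsub>B\<^esub> b \<notin> P"
        using primeideal.I_prime[OF pP, of u b] u b(1) Q(3) unfolding comap_def by auto
      moreover have "u \<otimes>\<^bsub>B\<^esub> b \<in> ?G" using u b c by blast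
      ultimately show "P \<in> {P \<in> prime_spec B. \<not> ?G \<subseteq> P}" using pP unfolding prime_spec_def by blast
    next
      fix P assume "P \<in> {P \<in> prime_spec B. \<not> ?G \<subseteq> P}"
      then obtain u b c and n :: nat where P: "P \<in> prime_spec B" "u \<otimes>\<^bsub>B\<^esub> b \<notin> P" "u \<in> E"
        "b \<in> carrier B" "c \<in> F" "f u [^]\<^bsub>C\<^esub> n \<otimes>\<^bsub>C\<^esub> c = f b" by blast
      interpret P: primeideal P B using P by (simp add: prime_spec_def)
      have "u \<notin> P" "b \<notin> P" using P P.I_l_closed P.I_r_closed E_closed by blast+
      then obtain Q where Q: "Q \<in> prime_spec C" "comap B f Q = P" using onto P by blast
      have "u \<notin> comap B f Q" "b \<notin> comap B f Q" using Q(2) \<open>u \<notin> P\<close> \<open>b \<notin> P\<close> by simp_all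
      then have "f b \<notin> Q" "f u \<notin> Q" using P(3,4) by (simp_all add: comap_def)
      moreover have "primeideal Q C" "c \<in> carrier C" using Q P F by (auto simp: prime_spec_def)
      ultimately have "c \<notin> Q" using mem_prime_iff[of Q u c n b] P(3,6) by simp
      then have "Q \<in> V" using Q(1) P(5) unfolding F(2) by blast
      then show "P \<in> comap B f ` V" using Q(2) by blast
    qed
    moreover have "?G \<subseteq> carrier B" using E_closed by auto
    ultimately show "openin (zariski B) (comap B f ` V)"
      unfolding openin_zariski by (intro exI[of _ ?G]) simp
  qed
  show "open_immersion B C f"
    unfolding open_immersion_def
  proof (intro conjI ballI)
    show "embedding_map (zariski C) (zariski B) (comap B f)"
      by (rule injective_open_imp_embedding_map[OF cont opn inj])
    show "openin (zariski B) (comap B f ` prime_spec C)"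
      unfolding img openin_zariski using E_sub by (intro exI[of _ E]) simp
    fix Q assume "Q \<in> prime_spec C"
    then have Q: "primeideal Q C" by (simp add: prime_spec_def)
    then obtain u where "u \<in> E" "f u \<notin> Q" using cover by blast
    then show "stalk_iso B C f Q" by (rule stalk_isoI[OF Q])
  qed (rule f_hom)
qed

end

section \<open>Families of discs\<close>

text \<open>A disc \<open>(s, m)\<close> stands for the coset \<open>s + x\<^sup>m A\<close>.  In the intended model \<open>K\<close> is \<open>A\<^sub>x[T]\<close>,
  \<open>R (s, m)\<close> is the subring \<open>A[\<tau>]\<close> generated by \<open>\<tau> = x\<^sup>-\<^sup>m (T - s)\<close>, and \<open>\<rho> (s, m)\<close> is its reduction
  modulo \<open>x\<close>, with values in \<open>P = (A/x)[t]\<close>.\<close>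

locale disc_system = A: domain A + K?: domain K + P: domain P
  for A :: "('a, 'm) ring_scheme" and K :: "('k, 'n) ring_scheme" (structure)
    and P :: "('p, 'l) ring_scheme" +
  fixes x :: 'a and c :: "'a \<Rightarrow> 'k" and T :: 'k and \<kappa> :: "'a \<Rightarrow> 'p" and t :: 'p
    and \<tau> :: "'a \<times> nat \<Rightarrow> 'k" and R :: "'a \<times> nat \<Rightarrow> 'k set" and \<rho> :: "'a \<times> nat \<Rightarrow> 'k \<Rightarrow> 'p"
  assumes x_closed [simp]: "x \<in> carrier A" and x_nz: "x \<noteq> \<zero>\<^bsub>A\<^esub>"
    and c_hom: "c \<in> ring_hom A K" and c_inj: "inj_on c (carrier A)" and c_unit: "c x \<in> Units K"
    and T_closed [simp]: "T \<in> carrier K"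
    and \<kappa>_hom: "\<kappa> \<in> ring_hom A P" and t_closed [simp]: "t \<in> carrier P"
    and \<kappa>_zero: "\<And>a. a \<in> carrier A \<Longrightarrow> \<kappa> a = \<zero>\<^bsub>P\<^esub> \<longleftrightarrow> a \<in> PIdl\<^bsub>A\<^esub> x"
    and \<kappa>_inv: "\<And>a. a \<in> carrier A \<Longrightarrow> a \<notin> PIdl\<^bsub>A\<^esub> x \<Longrightarrow> \<exists>b\<in>carrier A. \<kappa> a \<otimes>\<^bsub>P\<^esub> \<kappa> b = \<one>\<^bsub>P\<^esub>"
    and P_unit: "\<And>p q. p \<in> carrier P \<Longrightarrow> q \<in> carrier P \<Longrightarrow> p \<otimes>\<^bsub>P\<^esub> q = \<one>\<^bsub>P\<^esub> \<Longrightarrow> p \<in> \<kappa> ` carrier A"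
    and t_nonconst: "t \<notin> \<kappa> ` carrier A"
    and P_gen: "\<And>M. \<zero>\<^bsub>P\<^esub> \<in> M \<Longrightarrow>
        (\<And>a q. a \<in> carrier A \<Longrightarrow> q \<in> M \<Longrightarrow> q \<in> carrier P \<Longrightarrow> \<kappa> a \<oplus>\<^bsub>P\<^esub> t \<otimes>\<^bsub>P\<^esub> q \<in> M) \<Longrightarrow>
        carrier P \<subseteq> M"
    and R_subring: "\<And>D. fst D \<in> carrier A \<Longrightarrow> subring (R D) K"
    and c_mem: "\<And>D a. fst D \<in> carrier A \<Longrightarrow> a \<in> carrier A \<Longrightarrow> c a \<in> R D"
    and \<tau>_mem: "\<And>D. fst D \<in> carrier A \<Longrightarrow> \<tau> D \<in> R D"
    and \<tau>_eq: "\<And>D. fst D \<in> carrier A \<Longrightarrow> c x [^] snd D \<otimes> \<tau> D = T \<ominus> c (fst D)"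
    and R_gen: "\<And>D M. fst D \<in> carrier A \<Longrightarrow> \<zero> \<in> M \<Longrightarrow>
        (\<And>a q. a \<in> carrier A \<Longrightarrow> q \<in> M \<Longrightarrow> q \<in> R D \<Longrightarrow> c a \<oplus> \<tau> D \<otimes> q \<in> M) \<Longrightarrow> R D \<subseteq> M"
    and \<rho>_hom: "\<And>D. fst D \<in> carrier A \<Longrightarrow> \<rho> D \<in> ring_hom (K\<lparr>carrier := R D\<rparr>) P"
    and \<rho>_c: "\<And>D a. fst D \<in> carrier A \<Longrightarrow> a \<in> carrier A \<Longrightarrow> \<rho> D (c a) = \<kappa> a"
    and \<rho>_\<tau>: "\<And>D. fst D \<in> carrier A \<Longrightarrow> \<rho> D (\<tau> D) = t"
    and \<rho>_ker: "\<And>D y. fst D \<in> carrier A \<Longrightarrow> y \<in> R D \<Longrightarrow> \<rho> D y = \<zero>\<^bsub>P\<^esub> \<Longrightarrow> \<exists>z\<in>R D. y = c x \<otimes> z"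
    and denom: "\<And>D y. fst D \<in> carrier A \<Longrightarrow> y \<in> carrier K \<Longrightarrow> \<exists>n::nat. c x [^] n \<otimes> y \<in> R D"
    and \<tau>_memD: "\<And>D D'. fst D \<in> carrier A \<Longrightarrow> fst D' \<in> carrier A \<Longrightarrow> \<tau> D \<in> R D' \<Longrightarrow>
        snd D \<le> snd D' \<and> fst D \<ominus>\<^bsub>A\<^esub> fst D' \<in> PIdl\<^bsub>A\<^esub> (x [^]\<^bsub>A\<^esub> snd D)"
begin

abbreviation \<xi> where "\<xi> \<equiv> c x"

sublocale c: ring_hom_cring A K c
  by (rule UnivPoly.ring_hom_cringI[OF A.is_cring is_cring c_hom])

sublocale \<kappa>: ring_hom_cring A P \<kappa>
  by (rule UnivPoly.ring_hom_cringI[OF A.is_cring P.is_cring \<kappa>_hom])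

section \<open>Congruence of centres and the ring of a single disc\<close>

definition near :: "nat \<Rightarrow> 'a \<Rightarrow> 'a \<Rightarrow> bool" where
  "near m s s' \<longleftrightarrow> s \<ominus>\<^bsub>A\<^esub> s' \<in> PIdl\<^bsub>A\<^esub> (x [^]\<^bsub>A\<^esub> m)"

lemma ideal_pow: "ideal (PIdl\<^bsub>A\<^esub> (x [^]\<^bsub>A\<^esub> (m::nat))) A"
  by (rule A.cgenideal_ideal) simp

lemma near_iff: "near m s s' \<longleftrightarrow> (\<exists>a\<in>carrier A. s \<ominus>\<^bsub>A\<^esub> s' = x [^]\<^bsub>A\<^esub> m \<otimes>\<^bsub>A\<^esub> a)"
  unfolding near_def cgenideal_def using A.m_comm[OF A.nat_pow_closed[OF x_closed]] by auto

lemma near_refl [simp]: "s \<in> carrier A \<Longrightarrow> near m s s"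
  unfolding near_iff by (intro bexI[of _ "\<zero>\<^bsub>A\<^esub>"]) (simp_all add: A.r_right_minus_eq)

lemma near_sym:
  assumes "near m s s'" "s \<in> carrier A" "s' \<in> carrier A" shows "near m s' s"
proof -
  interpret I: ideal "PIdl\<^bsub>A\<^esub> (x [^]\<^bsub>A\<^esub> m)" A by (rule ideal_pow)
  have "\<ominus>\<^bsub>A\<^esub> (s \<ominus>\<^bsub>A\<^esub> s') = s' \<ominus>\<^bsub>A\<^esub> s"
    using assms by (simp add: A.minus_eq A.minus_add A.a_comm)
  then show ?thesis using assms I.a_inv_closed unfolding near_def by metis
qed

lemma near_trans:
  assumes "near m s s'" "near m s' s''" "s \<in> carrier A" "s' \<in> carrier A" "s'' \<in> carrier A"
  shows "near m s s''"
proof -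
  interpret I: ideal "PIdl\<^bsub>A\<^esub> (x [^]\<^bsub>A\<^esub> m)" A by (rule ideal_pow)
  have "(s \<ominus>\<^bsub>A\<^esub> s') \<oplus>\<^bsub>A\<^esub> (s' \<ominus>\<^bsub>A\<^esub> s'') = s \<ominus>\<^bsub>A\<^esub> s''"
    using assms(3-5) by (simp add: A.minus_eq A.a_assoc A.r_neg1)
  then show ?thesis using assms(1,2) I.a_closed unfolding near_def by metis
qed

lemma near_mono: "near m s s' \<Longrightarrow> m' \<le> m \<Longrightarrow> near m' s s'"
proof -
  assume "near m s s'" "m' \<le> m"
  then obtain a where a: "a \<in> carrier A" "s \<ominus>\<^bsub>A\<^esub> s' = x [^]\<^bsub>A\<^esub> m \<otimes>\<^bsub>A\<^esub> a" unfolding near_iff by blast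
  have "x [^]\<^bsub>A\<^esub> m = x [^]\<^bsub>A\<^esub> m' \<otimes>\<^bsub>A\<^esub> x [^]\<^bsub>A\<^esub> (m - m')"
    using \<open>m' \<le> m\<close> by (simp add: A.nat_pow_mult)
  then show ?thesis unfolding near_iff
    using a by (intro bexI[of _ "x [^]\<^bsub>A\<^esub> (m - m') \<otimes>\<^bsub>A\<^esub> a"]) (auto simp: A.m_assoc)
qed

lemma near_zero: "s \<in> carrier A \<Longrightarrow> s' \<in> carrier A \<Longrightarrow> near 0 s s'"
  unfolding near_iff by (intro bexI[of _ "s \<ominus>\<^bsub>A\<^esub> s'"]) auto

lemma \<xi>_closed [simp]: "\<xi> \<in> carrier K" by simp

lemma \<xi>_pow_unit: "\<xi> [^] (n::nat) \<in> Units K"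
  by (induct n) (simp_all add: c_unit Units_m_closed)

lemma \<xi>_pow_cancel: "y \<in> carrier K \<Longrightarrow> z \<in> carrier K \<Longrightarrow> \<xi> [^] (n::nat) \<otimes> y = \<xi> [^] n \<otimes> z \<longleftrightarrow> y = z"
  by (metis Units_l_cancel \<xi>_pow_unit)

lemma \<xi>_cancel: "y \<in> carrier K \<Longrightarrow> z \<in> carrier K \<Longrightarrow> \<xi> \<otimes> y = \<xi> \<otimes> z \<longleftrightarrow> y = z"
  by (metis Units_l_cancel c_unit)

lemma \<xi>_pow_nz: "\<xi> [^] (n::nat) \<noteq> \<zero>"
  using \<xi>_pow_cancel[of \<one> \<zero> n] one_not_zero by (metis r_null one_closed zero_closed \<xi>_closed nat_pow_closed r_one)

lemma \<xi>_div: "y \<in> carrier K \<Longrightarrow> \<exists>z\<in>carrier K. y = \<xi> \<otimes> z"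
  by (intro bexI[of _ "inv \<xi> \<otimes> y"]) (use c_unit in \<open>simp_all flip: m_assoc add: Units_r_inv\<close>)

context
  fixes D :: "'a \<times> nat" assumes D: "fst D \<in> carrier A"
begin

lemma R_sub: "R D \<subseteq> carrier K" using subringE(1)[OF R_subring[OF D]] .
lemma R_closed: "y \<in> R D \<Longrightarrow> y \<in> carrier K" using R_sub by blast
lemma R_zero: "\<zero> \<in> R D" using subringE(2)[OF R_subring[OF D]] .
lemma R_one: "\<one> \<in> R D" using subringE(3)[OF R_subring[OF D]] .
lemma R_add: "y \<in> R D \<Longrightarrow> z \<in> R D \<Longrightarrow> y \<oplus> z \<in> R D" using subringE(7)[OF R_subring[OF D]] .
lemma R_mult: "y \<in> R D \<Longrightarrow> z \<in> R D \<Longrightarrow> y \<otimes> z \<in> R D" using subringE(6)[OF R_subring[OF D]] .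
lemma R_neg: "y \<in> R D \<Longrightarrow> \<ominus> y \<in> R D" using subringE(5)[OF R_subring[OF D]] .
lemma R_minus: "y \<in> R D \<Longrightarrow> z \<in> R D \<Longrightarrow> y \<ominus> z \<in> R D"
  unfolding minus_eq by (intro R_add R_neg)
lemma R_pow: "y \<in> R D \<Longrightarrow> y [^] (n::nat) \<in> R D"
  by (induct n) (simp_all add: R_one R_mult)
lemma R_\<xi>: "\<xi> \<in> R D" by (rule c_mem[OF D]) simp

lemma \<tau>_closed: "\<tau> D \<in> carrier K" by (rule R_closed[OF \<tau>_mem[OF D]])

lemma \<rho>_closed: "y \<in> R D \<Longrightarrow> \<rho> D y \<in> carrier P"
  using ring_hom_closed[OF \<rho>_hom[OF D]] by simp
lemma \<rho>_add: "y \<in> R D \<Longrightarrow> z \<in> R D \<Longrightarrow> \<rho> D (y \<oplus> z) = \<rho> D y \<oplus>\<^bsub>P\<^esub> \<rho> D z"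
  using ring_hom_add[OF \<rho>_hom[OF D], of y z] by simp
lemma \<rho>_mult: "y \<in> R D \<Longrightarrow> z \<in> R D \<Longrightarrow> \<rho> D (y \<otimes> z) = \<rho> D y \<otimes>\<^bsub>P\<^esub> \<rho> D z"
  using ring_hom_mult[OF \<rho>_hom[OF D], of y z] by simp
lemma \<rho>_one: "\<rho> D \<one> = \<one>\<^bsub>P\<^esub>"
  using ring_hom_one[OF \<rho>_hom[OF D]] by simp
lemma \<rho>_zero: "\<rho> D \<zero> = \<zero>\<^bsub>P\<^esub>"
  using \<rho>_c[OF D, of "\<zero>\<^bsub>A\<^esub>"] by simp
lemma \<rho>_neg: "y \<in> R D \<Longrightarrow> \<rho> D (\<ominus> y) = \<ominus>\<^bsub>P\<^esub> \<rho> D y"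
  using \<rho>_add[of "\<ominus> y" y] by (intro P.minus_equality[symmetric]) (simp_all add: R_neg \<rho>_closed \<rho>_zero R_closed l_neg)
lemma \<rho>_minus: "y \<in> R D \<Longrightarrow> z \<in> R D \<Longrightarrow> \<rho> D (y \<ominus> z) = \<rho> D y \<ominus>\<^bsub>P\<^esub> \<rho> D z"
  unfolding minus_eq P.minus_eq by (simp add: \<rho>_add \<rho>_neg R_neg)
lemma \<rho>_pow: "y \<in> R D \<Longrightarrow> \<rho> D (y [^] (n::nat)) = \<rho> D y [^]\<^bsub>P\<^esub> n"
  by (induct n) (simp_all add: \<rho>_one \<rho>_mult R_pow)
lemma \<rho>_\<xi>: "\<rho> D \<xi> = \<zero>\<^bsub>P\<^esub>"
  using \<rho>_c[OF D, of x] \<kappa>_zero[of x] A.cgenideal_self[OF x_closed] by simp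
lemma \<rho>_\<xi>_mult: "y \<in> R D \<Longrightarrow> \<rho> D (\<xi> \<otimes> y) = \<zero>\<^bsub>P\<^esub>"
  by (simp add: \<rho>_mult R_\<xi> \<rho>_\<xi> \<rho>_closed)

text \<open>As \<open>\<xi>\<close> is invertible in \<open>K\<close>, membership in
  \<open>R D\<close> is a question about poles along \<open>x\<close>; the reduction decides whether
  one factor \<open>\<xi>\<close> can be cancelled.\<close>

lemma \<rho>_zero_iff: "y \<in> carrier K \<Longrightarrow> \<xi> \<otimes> y \<in> R D \<Longrightarrow> \<rho> D (\<xi> \<otimes> y) = \<zero>\<^bsub>P\<^esub> \<longleftrightarrow> y \<in> R D"
proof
  assume y: "y \<in> carrier K" "\<xi> \<otimes> y \<in> R D" "\<rho> D (\<xi> \<otimes> y) = \<zero>\<^bsub>P\<^esub>"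
  then obtain z where "z \<in> R D" "\<xi> \<otimes> y = \<xi> \<otimes> z" using \<rho>_ker[OF D] by blast
  then show "y \<in> R D" using y \<xi>_cancel R_closed by simp
qed (rule \<rho>_\<xi>_mult)

text \<open>\<open>P\<close> is a domain, so \<open>e\<close> is not a zero divisor modulo
  \<open>x\<close> and cannot cancel a pole along \<open>x\<close>. The power of
  \<open>\<xi>\<close> supplied by \<open>denom\<close> is removed one factor at a time.\<close>

lemma saturated:
  assumes e: "e \<in> R D" "\<rho> D e \<noteq> \<zero>\<^bsub>P\<^esub>" and y: "y \<in> carrier K" "e [^] (n::nat) \<otimes> y \<in> R D"
  shows "y \<in> R D"
proof -
  have eK: "e \<in> carrier K" using e R_closed by simp
  have en: "\<rho> D (e [^] n) \<noteq> \<zero>\<^bsub>P\<^esub>"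
    unfolding \<rho>_pow[OF e(1)] using e \<rho>_closed[OF e(1)] by (induct n) (auto simp: P.integral_iff)
  have "y \<in> R D" if "\<xi> [^] k \<otimes> y \<in> R D" for k :: nat
    using that
  proof (induct k)
    case 0 then show ?case using y by simp
  next
    case (Suc k)
    let ?z = "\<xi> [^] k \<otimes> y"
    have z: "\<xi> \<otimes> ?z \<in> R D" using Suc.prems y by (simp add: m_ac)
    have "e [^] n \<otimes> (\<xi> \<otimes> ?z) = \<xi> \<otimes> (\<xi> [^] k \<otimes> (e [^] n \<otimes> y))"
      using y eK by (simp add: m_ac)
    moreover have "\<xi> [^] k \<otimes> (e [^] n \<otimes> y) \<in> R D"
      by (rule c.hom_pow[OF x_closed, THEN subst]) (intro R_mult c_mem[OF D] y; simp)
    ultimately have "\<rho> D (e [^] n \<otimes> (\<xi> \<otimes> ?z)) = \<zero>\<^bsub>P\<^esub>" using \<rho>_\<xi>_mult by metis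
    then have "\<rho> D (e [^] n) \<otimes>\<^bsub>P\<^esub> \<rho> D (\<xi> \<otimes> ?z) = \<zero>\<^bsub>P\<^esub>"
      using \<rho>_mult[OF R_pow[OF e(1)] z] by metis
    then have "\<rho> D (\<xi> \<otimes> ?z) = \<zero>\<^bsub>P\<^esub>"
      using en P.integral_iff[OF \<rho>_closed[OF R_pow[OF e(1)]] \<rho>_closed[OF z]] by blast
    then have "?z \<in> R D" using \<rho>_zero_iff[OF _ z] y by simp
    then show ?case by (rule Suc.hyps)
  qed
  then show ?thesis using denom[OF D y(1)] by blast
qed

lemma R_min:
  assumes C: "subring C K" and "c ` carrier A \<subseteq> C" "\<tau> D \<in> C"
  shows "R D \<subseteq> C"
  by (rule R_gen[OF D]) (use assms subringE[OF C] in auto)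

lemma T_mem: "T \<in> R D"
proof -
  have "T = \<xi> [^] snd D \<otimes> \<tau> D \<oplus> c (fst D)"
    unfolding \<tau>_eq[OF D] using D by (simp add: minus_eq a_assoc l_neg)
  then show ?thesis using R_add R_mult R_pow R_\<xi> \<tau>_mem c_mem D by metis
qed

end

text \<open>Containment of cosets, smaller disc first; the smaller disc has the larger
  level.\<close>

definition le :: "'a \<times> nat \<Rightarrow> 'a \<times> nat \<Rightarrow> bool" where
  "le D' D \<longleftrightarrow> snd D \<le> snd D' \<and> near (snd D) (fst D') (fst D)"

text \<open>The coordinate of a disc is affine in that of a smaller disc. Both sides are compared
  after multiplication by the unit \<open>\<xi> [^] snd D\<close>, where they become
  \<open>T\<close> minus the centre of \<open>D\<close>.\<close>

lemma \<tau>_expand: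
  assumes "fst D \<in> carrier A" "fst D' \<in> carrier A" "snd D \<le> snd D'" "a \<in> carrier A"
    and "fst D' \<ominus>\<^bsub>A\<^esub> fst D = x [^]\<^bsub>A\<^esub> snd D \<otimes>\<^bsub>A\<^esub> a"
  shows "\<tau> D = c a \<oplus> \<xi> [^] (snd D' - snd D) \<otimes> \<tau> D'"
proof -
  note cl = \<tau>_closed[OF assms(1)] \<tau>_closed[OF assms(2)]
  have "\<xi> [^] snd D \<otimes> (c a \<oplus> \<xi> [^] (snd D' - snd D) \<otimes> \<tau> D') =
      c (x [^]\<^bsub>A\<^esub> snd D \<otimes>\<^bsub>A\<^esub> a) \<oplus> (\<xi> [^] snd D \<otimes> \<xi> [^] (snd D' - snd D)) \<otimes> \<tau> D'"
    using assms cl by (simp add: r_distr m_assoc)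
  also have "\<xi> [^] snd D \<otimes> \<xi> [^] (snd D' - snd D) = \<xi> [^] snd D'"
    using assms(3) by (simp add: nat_pow_mult)
  also have "c (x [^]\<^bsub>A\<^esub> snd D \<otimes>\<^bsub>A\<^esub> a) \<oplus> \<xi> [^] snd D' \<otimes> \<tau> D' = T \<ominus> c (fst D)"
  proof -
    have "(v \<ominus> u) \<oplus> (T \<ominus> v) = T \<ominus> u" if "u \<in> carrier K" "v \<in> carrier K" for u v
      using that T_closed by algebra
    from this[of "c (fst D)" "c (fst D')"] show ?thesis
      unfolding assms(5)[symmetric] \<tau>_eq[OF assms(2)] using assms(1,2)
      by (simp add: minus_eq A.minus_eq)
  qed
  also have "\<dots> = \<xi> [^] snd D \<otimes> \<tau> D" by (rule \<tau>_eq[OF assms(1), symmetric])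
  finally show ?thesis using assms cl by (simp add: \<xi>_pow_cancel)
qed

lemma le_imp_subset:
  assumes "fst D \<in> carrier A" "fst D' \<in> carrier A" "le D' D"
  shows "R D \<subseteq> R D'"
proof (rule R_min[OF assms(1) R_subring[OF assms(2)]])
  obtain a where "a \<in> carrier A" "fst D' \<ominus>\<^bsub>A\<^esub> fst D = x [^]\<^bsub>A\<^esub> snd D \<otimes>\<^bsub>A\<^esub> a"
    using assms(3) unfolding le_def near_iff by blast
  with assms show "\<tau> D \<in> R D'"
    using \<tau>_expand[OF assms(1,2)] R_add[OF assms(2)] R_mult[OF assms(2)] R_pow[OF assms(2)]
      R_\<xi>[OF assms(2)] \<tau>_mem[OF assms(2)] c_mem[OF assms(2)] unfolding le_def by metis
qed (use c_mem[OF assms(2)] in auto)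

lemma subset_imp_le:
  assumes "fst D \<in> carrier A" "fst D' \<in> carrier A" "R D \<subseteq> R D'"
  shows "le D' D"
proof -
  have "\<tau> D \<in> R D'" using \<tau>_mem[OF assms(1)] assms(3) by blast
  from \<tau>_memD[OF assms(1,2) this] show ?thesis
    unfolding le_def using near_sym[of "snd D" "fst D" "fst D'"] assms(1,2) by (auto simp: near_def)
qed

text \<open>Vanishing modulo \<open>x\<close> is divisibility by \<open>\<xi>\<close> in
  \<open>R D\<close>, and this persists in the larger ring \<open>R D'\<close>.\<close>

lemma le_zero:
  assumes "fst D \<in> carrier A" "fst D' \<in> carrier A" "le D' D" "y \<in> R D" "\<rho> D y = \<zero>\<^bsub>P\<^esub>"
  shows "\<rho> D' y = \<zero>\<^bsub>P\<^esub>"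
proof -
  obtain z where "z \<in> R D" "y = \<xi> \<otimes> z" using \<rho>_ker[OF assms(1,4,5)] by blast
  then show ?thesis using \<rho>_\<xi>_mult[OF assms(2)] le_imp_subset[OF assms(1-3)] by blast
qed

lemma le_one:
  assumes "fst D \<in> carrier A" "fst D' \<in> carrier A" "le D' D" "y \<in> R D" "\<rho> D y = \<one>\<^bsub>P\<^esub>"
  shows "\<rho> D' y = \<one>\<^bsub>P\<^esub>"
proof -
  have "\<rho> D (y \<ominus> \<one>) = \<zero>\<^bsub>P\<^esub>"
    using assms by (simp add: \<rho>_minus R_one \<rho>_one P.r_right_minus_eq)
  then have "\<rho> D' (y \<ominus> \<one>) = \<zero>\<^bsub>P\<^esub>"
    using le_zero[OF assms(1-3)] R_minus[OF assms(1)] R_one[OF assms(1)] assms(4) by blast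
  moreover have "y \<in> R D'" using le_imp_subset[OF assms(1-3)] assms(4) by blast
  ultimately show ?thesis
    using assms by (simp add: \<rho>_minus R_one \<rho>_one P.r_right_minus_eq \<rho>_closed)
qed

text \<open>Two discs meet exactly when their centres agree modulo the power of \<open>x\<close>
  given by the smaller level, and then one contains the other; hence the \<open>min\<close>.\<close>

definition fam :: "('a \<times> nat) set \<Rightarrow> bool" where
  "fam F \<longleftrightarrow> finite F \<and> F \<noteq> {} \<and> (\<forall>D\<in>F. fst D \<in> carrier A) \<and>
     (\<forall>D\<in>F. \<forall>D'\<in>F. D \<noteq> D' \<longrightarrow> \<not> near (min (snd D) (snd D')) (fst D) (fst D'))"

definition B :: "('a \<times> nat) set \<Rightarrow> 'k set" where
  "B F = (\<Inter>D\<in>F. R D)"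

lemma famD: "fam F \<Longrightarrow> D \<in> F \<Longrightarrow> fst D \<in> carrier A"
  unfolding fam_def by blast

lemma fam_finite: "fam F \<Longrightarrow> finite F" unfolding fam_def by blast

lemma fam_disjoint:
  "fam F \<Longrightarrow> D \<in> F \<Longrightarrow> D' \<in> F \<Longrightarrow> near (min (snd D) (snd D')) (fst D) (fst D') \<Longrightarrow> D = D'"
  unfolding fam_def by blast

lemma fam_subset: "fam F \<Longrightarrow> G \<subseteq> F \<Longrightarrow> G \<noteq> {} \<Longrightarrow> fam G"
  unfolding fam_def by (meson finite_subset subset_eq)

lemma B_memD: "b \<in> B F \<Longrightarrow> D \<in> F \<Longrightarrow> b \<in> R D"
  unfolding B_def by blast

lemma B_subring: "fam F \<Longrightarrow> subring (B F) K"
  unfolding B_def fam_def by (intro subring_Inter) (auto simp: R_subring)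

lemma B_closed: "fam F \<Longrightarrow> b \<in> B F \<Longrightarrow> b \<in> carrier K"
  using subringE(1)[OF B_subring] by blast

lemma c_B: "fam F \<Longrightarrow> a \<in> carrier A \<Longrightarrow> c a \<in> B F"
  unfolding B_def by (auto simp: c_mem famD)

lemma T_B: "fam F \<Longrightarrow> T \<in> B F"
  unfolding B_def by (auto simp: T_mem famD)

text \<open>The common kernel of the reductions is \<open>\<xi>\<close> times \<open>B F\<close>
  (see \<open>B_div\<close>), so this says that \<open>B F\<close> modulo \<open>x\<close> is the
  full product of copies of \<open>P\<close>, one for each disc.\<close>

definition dense :: "('a \<times> nat) set \<Rightarrow> bool" where
  "dense F \<longleftrightarrow> (\<forall>v \<in> F \<rightarrow> carrier P. \<exists>b\<in>B F. \<forall>D\<in>F. \<rho> D b = v D)"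

lemma B_add: "fam F \<Longrightarrow> y \<in> B F \<Longrightarrow> z \<in> B F \<Longrightarrow> y \<oplus> z \<in> B F"
  using subringE(7)[OF B_subring] .
lemma B_mult: "fam F \<Longrightarrow> y \<in> B F \<Longrightarrow> z \<in> B F \<Longrightarrow> y \<otimes> z \<in> B F"
  using subringE(6)[OF B_subring] .
lemma B_neg: "fam F \<Longrightarrow> y \<in> B F \<Longrightarrow> \<ominus> y \<in> B F"
  using subringE(5)[OF B_subring] .
lemma B_minus: "fam F \<Longrightarrow> y \<in> B F \<Longrightarrow> z \<in> B F \<Longrightarrow> y \<ominus> z \<in> B F"
  unfolding minus_eq by (intro B_add B_neg)
lemma B_one: "fam F \<Longrightarrow> \<one> \<in> B F"
  using subringE(3)[OF B_subring] .
lemma B_zero: "fam F \<Longrightarrow> \<zero> \<in> B F"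
  using subringE(2)[OF B_subring] .
lemma denseD:
  assumes "dense F" "\<And>D. D \<in> F \<Longrightarrow> v D \<in> carrier P"
  obtains b where "b \<in> B F" "\<And>D. D \<in> F \<Longrightarrow> \<rho> D b = v D"
proof -
  have "v \<in> F \<rightarrow> carrier P" using assms(2) by (rule Pi_I)
  then show ?thesis using assms(1) that unfolding dense_def by blast
qed

text \<open>Elements concentrated on a single disc suffice for density, and these may be obtained from
  the idempotents and lifts of \<open>t\<close> only.\<close>

lemma dense_if_concentrated:
  assumes F: "fam F"
    and conc: "\<And>D p. D \<in> F \<Longrightarrow> p \<in> carrier P \<Longrightarrow>
      \<exists>b\<in>B F. \<rho> D b = p \<and> (\<forall>D'\<in>F. D' \<noteq> D \<longrightarrow> \<rho> D' b = \<zero>\<^bsub>P\<^esub>)"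
  shows "dense F"
  unfolding dense_def
proof
  fix v assume v: "v \<in> F \<rightarrow> carrier P"
  have "\<exists>b\<in>B F. \<forall>D\<in>F. \<rho> D b = (if D \<in> G then v D else \<zero>\<^bsub>P\<^esub>)" if "finite G" "G \<subseteq> F" for G
    using that
  proof (induct G)
    case empty
    show ?case using B_zero[OF F] by (intro bexI[of _ \<zero>]) (simp_all add: \<rho>_zero famD[OF F])
  next
    case (insert E G)
    then obtain b where b: "b \<in> B F" "\<And>D. D \<in> F \<Longrightarrow> \<rho> D b = (if D \<in> G then v D else \<zero>\<^bsub>P\<^esub>)" by auto
    have E: "E \<in> F" using insert by auto
    then obtain b' where b': "b' \<in> B F" "\<rho> E b' = v E" "\<And>D. D \<in> F \<Longrightarrow> D \<noteq> E \<Longrightarrow> \<rho> D b' = \<zero>\<^bsub>P\<^esub>"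
      using conc[OF E, of "v E"] v by blast
    have "\<rho> D (b \<oplus> b') = (if D \<in> insert E G then v D else \<zero>\<^bsub>P\<^esub>)" if D: "D \<in> F" for D
    proof -
      have vD: "v D \<in> carrier P" using v D by auto
      have "\<rho> D (b \<oplus> b') = \<rho> D b \<oplus>\<^bsub>P\<^esub> \<rho> D b'"
        by (rule \<rho>_add[OF famD[OF F D]]) (use b(1) b'(1) D B_memD in auto)
      then show ?thesis using b(2)[OF D] b'(2) b'(3)[OF D] insert(2) vD by (cases "D = E") auto
    qed
    then show ?case using B_add[OF F b(1) b'(1)] by blast
  qed
  from this[OF fam_finite[OF F] subset_refl] show "\<exists>b\<in>B F. \<forall>D\<in>F. \<rho> D b = v D" by auto
qed

text \<open>\<open>P_gen\<close> builds every \<open>p\<close> from constants and \<open>t\<close>,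
  and these are lifted by the elements \<open>c a\<close> and by \<open>g\<close>.\<close>

lemma \<rho>_onto:
  assumes F: "fam F" "D \<in> F" and g: "g \<in> B F" "\<rho> D g = t" and p: "p \<in> carrier P"
  shows "\<exists>b\<in>B F. \<rho> D b = p"
proof -
  note D = famD[OF F]
  have gD: "g \<in> R D" using B_memD g F by blast
  have "carrier P \<subseteq> {p. \<exists>b\<in>B F. \<rho> D b = p}"
  proof (rule P_gen)
    show "\<zero>\<^bsub>P\<^esub> \<in> {p. \<exists>b\<in>B F. \<rho> D b = p}" using B_zero[OF F(1)] \<rho>_zero[OF D] by blast
    fix a q assume a: "a \<in> carrier A" and "q \<in> {p. \<exists>b\<in>B F. \<rho> D b = p}"
    then obtain b where b: "b \<in> B F" "\<rho> D b = q" by blast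
    then have bD: "b \<in> R D" using B_memD F by blast
    have "\<rho> D (c a \<oplus> g \<otimes> b) = \<kappa> a \<oplus>\<^bsub>P\<^esub> t \<otimes>\<^bsub>P\<^esub> q"
      using a b(2) g(2) by (simp add: \<rho>_add \<rho>_mult \<rho>_c D gD bD c_mem R_mult)
    moreover have "c a \<oplus> g \<otimes> b \<in> B F"
      using a b g by (intro B_add B_mult c_B F)
    ultimately show "\<kappa> a \<oplus>\<^bsub>P\<^esub> t \<otimes>\<^bsub>P\<^esub> q \<in> {p. \<exists>b\<in>B F. \<rho> D b = p}" by blast
  qed
  then show ?thesis using p by blast
qed

lemma dense_if_generators:
  assumes F: "fam F"
    and idem: "\<And>D. D \<in> F \<Longrightarrow> \<exists>e\<in>B F. \<rho> D e = \<one>\<^bsub>P\<^esub> \<and> (\<forall>D'\<in>F. D' \<noteq> D \<longrightarrow> \<rho> D' e = \<zero>\<^bsub>P\<^esub>)"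
    and gen: "\<And>D. D \<in> F \<Longrightarrow> \<exists>g\<in>B F. \<rho> D g = t"
  shows "dense F"
proof (rule dense_if_concentrated[OF F])
  fix D p assume D: "D \<in> F" and p: "p \<in> carrier P"
  obtain g where g: "g \<in> B F" "\<rho> D g = t" using gen[OF D] by blast
  obtain b where b: "b \<in> B F" "\<rho> D b = p" using \<rho>_onto[OF F D g p] by blast
  obtain e where e: "e \<in> B F" "\<rho> D e = \<one>\<^bsub>P\<^esub>" "\<And>D'. D' \<in> F \<Longrightarrow> D' \<noteq> D \<Longrightarrow> \<rho> D' e = \<zero>\<^bsub>P\<^esub>"
    using idem[OF D] by blast
  have "\<rho> D' (e \<otimes> b) = \<rho> D' e \<otimes>\<^bsub>P\<^esub> \<rho> D' b" if "D' \<in> F" for D'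
    using that b e by (intro \<rho>_mult famD[OF F] B_memD)
  moreover have "\<rho> D' b \<in> carrier P" if "D' \<in> F" for D'
    using that b by (intro \<rho>_closed famD[OF F] B_memD)
  ultimately show "\<exists>b\<in>B F. \<rho> D b = p \<and> (\<forall>D'\<in>F. D' \<noteq> D \<longrightarrow> \<rho> D' b = \<zero>\<^bsub>P\<^esub>)"
    using b e D p B_mult[OF F e(1) b(1)] by (intro bexI[of _ "e \<otimes> b"]) auto
qed

section \<open>Merging siblings, and density by induction along it\<close>

definition kids :: "'a \<Rightarrow> nat \<Rightarrow> ('a \<times> nat) set \<Rightarrow> ('a \<times> nat) set" where
  "kids s l F = {D \<in> F. snd D = Suc l \<and> near l (fst D) s}"

definition coarsen :: "'a \<Rightarrow> nat \<Rightarrow> ('a \<times> nat) set \<Rightarrow> ('a \<times> nat) set" where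
  "coarsen s l F = insert (s, l) (F - kids s l F)"

text \<open>A merge has to remove all discs inside \<open>(s, l)\<close> in one step, so none of
  them may lie deeper than the children at level \<open>Suc l\<close>.\<close>

definition lowest :: "'a \<Rightarrow> nat \<Rightarrow> ('a \<times> nat) set \<Rightarrow> bool" where
  "lowest s l F \<longleftrightarrow> fam F \<and> (s, Suc l) \<in> F \<and> (\<forall>D\<in>F. near l (fst D) s \<longrightarrow> snd D \<le> Suc l)"

text \<open>A member of level at most \<open>l\<close> that meets \<open>(s, l)\<close> would meet
  the member \<open>(s, Suc l)\<close> too and hence equal it by disjointness, although its level is
  smaller.\<close>

lemma lowest_near:
  assumes "lowest s l F" "D \<in> F" "near (min l (snd D)) (fst D) s"
  shows "D \<in> kids s l F"
proof -
  have F: "fam F" and s: "(s, Suc l) \<in> F" using assms unfolding lowest_def by auto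
  have sA: "s \<in> carrier A" using famD[OF F s] by simp
  have DA: "fst D \<in> carrier A" using famD[OF F assms(2)] .
  show ?thesis
  proof (cases "snd D \<le> l")
    case True
    then have "near (min (snd D) (snd (s, Suc l))) (fst D) (fst (s, Suc l))" using assms(3) by simp
    then have "D = (s, Suc l)" by (rule fam_disjoint[OF F assms(2) s])
    then show ?thesis using True by simp
  next
    case False
    then have "near l (fst D) s" using assms(3) by simp
    then show ?thesis using assms(1,2) False unfolding lowest_def kids_def by force
  qed
qed

lemma fam_coarsen:
  assumes "lowest s l F"
  shows "fam (coarsen s l F)"
proof -
  have F: "fam F" and s: "(s, Suc l) \<in> F" using assms unfolding lowest_def by auto
  have sA: "s \<in> carrier A" using famD[OF F s] by simp
  have new: "\<not> near (min (snd D) l) (fst D) s" if "D \<in> F - kids s l F" for D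
    using lowest_near[OF assms, of D] that by (auto simp: min.commute)
  show ?thesis
    unfolding fam_def
  proof (intro conjI ballI impI)
    show "finite (coarsen s l F)" "coarsen s l F \<noteq> {}"
      using fam_finite[OF F] by (auto simp: coarsen_def)
    fix D assume D: "D \<in> coarsen s l F"
    then show DA: "fst D \<in> carrier A" using famD[OF F, of D] sA by (auto simp: coarsen_def)
    fix D' assume D': "D' \<in> coarsen s l F" "D \<noteq> D'"
    then have D'A: "fst D' \<in> carrier A" using famD[OF F, of D'] sA by (auto simp: coarsen_def)
    consider "D = (s, l)" "D' \<in> F - kids s l F" | "D' = (s, l)" "D \<in> F - kids s l F"
      | "D \<in> F" "D' \<in> F" using D D' unfolding coarsen_def by auto
    then show "\<not> near (min (snd D) (snd D')) (fst D) (fst D')"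
    proof cases
      case 1
      then show ?thesis using new[OF 1(2)] near_sym[of _ s "fst D'"] sA D'A by (auto simp: min.commute)
    next
      case 2
      then show ?thesis using new[OF 2(2)] by auto
    next
      case 3
      then show ?thesis using fam_disjoint[OF F] D'(2) by blast
    qed
  qed
qed

lemma kids_le:
  assumes "lowest s l F" "D \<in> kids s l F" shows "le D (s, l)"
  using assms by (auto simp: le_def kids_def)

lemma B_coarsen_subset:
  assumes "lowest s l F" shows "B (coarsen s l F) \<subseteq> B F"
proof
  have F: "fam F" and s: "(s, Suc l) \<in> F" using assms unfolding lowest_def by auto
  have sA: "s \<in> carrier A" using famD[OF F s] by simp
  fix b assume b: "b \<in> B (coarsen s l F)"
  have "b \<in> R D" if D: "D \<in> F" for D
  proof (cases "D \<in> kids s l F")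
    case True
    have "b \<in> R (s, l)" using B_memD[OF b] by (simp add: coarsen_def)
    then show ?thesis
      using le_imp_subset[of "(s, l)" D] kids_le[OF assms True] famD[OF F D] sA by auto
  next
    case False
    then show ?thesis using D B_memD[OF b, of D] by (simp add: coarsen_def)
  qed
  then show "b \<in> B F" unfolding B_def by blast
qed

text \<open>The removed children contribute at least \<open>Suc l\<close>, because
  \<open>(s, Suc l)\<close> is one of them, and the parent at most \<open>l\<close>. This measure
  drives both the density proof and the chain of modifications.\<close>

lemma sum_levels_coarsen:
  assumes "lowest s l F" shows "sum snd (coarsen s l F) < sum snd F"
proof -
  have F: "fam F" and s: "(s, Suc l) \<in> F" using assms unfolding lowest_def by auto
  have sA: "s \<in> carrier A" using famD[OF F s] by simp
  have sk: "(s, Suc l) \<in> kids s l F" using s sA by (simp add: kids_def)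
  have fin: "finite F" by (rule fam_finite[OF F])
  have kF: "kids s l F \<subseteq> F" by (auto simp: kids_def)
  have "sum snd (coarsen s l F) \<le> l + sum snd (F - kids s l F)"
    unfolding coarsen_def using fin by (simp add: sum.insert_if)
  also have "\<dots> < Suc l + sum snd (F - kids s l F)" by simp
  also have "Suc l \<le> sum snd (kids s l F)"
    using member_le_sum[OF sk, of snd] finite_subset[OF kF fin] by simp
  then have "Suc l + sum snd (F - kids s l F) \<le> sum snd F"
    using sum.subset_diff[OF kF fin, of snd] by simp
  finally show ?thesis .
qed

lemma dense_idempotent:
  assumes "dense F"
  obtains e where "e \<in> B F" "\<And>D. D \<in> F \<Longrightarrow> \<rho> D e = (if D \<in> G then \<one>\<^bsub>P\<^esub> else \<zero>\<^bsub>P\<^esub>)"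
proof (rule denseD[OF assms])
  show "(if D \<in> G then \<one>\<^bsub>P\<^esub> else \<zero>\<^bsub>P\<^esub>) \<in> carrier P" for D by simp
qed (rule that)

text \<open>The residue of \<open>a\<close> is the point of the line of \<open>(s, l)\<close> over
  which the child \<open>D\<close> sits: passing to the child divides
  \<open>\<tau> (s, l) \<ominus> c a\<close> by \<open>\<xi>\<close>.\<close>

lemma kid_coord:
  assumes low: "lowest s l F" and D: "D \<in> kids s l F"
  obtains a where "a \<in> carrier A" "fst D \<ominus>\<^bsub>A\<^esub> s = x [^]\<^bsub>A\<^esub> l \<otimes>\<^bsub>A\<^esub> a" "\<tau> (s, l) = c a \<oplus> \<xi> \<otimes> \<tau> D"
proof -
  have F: "fam F" and s: "(s, Suc l) \<in> F" using low unfolding lowest_def by auto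
  have sA: "s \<in> carrier A" using famD[OF F s] by simp
  have DF: "D \<in> F" and lD: "snd D = Suc l" and "near l (fst D) s" using D by (auto simp: kids_def)
  then obtain a where a: "a \<in> carrier A" "fst D \<ominus>\<^bsub>A\<^esub> s = x [^]\<^bsub>A\<^esub> l \<otimes>\<^bsub>A\<^esub> a" unfolding near_iff by blast
  have "\<tau> (s, l) = c a \<oplus> \<xi> [^] (snd D - l) \<otimes> \<tau> D"
    using \<tau>_expand[of "(s, l)" D a] famD[OF F DF] sA a lD by simp
  then show ?thesis using a that lD by simp
qed

text \<open>Let \<open>g\<close> lift \<open>t\<close> on all discs of the coarser family. On a
  child \<open>D\<close> it reduces to a constant \<open>a D\<close>, and distinct children have
  distinct residues, so Lagrange polynomials in \<open>g\<close> separate them, while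
  \<open>E\<close> cuts away the discs that are not children. The coordinate of a child is corrected
  by a multiple of \<open>x\<close> until it can be realised in \<open>B F\<close>.\<close>

lemma dense_refine:
  assumes low: "lowest s l F" and dense: "dense (coarsen s l F)"
  shows "dense F"
proof -
  let ?G = "coarsen s l F" and ?e = "(s, l)"
  have F: "fam F" and s: "(s, Suc l) \<in> F" using low unfolding lowest_def by auto
  have sA: "s \<in> carrier A" using famD[OF F s] by simp
  then have eA: "fst ?e \<in> carrier A" by simp
  note G = fam_coarsen[OF low]
  have eG: "?e \<in> ?G" by (simp add: coarsen_def)
  have kF: "D \<in> F" if "D \<in> kids s l F" for D using that by (simp add: kids_def)
  have GF: "D \<in> ?G" if "D \<in> F" "D \<notin> kids s l F" for D using that by (simp add: coarsen_def)
  \<comment> \<open>The parent is not a member already: by \<open>lowest_near\<close> it would be a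
    child, whose level is \<open>Suc l\<close> and not \<open>l\<close>.\<close>
  have eF: "?e \<noteq> D" if "D \<in> F" for D
  proof
    assume eq: "?e = D"
    then have "?e \<in> F" using that by simp
    then have "?e \<in> kids s l F" using lowest_near[OF low, of ?e] sA by simp
    then show False by (simp add: kids_def)
  qed
  have BGF: "b \<in> B F" if "b \<in> B ?G" for b using B_coarsen_subset[OF low] that by blast
  have kid_sub: "y \<in> R D" if "y \<in> R ?e" "D \<in> kids s l F" for y D
    using le_imp_subset[OF eA famD[OF F kF[OF that(2)]] kids_le[OF low that(2)]] that(1) by blast
  have kid_zero: "\<rho> D y = \<zero>\<^bsub>P\<^esub>" if "y \<in> R ?e" "\<rho> ?e y = \<zero>\<^bsub>P\<^esub>" "D \<in> kids s l F" for y D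
    by (rule le_zero[OF eA famD[OF F kF[OF that(3)]] kids_le[OF low that(3)] that(1,2)])
  have kid_one: "\<rho> D y = \<one>\<^bsub>P\<^esub>" if "y \<in> R ?e" "\<rho> ?e y = \<one>\<^bsub>P\<^esub>" "D \<in> kids s l F" for y D
    by (rule le_one[OF eA famD[OF F kF[OF that(3)]] kids_le[OF low that(3)] that(1,2)])
  obtain E where E: "E \<in> B ?G" "\<And>D. D \<in> ?G \<Longrightarrow> \<rho> D E = (if D = ?e then \<one>\<^bsub>P\<^esub> else \<zero>\<^bsub>P\<^esub>)"
    using dense_idempotent[OF dense, of "{?e}"] by (simp only: singleton_iff) blast
  obtain g where g: "g \<in> B ?G" "\<And>D. D \<in> ?G \<Longrightarrow> \<rho> D g = t"
    using denseD[OF dense, of "\<lambda>D. t"] by auto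
  have ge: "g \<in> R ?e" "\<rho> ?e g = t" and Ee: "E \<in> R ?e" "\<rho> ?e E = \<one>\<^bsub>P\<^esub>"
    using g E eG B_memD by auto
  have \<tau>e: "\<tau> ?e \<in> R ?e" "\<rho> ?e (\<tau> ?e) = t" using \<tau>_mem \<rho>_\<tau> eA by blast+
  define a where "a = (\<lambda>D. SOME a. a \<in> carrier A \<and> fst D \<ominus>\<^bsub>A\<^esub> s = x [^]\<^bsub>A\<^esub> l \<otimes>\<^bsub>A\<^esub> a \<and> \<tau> ?e = c a \<oplus> \<xi> \<otimes> \<tau> D)"
  have a: "a D \<in> carrier A" "fst D \<ominus>\<^bsub>A\<^esub> s = x [^]\<^bsub>A\<^esub> l \<otimes>\<^bsub>A\<^esub> a D" "\<tau> ?e = c (a D) \<oplus> \<xi> \<otimes> \<tau> D"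
    if "D \<in> kids s l F" for D
  proof -
    have "\<exists>a. a \<in> carrier A \<and> fst D \<ominus>\<^bsub>A\<^esub> s = x [^]\<^bsub>A\<^esub> l \<otimes>\<^bsub>A\<^esub> a \<and> \<tau> ?e = c a \<oplus> \<xi> \<otimes> \<tau> D"
      using kid_coord[OF low that] by metis
    from someI_ex[OF this] show "a D \<in> carrier A" "fst D \<ominus>\<^bsub>A\<^esub> s = x [^]\<^bsub>A\<^esub> l \<otimes>\<^bsub>A\<^esub> a D"
      "\<tau> ?e = c (a D) \<oplus> \<xi> \<otimes> \<tau> D" unfolding a_def by blast+
  qed
  \<comment> \<open>\<open>g\<close> and \<open>\<tau> ?e\<close> agree modulo \<open>x\<close> on
    the parent, hence on each child, where \<open>\<tau> ?e\<close> is the constant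
    \<open>a D\<close> plus a multiple of \<open>x\<close>.\<close>
  have \<rho>g: "\<rho> D g = \<kappa> (a D)" if D: "D \<in> kids s l F" for D
  proof -
    note DA = famD[OF F kF[OF D]]
    have "\<rho> ?e (g \<ominus> \<tau> ?e) = \<zero>\<^bsub>P\<^esub>"
      using ge \<tau>e by (simp add: \<rho>_minus[OF eA] P.r_right_minus_eq)
    then have "\<rho> D (g \<ominus> \<tau> ?e) = \<zero>\<^bsub>P\<^esub>"
      using kid_zero[OF R_minus[OF eA ge(1) \<tau>e(1)] _ D] by simp
    then have "\<rho> D g = \<rho> D (\<tau> ?e)"
      using \<rho>_minus[OF DA kid_sub[OF ge(1) D] kid_sub[OF \<tau>e(1) D]]
        \<rho>_closed[OF DA kid_sub[OF ge(1) D]] \<rho>_closed[OF DA kid_sub[OF \<tau>e(1) D]]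
      by (simp add: P.r_right_minus_eq)
    also have "\<dots> = \<kappa> (a D)"
      unfolding a(3)[OF D]
      using a(1)[OF D] \<tau>_mem[OF DA] R_\<xi>[OF DA] by (simp add: \<rho>_add[OF DA] \<rho>_\<xi>_mult[OF DA] R_mult[OF DA] c_mem[OF DA] \<rho>_c[OF DA])
    finally show ?thesis .
  qed
  \<comment> \<open>Equal residues would place both children in one disc of level
    \<open>Suc l\<close>, so disjointness makes the difference a unit modulo
    \<open>x\<close>.\<close>
  have a_inv: "\<exists>b\<in>carrier A. \<kappa> (a D \<ominus>\<^bsub>A\<^esub> a D') \<otimes>\<^bsub>P\<^esub> \<kappa> b = \<one>\<^bsub>P\<^esub>"
    if D: "D \<in> kids s l F" and D': "D' \<in> kids s l F" and ne: "D \<noteq> D'" for D D'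
  proof (rule \<kappa>_inv)
    note DA = famD[OF F kF[OF D]] and D'A = famD[OF F kF[OF D']]
    show "a D \<ominus>\<^bsub>A\<^esub> a D' \<in> carrier A" using a(1) D D' by simp
    show "a D \<ominus>\<^bsub>A\<^esub> a D' \<notin> PIdl\<^bsub>A\<^esub> x"
    proof
      assume "a D \<ominus>\<^bsub>A\<^esub> a D' \<in> PIdl\<^bsub>A\<^esub> x"
      then obtain b where b: "b \<in> carrier A" "a D \<ominus>\<^bsub>A\<^esub> a D' = b \<otimes>\<^bsub>A\<^esub> x" unfolding cgenideal_def by blast
      have "fst D \<ominus>\<^bsub>A\<^esub> fst D' = (fst D \<ominus>\<^bsub>A\<^esub> s) \<ominus>\<^bsub>A\<^esub> (fst D' \<ominus>\<^bsub>A\<^esub> s)"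
        using DA D'A sA by algebra
      also have "\<dots> = x [^]\<^bsub>A\<^esub> l \<otimes>\<^bsub>A\<^esub> (a D \<ominus>\<^bsub>A\<^esub> a D')"
        unfolding a(2)[OF D] a(2)[OF D'] using a(1)[OF D] a(1)[OF D']
        by (simp add: A.minus_eq A.r_distr A.r_minus)
      also have "\<dots> = x [^]\<^bsub>A\<^esub> Suc l \<otimes>\<^bsub>A\<^esub> b"
        unfolding b(2) using b(1) by (simp add: A.m_ac)
      finally have "near (Suc l) (fst D) (fst D')" unfolding near_iff using b(1) by blast
      then have "D = D'"
        using fam_disjoint[OF F kF[OF D] kF[OF D']] D D' by (simp add: kids_def)
      then show False using ne by simp
    qed
  qed
  have lagrange: "\<exists>u\<in>B F. \<rho> D u = \<one>\<^bsub>P\<^esub> \<and> (\<forall>D'\<in>Z. \<rho> D' u = \<zero>\<^bsub>P\<^esub>)"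
    if D: "D \<in> kids s l F" and Z: "finite Z" "Z \<subseteq> kids s l F - {D}" for D Z
    using Z
  proof (induct Z)
    case empty
    show ?case using B_one[OF F] \<rho>_one[OF famD[OF F kF[OF D]]] by blast
  next
    case (insert D1 Z)
    note DA = famD[OF F kF[OF D]]
    obtain u where u: "u \<in> B F" "\<rho> D u = \<one>\<^bsub>P\<^esub>" "\<And>D'. D' \<in> Z \<Longrightarrow> \<rho> D' u = \<zero>\<^bsub>P\<^esub>"
      using insert by blast
    have D1: "D1 \<in> kids s l F" "D \<noteq> D1" using insert by auto
    note D1A = famD[OF F kF[OF D1(1)]]
    obtain b where b: "b \<in> carrier A" "\<kappa> (a D \<ominus>\<^bsub>A\<^esub> a D1) \<otimes>\<^bsub>P\<^esub> \<kappa> b = \<one>\<^bsub>P\<^esub>"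
      using a_inv[OF D D1] by blast
    \<comment> \<open>A Lagrange factor: it vanishes on \<open>D1\<close> and, by the choice of
      \<open>b\<close>, is 1 on \<open>D\<close>.\<close>
    define w where "w = (g \<ominus> c (a D1)) \<otimes> c b"
    have wB: "w \<in> B F" unfolding w_def
      using a(1)[OF D1(1)] b(1) by (intro B_mult B_minus c_B F BGF g)
    have \<rho>w: "\<rho> D' w = (\<kappa> (a D') \<ominus>\<^bsub>P\<^esub> \<kappa> (a D1)) \<otimes>\<^bsub>P\<^esub> \<kappa> b" if D': "D' \<in> kids s l F" for D'
    proof -
      note D'A = famD[OF F kF[OF D']]
      show ?thesis unfolding w_def using a(1)[OF D1(1)] b(1) kid_sub[OF ge(1) D']
        by (simp add: \<rho>_mult[OF D'A] \<rho>_minus[OF D'A] R_minus[OF D'A] c_mem[OF D'A] \<rho>_c[OF D'A] \<rho>g[OF D'])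
    qed
    have "\<rho> D w = \<one>\<^bsub>P\<^esub>" unfolding \<rho>w[OF D] using b a(1)[OF D] a(1)[OF D1(1)]
      by (simp add: A.minus_eq P.minus_eq)
    moreover have "\<rho> D1 w = \<zero>\<^bsub>P\<^esub>" unfolding \<rho>w[OF D1(1)] using b(1) a(1)[OF D1(1)]
      by (simp add: P.minus_eq P.r_neg)
    moreover have "\<rho> D' (u \<otimes> w) = \<rho> D' u \<otimes>\<^bsub>P\<^esub> \<rho> D' w" "\<rho> D' u \<in> carrier P" "\<rho> D' w \<in> carrier P"
      if "D' \<in> F" for D'
      using that u(1) wB by (auto intro!: \<rho>_mult \<rho>_closed famD[OF F] B_memD)
    moreover have "D' \<in> F" if "D' \<in> Z" for D' using that insert.prems kF[of D'] by blast
    ultimately show ?case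
      using u kF[OF D] kF[OF D1(1)] B_mult[OF F u(1) wB] by (intro bexI[of _ "u \<otimes> w"]) auto
  qed
  have idem: "\<exists>u\<in>B F. \<rho> D u = \<one>\<^bsub>P\<^esub> \<and> (\<forall>D'\<in>F. D' \<noteq> D \<longrightarrow> \<rho> D' u = \<zero>\<^bsub>P\<^esub>)" if DF: "D \<in> F" for D
  proof (cases "D \<in> kids s l F")
    case False
    then have DG: "D \<in> ?G" using GF DF by blast
    obtain u where u: "u \<in> B ?G" "\<And>D'. D' \<in> ?G \<Longrightarrow> \<rho> D' u = (if D' = D then \<one>\<^bsub>P\<^esub> else \<zero>\<^bsub>P\<^esub>)"
      using dense_idempotent[OF dense, of "{D}"] by (simp only: singleton_iff) blast
    have "\<rho> D' u = \<zero>\<^bsub>P\<^esub>" if "D' \<in> F" "D' \<noteq> D" for D'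
    proof (cases "D' \<in> kids s l F")
      case True
      then show ?thesis using kid_zero[OF B_memD[OF u(1) eG] _ True] u(2)[OF eG] eF[OF DF] by simp
    next
      case False
      then show ?thesis using u(2)[OF GF[OF that(1)]] that(2) by simp
    qed
    then show ?thesis using u(2)[OF DG] BGF[OF u(1)] by auto
  next
    case True
    have "finite (kids s l F - {D})" using fam_finite[OF F] by (simp add: kids_def)
    then obtain u where u: "u \<in> B F" "\<rho> D u = \<one>\<^bsub>P\<^esub>" "\<And>D'. D' \<in> kids s l F - {D} \<Longrightarrow> \<rho> D' u = \<zero>\<^bsub>P\<^esub>"
      using lagrange[OF True _ subset_refl] by blast
    have m: "\<rho> D' (u \<otimes> E) = \<rho> D' u \<otimes>\<^bsub>P\<^esub> \<rho> D' E" "\<rho> D' u \<in> carrier P" "\<rho> D' E \<in> carrier P"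
      if "D' \<in> F" for D'
      using that u(1) BGF[OF E(1)] by (auto intro!: \<rho>_mult \<rho>_closed famD[OF F] B_memD)
    have "\<rho> D (u \<otimes> E) = \<one>\<^bsub>P\<^esub>" using m[OF DF] u(2) kid_one[OF Ee True] by simp
    moreover have "\<rho> D' (u \<otimes> E) = \<zero>\<^bsub>P\<^esub>" if D': "D' \<in> F" "D' \<noteq> D" for D'
    proof (cases "D' \<in> kids s l F")
      case True
      then show ?thesis using m[OF D'(1)] u(3)[of D'] D' by simp
    next
      case False
      then show ?thesis using m[OF D'(1)] E(2)[OF GF[OF D'(1)]] eF[OF D'(1)] by auto
    qed
    ultimately show ?thesis using B_mult[OF F u(1) BGF[OF E(1)]] by blast
  qed
  \<comment> \<open>The element \<open>\<tau> ?e\<close>, not known to lie in \<open>B F\<close>, is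
    approximated by elements of the coarser ring up to second order: in the end
    \<open>\<tau> ?e = g + x g' + x^2 z\<close>.\<close>
  obtain w where w: "w \<in> R ?e" "\<tau> ?e \<ominus> g = \<xi> \<otimes> w"
  proof -
    have "\<rho> ?e (\<tau> ?e \<ominus> g) = \<zero>\<^bsub>P\<^esub>" using ge \<tau>e by (simp add: \<rho>_minus[OF eA] P.r_right_minus_eq)
    then show ?thesis using \<rho>_ker[OF eA R_minus[OF eA \<tau>e(1) ge(1)]] that by blast
  qed
  obtain g' where g': "g' \<in> B ?G" "\<rho> ?e g' = \<rho> ?e w"
    using denseD[OF dense, of "\<lambda>D. \<rho> ?e w"] \<rho>_closed[OF eA w(1)] eG by metis
  have g'e: "g' \<in> R ?e" using B_memD[OF g'(1) eG] .
  obtain z where z: "z \<in> R ?e" "w \<ominus> g' = \<xi> \<otimes> z"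
  proof -
    have "\<rho> ?e (w \<ominus> g') = \<zero>\<^bsub>P\<^esub>"
      using w g' g'e \<rho>_closed[OF eA w(1)] by (simp add: \<rho>_minus[OF eA] P.r_right_minus_eq)
    then show ?thesis using \<rho>_ker[OF eA R_minus[OF eA w(1) g'e]] that by blast
  qed
  have gen: "\<exists>q\<in>B F. \<rho> D q = t" if DF: "D \<in> F" for D
  proof (cases "D \<in> kids s l F")
    case False
    then show ?thesis using g GF[OF DF] BGF by blast
  next
    case True
    note DA = famD[OF F DF]
    obtain u where u: "u \<in> B F" "\<rho> D u = \<one>\<^bsub>P\<^esub>" "\<And>D'. D' \<in> F \<Longrightarrow> D' \<noteq> D \<Longrightarrow> \<rho> D' u = \<zero>\<^bsub>P\<^esub>"
      using idem[OF DF] by blast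
    \<comment> \<open>\<open>v\<close> reduces to \<open>t\<close> on \<open>D\<close>, and
      \<open>x v = g + x g' - a D\<close> lies in \<open>B F\<close>. On the other discs
      \<open>v\<close> has at most a simple pole, which the factor \<open>u\<close> removes because
      \<open>u\<close> is divisible by \<open>x\<close> there.\<close>
    define v where "v = \<tau> D \<ominus> \<xi> \<otimes> z"
    define q where "q = u \<otimes> v"
    note K = R_closed[OF eA ge(1)] R_closed[OF eA g'e] R_closed[OF eA w(1)] R_closed[OF eA z(1)]
      \<tau>_closed[OF DA] B_closed[OF F u(1)] \<tau>_closed[OF eA]
    have aK: "c (a D) \<in> carrier K" using a(1)[OF True] by simp
    have vK: "v \<in> carrier K" unfolding v_def using K by simp
    have "\<xi> \<otimes> v = (c (a D) \<oplus> \<xi> \<otimes> \<tau> D) \<ominus> c (a D) \<ominus> \<xi> \<otimes> (\<xi> \<otimes> z)"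
      unfolding v_def using K aK \<xi>_closed by algebra
    also have "\<dots> = \<tau> ?e \<ominus> c (a D) \<ominus> \<xi> \<otimes> (w \<ominus> g')" unfolding z(2) a(3)[OF True] ..
    also have "\<dots> = \<tau> ?e \<ominus> c (a D) \<ominus> (\<xi> \<otimes> w) \<oplus> \<xi> \<otimes> g'"
      using K aK \<xi>_closed by algebra
    also have "\<dots> = (g \<oplus> \<xi> \<otimes> g') \<ominus> c (a D)" unfolding w(2)[symmetric]
      using K aK \<xi>_closed by algebra
    finally have v: "\<xi> \<otimes> v = (g \<oplus> \<xi> \<otimes> g') \<ominus> c (a D)" .
    have vB: "\<xi> \<otimes> v \<in> B F" unfolding v
      using a(1)[OF True] by (intro B_minus B_add B_mult c_B F BGF g g') simp_all
    have qK: "q \<in> carrier K" unfolding q_def using K vK by simp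
    have "q \<in> R D'" if D': "D' \<in> F" for D'
    proof (cases "D' = D")
      case True
      then show ?thesis unfolding q_def v_def
        using kid_sub[OF z(1) \<open>D \<in> kids s l F\<close>] B_memD[OF u(1) DF]
        by (auto intro!: R_mult[OF DA] R_minus[OF DA] \<tau>_mem[OF DA] R_\<xi>[OF DA])
    next
      case False
      note D'A = famD[OF F D']
      have \<xi>q: "\<xi> \<otimes> q = u \<otimes> (\<xi> \<otimes> v)" unfolding q_def using K vK by (simp add: m_lcomm)
      have "\<rho> D' (u \<otimes> (\<xi> \<otimes> v)) = \<zero>\<^bsub>P\<^esub>"
        using \<rho>_mult[OF D'A B_memD[OF u(1) D'] B_memD[OF vB D']] u(3)[OF D' False]
          \<rho>_closed[OF D'A B_memD[OF vB D']] by simp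
      then show ?thesis
        using \<rho>_zero_iff[OF D'A qK] R_mult[OF D'A B_memD[OF u(1) D'] B_memD[OF vB D']] \<xi>q by simp
    qed
    then have "q \<in> B F" unfolding B_def by blast
    moreover have "\<rho> D q = t"
      unfolding q_def v_def
      using kid_sub[OF z(1) True] B_memD[OF u(1) DF] u(2) \<tau>_mem[OF DA]
      by (simp add: \<rho>_mult[OF DA] \<rho>_minus[OF DA] R_minus[OF DA] R_mult[OF DA] R_\<xi>[OF DA]
        \<rho>_\<xi>[OF DA] \<rho>_\<tau>[OF DA] \<rho>_closed[OF DA] P.minus_eq)
    ultimately show ?thesis by blast
  qed
  show ?thesis by (rule dense_if_generators[OF F idem gen])
qed

lemma dense_single:
  assumes "fst D \<in> carrier A" shows "dense {D}"
proof -
  have F: "fam {D}" using assms by (simp add: fam_def)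
  show ?thesis
  proof (rule dense_if_generators[OF F])
    show "\<exists>e\<in>B {D}. \<rho> D' e = \<one>\<^bsub>P\<^esub> \<and> (\<forall>D''\<in>{D}. D'' \<noteq> D' \<longrightarrow> \<rho> D'' e = \<zero>\<^bsub>P\<^esub>)" if "D' \<in> {D}" for D'
      using B_one[OF F] \<rho>_one[OF assms] that by blast
    show "\<exists>g\<in>B {D}. \<rho> D' g = t" if "D' \<in> {D}" for D'
      using \<tau>_mem[OF assms] \<rho>_\<tau>[OF assms] that by (auto simp: B_def)
  qed
qed

text \<open>Induction on the sum of the levels. A disc of maximal level \<open>Suc l\<close> has a
  parent to which \<open>dense_refine\<close> applies; if all levels are 0, disjointness leaves a
  single disc.\<close>

theorem density: "fam F \<Longrightarrow> dense F"
proof (induct "sum snd F" arbitrary: F rule: less_induct)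
  case less
  note F = \<open>fam F\<close>
  have fin: "finite (snd ` F)" "snd ` F \<noteq> {}" using F by (auto simp: fam_def)
  define n where "n = Max (snd ` F)"
  have max: "snd D \<le> n" if "D \<in> F" for D unfolding n_def using fin that by simp
  obtain D where D: "D \<in> F" "snd D = n" using Max_in[OF fin] unfolding n_def by force
  show ?case
  proof (cases n)
    case 0
    have "D' = D" if "D' \<in> F" for D'
      using fam_disjoint[OF F that D(1)] near_zero[OF famD[OF F that] famD[OF F D(1)]] D(2) 0 by simp
    then have "F = {D}" using D by blast
    then show ?thesis using dense_single[OF famD[OF F D(1)]] by simp
  next
    case (Suc l)
    have low: "lowest (fst D) l F"
      unfolding lowest_def using F max Suc D by (metis prod.collapse)
    show ?thesis
      by (rule dense_refine[OF low less.hyps[OF sum_levels_coarsen[OF low] fam_coarsen[OF low]]])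
  qed
qed

section \<open>Consequences of density\<close>

lemma ex_idempotent:
  assumes "fam F"
  shows "\<exists>e\<in>B F. \<forall>E\<in>F. \<rho> E e = (if E = D then \<one>\<^bsub>P\<^esub> else \<zero>\<^bsub>P\<^esub>)"
proof -
  have "(\<lambda>E. if E = D then \<one>\<^bsub>P\<^esub> else \<zero>\<^bsub>P\<^esub>) \<in> F \<rightarrow> carrier P" by simp
  then show ?thesis using density[OF assms] unfolding dense_def by (rule bspec[rotated])
qed

lemma idempotent:
  assumes "fam F"
  obtains e where "e \<in> B F" "\<And>D. D \<in> F \<Longrightarrow> \<rho> D e = (if D \<in> G then \<one>\<^bsub>P\<^esub> else \<zero>\<^bsub>P\<^esub>)"
  using dense_idempotent[OF density[OF assms(1)], of G] by blast

lemma B_div: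
  assumes F: "fam F" and b: "b \<in> B F" "\<And>D. D \<in> F \<Longrightarrow> \<rho> D b = \<zero>\<^bsub>P\<^esub>"
  shows "\<exists>z\<in>B F. b = \<xi> \<otimes> z"
proof -
  obtain z where z: "z \<in> carrier K" "b = \<xi> \<otimes> z" using \<xi>_div[OF B_closed[OF F b(1)]] by blast
  have "z \<in> R D" if D: "D \<in> F" for D
    using \<rho>_zero_iff[OF famD[OF F D] z(1)] B_memD[OF b(1) D] b(2)[OF D] unfolding z(2) by blast
  then show ?thesis using z(2) unfolding B_def by blast
qed

text \<open>Stated with \<open>eventually\<close> so that the exponents for the finitely many discs
  of a family combine to a common one.\<close>

lemma eventually_R:
  assumes D: "fst D \<in> carrier A" and y: "y \<in> carrier K"
  shows "eventually (\<lambda>n. \<xi> [^] n \<otimes> y \<in> R D) sequentially"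
proof -
  obtain k :: nat where k: "\<xi> [^] k \<otimes> y \<in> R D" using denom[OF D y] by blast
  have "\<xi> [^] n \<otimes> y \<in> R D" if "n \<ge> k" for n
  proof -
    have "\<xi> [^] n \<otimes> y = \<xi> [^] (n - k) \<otimes> (\<xi> [^] k \<otimes> y)"
      using that y by (simp add: nat_pow_mult flip: m_assoc)
    also have "\<dots> \<in> R D" by (rule R_mult[OF D R_pow[OF D R_\<xi>[OF D]] k])
    finally show ?thesis .
  qed
  then show ?thesis unfolding eventually_sequentially by blast
qed

lemma denom_B:
  assumes F: "fam F" and y: "y \<in> carrier K"
  shows "\<exists>n::nat. \<xi> [^] n \<otimes> y \<in> B F"
proof -
  have "eventually (\<lambda>n. \<forall>D\<in>F. \<xi> [^] n \<otimes> y \<in> R D) sequentially"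
    by (rule eventually_ball_finite[OF fam_finite[OF F]]) (use eventually_R[OF famD[OF F] y] in blast)
  then show ?thesis unfolding eventually_sequentially B_def by blast
qed

text \<open>\<open>B F\<close> and \<open>B G\<close> agree after inverting \<open>e\<close>: on a
  disc outside \<open>G\<close> the element \<open>e\<close> is a multiple of \<open>\<xi>\<close>,
  so its powers clear the poles of \<open>y\<close> there, and on \<open>G\<close> there is nothing
  to clear.\<close>

lemma denom_idempotent:
  assumes F: "fam F" and G: "G \<subseteq> F" "G \<noteq> {}"
    and e: "e \<in> B F" "\<And>D. D \<in> F \<Longrightarrow> \<rho> D e = (if D \<in> G then \<one>\<^bsub>P\<^esub> else \<zero>\<^bsub>P\<^esub>)"
    and y: "y \<in> B G"
  shows "\<exists>n::nat. e [^] n \<otimes> y \<in> B F"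
proof -
  have yK: "y \<in> carrier K" using B_closed[OF fam_subset[OF F G] y] .
  have eK: "e \<in> carrier K" using B_closed[OF F e(1)] .
  have "eventually (\<lambda>n. e [^] n \<otimes> y \<in> R D) sequentially" if D: "D \<in> F" for D
  proof -
    note DA = famD[OF F D] and eD = B_memD[OF e(1) D]
    show ?thesis
    proof (cases "D \<in> G")
      case True
      then have "e [^] n \<otimes> y \<in> R D" for n :: nat
        using R_mult[OF DA R_pow[OF DA eD] B_memD[OF y]] by blast
      then show ?thesis by simp
    next
      case False
      then obtain z where z: "z \<in> R D" "e = \<xi> \<otimes> z" using \<rho>_ker[OF DA eD] e(2)[OF D] by auto
      have "e [^] n \<otimes> y = z [^] n \<otimes> (\<xi> [^] n \<otimes> y)" for n :: nat
        unfolding z(2) using R_closed[OF DA z(1)] yK by (simp add: nat_pow_distrib m_ac)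
      moreover have "eventually (\<lambda>n. z [^] n \<otimes> (\<xi> [^] n \<otimes> y) \<in> R D) sequentially"
        by (rule eventually_mono[OF eventually_R[OF DA yK]]) (rule R_mult[OF DA R_pow[OF DA z(1)]])
      ultimately show ?thesis by simp
    qed
  qed
  then have "eventually (\<lambda>n. \<forall>D\<in>F. e [^] n \<otimes> y \<in> R D) sequentially"
    by (intro eventually_ball_finite[OF fam_finite[OF F]]) blast
  then show ?thesis unfolding eventually_sequentially B_def by blast
qed

lemma B_single: "B {D} = R D"
  unfolding B_def by simp

text \<open>The lifted idempotents of \<open>B F\<close> add up to 1 modulo \<open>x\<close>, so one
  of them does not vanish on \<open>D'\<close>. A power of it carries any element of the ring of its
  disc \<open>D\<close> into \<open>B F\<close> and so into \<open>R D'\<close>, and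
  \<open>saturated\<close> removes that power again.\<close>

lemma refines:
  assumes F: "fam F" and F': "fam F'" and sub: "B F \<subseteq> B F'" and D': "D' \<in> F'"
  shows "\<exists>D\<in>F. le D' D"
proof -
  note D'A = famD[OF F' D']
  have mem: "b \<in> R D'" if "b \<in> B F" for b using B_memD[OF _ D'] sub that by blast
  have "\<exists>D\<in>F. \<exists>e\<in>B F. (\<forall>E\<in>F. \<rho> E e = (if E = D then \<one>\<^bsub>P\<^esub> else \<zero>\<^bsub>P\<^esub>)) \<and> \<rho> D' e \<noteq> \<zero>\<^bsub>P\<^esub>"
  proof (rule ccontr)
    assume neg: "\<not> ?thesis"
    \<comment> \<open>\<open>u\<close> is the sum of the lifted idempotents of the discs in
      \<open>Z\<close>; under the contrary assumption each summand vanishes on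
      \<open>D'\<close>.\<close>
    have "\<exists>u\<in>B F. (\<forall>E\<in>F. \<rho> E u = (if E \<in> Z then \<one>\<^bsub>P\<^esub> else \<zero>\<^bsub>P\<^esub>)) \<and> \<rho> D' u = \<zero>\<^bsub>P\<^esub>"
      if "finite Z" "Z \<subseteq> F" for Z
      using that
    proof (induct Z)
      case empty
      show ?case using B_zero[OF F] \<rho>_zero[OF D'A] by (intro bexI[of _ \<zero>]) (simp_all add: \<rho>_zero famD[OF F])
    next
      case (insert D Z)
      then obtain u where u: "u \<in> B F" "\<And>E. E \<in> F \<Longrightarrow> \<rho> E u = (if E \<in> Z then \<one>\<^bsub>P\<^esub> else \<zero>\<^bsub>P\<^esub>)"
        "\<rho> D' u = \<zero>\<^bsub>P\<^esub>" by auto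
      obtain e where e: "e \<in> B F" "\<And>E. E \<in> F \<Longrightarrow> \<rho> E e = (if E = D then \<one>\<^bsub>P\<^esub> else \<zero>\<^bsub>P\<^esub>)"
        using ex_idempotent[OF F, of D] by blast
      have "\<rho> D' e = \<zero>\<^bsub>P\<^esub>" using neg e insert(4) by blast
      then have "\<rho> D' (u \<oplus> e) = \<zero>\<^bsub>P\<^esub>"
        using u(3) by (simp add: \<rho>_add[OF D'A] mem u(1) e(1))
      moreover have "\<rho> E (u \<oplus> e) = (if E \<in> insert D Z then \<one>\<^bsub>P\<^esub> else \<zero>\<^bsub>P\<^esub>)" if E: "E \<in> F" for E
        using \<rho>_add[OF famD[OF F E] B_memD[OF u(1) E] B_memD[OF e(1) E]] u(2)[OF E] e(2)[OF E] insert(2)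
        by auto
      ultimately show ?case using B_add[OF F u(1) e(1)] by blast
    qed
    from this[OF fam_finite[OF F] subset_refl] obtain u where
      u: "u \<in> B F" "\<And>E. E \<in> F \<Longrightarrow> \<rho> E u = \<one>\<^bsub>P\<^esub>" "\<rho> D' u = \<zero>\<^bsub>P\<^esub>" by auto
    have "\<rho> E (u \<ominus> \<one>) = \<zero>\<^bsub>P\<^esub>" if E: "E \<in> F" for E
      using u(2)[OF E] B_memD[OF u(1) E] by (simp add: \<rho>_minus[OF famD[OF F E]] R_one[OF famD[OF F E]]
        \<rho>_one[OF famD[OF F E]] P.r_right_minus_eq)
    then obtain z where "z \<in> B F" "u \<ominus> \<one> = \<xi> \<otimes> z"
      using B_div[OF F B_minus[OF F u(1) B_one[OF F]]] by blast
    then have "\<rho> D' (u \<ominus> \<one>) = \<zero>\<^bsub>P\<^esub>" using \<rho>_\<xi>_mult[OF D'A mem] by simp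
    then have "\<rho> D' u = \<one>\<^bsub>P\<^esub>"
      using mem[OF u(1)] by (simp add: \<rho>_minus[OF D'A] R_one[OF D'A] \<rho>_one[OF D'A] P.r_right_minus_eq u(3))
    then show False using u(3) by simp
  qed
  then obtain D e where D: "D \<in> F" and e: "e \<in> B F" "\<And>E. E \<in> F \<Longrightarrow> \<rho> E e = (if E = D then \<one>\<^bsub>P\<^esub> else \<zero>\<^bsub>P\<^esub>)"
    "\<rho> D' e \<noteq> \<zero>\<^bsub>P\<^esub>" by blast
  have "R D \<subseteq> R D'"
  proof
    fix y assume y: "y \<in> R D"
    have "\<exists>n::nat. e [^] n \<otimes> y \<in> B F"
      by (rule denom_idempotent[OF F, of "{D}"]) (use D e y in \<open>simp_all add: B_single\<close>)
    then obtain n :: nat where "e [^] n \<otimes> y \<in> R D'" using mem by blast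
    then show "y \<in> R D'"
      using saturated[OF D'A mem[OF e(1)] e(3)] R_closed[OF famD[OF F D] y] by blast
  qed
  then show ?thesis using subset_imp_le[OF famD[OF F D] D'A] D by blast
qed

text \<open>The exponents are arranged so that the claim passes through an induction that splits off one factor.\<close>

lemma pow_add_mem:
  assumes C: "subring C K" and u: "u \<in> C" and v: "v \<in> C"
  shows "b \<in> carrier K \<Longrightarrow> u [^] (n::nat) \<otimes> b \<in> C \<Longrightarrow> v [^] (m::nat) \<otimes> b \<in> C \<Longrightarrow>
    (u \<oplus> v) [^] (n + m) \<otimes> b \<in> C"
proof (induct "n + m" arbitrary: n m b)
  note CE = subringE[OF C]
  have uK: "u \<in> carrier K" and vK: "v \<in> carrier K" using u v CE(1) by auto
  have pow: "w [^] (i::nat) \<in> C" if "w \<in> C" for w i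
    by (induct i) (simp_all add: CE(3) CE(6) that)
  {
    case 0
    then show ?case by simp
  next
    case (Suc k)
    note bK = Suc.prems(1)
    have *: "(u \<oplus> v) [^] i \<otimes> b \<in> C" if "b \<in> C" for i :: nat
      by (rule CE(6)[OF pow[OF CE(7)[OF u v]] that])
    show ?case
    proof (cases n)
      case 0
      then show ?thesis using * Suc.prems by simp
    next
      case n: (Suc n')
      show ?thesis
      proof (cases m)
        case 0
        then show ?thesis using * Suc.prems by simp
      next
        case m: (Suc m')
        \<comment> \<open>One factor \<open>u \<oplus> v\<close> is split off and distributed over
          \<open>b\<close>. For \<open>u \<otimes> b\<close> the exponent of \<open>u\<close> may
          drop by one, for \<open>v \<otimes> b\<close> that of \<open>v\<close>.\<close>
        have "u [^] n' \<otimes> (u \<otimes> b) \<in> C" using Suc.prems(2) n uK bK by (simp add: m_assoc)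
        moreover have "v [^] m \<otimes> (u \<otimes> b) \<in> C"
          using CE(6)[OF u Suc.prems(3)] uK vK bK by (simp add: m_lcomm)
        ultimately have 1: "(u \<oplus> v) [^] k \<otimes> (u \<otimes> b) \<in> C"
          using Suc.hyps(1)[of n' m "u \<otimes> b"] Suc.hyps(2) n uK bK by simp
        have "v [^] m' \<otimes> (v \<otimes> b) \<in> C" using Suc.prems(3) m vK bK by (simp add: m_assoc)
        moreover have "u [^] n \<otimes> (v \<otimes> b) \<in> C"
          using CE(6)[OF v Suc.prems(2)] uK vK bK by (simp add: m_lcomm)
        ultimately have 2: "(u \<oplus> v) [^] k \<otimes> (v \<otimes> b) \<in> C"
          using Suc.hyps(1)[of n m' "v \<otimes> b"] Suc.hyps(2) m vK bK by simp
        have "(u \<oplus> v) [^] (n + m) \<otimes> b = (u \<oplus> v) [^] k \<otimes> (u \<otimes> b) \<oplus> (u \<oplus> v) [^] k \<otimes> (v \<otimes> b)"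
          unfolding Suc.hyps(2)[symmetric] using uK vK bK by (simp add: m_assoc l_distr r_distr)
        then show ?thesis using CE(7)[OF 1 2] by simp
      qed
    qed
  }
qed

lemma \<tau>_origin: "\<tau> (\<zero>\<^bsub>A\<^esub>, 0) = T"
proof -
  have z: "fst (\<zero>\<^bsub>A\<^esub>, 0) \<in> carrier A" by simp
  show ?thesis using \<tau>_eq[OF z] \<tau>_closed[OF z] by (simp add: minus_eq)
qed

text \<open>Let \<open>u\<close> be the sum of the lifted idempotents \<open>e D\<close>; then
  \<open>1 = u + x z\<close> for some \<open>z\<close> in \<open>B F\<close>. An algebra
  \<open>C\<close> containing \<open>X\<close> contains \<open>b\<close> times a power of each
  \<open>e D\<close>, because \<open>b\<close> is a polynomial in \<open>\<tau> D\<close>, and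
  \<open>b\<close> times a power of \<open>x\<close>, because that is a polynomial in
  \<open>T\<close>. A high power of the identity for 1 then yields \<open>b\<close> itself.\<close>

lemma finitely_generated:
  assumes F: "fam F"
  shows "\<exists>X. finite X \<and> X \<subseteq> B F \<and> (\<forall>C. subring C K \<longrightarrow> c ` carrier A \<subseteq> C \<longrightarrow> X \<subseteq> C \<longrightarrow> B F \<subseteq> C)"
proof -
  have "\<forall>D. \<exists>e. D \<in> F \<longrightarrow> e \<in> B F \<and> (\<forall>E\<in>F. \<rho> E e = (if E = D then \<one>\<^bsub>P\<^esub> else \<zero>\<^bsub>P\<^esub>))"
  proof
    fix D
    show "\<exists>e. D \<in> F \<longrightarrow> e \<in> B F \<and> (\<forall>E\<in>F. \<rho> E e = (if E = D then \<one>\<^bsub>P\<^esub> else \<zero>\<^bsub>P\<^esub>))"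
      using ex_idempotent[OF F, of D] by blast
  qed
  from choice[OF this] obtain e where
    e: "\<And>D. D \<in> F \<Longrightarrow> e D \<in> B F" "\<And>D E. D \<in> F \<Longrightarrow> E \<in> F \<Longrightarrow> \<rho> E (e D) = (if E = D then \<one>\<^bsub>P\<^esub> else \<zero>\<^bsub>P\<^esub>)"
    by blast
  have eK: "e D \<in> carrier K" if "D \<in> F" for D using B_closed[OF F e(1)[OF that]] .
  have "\<forall>D. \<exists>n::nat. D \<in> F \<longrightarrow> e D [^] n \<otimes> \<tau> D \<in> B F"
  proof
    fix D
    show "\<exists>n::nat. D \<in> F \<longrightarrow> e D [^] n \<otimes> \<tau> D \<in> B F"
    proof (cases "D \<in> F")
      case True
      have "\<exists>n::nat. e D [^] n \<otimes> \<tau> D \<in> B F"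
        by (rule denom_idempotent[OF F, of "{D}"])
          (use True e \<tau>_mem[OF famD[OF F True]] in \<open>simp_all add: B_single\<close>)
      then show ?thesis by blast
    qed blast
  qed
  from choice[OF this] obtain N :: "_ \<Rightarrow> nat" where N: "\<And>D. D \<in> F \<Longrightarrow> e D [^] N D \<otimes> \<tau> D \<in> B F" by blast
  \<comment> \<open>The sum is built up together with its effect on denominators, for all
    \<open>C\<close> and \<open>b\<close> at once: \<open>pow_add_mem\<close> treats each new
    summand.\<close>
  have "\<exists>u\<in>B F. (\<forall>E\<in>F. \<rho> E u = (if E \<in> Z then \<one>\<^bsub>P\<^esub> else \<zero>\<^bsub>P\<^esub>)) \<and>
      (\<forall>C b. subring C K \<longrightarrow> e ` F \<subseteq> C \<longrightarrow> b \<in> carrier K \<longrightarrow> (\<forall>D\<in>Z. \<exists>n::nat. e D [^] n \<otimes> b \<in> C) \<longrightarrow>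
        u \<in> C \<and> (\<exists>n::nat. u [^] n \<otimes> b \<in> C))" if "finite Z" "Z \<subseteq> F" for Z
    using that
  proof (induct Z)
    case empty
    have "\<zero> [^] (1::nat) \<otimes> b = \<zero>" if "b \<in> carrier K" for b using that by simp
    then show ?case using subringE(2) B_zero[OF F]
      by (intro bexI[of _ \<zero>] conjI) (auto simp: \<rho>_zero famD[OF F] simp del: nat_pow_Suc intro!: exI[of _ "1::nat"])
  next
    case (insert D Z)
    have "Z \<subseteq> F" using insert(4) by blast
    from insert(3)[OF this] obtain u where u: "u \<in> B F" "\<And>E. E \<in> F \<Longrightarrow> \<rho> E u = (if E \<in> Z then \<one>\<^bsub>P\<^esub> else \<zero>\<^bsub>P\<^esub>)"
      and u3: "\<forall>C b. subring C K \<longrightarrow> e ` F \<subseteq> C \<longrightarrow> b \<in> carrier K \<longrightarrow> (\<forall>D\<in>Z. \<exists>n::nat. e D [^] n \<otimes> b \<in> C) \<longrightarrow>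
        u \<in> C \<and> (\<exists>n::nat. u [^] n \<otimes> b \<in> C)" by blast
    have D: "D \<in> F" using insert by auto
    show ?case
    proof (intro bexI[of _ "u \<oplus> e D"] conjI allI impI ballI)
      show "u \<oplus> e D \<in> B F" by (rule B_add[OF F u(1) e(1)[OF D]])
      show "\<rho> E (u \<oplus> e D) = (if E \<in> insert D Z then \<one>\<^bsub>P\<^esub> else \<zero>\<^bsub>P\<^esub>)" if E: "E \<in> F" for E
        using \<rho>_add[OF famD[OF F E] B_memD[OF u(1) E] B_memD[OF e(1)[OF D] E]] u(2)[OF E] e(2)[OF D E] insert(2)
        by auto
    next
      fix C b assume C: "subring C K" "e ` F \<subseteq> C" "b \<in> carrier K" "\<forall>D'\<in>insert D Z. \<exists>n::nat. e D' [^] n \<otimes> b \<in> C"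
      from u3 C obtain n :: nat where n: "u \<in> C" "u [^] n \<otimes> b \<in> C" by blast
      from C(4) obtain m :: nat where m: "e D [^] m \<otimes> b \<in> C" by blast
      have eC: "e D \<in> C" using C(2) D by blast
      show "u \<oplus> e D \<in> C" using subringE(7)[OF C(1) n(1) eC] .
      show "\<exists>n::nat. (u \<oplus> e D) [^] n \<otimes> b \<in> C" using pow_add_mem[OF C(1) n(1) eC C(3) n(2) m] by blast
    qed
  qed
  from this[OF fam_finite[OF F] subset_refl] obtain u where
    u: "u \<in> B F" "\<And>E. E \<in> F \<Longrightarrow> \<rho> E u = (if E \<in> F then \<one>\<^bsub>P\<^esub> else \<zero>\<^bsub>P\<^esub>)"
    and u3: "\<forall>C b. subring C K \<longrightarrow> e ` F \<subseteq> C \<longrightarrow> b \<in> carrier K \<longrightarrow> (\<forall>D\<in>F. \<exists>n::nat. e D [^] n \<otimes> b \<in> C) \<longrightarrow>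
        u \<in> C \<and> (\<exists>n::nat. u [^] n \<otimes> b \<in> C)" by blast
  have "\<rho> E (\<one> \<ominus> u) = \<zero>\<^bsub>P\<^esub>" if E: "E \<in> F" for E
    using u(2)[OF E] E B_memD[OF u(1) E] by (simp add: \<rho>_minus[OF famD[OF F E]] R_one[OF famD[OF F E]]
        \<rho>_one[OF famD[OF F E]] P.r_right_minus_eq)
  then obtain z where z: "z \<in> B F" "\<one> \<ominus> u = \<xi> \<otimes> z"
    using B_div[OF F B_minus[OF F B_one[OF F] u(1)]] by blast
  define X where "X = {T, z} \<union> e ` F \<union> (\<lambda>D. e D [^] N D \<otimes> \<tau> D) ` F"
  have "B F \<subseteq> C" if C: "subring C K" "c ` carrier A \<subseteq> C" "X \<subseteq> C" for C
  proof
    note CE = subringE[OF C(1)]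
    have pow: "w [^] (i::nat) \<in> C" if "w \<in> C" for w i
      by (induct i) (simp_all add: CE(3) CE(6) that)
    fix b assume b: "b \<in> B F"
    note bK = B_closed[OF F b]
    have gens: "\<exists>n::nat. e D [^] n \<otimes> b \<in> C" if D: "D \<in> F" for D
    proof -
      note DA = famD[OF F D]
      have "R D \<subseteq> {y. \<exists>n::nat. e D [^] n \<otimes> y \<in> C}"
      proof (rule R_gen[OF DA])
        show "\<zero> \<in> {y. \<exists>n::nat. e D [^] n \<otimes> y \<in> C}" using CE(2) eK[OF D] by simp
        fix a q assume a: "a \<in> carrier A" and "q \<in> {y. \<exists>n::nat. e D [^] n \<otimes> y \<in> C}" and q: "q \<in> R D"
        then obtain n :: nat where n: "e D [^] n \<otimes> q \<in> C" by blast
        note cl = eK[OF D] R_closed[OF DA q] \<tau>_closed[OF DA] c.hom_closed[OF a]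
        have eq: "e D [^] (N D + n) \<otimes> (c a \<oplus> \<tau> D \<otimes> q) =
          e D [^] (N D + n) \<otimes> c a \<oplus> (e D [^] N D \<otimes> \<tau> D) \<otimes> (e D [^] n \<otimes> q)"
          using cl by (simp add: r_distr m_ac flip: nat_pow_mult)
        have g: "e D \<in> C" "e D [^] N D \<otimes> \<tau> D \<in> C" "c a \<in> C" using C D a unfolding X_def by auto
        have "e D [^] (N D + n) \<otimes> (c a \<oplus> \<tau> D \<otimes> q) \<in> C"
          unfolding eq by (rule CE(7)[OF CE(6)[OF pow[OF g(1)] g(3)] CE(6)[OF g(2) n]])
        then show "c a \<oplus> \<tau> D \<otimes> q \<in> {y. \<exists>n::nat. e D [^] n \<otimes> y \<in> C}" by blast
      qed
      then show ?thesis using B_memD[OF b D] by blast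
    qed
    have "e ` F \<subseteq> C" using C(3) unfolding X_def by blast
    then obtain n :: nat where n: "u \<in> C" "u [^] n \<otimes> b \<in> C" using u3 C(1) bK gens by blast
    have o: "fst (\<zero>\<^bsub>A\<^esub>, 0) \<in> carrier A" by simp
    obtain m :: nat where "\<xi> [^] m \<otimes> b \<in> R (\<zero>\<^bsub>A\<^esub>, 0)" using denom[OF o bK] by blast
    moreover have "R (\<zero>\<^bsub>A\<^esub>, 0) \<subseteq> C"
      by (rule R_min[OF o C(1,2)]) (use C(3) in \<open>simp add: \<tau>_origin X_def\<close>)
    ultimately have m: "\<xi> [^] m \<otimes> b \<in> C" by blast
    have zC: "z \<in> C" "\<xi> \<in> C" using C unfolding X_def by auto
    have zK: "z \<in> carrier K" using zC CE(1) by blast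
    have "(\<xi> \<otimes> z) [^] m \<otimes> b = z [^] m \<otimes> (\<xi> [^] m \<otimes> b)"
      using zK bK by (simp add: nat_pow_distrib m_ac)
    then have "(\<xi> \<otimes> z) [^] m \<otimes> b \<in> C" using CE(6)[OF pow[OF zC(1)] m] by simp
    then have "(u \<oplus> \<xi> \<otimes> z) [^] (n + m) \<otimes> b \<in> C"
      by (rule pow_add_mem[OF C(1) n(1) CE(6)[OF zC(2,1)] bK n(2)])
    moreover have "u \<oplus> (\<one> \<ominus> u) = \<one>"
      using B_closed[OF F u(1)] one_closed by algebra
    ultimately show "b \<in> C" unfolding z(2) using bK by simp
  qed
  moreover have "finite X" "X \<subseteq> B F"
    unfolding X_def using fam_finite[OF F] T_B[OF F] z(1) e(1) N by auto
  ultimately show ?thesis by blast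
qed

text \<open>A nonconstant \<open>\<eta> (\<tau> D)\<close> is transcendental over the residue field,
  so an element of \<open>R D\<close> killed by \<open>\<eta>\<close> is already killed by
  \<open>\<rho> D\<close>. Hence nothing in \<open>R D\<close> becomes newly divisible by
  \<open>x\<close> in \<open>C\<close>, and \<open>C\<close> adds no element.\<close>

lemma line_nonconstant:
  assumes C: "subring C K" "c ` carrier A \<subseteq> C"
    and \<eta>: "\<eta> \<in> ring_hom (K\<lparr>carrier := C\<rparr>) P" "\<And>a. a \<in> carrier A \<Longrightarrow> \<eta> (c a) = \<kappa> a"
    and D: "fst D \<in> carrier A" "\<tau> D \<in> C" "\<eta> (\<tau> D) \<notin> \<kappa> ` carrier A"
  shows "C = R D"
proof -
  note CE = subringE[OF C(1)]
  have \<eta>m: "\<eta> (y \<otimes> z) = \<eta> y \<otimes>\<^bsub>P\<^esub> \<eta> z" and \<eta>a: "\<eta> (y \<oplus> z) = \<eta> y \<oplus>\<^bsub>P\<^esub> \<eta> z" and \<eta>c: "\<eta> y \<in> carrier P"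
    if "y \<in> C" "z \<in> C" for y z
    using ring_hom_mult[OF \<eta>(1), of y z] ring_hom_add[OF \<eta>(1), of y z] ring_hom_closed[OF \<eta>(1), of y] that
    by simp_all
  have RC: "R D \<subseteq> C" by (rule R_min[OF D(1) C D(2)])
  have zero: "\<zero>\<^bsub>P\<^esub> \<in> \<kappa> ` carrier A" by (rule image_eqI[of _ _ "\<zero>\<^bsub>A\<^esub>"]) simp_all
  have red: "R D \<subseteq> {y. \<eta> y = \<zero>\<^bsub>P\<^esub> \<longrightarrow> \<rho> D y = \<zero>\<^bsub>P\<^esub>}"
  proof (rule R_gen[OF D(1)])
    show "\<zero> \<in> {y. \<eta> y = \<zero>\<^bsub>P\<^esub> \<longrightarrow> \<rho> D y = \<zero>\<^bsub>P\<^esub>}" by (simp add: \<rho>_zero[OF D(1)])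
    fix a q assume a: "a \<in> carrier A" and q: "q \<in> {y. \<eta> y = \<zero>\<^bsub>P\<^esub> \<longrightarrow> \<rho> D y = \<zero>\<^bsub>P\<^esub>}" "q \<in> R D"
    have cl: "c a \<in> C" "q \<in> C" "\<tau> D \<otimes> q \<in> C" using a C q(2) RC D(2) CE(6) by auto
    let ?p = "\<eta> (\<tau> D)"
    have pP: "?p \<in> carrier P" "\<eta> q \<in> carrier P" using \<eta>c D(2) cl by auto
    have eq: "\<eta> (c a \<oplus> \<tau> D \<otimes> q) = \<kappa> a \<oplus>\<^bsub>P\<^esub> ?p \<otimes>\<^bsub>P\<^esub> \<eta> q"
      using cl a D(2) by (simp add: \<eta>a \<eta>m \<eta>(2))
    have "\<rho> D (c a \<oplus> \<tau> D \<otimes> q) = \<zero>\<^bsub>P\<^esub>" if z: "\<eta> (c a \<oplus> \<tau> D \<otimes> q) = \<zero>\<^bsub>P\<^esub>"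
    proof -
      \<comment> \<open>If \<open>a\<close> were a unit modulo \<open>x\<close>, the relation
        \<open>\<kappa> a + ?p \<eta> q = 0\<close> would make \<open>?p\<close> a unit of
        \<open>P\<close>, hence a constant by \<open>P_unit\<close>.\<close>
      have "a \<in> PIdl\<^bsub>A\<^esub> x"
      proof (rule ccontr)
        assume "a \<notin> PIdl\<^bsub>A\<^esub> x"
        then obtain b where b: "b \<in> carrier A" "\<kappa> a \<otimes>\<^bsub>P\<^esub> \<kappa> b = \<one>\<^bsub>P\<^esub>" using \<kappa>_inv[OF a] by blast
        have \<kappa>b: "\<kappa> b \<in> carrier P" "\<kappa> a \<in> carrier P" using a b by auto
        have "\<kappa> a \<oplus>\<^bsub>P\<^esub> ?p \<otimes>\<^bsub>P\<^esub> \<eta> q = \<zero>\<^bsub>P\<^esub>" using z eq by simp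
        then have "(\<kappa> a \<oplus>\<^bsub>P\<^esub> ?p \<otimes>\<^bsub>P\<^esub> \<eta> q) \<otimes>\<^bsub>P\<^esub> \<kappa> b = \<zero>\<^bsub>P\<^esub>" using \<kappa>b by simp
        then have "\<one>\<^bsub>P\<^esub> \<oplus>\<^bsub>P\<^esub> ?p \<otimes>\<^bsub>P\<^esub> \<eta> q \<otimes>\<^bsub>P\<^esub> \<kappa> b = \<zero>\<^bsub>P\<^esub>" using \<kappa>b pP b(2) by (simp add: P.l_distr)
        then have "\<one>\<^bsub>P\<^esub> = \<ominus>\<^bsub>P\<^esub> (?p \<otimes>\<^bsub>P\<^esub> \<eta> q \<otimes>\<^bsub>P\<^esub> \<kappa> b)"
          using \<kappa>b pP P.minus_equality[of "\<one>\<^bsub>P\<^esub>" "?p \<otimes>\<^bsub>P\<^esub> \<eta> q \<otimes>\<^bsub>P\<^esub> \<kappa> b"] by simp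
        then have "?p \<otimes>\<^bsub>P\<^esub> (\<ominus>\<^bsub>P\<^esub> (\<eta> q \<otimes>\<^bsub>P\<^esub> \<kappa> b)) = \<one>\<^bsub>P\<^esub>"
          using \<kappa>b pP by (simp add: P.r_minus P.m_assoc)
        from P_unit[OF pP(1) _ this] show False using D(3) \<kappa>b pP by simp
      qed
      then have \<kappa>a: "\<kappa> a = \<zero>\<^bsub>P\<^esub>" using \<kappa>_zero[OF a] by simp
      then have "?p \<otimes>\<^bsub>P\<^esub> \<eta> q = \<zero>\<^bsub>P\<^esub>" using z eq pP by simp
      then have "\<eta> q = \<zero>\<^bsub>P\<^esub>" using P.integral_iff[OF pP] D(3) zero by auto
      then have "\<rho> D q = \<zero>\<^bsub>P\<^esub>" using q(1) by blast
      then show ?thesis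
        using \<kappa>a a q(2) \<tau>_mem[OF D(1)]
        by (simp add: \<rho>_add[OF D(1)] \<rho>_mult[OF D(1)] R_mult[OF D(1)] c_mem[OF D(1)] \<rho>_c[OF D(1)] \<rho>_\<tau>[OF D(1)])
    qed
    then show "c a \<oplus> \<tau> D \<otimes> q \<in> {y. \<eta> y = \<zero>\<^bsub>P\<^esub> \<longrightarrow> \<rho> D y = \<zero>\<^bsub>P\<^esub>}" by blast
  qed
  have "y \<in> R D" if y: "y \<in> C" for y
  proof -
    have yK: "y \<in> carrier K" using y CE(1) by blast
    have "y \<in> R D" if "\<xi> [^] k \<otimes> y \<in> R D" for k :: nat
      using that
    proof (induct k)
      case 0 then show ?case using yK by simp
    next
      case (Suc k)
      let ?z = "\<xi> [^] k \<otimes> y"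
      have "\<xi> \<in> C" using C(2) by auto
      then have "\<xi> [^] k \<in> C" by (induct k) (auto intro: CE(3) CE(6))
      then have "?z \<in> C" using CE(6) y by blast
      then have "\<eta> (\<xi> \<otimes> ?z) = \<zero>\<^bsub>P\<^esub>"
        using \<open>\<xi> \<in> C\<close> \<kappa>_zero[of x] A.cgenideal_self[OF x_closed] by (simp add: \<eta>m \<eta>(2) \<eta>c)
      moreover have z: "\<xi> \<otimes> ?z \<in> R D" using Suc.prems yK by (simp add: m_ac)
      ultimately have "\<rho> D (\<xi> \<otimes> ?z) = \<zero>\<^bsub>P\<^esub>" using red by blast
      then have "?z \<in> R D" using \<rho>_zero_iff[OF D(1) _ z] yK by simp
      then show ?case by (rule Suc.hyps)
    qed
    then show ?thesis using denom[OF D(1) yK] by blast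
  qed
  then show ?thesis using RC by blast
qed

text \<open>Since \<open>T\<close> is the centre of \<open>D\<close> plus
  \<open>\<xi> [^] snd D\<close> times \<open>\<tau> D\<close>, a polynomial in \<open>T\<close> is
  constant up to a multiple of that power; Horner induction keeps the cofactor in
  \<open>R D\<close>.\<close>

lemma origin_expand:
  assumes D: "fst D \<in> carrier A" and y: "y \<in> R (\<zero>\<^bsub>A\<^esub>, 0)"
  shows "\<exists>a\<in>carrier A. \<exists>q\<in>R D. y = c a \<oplus> \<xi> [^] snd D \<otimes> q"
proof -
  have o: "fst (\<zero>\<^bsub>A\<^esub>, 0) \<in> carrier A" by simp
  let ?M = "{y. \<exists>a\<in>carrier A. \<exists>q\<in>R D. y = c a \<oplus> \<xi> [^] snd D \<otimes> q}"
  let ?s = "fst D" and ?k = "\<xi> [^] snd D"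
  have T: "T = c ?s \<oplus> ?k \<otimes> \<tau> D"
    unfolding \<tau>_eq[OF D] using D c.hom_closed[OF D] T_closed by algebra
  have "R (\<zero>\<^bsub>A\<^esub>, 0) \<subseteq> ?M"
  proof (rule R_gen[OF o])
    show "\<zero> \<in> ?M" using R_zero[OF D] by (intro CollectI bexI[of _ "\<zero>\<^bsub>A\<^esub>"] bexI[of _ \<zero>]) auto
    fix a' y assume a': "a' \<in> carrier A" and "y \<in> ?M" "y \<in> R (\<zero>\<^bsub>A\<^esub>, 0)"
    then obtain a q where a: "a \<in> carrier A" and q: "q \<in> R D" and y: "y = c a \<oplus> ?k \<otimes> q" by blast
    note cl = c.hom_closed[OF a] c.hom_closed[OF a'] c.hom_closed[OF D] \<tau>_closed[OF D] R_closed[OF D q]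
      nat_pow_closed[OF \<xi>_closed, of "snd D"]
    have "c a' \<oplus> T \<otimes> y = (c a' \<oplus> c ?s \<otimes> c a) \<oplus> ?k \<otimes> (\<tau> D \<otimes> c a \<oplus> (c ?s \<oplus> ?k \<otimes> \<tau> D) \<otimes> q)"
      unfolding y T using cl by algebra
    also have "\<dots> = c (a' \<oplus>\<^bsub>A\<^esub> ?s \<otimes>\<^bsub>A\<^esub> a) \<oplus> ?k \<otimes> (\<tau> D \<otimes> c a \<oplus> T \<otimes> q)"
      unfolding T[symmetric] using a a' D by simp
    finally have "c a' \<oplus> T \<otimes> y = \<dots>" .
    moreover have "\<tau> D \<otimes> c a \<oplus> T \<otimes> q \<in> R D"
      by (intro R_add[OF D] R_mult[OF D] \<tau>_mem[OF D] c_mem[OF D] a T_mem[OF D] q)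
    moreover have "a' \<oplus>\<^bsub>A\<^esub> ?s \<otimes>\<^bsub>A\<^esub> a \<in> carrier A" using a a' D by simp
    ultimately show "c a' \<oplus> \<tau> (\<zero>\<^bsub>A\<^esub>, 0) \<otimes> y \<in> ?M" unfolding \<tau>_origin by blast
  qed
  from subsetD[OF this y] show ?thesis by simp
qed

text \<open>Starting from \<open>T\<close>, as long as \<open>\<tau>\<close> is constant modulo \<open>x\<close> one may subtract the constant and
  divide by \<open>x\<close>; a preimage of \<open>t\<close> bounds the number of such steps.\<close>

lemma line_is_disc:
  assumes C: "subring C K" "c ` carrier A \<subseteq> C" "T \<in> C"
    and \<eta>: "\<eta> \<in> ring_hom (K\<lparr>carrier := C\<rparr>) P" "\<And>a. a \<in> carrier A \<Longrightarrow> \<eta> (c a) = \<kappa> a"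
    and ker: "\<And>y. y \<in> C \<Longrightarrow> \<eta> y = \<zero>\<^bsub>P\<^esub> \<Longrightarrow> \<exists>z\<in>C. y = \<xi> \<otimes> z"
    and u: "u \<in> C" "\<eta> u = t"
  shows "\<exists>D. fst D \<in> carrier A \<and> C = R D"
proof (rule ccontr)
  assume neg: "\<not> ?thesis"
  note CE = subringE[OF C(1)]
  have \<eta>m: "\<eta> (y \<otimes> z) = \<eta> y \<otimes>\<^bsub>P\<^esub> \<eta> z" and \<eta>a: "\<eta> (y \<oplus> z) = \<eta> y \<oplus>\<^bsub>P\<^esub> \<eta> z" and \<eta>c: "\<eta> y \<in> carrier P"
    if "y \<in> C" "z \<in> C" for y z
    using ring_hom_mult[OF \<eta>(1), of y z] ring_hom_add[OF \<eta>(1), of y z] ring_hom_closed[OF \<eta>(1), of y] that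
    by simp_all
  have CK: "y \<in> carrier K" if "y \<in> C" for y using that CE(1) by blast
  have \<xi>C: "\<xi> \<in> C" using C(2) by auto
  have \<kappa>x: "\<kappa> x = \<zero>\<^bsub>P\<^esub>" using \<kappa>_zero[of x] A.cgenideal_self[OF x_closed] by simp
  \<comment> \<open>The centre is found digit by digit: \<open>\<eta>\<close> of the current
    coordinate is some constant \<open>\<kappa> a\<close>, as otherwise
    \<open>line_nonconstant\<close> would identify \<open>C\<close> with a disc ring, and
    \<open>a\<close> is the next digit.\<close>
  have chain: "\<exists>s\<in>carrier A. \<tau> (s, m) \<in> C" for m
  proof (induct m)
    case 0
    show ?case using C(3) \<tau>_origin by (intro bexI[of _ "\<zero>\<^bsub>A\<^esub>"]) auto
  next
    case (Suc m)
    then obtain s where s: "s \<in> carrier A" "\<tau> (s, m) \<in> C" by blast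
    have sA: "fst (s, m) \<in> carrier A" using s by simp
    have "\<eta> (\<tau> (s, m)) \<in> \<kappa> ` carrier A"
      using line_nonconstant[OF C(1,2) \<eta>, of "(s, m)"] neg s sA by blast
    then obtain a where a: "a \<in> carrier A" "\<eta> (\<tau> (s, m)) = \<kappa> a" by blast
    have mc: "c (\<ominus>\<^bsub>A\<^esub> a) \<in> C" by (rule subsetD[OF C(2) imageI]) (simp add: a(1))
    have "\<eta> (\<tau> (s, m) \<oplus> c (\<ominus>\<^bsub>A\<^esub> a)) = \<kappa> a \<oplus>\<^bsub>P\<^esub> \<kappa> (\<ominus>\<^bsub>A\<^esub> a)"
      using \<eta>a[OF s(2) mc] \<eta>(2)[of "\<ominus>\<^bsub>A\<^esub> a"] a by simp
    also have "\<dots> = \<zero>\<^bsub>P\<^esub>" using a by (simp add: P.r_neg)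
    finally obtain z where z: "z \<in> C" "\<tau> (s, m) \<oplus> c (\<ominus>\<^bsub>A\<^esub> a) = \<xi> \<otimes> z"
      using ker[OF CE(7)[OF s(2) mc]] by blast
    define s' where "s' = s \<oplus>\<^bsub>A\<^esub> x [^]\<^bsub>A\<^esub> m \<otimes>\<^bsub>A\<^esub> a"
    have s': "s' \<in> carrier A" unfolding s'_def using s a by simp
    have s'A: "fst (s', Suc m) \<in> carrier A" using s' by simp
    have "\<tau> (s, m) = c a \<oplus> \<xi> [^] (Suc m - m) \<otimes> \<tau> (s', Suc m)"
      using \<tau>_expand[OF sA s'A, of a] s s' a
      unfolding s'_def by (simp add: A.minus_eq A.a_ac A.r_neg1 A.r_neg2 A.r_neg)
    then have "\<tau> (s, m) = c a \<oplus> \<xi> \<otimes> \<tau> (s', Suc m)" by simp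
    then have "\<xi> \<otimes> z = (c a \<oplus> \<xi> \<otimes> \<tau> (s', Suc m)) \<oplus> \<ominus> c a" using z(2) a by simp
    also have "\<dots> = \<xi> \<otimes> \<tau> (s', Suc m)"
      using c.hom_closed[OF a(1)] \<xi>_closed \<tau>_closed[OF s'A] by algebra
    finally have "\<tau> (s', Suc m) = z" using \<xi>_cancel[OF CK[OF z(1)] \<tau>_closed[OF s'A]] by simp
    then show ?case using z(1) s' by blast
  qed
  have o: "fst (\<zero>\<^bsub>A\<^esub>, 0) \<in> carrier A" by simp
  \<comment> \<open>\<open>M\<close> bounds the pole of \<open>u\<close> relative to
    \<open>A[T]\<close>. Once \<open>C\<close> contains a coordinate of level \<open>Suc M\<close>,
    \<open>u\<close> turns out to be a constant plus a multiple of \<open>x\<close>, against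
    \<open>\<eta> u = t\<close>.\<close>
  obtain M :: nat where M: "\<xi> [^] M \<otimes> u \<in> R (\<zero>\<^bsub>A\<^esub>, 0)" using denom[OF o CK[OF u(1)]] by blast
  obtain s where s: "s \<in> carrier A" "\<tau> (s, Suc M) \<in> C" using chain by blast
  have sA: "fst (s, Suc M) \<in> carrier A" using s by simp
  obtain a q where a: "a \<in> carrier A" and q: "q \<in> R (s, Suc M)" and eq: "\<xi> [^] M \<otimes> u = c a \<oplus> \<xi> [^] Suc M \<otimes> q"
    using origin_expand[OF sA M] by auto
  have qC: "q \<in> C" using R_min[OF sA C(1,2) s(2)] q by blast
  have w: "u \<oplus> \<ominus> (\<xi> \<otimes> q) \<in> C" by (intro CE(7) CE(5) CE(6) u \<xi>C qC)
  note cl = CK[OF u(1)] CK[OF qC] c.hom_closed[OF a] \<xi>_closed nat_pow_closed[OF \<xi>_closed, of M]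
  \<comment> \<open>A constant divisible by a power of \<open>x\<close> in \<open>C\<close> is so
    divisible in \<open>A\<close>: its reduction \<open>\<kappa> a\<close> vanishes, so a factor
    \<open>x\<close> can be taken out of \<open>a\<close>.\<close>
  have div: "\<exists>a'\<in>carrier A. w = c a'" if "a \<in> carrier A" "w \<in> C" "c a = \<xi> [^] k \<otimes> w" for a w and k :: nat
    using that
  proof (induct k arbitrary: a)
    case 0 then show ?case using CK by auto
  next
    case (Suc k)
    let ?z = "\<xi> [^] k \<otimes> w"
    have "\<xi> [^] k \<in> C" by (induct k) (auto intro: CE(3) CE(6) \<xi>C)
    then have zC: "?z \<in> C" using CE(6) Suc.prems(2) by blast
    have ca: "c a = \<xi> \<otimes> ?z" using Suc.prems CK[OF Suc.prems(2)] by (simp add: m_ac)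
    have "\<kappa> a = \<zero>\<^bsub>P\<^esub>"
      using \<eta>(2)[OF Suc.prems(1)] \<kappa>x unfolding ca by (simp add: \<eta>m[OF \<xi>C zC] \<eta>(2) \<eta>c[OF zC zC])
    then obtain a1 where a1: "a1 \<in> carrier A" "a = a1 \<otimes>\<^bsub>A\<^esub> x"
      using \<kappa>_zero[OF Suc.prems(1)] unfolding cgenideal_def by blast
    have "\<xi> \<otimes> c a1 = \<xi> \<otimes> ?z" using ca unfolding a1(2) using a1(1) by (simp add: m_comm)
    then have "c a1 = ?z" using \<xi>_cancel[OF c.hom_closed[OF a1(1)] CK[OF zC]] by simp
    then show ?case by (rule Suc.hyps[OF a1(1) Suc.prems(2)])
  qed
  have "\<xi> [^] M \<otimes> (u \<oplus> \<ominus> (\<xi> \<otimes> q)) = \<xi> [^] M \<otimes> u \<oplus> \<ominus> (\<xi> [^] Suc M \<otimes> q)"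
    using cl by (simp add: r_distr r_minus m_assoc)
  also have "\<dots> = c a" unfolding eq using cl by (simp add: a_assoc r_neg)
  finally obtain a' where a': "a' \<in> carrier A" "u \<oplus> \<ominus> (\<xi> \<otimes> q) = c a'" using div[OF a w] by metis
  have "u = c a' \<oplus> \<xi> \<otimes> q" unfolding a'(2)[symmetric] using cl by (simp add: a_assoc l_neg)
  then have "\<eta> u = \<kappa> a' \<oplus>\<^bsub>P\<^esub> \<kappa> x \<otimes>\<^bsub>P\<^esub> \<eta> q"
    using a' C(2) \<xi>C qC CE(6) by (auto simp: \<eta>a \<eta>m \<eta>(2))
  then have "t = \<kappa> a'" using u(2) \<kappa>x a' \<eta>c[OF qC qC] by simp
  then show False using t_nonconst a'(1) by blast
qed

end

text \<open>\<open>J\<close> stands for a coordinate ring embedded in \<open>K\<close>, and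
  \<open>h i\<close> for the restriction of functions to the \<open>i\<close>-th of the
  \<open>N\<close> lines of its special fiber.\<close>

locale disc_covered = disc_system A K P x c T \<kappa> t \<tau> R \<rho>
  for A :: "('a, 'm) ring_scheme" and K :: "('k, 'n) ring_scheme" (structure)
    and P :: "('p, 'l) ring_scheme" and x c T \<kappa> t \<tau> R \<rho> +
  fixes J :: "'k set" and N :: nat and h :: "nat \<Rightarrow> 'k \<Rightarrow> 'p"
  assumes J: "subring J K" and cJ: "c ` carrier A \<subseteq> J" and TJ: "T \<in> J"
    and denomJ: "\<And>y. y \<in> carrier K \<Longrightarrow> \<exists>n::nat. c x [^] n \<otimes> y \<in> J"
    and N: "N > 0"
    and h_hom: "\<And>i. i < N \<Longrightarrow> h i \<in> ring_hom (K\<lparr>carrier := J\<rparr>) P"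
    and h_c: "\<And>i a. i < N \<Longrightarrow> a \<in> carrier A \<Longrightarrow> h i (c a) = \<kappa> a"
    and h_surj: "\<And>v. (\<And>i. i < N \<Longrightarrow> v i \<in> carrier P) \<Longrightarrow> \<exists>b\<in>J. \<forall>i<N. h i b = v i"
    and h_ker: "\<And>b. b \<in> J \<Longrightarrow> (\<And>i. i < N \<Longrightarrow> h i b = \<zero>\<^bsub>P\<^esub>) \<Longrightarrow> \<exists>b'\<in>J. b = c x \<otimes> b'"
begin

lemma J_closed: "y \<in> J \<Longrightarrow> y \<in> carrier K" using subringE(1)[OF J] by blast
lemma J_mult: "y \<in> J \<Longrightarrow> z \<in> J \<Longrightarrow> y \<otimes> z \<in> J" by (rule subringE(6)[OF J])
lemma J_add: "y \<in> J \<Longrightarrow> z \<in> J \<Longrightarrow> y \<oplus> z \<in> J" by (rule subringE(7)[OF J])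
lemma J_pow: "y \<in> J \<Longrightarrow> y [^] (n::nat) \<in> J"
  by (induct n) (auto intro: subringE(3)[OF J] J_mult)
lemma J_\<xi>: "\<xi> \<in> J" by (rule subsetD[OF cJ imageI]) simp

lemma h_mult: "i < N \<Longrightarrow> y \<in> J \<Longrightarrow> z \<in> J \<Longrightarrow> h i (y \<otimes> z) = h i y \<otimes>\<^bsub>P\<^esub> h i z"
  using ring_hom_mult[OF h_hom, of i y z] by simp
lemma h_add: "i < N \<Longrightarrow> y \<in> J \<Longrightarrow> z \<in> J \<Longrightarrow> h i (y \<oplus> z) = h i y \<oplus>\<^bsub>P\<^esub> h i z"
  using ring_hom_add[OF h_hom, of i y z] by simp
lemma h_closed: "i < N \<Longrightarrow> y \<in> J \<Longrightarrow> h i y \<in> carrier P"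
  using ring_hom_closed[OF h_hom, of i y] by simp
lemma h_one: "i < N \<Longrightarrow> h i \<one> = \<one>\<^bsub>P\<^esub>"
  using ring_hom_one[OF h_hom, of i] by simp
lemma h_pow: "i < N \<Longrightarrow> y \<in> J \<Longrightarrow> h i (y [^] (n::nat)) = h i y [^]\<^bsub>P\<^esub> n"
  by (induct n) (simp_all add: h_one h_mult J_pow)
lemma h_\<xi>: "i < N \<Longrightarrow> h i \<xi> = \<zero>\<^bsub>P\<^esub>"
  using h_c[of i x] \<kappa>_zero[of x] A.cgenideal_self[OF x_closed] by simp

text \<open>Idempotent only modulo \<open>x\<close>: a lift of the characteristic function of the
  \<open>i\<close>-th component.\<close>

definition idem where
  "idem i = (SOME e. e \<in> J \<and> (\<forall>j<N. h j e = (if j = i then \<one>\<^bsub>P\<^esub> else \<zero>\<^bsub>P\<^esub>)))"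

lemma idem: "idem i \<in> J" "j < N \<Longrightarrow> h j (idem i) = (if j = i then \<one>\<^bsub>P\<^esub> else \<zero>\<^bsub>P\<^esub>)"
proof -
  have "\<exists>e. e \<in> J \<and> (\<forall>j<N. h j e = (if j = i then \<one>\<^bsub>P\<^esub> else \<zero>\<^bsub>P\<^esub>))"
  proof -
    have "\<exists>e\<in>J. \<forall>j<N. h j e = (if j = i then \<one>\<^bsub>P\<^esub> else \<zero>\<^bsub>P\<^esub>)" by (rule h_surj) simp
    then show ?thesis by blast
  qed
  from someI_ex[OF this] show "idem i \<in> J" "j < N \<Longrightarrow> h j (idem i) = (if j = i then \<one>\<^bsub>P\<^esub> else \<zero>\<^bsub>P\<^esub>)"
    unfolding idem_def by blast+
qed

lemma idem_closed [simp]: "idem i \<in> carrier K" by (rule J_closed[OF idem(1)])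

text \<open>Functions on the surface with all fiber components except the \<open>i\<close>-th
  removed: elements of \<open>K\<close> that lie in \<open>J\<close> after inverting
  \<open>idem i\<close>.\<close>

definition chart :: "nat \<Rightarrow> 'k set" where
  "chart i = {y \<in> carrier K. \<exists>n::nat. idem i [^] n \<otimes> y \<in> J}"

text \<open>The extension of \<open>h i\<close> from \<open>J\<close> to the chart; the chosen power
  is immaterial because \<open>idem i\<close> reduces to 1 on the \<open>i\<close>-th
  component.\<close>

definition \<eta> where
  "\<eta> i y = h i (idem i [^] (SOME n::nat. idem i [^] n \<otimes> y \<in> J) \<otimes> y)"

lemma h_idem_pow:
  assumes "i < N" "z \<in> J" shows "h i (idem i [^] (n::nat) \<otimes> z) = h i z"
  using assms by (simp add: h_mult h_pow J_pow idem h_closed)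

lemma \<eta>_eq:
  assumes i: "i < N" and y: "y \<in> carrier K" "idem i [^] (n::nat) \<otimes> y \<in> J"
  shows "\<eta> i y = h i (idem i [^] n \<otimes> y)"
proof -
  define m where "m = (SOME n::nat. idem i [^] n \<otimes> y \<in> J)"
  have m: "idem i [^] m \<otimes> y \<in> J" unfolding m_def by (rule someI[of _ n]) (rule y(2))
  have "idem i [^] n \<otimes> (idem i [^] m \<otimes> y) = idem i [^] m \<otimes> (idem i [^] n \<otimes> y)"
    using y(1) by (simp add: m_lcomm)
  then have "h i (idem i [^] m \<otimes> y) = h i (idem i [^] n \<otimes> y)"
    using h_idem_pow[OF i m, of n] h_idem_pow[OF i y(2), of m] by simp
  then show ?thesis unfolding \<eta>_def m_def[symmetric] .
qed

lemma chartE: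
  assumes "y \<in> chart i"
  obtains n :: nat where "y \<in> carrier K" "idem i [^] n \<otimes> y \<in> J"
  using assms unfolding chart_def by blast

lemma J_chart: "y \<in> J \<Longrightarrow> y \<in> chart i"
  unfolding chart_def using J_closed by (auto intro!: exI[of _ "0::nat"])

lemma \<eta>_J: "i < N \<Longrightarrow> y \<in> J \<Longrightarrow> \<eta> i y = h i y"
  using \<eta>_eq[of i y 0] J_closed by simp

lemma chart_ops:
  assumes "y \<in> chart i" "z \<in> chart i"
  shows "y \<oplus> z \<in> chart i" "y \<otimes> z \<in> chart i"
    and "i < N \<Longrightarrow> \<eta> i (y \<oplus> z) = \<eta> i y \<oplus>\<^bsub>P\<^esub> \<eta> i z" "i < N \<Longrightarrow> \<eta> i (y \<otimes> z) = \<eta> i y \<otimes>\<^bsub>P\<^esub> \<eta> i z"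
proof -
  let ?e = "idem i"
  obtain n :: nat where y: "y \<in> carrier K" "?e [^] n \<otimes> y \<in> J" using assms(1) by (rule chartE)
  obtain m :: nat where z: "z \<in> carrier K" "?e [^] m \<otimes> z \<in> J" using assms(2) by (rule chartE)
  have eJ: "?e [^] k \<in> J" for k :: nat by (rule J_pow[OF idem(1)])
  have a: "?e [^] (n + m) \<otimes> (y \<oplus> z) = ?e [^] m \<otimes> (?e [^] n \<otimes> y) \<oplus> ?e [^] n \<otimes> (?e [^] m \<otimes> z)"
    using y z by (simp add: l_distr r_distr m_ac flip: nat_pow_mult)
  have b: "?e [^] (n + m) \<otimes> (y \<otimes> z) = (?e [^] n \<otimes> y) \<otimes> (?e [^] m \<otimes> z)"
    using y z by (simp add: m_ac flip: nat_pow_mult)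
  have aJ: "?e [^] (n + m) \<otimes> (y \<oplus> z) \<in> J" unfolding a by (intro J_add J_mult eJ y z)
  have bJ: "?e [^] (n + m) \<otimes> (y \<otimes> z) \<in> J" unfolding b by (intro J_mult y z)
  show "y \<oplus> z \<in> chart i" "y \<otimes> z \<in> chart i"
    using aJ bJ y z unfolding chart_def by blast+
  assume i: "i < N"
  show "\<eta> i (y \<oplus> z) = \<eta> i y \<oplus>\<^bsub>P\<^esub> \<eta> i z"
    using \<eta>_eq[OF i _ aJ] \<eta>_eq[OF i y] \<eta>_eq[OF i z] y z
    by (simp add: a h_add[OF i] J_mult eJ h_idem_pow[OF i])
  show "\<eta> i (y \<otimes> z) = \<eta> i y \<otimes>\<^bsub>P\<^esub> \<eta> i z"
    using \<eta>_eq[OF i _ bJ] \<eta>_eq[OF i y] \<eta>_eq[OF i z] y z by (simp add: b h_mult[OF i])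
qed

lemma chart_subring: "subring (chart i) K"
proof (rule subringI)
  show "chart i \<subseteq> carrier K" unfolding chart_def by blast
  show "\<one> \<in> chart i" by (rule J_chart[OF subringE(3)[OF J]])
  fix y z assume y: "y \<in> chart i"
  then have yK: "y \<in> carrier K" unfolding chart_def by blast
  have "\<ominus> \<one> \<otimes> y \<in> chart i"
    by (rule chart_ops(2)[OF J_chart[OF subringE(5)[OF J subringE(3)[OF J]]] y])
  then show "\<ominus> y \<in> chart i" using yK by (simp add: l_minus)
  assume "z \<in> chart i"
  with y show "y \<oplus> z \<in> chart i" "y \<otimes> z \<in> chart i" by (rule chart_ops)+
qed

lemma \<eta>_hom:
  assumes i: "i < N" shows "\<eta> i \<in> ring_hom (K\<lparr>carrier := chart i\<rparr>) P"
proof (rule ring_hom_memI)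
  fix y assume "y \<in> carrier (K\<lparr>carrier := chart i\<rparr>)"
  then have "y \<in> chart i" by simp
  then obtain n :: nat where "y \<in> carrier K" "idem i [^] n \<otimes> y \<in> J" by (rule chartE)
  then show "\<eta> i y \<in> carrier P" using \<eta>_eq[OF i] h_closed[OF i] by simp
qed (use i chart_ops \<eta>_J[OF i subringE(3)[OF J]] h_one in simp_all)

text \<open>One further factor \<open>idem i\<close> makes the element vanish on the other
  components as well, so that it is divisible by \<open>\<xi>\<close> in \<open>J\<close>; hence
  \<open>y\<close> divided by \<open>\<xi>\<close> still belongs to the chart.\<close>

lemma \<eta>_ker:
  assumes i: "i < N" and y: "y \<in> chart i" "\<eta> i y = \<zero>\<^bsub>P\<^esub>"
  shows "\<exists>z\<in>chart i. y = \<xi> \<otimes> z"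
proof -
  let ?e = "idem i"
  obtain n :: nat where n: "y \<in> carrier K" "?e [^] n \<otimes> y \<in> J" using y(1) by (rule chartE)
  have eq: "?e [^] Suc n \<otimes> y = ?e \<otimes> (?e [^] n \<otimes> y)" using n by (simp add: m_ac)
  have "h j (?e [^] Suc n \<otimes> y) = \<zero>\<^bsub>P\<^esub>" if j: "j < N" for j
    unfolding eq
  proof (cases "j = i")
    case True
    then show "h j (?e \<otimes> (?e [^] n \<otimes> y)) = \<zero>\<^bsub>P\<^esub>"
      using h_mult[OF j idem(1) n(2)] \<eta>_eq[OF i n] y(2) h_closed[OF j idem(1)] P.r_null by metis
  next
    case False
    then have "h j ?e = \<zero>\<^bsub>P\<^esub>" using idem(2)[OF j, of i] by simp
    then show "h j (?e \<otimes> (?e [^] n \<otimes> y)) = \<zero>\<^bsub>P\<^esub>"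
      using h_mult[OF j idem(1) n(2)] h_closed[OF j n(2)] P.l_null by metis
  qed
  moreover have "?e [^] Suc n \<otimes> y \<in> J" unfolding eq by (rule J_mult[OF idem(1) n(2)])
  ultimately obtain b where b: "b \<in> J" "?e [^] Suc n \<otimes> y = \<xi> \<otimes> b" using h_ker by blast
  obtain z where z: "z \<in> carrier K" "y = \<xi> \<otimes> z" using \<xi>_div[OF n(1)] by blast
  have "\<xi> \<otimes> (?e [^] Suc n \<otimes> z) = \<xi> \<otimes> b"
    using b(2) z idem_closed[of i] unfolding z(2) by (simp only: m_lcomm \<xi>_closed nat_pow_closed)
  then have "?e [^] Suc n \<otimes> z = b"
    using \<xi>_cancel[of "?e [^] Suc n \<otimes> z" b] z(1) J_closed[OF b(1)] nat_pow_closed[OF idem_closed] by blast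
  then have "z \<in> chart i" unfolding chart_def using z(1) b(1) by blast
  then show ?thesis using z(2) by blast
qed

lemma chart_disc:
  assumes i: "i < N" shows "\<exists>D. fst D \<in> carrier A \<and> chart i = R D"
proof -
  obtain u where u: "u \<in> J" "\<forall>j<N. h j u = t" using h_surj[of "\<lambda>_. t"] by auto
  show ?thesis
  proof (rule line_is_disc[OF chart_subring _ _ \<eta>_hom[OF i] _ \<eta>_ker[OF i]])
    show "c ` carrier A \<subseteq> chart i" using cJ J_chart by blast
    show "T \<in> chart i" by (rule J_chart[OF TJ])
    show "\<eta> i (c a) = \<kappa> a" if "a \<in> carrier A" for a
      using \<eta>_J[OF i subsetD[OF cJ imageI[OF that]]] h_c[OF i that] by simp
    show "u \<in> chart i" by (rule J_chart[OF u(1)])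
    show "\<eta> i u = t" using \<eta>_J[OF i u(1)] u(2) i by simp
  qed
qed

text \<open>Induction on the pole order along the fiber: if \<open>\<xi> z\<close> is in
  \<open>J\<close> and \<open>z\<close> is in every chart, then \<open>\<xi> z\<close> vanishes on
  every component, so \<open>z\<close> is in \<open>J\<close> by \<open>h_ker\<close>.\<close>

lemma chart_Inter:
  assumes y: "y \<in> carrier K" "\<And>i. i < N \<Longrightarrow> y \<in> chart i"
  shows "y \<in> J"
proof -
  have "y \<in> J" if "\<xi> [^] k \<otimes> y \<in> J" for k :: nat
    using that
  proof (induct k)
    case 0 then show ?case using y by simp
  next
    case (Suc k)
    let ?z = "\<xi> [^] k \<otimes> y"
    have z: "\<xi> \<otimes> ?z \<in> J" using Suc.prems y(1) by (simp add: m_ac)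
    have "h i (\<xi> \<otimes> ?z) = \<zero>\<^bsub>P\<^esub>" if i: "i < N" for i
    proof -
      have "?z \<in> chart i"
        by (rule chart_ops(2)[OF J_chart[OF J_pow[OF J_\<xi>]] y(2)[OF i]])
      then obtain n :: nat where n: "idem i [^] n \<otimes> ?z \<in> J" by (rule chartE)
      have "idem i [^] n \<otimes> (\<xi> \<otimes> ?z) = \<xi> \<otimes> (idem i [^] n \<otimes> ?z)"
        using y(1) by (simp add: m_lcomm)
      then have "h i (\<xi> \<otimes> ?z) = h i (\<xi> \<otimes> (idem i [^] n \<otimes> ?z))" using h_idem_pow[OF i z, of n] by simp
      then show ?thesis using h_mult[OF i J_\<xi> n] h_\<xi>[OF i] h_closed[OF i n] by simp
    qed
    then obtain b where b: "b \<in> J" "\<xi> \<otimes> ?z = \<xi> \<otimes> b" using h_ker[OF z] by blast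
    then have "?z = b" using \<xi>_cancel[of ?z b] y(1) J_closed by simp
    then show ?case using Suc.hyps b(1) by simp
  qed
  then show ?thesis using denomJ[OF y(1)] by blast
qed

text \<open>\<open>idem j\<close> is divisible by \<open>\<xi>\<close> on chart \<open>i\<close> but
  reduces to 1 on chart \<open>j\<close>.\<close>

lemma chart_not_subset:
  assumes "i < N" "j < N" "i \<noteq> j" shows "\<not> chart i \<subseteq> chart j"
proof
  assume sub: "chart i \<subseteq> chart j"
  have "\<eta> i (idem j) = \<zero>\<^bsub>P\<^esub>" using \<eta>_J[OF assms(1) idem(1)] idem(2)[OF assms(1)] assms(3) by simp
  then obtain z where z: "z \<in> chart i" "idem j = \<xi> \<otimes> z"
    using \<eta>_ker[OF assms(1) J_chart[OF idem(1)]] by blast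
  then have zj: "z \<in> chart j" using sub by blast
  have cl: "\<eta> j z \<in> carrier P" using ring_hom_closed[OF \<eta>_hom[OF assms(2)], of z] zj by simp
  have "\<eta> j (idem j) = \<zero>\<^bsub>P\<^esub>"
    unfolding z(2) chart_ops(4)[OF J_chart[OF J_\<xi>] zj assms(2)] using \<eta>_J[OF assms(2) J_\<xi>] h_\<xi>[OF assms(2)] cl
    by simp
  then show False using \<eta>_J[OF assms(2) idem(1)] idem(2)[OF assms(2)] by simp
qed

text \<open>Each chart is a disc ring and \<open>J\<close> is their intersection. The discs are
  disjoint because discs that meet are nested, and this would nest the charts.\<close>

theorem classification: "\<exists>F. fam F \<and> J = B F"
proof -
  have "\<forall>i. \<exists>D. i < N \<longrightarrow> fst D \<in> carrier A \<and> chart i = R D" using chart_disc by blast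
  from choice[OF this] obtain D where D: "\<And>i. i < N \<Longrightarrow> fst (D i) \<in> carrier A" "\<And>i. i < N \<Longrightarrow> chart i = R (D i)"
    by blast
  have dis: "\<not> near (min (snd (D i)) (snd (D j))) (fst (D i)) (fst (D j))"
    if ij: "i < N" "j < N" "i \<noteq> j" for i j
  proof
    assume near: "near (min (snd (D i)) (snd (D j))) (fst (D i)) (fst (D j))"
    show False
    proof (cases "snd (D i) \<le> snd (D j)")
      case True
      then have "le (D j) (D i)"
        unfolding le_def using near near_sym[of _ "fst (D i)" "fst (D j)"] D(1) ij by simp
      then show False
        using le_imp_subset[OF D(1) D(1)] D(2) ij chart_not_subset[OF ij] by blast
    next
      case False
      then have "le (D i) (D j)" unfolding le_def using near by (simp add: min_def)
      then show False
        using le_imp_subset[OF D(1) D(1)] D(2) ij chart_not_subset[of j i] by blast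
    qed
  qed
  let ?F = "D ` {..<N}"
  have F: "fam ?F" unfolding fam_def using N D(1) dis by auto
  have "J = B ?F"
  proof
    show "J \<subseteq> B ?F" unfolding B_def using J_chart D(2) by auto
    show "B ?F \<subseteq> J"
    proof
      fix y assume y: "y \<in> B ?F"
      show "y \<in> J"
        by (rule chart_Inter[OF B_closed[OF F y]]) (use B_memD[OF y] D(2) in auto)
    qed
  qed
  then show ?thesis using F by blast
qed

end

section \<open>The surfaces' common function ring\<close>

locale dfs_base = A: domain A for A :: "('a, 'm) ring_scheme" +
  fixes x :: 'a
  assumes x_closed [simp, intro]: "x \<in> carrier A" and x_nz: "x \<noteq> \<zero>\<^bsub>A\<^esub>"
    and x_max: "maximalideal (PIdl\<^bsub>A\<^esub> x) A"
begin

abbreviation Ax where "Ax \<equiv> loc_at A x"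
abbreviation K where "K \<equiv> UP Ax"
abbreviation k where "k \<equiv> A Quot (PIdl\<^bsub>A\<^esub> x)"
abbreviation P where "P \<equiv> UP k"
abbreviation fr where "fr \<equiv> loc_frac A (powers A x)"
abbreviation fr1 where "fr1 \<equiv> \<lambda>a. loc_frac A (powers A x) a \<one>\<^bsub>A\<^esub>"
definition c where "c a = monom K (fr a \<one>\<^bsub>A\<^esub>) 0"
definition T where "T = monom K \<one>\<^bsub>Ax\<^esub> 1"
definition \<kappa> where "\<kappa> a = monom P ((PIdl\<^bsub>A\<^esub> x) +>\<^bsub>A\<^esub> a) 0"
definition t where "t = monom P \<one>\<^bsub>k\<^esub> 1"
abbreviation \<Lambda> where "\<Lambda> \<equiv> loc_poly A x"
abbreviation red where "red \<equiv> up_map A ((+>\<^bsub>A\<^esub>) (PIdl\<^bsub>A\<^esub> x))"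
abbreviation \<chi> where "\<chi> \<equiv> chart_trans A x"
abbreviation mon where "mon a n \<equiv> monom (UP A) a n"

definition \<Phi> :: "'a \<times> nat \<Rightarrow> (nat \<Rightarrow> 'a) \<Rightarrow> nat \<Rightarrow> ('a \<times> 'a) set" where
  "\<Phi> D p = \<chi> (snd D) (fst D) 0 \<zero>\<^bsub>A\<^esub> (\<Lambda> p)"
definition \<Psi> :: "'a \<times> nat \<Rightarrow> (nat \<Rightarrow> ('a \<times> 'a) set) \<Rightarrow> nat \<Rightarrow> ('a \<times> 'a) set" where
  "\<Psi> D y = \<chi> 0 \<zero>\<^bsub>A\<^esub> (snd D) (fst D) y"
definition \<tau> :: "'a \<times> nat \<Rightarrow> nat \<Rightarrow> ('a \<times> 'a) set" where
  "\<tau> D = \<chi> (snd D) (fst D) 0 \<zero>\<^bsub>A\<^esub> T"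
definition R :: "'a \<times> nat \<Rightarrow> (nat \<Rightarrow> ('a \<times> 'a) set) set" where
  "R D = \<Phi> D ` carrier (UP A)"
definition coord :: "'a \<times> nat \<Rightarrow> (nat \<Rightarrow> ('a \<times> 'a) set) \<Rightarrow> nat \<Rightarrow> 'a" where
  "coord D = inv_into (carrier (UP A)) (\<Phi> D)"
definition \<rho> :: "'a \<times> nat \<Rightarrow> (nat \<Rightarrow> ('a \<times> 'a) set) \<Rightarrow> nat \<Rightarrow> 'a set" where
  "\<rho> D y = red (coord D y)"

sublocale I: maximalideal "PIdl\<^bsub>A\<^esub> x" A by (rule x_max)
sublocale loc: frac A "powers A x" by (rule A.frac_powers[OF x_closed x_nz])
sublocale Ax: domain Ax by (rule loc.loc_domain)
sublocale k: field k by (rule I.quotient_is_field[OF A.is_cring])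
sublocale UA: UP_domain A "UP A" by unfold_locales simp
sublocale K: UP_domain Ax K by unfold_locales simp
sublocale P: UP_domain k P by unfold_locales simp
sublocale fr1: up_functor A Ax fr1
  by (intro up_functor.intro UnivPoly.ring_hom_cringI A.is_cring Ax.is_cring loc.frac_hom)
sublocale kq: up_functor A k "(+>\<^bsub>A\<^esub>) (PIdl\<^bsub>A\<^esub> x)"
  by (intro up_functor.intro UnivPoly.ring_hom_cringI A.is_cring k.is_cring I.rcos_ring_hom)

declare loc.frac_mult [simp del] loc.frac_add [simp del]

lemma x_pow_mem [simp, intro]: "x [^]\<^bsub>A\<^esub> (n::nat) \<in> powers A x"
  unfolding powers_def by blast

lemma loc_poly_up_map: "\<Lambda> = up_map A fr1"
  unfolding loc_poly_def up_map_def ..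

lemma \<Lambda>_hom: "\<Lambda> \<in> ring_hom (UP A) K"
  unfolding loc_poly_up_map by (rule fr1.up_map_hom)

lemma \<Lambda>_inj: "inj_on \<Lambda> (carrier (UP A))"
  unfolding loc_poly_up_map by (rule fr1.up_map_inj[OF loc.frac_inj])

sublocale \<Lambda>: ring_hom_cring "UP A" K \<Lambda>
  by (rule UnivPoly.ring_hom_cringI[OF UA.P.is_cring K.P.is_cring \<Lambda>_hom])

lemma \<Lambda>_monom: "a \<in> carrier A \<Longrightarrow> \<Lambda> (mon a n) = monom K (fr a \<one>\<^bsub>A\<^esub>) n"
  unfolding loc_poly_up_map by (rule fr1.up_map_monom)

lemma \<Lambda>_const: "a \<in> carrier A \<Longrightarrow> \<Lambda> (mon a 0) = c a"
  unfolding c_def by (rule \<Lambda>_monom)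

lemma \<Lambda>_var: "\<Lambda> (mon \<one>\<^bsub>A\<^esub> 1) = T"
  unfolding T_def loc.loc_one by (rule \<Lambda>_monom) simp

lemma c_hom: "c \<in> ring_hom A K"
proof (rule ring_hom_memI)
  fix a b assume "a \<in> carrier A" "b \<in> carrier A"
  then show "c (a \<otimes>\<^bsub>A\<^esub> b) = c a \<otimes>\<^bsub>K\<^esub> c b" "c (a \<oplus>\<^bsub>A\<^esub> b) = c a \<oplus>\<^bsub>K\<^esub> c b"
    unfolding c_def
    using ring_hom_mult[OF K.const_ring_hom, of "fr1 a" "fr1 b"]
      ring_hom_add[OF K.const_ring_hom, of "fr1 a" "fr1 b"] loc.M_one by simp_all
next
  show "c \<one>\<^bsub>A\<^esub> = \<one>\<^bsub>K\<^esub>" unfolding c_def using K.monom_one by simp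
qed (auto simp: c_def loc.M_one)

sublocale c: ring_hom_cring A K c
  by (rule UnivPoly.ring_hom_cringI[OF A.is_cring K.P.is_cring c_hom])

lemma c_inj: "inj_on c (carrier A)"
proof (rule inj_onI)
  fix a b assume ab: "a \<in> carrier A" "b \<in> carrier A" "c a = c b"
  have "fr a \<one>\<^bsub>A\<^esub> = fr b \<one>\<^bsub>A\<^esub>"
    by (rule inj_onD[OF K.monom_inj ab(3)[unfolded c_def]]) (use ab in auto)
  then show "a = b" by (rule inj_onD[OF loc.frac_inj _ ab(1,2)])
qed

lemma c_frac:
  assumes "s \<in> powers A x" "a \<in> carrier A"
  shows "c s \<otimes>\<^bsub>K\<^esub> monom K (fr a s) n = monom K (fr a \<one>\<^bsub>A\<^esub>) n"
proof -
  have "c s \<otimes>\<^bsub>K\<^esub> monom K (fr a s) n = monom K (fr s \<one>\<^bsub>A\<^esub> \<otimes>\<^bsub>Ax\<^esub> fr a s) (0 + n)"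
    unfolding c_def by (rule K.monom_mult[symmetric]) (use assms in auto)
  also have "fr s \<one>\<^bsub>A\<^esub> \<otimes>\<^bsub>Ax\<^esub> fr a s = fr a \<one>\<^bsub>A\<^esub>"
    unfolding loc.frac_mult[OF loc.M_closed[OF assms(1)] loc.M_one assms(2,1)]
    using assms by (simp add: loc.M_one loc.M_mult A.m_ac)
  finally show ?thesis by simp
qed

lemma c_unit: "c x \<in> Units K"
proof -
  have x: "x \<in> powers A x" using x_pow_mem[of 1] by simp
  have one: "monom K (fr \<one>\<^bsub>A\<^esub> \<one>\<^bsub>A\<^esub>) 0 = \<one>\<^bsub>K\<^esub>" by (simp flip: loc.loc_one)
  have inv: "c x \<otimes>\<^bsub>K\<^esub> monom K (fr \<one>\<^bsub>A\<^esub> x) 0 = \<one>\<^bsub>K\<^esub>"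
    using c_frac[OF x A.one_closed, of 0] one by simp
  have cl: "monom K (fr \<one>\<^bsub>A\<^esub> x) 0 \<in> carrier K" using x by simp
  from inv have "monom K (fr \<one>\<^bsub>A\<^esub> x) 0 \<otimes>\<^bsub>K\<^esub> c x = \<one>\<^bsub>K\<^esub>" using cl by (simp add: K.P.m_comm)
  with inv cl show ?thesis unfolding Units_def by auto
qed

lemma T_closed [simp, intro]: "T \<in> carrier K"
  unfolding T_def by simp

text \<open>The value of the transition map at \<open>T\<close> (see \<open>\<chi>_T\<close>); later
  computations reach it through \<open>\<theta>_eq\<close>, where no denominators occur.\<close>

definition \<theta> :: "nat \<Rightarrow> 'a \<Rightarrow> nat \<Rightarrow> 'a \<Rightarrow> nat \<Rightarrow> ('a \<times> 'a) set" where
  "\<theta> m s m' s' = monom K (fr (s' \<ominus>\<^bsub>A\<^esub> s) (x [^]\<^bsub>A\<^esub> m)) 0 \<oplus>\<^bsub>K\<^esub> monom K (fr (x [^]\<^bsub>A\<^esub> m') (x [^]\<^bsub>A\<^esub> m)) 1"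

lemma \<theta>_closed [simp]: "s \<in> carrier A \<Longrightarrow> s' \<in> carrier A \<Longrightarrow> \<theta> m s m' s' \<in> carrier K"
  unfolding \<theta>_def by (intro K.P.a_closed K.monom_closed loc.frac_closed) auto

lemma \<chi>_eval: "\<chi> m s m' s' = eval Ax K (\<lambda>a. monom K a 0) (\<theta> m s m' s')"
  unfolding chart_trans_def \<theta>_def Let_def ..

sublocale ev: UP_pre_univ_prop Ax K "\<lambda>a. monom K a 0" K
  by (intro UP_pre_univ_prop.intro UnivPoly.ring_hom_cringI K.const_ring_hom Ax.is_cring K.P.is_cring K.UP_cring_axioms)

section \<open>Transition maps of charts as substitutions\<close>

context
  fixes s s' assumes s: "s \<in> carrier A" "s' \<in> carrier A"
begin

lemma \<chi>_hom: "\<chi> m s m' s' \<in> ring_hom K K"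
  unfolding \<chi>_eval by (rule ev.eval_ring_hom) (simp add: s)

lemma \<chi>_closed: "y \<in> carrier K \<Longrightarrow> \<chi> m s m' s' y \<in> carrier K"
  by (rule ring_hom_closed[OF \<chi>_hom])

lemma \<chi>_const: "a \<in> carrier Ax \<Longrightarrow> \<chi> m s m' s' (monom K a 0) = monom K a 0"
  unfolding \<chi>_eval by (rule ev.eval_const) (simp_all add: s)

lemma \<chi>_c: "a \<in> carrier A \<Longrightarrow> \<chi> m s m' s' (c a) = c a"
  unfolding c_def by (rule \<chi>_const) auto

lemma \<chi>_T: "\<chi> m s m' s' T = \<theta> m s m' s'"
  unfolding \<chi>_eval T_def by (rule ev.eval_monom1) (simp add: s)

lemma \<theta>_eq: "c x [^]\<^bsub>K\<^esub> m \<otimes>\<^bsub>K\<^esub> \<theta> m s m' s' = c (s' \<ominus>\<^bsub>A\<^esub> s) \<oplus>\<^bsub>K\<^esub> c x [^]\<^bsub>K\<^esub> m' \<otimes>\<^bsub>K\<^esub> T"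
proof -
  have "c (x [^]\<^bsub>A\<^esub> m) \<otimes>\<^bsub>K\<^esub> \<theta> m s m' s' =
      c (x [^]\<^bsub>A\<^esub> m) \<otimes>\<^bsub>K\<^esub> monom K (fr (s' \<ominus>\<^bsub>A\<^esub> s) (x [^]\<^bsub>A\<^esub> m)) 0 \<oplus>\<^bsub>K\<^esub>
      c (x [^]\<^bsub>A\<^esub> m) \<otimes>\<^bsub>K\<^esub> monom K (fr (x [^]\<^bsub>A\<^esub> m') (x [^]\<^bsub>A\<^esub> m)) 1"
    unfolding \<theta>_def by (rule K.P.r_distr) (use s in auto)
  also have "\<dots> = c (s' \<ominus>\<^bsub>A\<^esub> s) \<oplus>\<^bsub>K\<^esub> monom K (fr (x [^]\<^bsub>A\<^esub> m') \<one>\<^bsub>A\<^esub>) 1"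
    unfolding c_frac[OF x_pow_mem A.minus_closed[OF s(2,1)]] c_frac[OF x_pow_mem A.nat_pow_closed[OF x_closed]]
    by (simp only: c_def)
  also have "monom K (fr (x [^]\<^bsub>A\<^esub> m') \<one>\<^bsub>A\<^esub>) 1 = c (x [^]\<^bsub>A\<^esub> m') \<otimes>\<^bsub>K\<^esub> T"
  proof -
    have "c (x [^]\<^bsub>A\<^esub> m') \<otimes>\<^bsub>K\<^esub> T = monom K (fr (x [^]\<^bsub>A\<^esub> m') \<one>\<^bsub>A\<^esub> \<otimes>\<^bsub>Ax\<^esub> \<one>\<^bsub>Ax\<^esub>) (0 + 1)"
      unfolding c_def T_def by (rule K.monom_mult[symmetric]) auto
    then show ?thesis by simp
  qed
  finally show ?thesis by simp
qed

end

lemma \<xi>_pow_cancel: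
  assumes "y \<in> carrier K" "z \<in> carrier K" "c x [^]\<^bsub>K\<^esub> (m::nat) \<otimes>\<^bsub>K\<^esub> y = c x [^]\<^bsub>K\<^esub> m \<otimes>\<^bsub>K\<^esub> z"
  shows "y = z"
proof -
  have "c x [^]\<^bsub>K\<^esub> m \<in> Units K"
    by (induct m) (simp_all add: c_unit K.P.Units_m_closed)
  then show ?thesis using K.P.Units_l_cancel assms by blast
qed

lemma \<chi>_trans:
  assumes s: "s \<in> carrier A" "s' \<in> carrier A" "s'' \<in> carrier A" and y: "y \<in> carrier K"
  shows "\<chi> m' s' m'' s'' (\<chi> m s m' s' y) = \<chi> m s m'' s'' y"
proof -
  let ?f = "\<chi> m s m' s'" and ?g = "\<chi> m' s' m'' s''"
  note f = \<chi>_hom[OF s(1,2), of m m'] and g = \<chi>_hom[OF s(2,3), of m' m'']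
  interpret g: ring_hom_cring K K ?g
    by (rule UnivPoly.ring_hom_cringI[OF K.P.is_cring K.P.is_cring g])
  have "(?g \<circ> ?f) y = \<chi> m s m'' s'' y"
  proof (rule K.hom_eq_on_UP[OF K.P.is_cring ring_hom_trans[OF f g] \<chi>_hom[OF s(1,3)] _ _ y])
    show "(?g \<circ> ?f) (monom K a 0) = \<chi> m s m'' s'' (monom K a 0)" if "a \<in> carrier Ax" for a
      using that s by (simp add: \<chi>_const)
    have "c x [^]\<^bsub>K\<^esub> m \<otimes>\<^bsub>K\<^esub> ?g (?f T) = ?g (c x [^]\<^bsub>K\<^esub> m \<otimes>\<^bsub>K\<^esub> ?f T)"
      using \<chi>_closed[OF s(1,2), of T] \<chi>_c[OF s(2,3), of x] by (simp)
    also have "\<dots> = ?g (c (s' \<ominus>\<^bsub>A\<^esub> s) \<oplus>\<^bsub>K\<^esub> c x [^]\<^bsub>K\<^esub> m' \<otimes>\<^bsub>K\<^esub> T)"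
      unfolding \<chi>_T[OF s(1,2)] \<theta>_eq[OF s(1,2)] ..
    also have "\<dots> = c (s' \<ominus>\<^bsub>A\<^esub> s) \<oplus>\<^bsub>K\<^esub> c x [^]\<^bsub>K\<^esub> m' \<otimes>\<^bsub>K\<^esub> ?g T"
      using s \<chi>_c[OF s(2,3), of "s' \<ominus>\<^bsub>A\<^esub> s"] \<chi>_c[OF s(2,3), of x] by (simp)
    also have "\<dots> = c (s' \<ominus>\<^bsub>A\<^esub> s) \<oplus>\<^bsub>K\<^esub> (c (s'' \<ominus>\<^bsub>A\<^esub> s') \<oplus>\<^bsub>K\<^esub> c x [^]\<^bsub>K\<^esub> m'' \<otimes>\<^bsub>K\<^esub> T)"
      unfolding \<chi>_T[OF s(2,3)] \<theta>_eq[OF s(2,3)] ..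
    also have "\<dots> = c ((s' \<ominus>\<^bsub>A\<^esub> s) \<oplus>\<^bsub>A\<^esub> (s'' \<ominus>\<^bsub>A\<^esub> s')) \<oplus>\<^bsub>K\<^esub> c x [^]\<^bsub>K\<^esub> m'' \<otimes>\<^bsub>K\<^esub> T"
      using s by (simp add: K.P.a_assoc)
    also have "(s' \<ominus>\<^bsub>A\<^esub> s) \<oplus>\<^bsub>A\<^esub> (s'' \<ominus>\<^bsub>A\<^esub> s') = s'' \<ominus>\<^bsub>A\<^esub> s" using s by algebra
    also have "c (s'' \<ominus>\<^bsub>A\<^esub> s) \<oplus>\<^bsub>K\<^esub> c x [^]\<^bsub>K\<^esub> m'' \<otimes>\<^bsub>K\<^esub> T = c x [^]\<^bsub>K\<^esub> m \<otimes>\<^bsub>K\<^esub> \<chi> m s m'' s'' T"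
      unfolding \<chi>_T[OF s(1,3)] \<theta>_eq[OF s(1,3)] ..
    finally have "?g (?f T) = \<chi> m s m'' s'' T"
      by (rule \<xi>_pow_cancel[OF \<chi>_closed[OF s(2,3) \<chi>_closed[OF s(1,2) T_closed]] \<chi>_closed[OF s(1,3) T_closed]])
    then show "(?g \<circ> ?f) (monom K \<one>\<^bsub>Ax\<^esub> 1) = \<chi> m s m'' s'' (monom K \<one>\<^bsub>Ax\<^esub> 1)"
      unfolding T_def comp_apply .
  qed
  then show ?thesis by simp
qed

lemma \<chi>_refl:
  assumes s: "s \<in> carrier A" and y: "y \<in> carrier K"
  shows "\<chi> m s m s y = y"
proof -
  have "\<chi> m s m s y = id y"
  proof (rule K.hom_eq_on_UP[OF K.P.is_cring \<chi>_hom[OF s s] _ _ _ y])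
    show "id \<in> ring_hom K K" by (rule ring_hom_memI) auto
    show "\<chi> m s m s (monom K a 0) = id (monom K a 0)" if "a \<in> carrier Ax" for a
      using that s by (simp add: \<chi>_const)
    have "c x [^]\<^bsub>K\<^esub> m \<otimes>\<^bsub>K\<^esub> \<theta> m s m s = c x [^]\<^bsub>K\<^esub> m \<otimes>\<^bsub>K\<^esub> T"
      unfolding \<theta>_eq[OF s s] using s by (simp add: A.r_right_minus_eq)
    then have "\<theta> m s m s = T" by (rule \<xi>_pow_cancel[rotated 2]) (use s in auto)
    then show "\<chi> m s m s (monom K \<one>\<^bsub>Ax\<^esub> 1) = id (monom K \<one>\<^bsub>Ax\<^esub> 1)"
      using \<chi>_T[OF s s] unfolding T_def by simp
  qed
  then show ?thesis by simp
qed

section \<open>The ring of a disc and its reduction modulo the parameter\<close>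

context
  fixes D :: "'a \<times> nat" assumes D: "fst D \<in> carrier A"
begin

lemma \<Phi>_hom: "\<Phi> D \<in> ring_hom (UP A) K"
proof -
  have "\<chi> (snd D) (fst D) 0 \<zero>\<^bsub>A\<^esub> \<circ> \<Lambda> \<in> ring_hom (UP A) K"
    by (rule ring_hom_trans[OF \<Lambda>_hom \<chi>_hom[OF D A.zero_closed]])
  moreover have "\<chi> (snd D) (fst D) 0 \<zero>\<^bsub>A\<^esub> \<circ> \<Lambda> = \<Phi> D" by (rule ext) (simp add: \<Phi>_def)
  ultimately show ?thesis by simp
qed

lemma \<Phi>_closed: "p \<in> carrier (UP A) \<Longrightarrow> \<Phi> D p \<in> carrier K"
  by (rule ring_hom_closed[OF \<Phi>_hom])

lemma \<Psi>_hom: "\<Psi> D \<in> ring_hom K K"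
proof -
  have "\<Psi> D = \<chi> 0 \<zero>\<^bsub>A\<^esub> (snd D) (fst D)" by (rule ext) (simp add: \<Psi>_def)
  then show ?thesis using \<chi>_hom[OF A.zero_closed D] by simp
qed

lemma \<Psi>_closed: "y \<in> carrier K \<Longrightarrow> \<Psi> D y \<in> carrier K"
  by (rule ring_hom_closed[OF \<Psi>_hom])

lemma \<Psi>_\<Phi>: "p \<in> carrier (UP A) \<Longrightarrow> \<Psi> D (\<Phi> D p) = \<Lambda> p"
  unfolding \<Psi>_def \<Phi>_def using D by (simp add: \<chi>_trans \<chi>_refl)

lemma \<Psi>_inj: "y \<in> carrier K \<Longrightarrow> z \<in> carrier K \<Longrightarrow> \<Psi> D y = \<Psi> D z \<Longrightarrow> y = z"
proof -
  assume yz: "y \<in> carrier K" "z \<in> carrier K" "\<Psi> D y = \<Psi> D z"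
  then have "\<chi> (snd D) (fst D) 0 \<zero>\<^bsub>A\<^esub> (\<Psi> D y) = \<chi> (snd D) (fst D) 0 \<zero>\<^bsub>A\<^esub> (\<Psi> D z)" by simp
  then show ?thesis unfolding \<Psi>_def using D yz by (simp add: \<chi>_trans \<chi>_refl)
qed

lemma \<Phi>_inj: "inj_on (\<Phi> D) (carrier (UP A))"
proof (rule inj_onI)
  fix p q assume pq: "p \<in> carrier (UP A)" "q \<in> carrier (UP A)" "\<Phi> D p = \<Phi> D q"
  then have "\<Lambda> p = \<Lambda> q" using \<Psi>_\<Phi> by metis
  then show "p = q" by (rule inj_onD[OF \<Lambda>_inj _ pq(1,2)])
qed

lemma \<Phi>_const: "a \<in> carrier A \<Longrightarrow> \<Phi> D (mon a 0) = c a"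
  unfolding \<Phi>_def using D by (simp add: \<Lambda>_const \<chi>_c)

lemma \<Phi>_var: "\<Phi> D (mon \<one>\<^bsub>A\<^esub> 1) = \<tau> D"
  unfolding \<Phi>_def \<tau>_def \<Lambda>_var ..

lemma coord_\<Phi>: "p \<in> carrier (UP A) \<Longrightarrow> coord D (\<Phi> D p) = p"
  unfolding coord_def by (rule inv_into_f_f[OF \<Phi>_inj])

lemma coord_closed: "y \<in> R D \<Longrightarrow> coord D y \<in> carrier (UP A)"
  unfolding R_def coord_def by (rule inv_into_into)

lemma \<Phi>_coord: "y \<in> R D \<Longrightarrow> \<Phi> D (coord D y) = y"
  unfolding R_def coord_def by (rule f_inv_into_f[of y "\<Phi> D"])

lemma \<Lambda>_coord: "y \<in> R D \<Longrightarrow> \<Lambda> (coord D y) = \<Psi> D y"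
  using \<Psi>_\<Phi>[OF coord_closed] \<Phi>_coord by simp

lemma R_iff: "y \<in> carrier K \<Longrightarrow> y \<in> R D \<longleftrightarrow> \<Psi> D y \<in> \<Lambda> ` carrier (UP A)"
proof
  assume "y \<in> R D"
  then show "\<Psi> D y \<in> \<Lambda> ` carrier (UP A)" using \<Lambda>_coord coord_closed by (metis imageI)
next
  assume y: "y \<in> carrier K" and "\<Psi> D y \<in> \<Lambda> ` carrier (UP A)"
  then obtain p where p: "p \<in> carrier (UP A)" "\<Psi> D y = \<Psi> D (\<Phi> D p)" using \<Psi>_\<Phi> by auto
  then have "y = \<Phi> D p" using \<Psi>_inj y \<Phi>_closed by blast
  then show "y \<in> R D" unfolding R_def using p by blast
qed

lemma R_mem: "p \<in> carrier (UP A) \<Longrightarrow> \<Phi> D p \<in> R D"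
  unfolding R_def by blast

lemma R_subring: "subring (R D) K"
proof -
  interpret \<Phi>: ring_hom_cring "UP A" K "\<Phi> D"
    by (rule UnivPoly.ring_hom_cringI[OF UA.P.is_cring K.P.is_cring \<Phi>_hom])
  show ?thesis unfolding R_def
    by (rule \<Phi>.ring.img_is_subring[OF UA.P.carrier_is_subring])
qed

lemma \<rho>_\<Phi>: "p \<in> carrier (UP A) \<Longrightarrow> \<rho> D (\<Phi> D p) = red p"
  unfolding \<rho>_def by (simp add: coord_\<Phi>)

lemma \<rho>_hom: "\<rho> D \<in> ring_hom (K\<lparr>carrier := R D\<rparr>) P"
proof (rule ring_hom_memI)
  fix y z assume "y \<in> carrier (K\<lparr>carrier := R D\<rparr>)" "z \<in> carrier (K\<lparr>carrier := R D\<rparr>)"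
  then obtain p q where pq: "p \<in> carrier (UP A)" "y = \<Phi> D p" "q \<in> carrier (UP A)" "z = \<Phi> D q"
    unfolding R_def by auto
  have "\<rho> D (\<Phi> D p \<otimes>\<^bsub>K\<^esub> \<Phi> D q) = \<rho> D (\<Phi> D (p \<otimes>\<^bsub>UP A\<^esub> q))"
    using pq by (simp add: ring_hom_mult[OF \<Phi>_hom])
  then show "\<rho> D (y \<otimes>\<^bsub>K\<lparr>carrier := R D\<rparr>\<^esub> z) = \<rho> D y \<otimes>\<^bsub>P\<^esub> \<rho> D z"
    unfolding pq(2,4) using pq(1,3) ring_hom_mult[OF kq.up_map_hom] by (simp add: \<rho>_\<Phi>)
  have "\<rho> D (\<Phi> D p \<oplus>\<^bsub>K\<^esub> \<Phi> D q) = \<rho> D (\<Phi> D (p \<oplus>\<^bsub>UP A\<^esub> q))"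
    using pq by (simp add: ring_hom_add[OF \<Phi>_hom])
  then show "\<rho> D (y \<oplus>\<^bsub>K\<lparr>carrier := R D\<rparr>\<^esub> z) = \<rho> D y \<oplus>\<^bsub>P\<^esub> \<rho> D z"
    unfolding pq(2,4) using pq(1,3) ring_hom_add[OF kq.up_map_hom] by (simp add: \<rho>_\<Phi>)
next
  fix y assume "y \<in> carrier (K\<lparr>carrier := R D\<rparr>)"
  then obtain p where "p \<in> carrier (UP A)" "y = \<Phi> D p" unfolding R_def by auto
  then show "\<rho> D y \<in> carrier P" by (simp add: \<rho>_\<Phi>)
next
  have "\<rho> D (\<Phi> D \<one>\<^bsub>UP A\<^esub>) = \<one>\<^bsub>P\<^esub>"
    unfolding \<rho>_\<Phi>[OF UA.P.one_closed] by (rule ring_hom_one[OF kq.up_map_hom])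
  then show "\<rho> D \<one>\<^bsub>K\<lparr>carrier := R D\<rparr>\<^esub> = \<one>\<^bsub>P\<^esub>" by (simp add: ring_hom_one[OF \<Phi>_hom])
qed

text \<open>The reduction of a polynomial vanishes only if all its coefficients are multiples of
  \<open>x\<close>, and \<open>UP_smult_mem\<close> takes that factor out of the whole
  polynomial.\<close>

lemma \<rho>_ker:
  assumes "y \<in> R D" "\<rho> D y = \<zero>\<^bsub>P\<^esub>"
  shows "\<exists>z\<in>R D. y = c x \<otimes>\<^bsub>K\<^esub> z"
proof -
  obtain p where p: "p \<in> carrier (UP A)" "y = \<Phi> D p" using assms unfolding R_def by auto
  then have "red p = \<zero>\<^bsub>P\<^esub>" using assms by (simp add: \<rho>_\<Phi>)
  then have "\<And>n. (PIdl\<^bsub>A\<^esub> x) +>\<^bsub>A\<^esub> coeff (UP A) p n = \<zero>\<^bsub>k\<^esub>" using kq.up_map_zero_iff[OF p(1)] by simp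
  then have mem: "\<And>n. coeff (UP A) p n \<in> PIdl\<^bsub>A\<^esub> x"
    using p(1) I.rcos_const_imp_mem unfolding FactRing_def by simp
  have "\<exists>q\<in>carrier (UP A). p = mon x 0 \<otimes>\<^bsub>UP A\<^esub> q"
  proof (rule UA.UP_smult_mem[OF p(1) x_closed])
    show "\<exists>a\<in>carrier A. coeff (UP A) p n = x \<otimes>\<^bsub>A\<^esub> a" for n
      using mem[of n] A.m_comm[OF x_closed] unfolding cgenideal_def by auto
    fix a b assume "a \<in> carrier A" "b \<in> carrier A" "x \<otimes>\<^bsub>A\<^esub> a = x \<otimes>\<^bsub>A\<^esub> b"
    then show "a = b" using A.m_lcancel[OF x_nz x_closed] by blast
  qed
  then obtain q where q: "q \<in> carrier (UP A)" "p = mon x 0 \<otimes>\<^bsub>UP A\<^esub> q" by blast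
  have "y = c x \<otimes>\<^bsub>K\<^esub> \<Phi> D q"
    unfolding p(2) q(2) using q(1) by (simp add: ring_hom_mult[OF \<Phi>_hom] \<Phi>_const)
  then show ?thesis using R_mem[OF q(1)] by blast
qed

lemma R_gen:
  assumes "\<zero>\<^bsub>K\<^esub> \<in> M"
    and step: "\<And>a q. a \<in> carrier A \<Longrightarrow> q \<in> M \<Longrightarrow> q \<in> R D \<Longrightarrow> c a \<oplus>\<^bsub>K\<^esub> \<tau> D \<otimes>\<^bsub>K\<^esub> q \<in> M"
  shows "R D \<subseteq> M"
proof
  fix y assume "y \<in> R D"
  then obtain p where p: "p \<in> carrier (UP A)" "y = \<Phi> D p" unfolding R_def by auto
  have "\<Phi> D p \<in> M" using p(1)
  proof (induct rule: UA.UP_Horner_induct)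
    case zero
    interpret \<Phi>: ring_hom_cring "UP A" K "\<Phi> D"
      by (rule UnivPoly.ring_hom_cringI[OF UA.P.is_cring K.P.is_cring \<Phi>_hom])
    show ?case using assms(1) by simp
  next
    case (step a q)
    have "\<Phi> D (mon a 0 \<oplus>\<^bsub>UP A\<^esub> mon \<one>\<^bsub>A\<^esub> 1 \<otimes>\<^bsub>UP A\<^esub> q) = c a \<oplus>\<^bsub>K\<^esub> \<tau> D \<otimes>\<^bsub>K\<^esub> \<Phi> D q"
      unfolding \<Phi>_var[symmetric] using step(1,2)
      by (simp add: ring_hom_add[OF \<Phi>_hom] ring_hom_mult[OF \<Phi>_hom] \<Phi>_const)
    then show ?case using assms(2)[OF step(1,3) R_mem[OF step(2)]] by metis
  qed
  then show "y \<in> M" using p(2) by simp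
qed

lemma denom:
  assumes y: "y \<in> carrier K"
  shows "\<exists>n::nat. c x [^]\<^bsub>K\<^esub> n \<otimes>\<^bsub>K\<^esub> y \<in> R D"
proof -
  \<comment> \<open>For the origin chart: each Horner step brings in one coefficient
    \<open>a\<close> with its own denominator, whose exponent \<open>m\<close> is added to the
    exponent \<open>n\<close> reached so far.\<close>
  have *: "\<exists>n::nat. \<exists>p\<in>carrier (UP A). c x [^]\<^bsub>K\<^esub> n \<otimes>\<^bsub>K\<^esub> w = \<Lambda> p" if "w \<in> carrier K" for w
    using that
  proof (induct rule: K.UP_Horner_induct)
    case zero
    have "c x [^]\<^bsub>K\<^esub> (0::nat) \<otimes>\<^bsub>K\<^esub> \<zero>\<^bsub>K\<^esub> = \<Lambda> \<zero>\<^bsub>UP A\<^esub>" by simp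
    then show ?case using UA.UP_zero_closed by blast
  next
    case (step a q)
    obtain n :: nat and p where p: "p \<in> carrier (UP A)" "c x [^]\<^bsub>K\<^esub> n \<otimes>\<^bsub>K\<^esub> q = \<Lambda> p" using step(3) by blast
    obtain r s where rs: "r \<in> carrier A" "s \<in> powers A x" "a = fr r s" using step(1) by (rule loc.frac_cases)
    then obtain m :: nat where m: "s = x [^]\<^bsub>A\<^esub> m" unfolding powers_def by blast
    let ?a = "mon (x [^]\<^bsub>A\<^esub> n \<otimes>\<^bsub>A\<^esub> r) 0" and ?q = "mon (x [^]\<^bsub>A\<^esub> m) 0 \<otimes>\<^bsub>UP A\<^esub> (mon \<one>\<^bsub>A\<^esub> 1 \<otimes>\<^bsub>UP A\<^esub> p)"
    have ma: "c x [^]\<^bsub>K\<^esub> m \<otimes>\<^bsub>K\<^esub> monom K a 0 = c r"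
      unfolding rs(3) m using c_frac[of s r 0] rs m by (simp add: c_def[symmetric])
    have xK: "c x [^]\<^bsub>K\<^esub> i \<in> carrier K" for i :: nat by simp
    have aK: "monom K a 0 \<in> carrier K" using step(1) by simp
    have "c x [^]\<^bsub>K\<^esub> (n + m) \<otimes>\<^bsub>K\<^esub> (monom K a 0 \<oplus>\<^bsub>K\<^esub> T \<otimes>\<^bsub>K\<^esub> q) =
      c x [^]\<^bsub>K\<^esub> n \<otimes>\<^bsub>K\<^esub> (c x [^]\<^bsub>K\<^esub> m \<otimes>\<^bsub>K\<^esub> monom K a 0) \<oplus>\<^bsub>K\<^esub>
      c x [^]\<^bsub>K\<^esub> m \<otimes>\<^bsub>K\<^esub> (T \<otimes>\<^bsub>K\<^esub> (c x [^]\<^bsub>K\<^esub> n \<otimes>\<^bsub>K\<^esub> q))"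
      unfolding K.P.nat_pow_mult[OF c.hom_closed[OF x_closed], symmetric]
      using xK[of n] xK[of m] aK T_closed step(2) by algebra
    also have "\<dots> = \<Lambda> (?a \<oplus>\<^bsub>UP A\<^esub> ?q)"
    proof -
      have "\<Lambda> ?a = c x [^]\<^bsub>K\<^esub> n \<otimes>\<^bsub>K\<^esub> c r" using rs(1) \<Lambda>_const[of "x [^]\<^bsub>A\<^esub> n \<otimes>\<^bsub>A\<^esub> r"] by simp
      moreover have "\<Lambda> ?q = c x [^]\<^bsub>K\<^esub> m \<otimes>\<^bsub>K\<^esub> (T \<otimes>\<^bsub>K\<^esub> \<Lambda> p)"
        using p(1) \<Lambda>_const[of "x [^]\<^bsub>A\<^esub> m"] \<Lambda>_var by simp
      moreover have "\<Lambda> (?a \<oplus>\<^bsub>UP A\<^esub> ?q) = \<Lambda> ?a \<oplus>\<^bsub>K\<^esub> \<Lambda> ?q"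
        by (rule \<Lambda>.hom_add) (use rs(1) p(1) in auto)
      ultimately show ?thesis unfolding ma p(2) by simp
    qed
    finally have "c x [^]\<^bsub>K\<^esub> (n + m) \<otimes>\<^bsub>K\<^esub> (monom K a 0 \<oplus>\<^bsub>K\<^esub> monom K \<one>\<^bsub>Ax\<^esub> 1 \<otimes>\<^bsub>K\<^esub> q) = \<Lambda> (?a \<oplus>\<^bsub>UP A\<^esub> ?q)"
      unfolding T_def .
    moreover have "?a \<oplus>\<^bsub>UP A\<^esub> ?q \<in> carrier (UP A)"
      using rs(1) p(1) by (intro UA.P.a_closed UA.P.m_closed UA.monom_closed) auto
    ultimately show ?case by blast
  qed
  \<comment> \<open>The general disc is reduced to that case by \<open>\<Psi> D\<close>, which fixes
    \<open>c x\<close>.\<close>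
  obtain n :: nat and p where p: "p \<in> carrier (UP A)" "c x [^]\<^bsub>K\<^esub> n \<otimes>\<^bsub>K\<^esub> \<Psi> D y = \<Lambda> p"
    using *[OF \<Psi>_closed[OF y]] by blast
  interpret \<Psi>: ring_hom_cring K K "\<Psi> D"
    by (rule UnivPoly.ring_hom_cringI[OF K.P.is_cring K.P.is_cring \<Psi>_hom])
  have "\<Psi> D (c x) = c x" unfolding \<Psi>_def using D by (simp add: \<chi>_c)
  then have "\<Psi> D (c x [^]\<^bsub>K\<^esub> n \<otimes>\<^bsub>K\<^esub> y) = \<Lambda> p" using p(2) y by simp
  then have "c x [^]\<^bsub>K\<^esub> n \<otimes>\<^bsub>K\<^esub> y \<in> R D" using R_iff y p(1) by simp
  then show ?thesis by blast
qed

lemma \<tau>_eq: "c x [^]\<^bsub>K\<^esub> snd D \<otimes>\<^bsub>K\<^esub> \<tau> D = T \<ominus>\<^bsub>K\<^esub> c (fst D)"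
proof -
  have "c x [^]\<^bsub>K\<^esub> snd D \<otimes>\<^bsub>K\<^esub> \<tau> D = c (\<zero>\<^bsub>A\<^esub> \<ominus>\<^bsub>A\<^esub> fst D) \<oplus>\<^bsub>K\<^esub> c x [^]\<^bsub>K\<^esub> (0::nat) \<otimes>\<^bsub>K\<^esub> T"
    unfolding \<tau>_def \<chi>_T[OF D A.zero_closed] by (rule \<theta>_eq[OF D A.zero_closed])
  also have "\<dots> = T \<ominus>\<^bsub>K\<^esub> c (fst D)"
    using D by (simp add: A.minus_eq K.P.minus_eq K.P.a_comm)
  finally show ?thesis .
qed

end

lemma one_notin_I: "\<one>\<^bsub>A\<^esub> \<notin> PIdl\<^bsub>A\<^esub> x"
  using I.I_notcarr I.one_imp_carrier by blast

text \<open>With \<open>m\<close>, \<open>s\<close> for \<open>D\<close> and \<open>m'\<close>,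
  \<open>s'\<close> for \<open>D'\<close>, membership means \<open>x^m p = (s' - s) + x^m' T\<close>
  with \<open>p\<close> over \<open>A\<close>. The constant coefficient gives the congruence of
  centres; the linear one shows that \<open>x^m\<close> divides \<open>x^m'\<close>, which for
  \<open>m > m'\<close> would make \<open>x\<close> invertible.\<close>

lemma \<tau>_memD:
  assumes D: "fst D \<in> carrier A" "fst D' \<in> carrier A" and mem: "\<tau> D \<in> R D'"
  shows "snd D \<le> snd D' \<and> fst D \<ominus>\<^bsub>A\<^esub> fst D' \<in> PIdl\<^bsub>A\<^esub> (x [^]\<^bsub>A\<^esub> snd D)"
proof -
  let ?m = "snd D" and ?m' = "snd D'" and ?s = "fst D" and ?s' = "fst D'"
  obtain p where p: "p \<in> carrier (UP A)" "\<tau> D = \<Phi> D' p" using mem unfolding R_def by auto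
  have "\<Lambda> p = \<Psi> D' (\<tau> D)" unfolding p(2) by (rule \<Psi>_\<Phi>[OF D(2) p(1), symmetric])
  also have "\<dots> = \<theta> ?m ?s ?m' ?s'"
    unfolding \<Psi>_def \<tau>_def \<chi>_trans[OF D(1) A.zero_closed D(2) T_closed] by (rule \<chi>_T[OF D])
  finally have "c x [^]\<^bsub>K\<^esub> ?m \<otimes>\<^bsub>K\<^esub> \<Lambda> p = c (?s' \<ominus>\<^bsub>A\<^esub> ?s) \<oplus>\<^bsub>K\<^esub> c x [^]\<^bsub>K\<^esub> ?m' \<otimes>\<^bsub>K\<^esub> T"
    using \<theta>_eq[OF D] by simp
  moreover have "\<Lambda> (mon (x [^]\<^bsub>A\<^esub> ?m) 0 \<otimes>\<^bsub>UP A\<^esub> p) = c x [^]\<^bsub>K\<^esub> ?m \<otimes>\<^bsub>K\<^esub> \<Lambda> p"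
    using p(1) \<Lambda>_const[of "x [^]\<^bsub>A\<^esub> ?m"] by simp
  moreover have "\<Lambda> (mon (?s' \<ominus>\<^bsub>A\<^esub> ?s) 0 \<oplus>\<^bsub>UP A\<^esub> mon (x [^]\<^bsub>A\<^esub> ?m') 0 \<otimes>\<^bsub>UP A\<^esub> mon \<one>\<^bsub>A\<^esub> 1) =
      c (?s' \<ominus>\<^bsub>A\<^esub> ?s) \<oplus>\<^bsub>K\<^esub> c x [^]\<^bsub>K\<^esub> ?m' \<otimes>\<^bsub>K\<^esub> T"
    using D \<Lambda>_const[of "x [^]\<^bsub>A\<^esub> ?m'"] \<Lambda>_const[of "?s' \<ominus>\<^bsub>A\<^esub> ?s"] \<Lambda>_var by simp
  ultimately have eq: "mon (x [^]\<^bsub>A\<^esub> ?m) 0 \<otimes>\<^bsub>UP A\<^esub> p =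
      mon (?s' \<ominus>\<^bsub>A\<^esub> ?s) 0 \<oplus>\<^bsub>UP A\<^esub> mon (x [^]\<^bsub>A\<^esub> ?m') 0 \<otimes>\<^bsub>UP A\<^esub> mon \<one>\<^bsub>A\<^esub> 1"
    by (intro inj_onD[OF \<Lambda>_inj]) (use D p(1) in auto)
  have rhs: "mon (x [^]\<^bsub>A\<^esub> ?m') 0 \<otimes>\<^bsub>UP A\<^esub> mon \<one>\<^bsub>A\<^esub> 1 = mon (x [^]\<^bsub>A\<^esub> ?m') 1"
    using UA.monom_mult[of "x [^]\<^bsub>A\<^esub> ?m'" "\<one>\<^bsub>A\<^esub>" 0 1] by simp
  have co: "x [^]\<^bsub>A\<^esub> ?m \<otimes>\<^bsub>A\<^esub> coeff (UP A) p n = coeff (UP A) (mon (?s' \<ominus>\<^bsub>A\<^esub> ?s) 0 \<oplus>\<^bsub>UP A\<^esub> mon (x [^]\<^bsub>A\<^esub> ?m') 1) n" for n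
    using UA.coeff_monom_mult[OF A.nat_pow_closed[OF x_closed] p(1), of ?m 0 n] unfolding eq rhs by simp
  have pc: "coeff (UP A) p n \<in> carrier A" for n using p(1) by simp
  have 0: "?s' \<ominus>\<^bsub>A\<^esub> ?s = x [^]\<^bsub>A\<^esub> ?m \<otimes>\<^bsub>A\<^esub> coeff (UP A) p 0" using co[of 0] D by simp
  have 1: "x [^]\<^bsub>A\<^esub> ?m' = x [^]\<^bsub>A\<^esub> ?m \<otimes>\<^bsub>A\<^esub> coeff (UP A) p 1" using co[of 1] D by simp
  have "?s \<ominus>\<^bsub>A\<^esub> ?s' = \<ominus>\<^bsub>A\<^esub> (?s' \<ominus>\<^bsub>A\<^esub> ?s)" using D by (simp add: A.minus_eq A.minus_add A.a_comm)
  also have "\<dots> = (\<ominus>\<^bsub>A\<^esub> coeff (UP A) p 0) \<otimes>\<^bsub>A\<^esub> x [^]\<^bsub>A\<^esub> ?m"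
    unfolding 0 using pc[of 0] by (simp add: A.r_minus A.l_minus A.m_comm)
  finally have "?s \<ominus>\<^bsub>A\<^esub> ?s' \<in> PIdl\<^bsub>A\<^esub> (x [^]\<^bsub>A\<^esub> ?m)"
    unfolding cgenideal_def using pc[of 0] by blast
  moreover have "?m \<le> ?m'"
  proof (rule ccontr)
    assume "\<not> ?m \<le> ?m'"
    then obtain i where i: "?m = ?m' + Suc i" by (metis add_Suc_right less_imp_Suc_add not_le)
    have nz: "x [^]\<^bsub>A\<^esub> ?m' \<noteq> \<zero>\<^bsub>A\<^esub>" using loc.M_nz[OF x_pow_mem] .
    let ?b = "x [^]\<^bsub>A\<^esub> i \<otimes>\<^bsub>A\<^esub> coeff (UP A) p 1"
    have b: "?b \<in> carrier A" using pc[of 1] by simp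
    have "x [^]\<^bsub>A\<^esub> ?m = x [^]\<^bsub>A\<^esub> ?m' \<otimes>\<^bsub>A\<^esub> (x [^]\<^bsub>A\<^esub> i \<otimes>\<^bsub>A\<^esub> x)"
      unfolding i by (simp add: A.nat_pow_mult[symmetric] A.m_assoc)
    then have "x [^]\<^bsub>A\<^esub> ?m' = (x [^]\<^bsub>A\<^esub> ?m' \<otimes>\<^bsub>A\<^esub> (x [^]\<^bsub>A\<^esub> i \<otimes>\<^bsub>A\<^esub> x)) \<otimes>\<^bsub>A\<^esub> coeff (UP A) p 1"
      using 1 by metis
    also have "\<dots> = x [^]\<^bsub>A\<^esub> ?m' \<otimes>\<^bsub>A\<^esub> (?b \<otimes>\<^bsub>A\<^esub> x)"
      using pc[of 1] by (simp add: A.m_ac)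
    finally have "x [^]\<^bsub>A\<^esub> ?m' \<otimes>\<^bsub>A\<^esub> \<one>\<^bsub>A\<^esub> = x [^]\<^bsub>A\<^esub> ?m' \<otimes>\<^bsub>A\<^esub> (?b \<otimes>\<^bsub>A\<^esub> x)" by simp
    then have "\<one>\<^bsub>A\<^esub> = ?b \<otimes>\<^bsub>A\<^esub> x"
      using A.m_lcancel[OF nz, of "\<one>\<^bsub>A\<^esub>" "?b \<otimes>\<^bsub>A\<^esub> x"] b by simp
    then show False using one_notin_I b unfolding cgenideal_def by blast
  qed
  ultimately show ?thesis by simp
qed

lemma \<kappa>_hom: "\<kappa> \<in> ring_hom A P"
proof (rule ring_hom_memI)
  fix a b assume "a \<in> carrier A" "b \<in> carrier A"
  then show "\<kappa> (a \<otimes>\<^bsub>A\<^esub> b) = \<kappa> a \<otimes>\<^bsub>P\<^esub> \<kappa> b" "\<kappa> (a \<oplus>\<^bsub>A\<^esub> b) = \<kappa> a \<oplus>\<^bsub>P\<^esub> \<kappa> b"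
    unfolding \<kappa>_def
    using ring_hom_mult[OF P.const_ring_hom, of "(PIdl\<^bsub>A\<^esub> x) +>\<^bsub>A\<^esub> a" "(PIdl\<^bsub>A\<^esub> x) +>\<^bsub>A\<^esub> b"]
      ring_hom_add[OF P.const_ring_hom, of "(PIdl\<^bsub>A\<^esub> x) +>\<^bsub>A\<^esub> a" "(PIdl\<^bsub>A\<^esub> x) +>\<^bsub>A\<^esub> b"] by simp_all
next
  show "\<kappa> \<one>\<^bsub>A\<^esub> = \<one>\<^bsub>P\<^esub>" unfolding \<kappa>_def using P.monom_one by simp
qed (auto simp: \<kappa>_def)

lemma k_carrier: "carrier k = (+>\<^bsub>A\<^esub>) (PIdl\<^bsub>A\<^esub> x) ` carrier A"
  unfolding FactRing_def A_RCOSETS_def' by auto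

lemma const_image: "(\<lambda>a. monom P a 0) ` carrier k = \<kappa> ` carrier A"
  unfolding k_carrier image_image \<kappa>_def ..

lemma quot_zero_iff: "a \<in> carrier A \<Longrightarrow> (PIdl\<^bsub>A\<^esub> x) +>\<^bsub>A\<^esub> a = \<zero>\<^bsub>k\<^esub> \<longleftrightarrow> a \<in> PIdl\<^bsub>A\<^esub> x"
  unfolding FactRing_def
  using I.rcos_const_imp_mem[of a] A.a_coset_join2[OF _ I.a_subgroup, of a] by auto

sublocale disc_system A K P x c T \<kappa> t \<tau> R \<rho>
proof (intro disc_system.intro disc_system_axioms.intro A.domain_axioms K.UP_domain P.UP_domain)
  show "\<kappa> a = \<zero>\<^bsub>P\<^esub> \<longleftrightarrow> a \<in> PIdl\<^bsub>A\<^esub> x" if a: "a \<in> carrier A" for a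
  proof -
    have "\<kappa> a = \<zero>\<^bsub>P\<^esub> \<longleftrightarrow> (PIdl\<^bsub>A\<^esub> x) +>\<^bsub>A\<^esub> a = \<zero>\<^bsub>k\<^esub>"
    proof
      assume "\<kappa> a = \<zero>\<^bsub>P\<^esub>"
      then have "coeff P (\<kappa> a) 0 = coeff P \<zero>\<^bsub>P\<^esub> 0" by simp
      then show "(PIdl\<^bsub>A\<^esub> x) +>\<^bsub>A\<^esub> a = \<zero>\<^bsub>k\<^esub>" using a unfolding \<kappa>_def by simp
    next
      assume "(PIdl\<^bsub>A\<^esub> x) +>\<^bsub>A\<^esub> a = \<zero>\<^bsub>k\<^esub>"
      then show "\<kappa> a = \<zero>\<^bsub>P\<^esub>" unfolding \<kappa>_def by (simp add: P.monom_zero)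
    qed
    then show ?thesis using quot_zero_iff[OF a] by simp
  qed
  show "\<exists>b\<in>carrier A. \<kappa> a \<otimes>\<^bsub>P\<^esub> \<kappa> b = \<one>\<^bsub>P\<^esub>" if a: "a \<in> carrier A" "a \<notin> PIdl\<^bsub>A\<^esub> x" for a
  proof -
    let ?a = "(PIdl\<^bsub>A\<^esub> x) +>\<^bsub>A\<^esub> a"
    have ak: "?a \<in> carrier k" using a(1) by simp
    have "?a \<noteq> \<zero>\<^bsub>k\<^esub>" using quot_zero_iff[OF a(1)] a(2) by simp
    then have "?a \<in> Units k" using k.field_Units ak by simp
    then have inv: "inv\<^bsub>k\<^esub> ?a \<in> carrier k" "?a \<otimes>\<^bsub>k\<^esub> inv\<^bsub>k\<^esub> ?a = \<one>\<^bsub>k\<^esub>" by auto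
    then obtain b where b: "b \<in> carrier A" "(PIdl\<^bsub>A\<^esub> x) +>\<^bsub>A\<^esub> b = inv\<^bsub>k\<^esub> ?a" using k_carrier by auto
    have "\<kappa> a \<otimes>\<^bsub>P\<^esub> \<kappa> b = monom P (?a \<otimes>\<^bsub>k\<^esub> inv\<^bsub>k\<^esub> ?a) (0 + 0)"
      unfolding \<kappa>_def b(2) by (rule P.monom_mult[symmetric, OF ak inv(1)])
    then have "\<kappa> a \<otimes>\<^bsub>P\<^esub> \<kappa> b = \<one>\<^bsub>P\<^esub>" unfolding inv(2) using P.monom_one by simp
    then show ?thesis using b(1) by blast
  qed
  show "p \<in> \<kappa> ` carrier A" if "p \<in> carrier P" "q \<in> carrier P" "p \<otimes>\<^bsub>P\<^esub> q = \<one>\<^bsub>P\<^esub>" for p q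
    using P.UP_unit_const[OF that] unfolding const_image[symmetric] by blast
  show "t \<notin> \<kappa> ` carrier A"
  proof
    assume "t \<in> \<kappa> ` carrier A"
    then obtain a where a: "a \<in> carrier A" "t = \<kappa> a" by blast
    have "coeff P t 1 = \<one>\<^bsub>k\<^esub>" unfolding t_def by simp
    moreover have "coeff P t 1 = \<zero>\<^bsub>k\<^esub>" unfolding a(2) \<kappa>_def using a(1) by simp
    ultimately show False using k.one_not_zero by simp
  qed
  show "carrier P \<subseteq> M" if M: "\<zero>\<^bsub>P\<^esub> \<in> M"
    "\<And>a q. a \<in> carrier A \<Longrightarrow> q \<in> M \<Longrightarrow> q \<in> carrier P \<Longrightarrow> \<kappa> a \<oplus>\<^bsub>P\<^esub> t \<otimes>\<^bsub>P\<^esub> q \<in> M" for M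
  proof
    fix p assume "p \<in> carrier P"
    then show "p \<in> M"
    proof (induct rule: P.UP_Horner_induct)
      case zero show ?case by (rule M(1))
    next
      case (step a q)
      then obtain b where b: "b \<in> carrier A" "a = (PIdl\<^bsub>A\<^esub> x) +>\<^bsub>A\<^esub> b" using k_carrier by auto
      show ?case using M(2)[OF b(1) step(3,2)] unfolding \<kappa>_def t_def b(2) .
    qed
  qed
  show "c a \<in> R D" if "fst D \<in> carrier A" "a \<in> carrier A" for D a
    using R_mem[OF that(1), of "mon a 0"] \<Phi>_const[OF that] that by simp
  show "\<tau> D \<in> R D" if "fst D \<in> carrier A" for D
    using R_mem[OF that, of "mon \<one>\<^bsub>A\<^esub> 1"] \<Phi>_var[OF that] by simp
  show "\<rho> D (c a) = \<kappa> a" if "fst D \<in> carrier A" "a \<in> carrier A" for D a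
    using \<rho>_\<Phi>[OF that(1), of "mon a 0"] \<Phi>_const[OF that] that by (simp add: \<kappa>_def)
  show "\<rho> D (\<tau> D) = t" if "fst D \<in> carrier A" for D
    using \<rho>_\<Phi>[OF that(1), of "mon \<one>\<^bsub>A\<^esub> 1"] \<Phi>_var[OF that] by (simp add: t_def)
  show "t \<in> carrier P" unfolding t_def by simp
  show "x \<noteq> \<zero>\<^bsub>A\<^esub>" "c \<in> ring_hom A K" "inj_on c (carrier A)" "c x \<in> Units K" "\<kappa> \<in> ring_hom A P"
    by (fact x_nz c_hom c_inj c_unit \<kappa>_hom)+
  show "subring (R D) K" if "fst D \<in> carrier A" for D using that by (rule R_subring)
  show "c x [^]\<^bsub>K\<^esub> snd D \<otimes>\<^bsub>K\<^esub> \<tau> D = T \<ominus>\<^bsub>K\<^esub> c (fst D)" if "fst D \<in> carrier A" for D using that by (rule \<tau>_eq)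
  show "\<rho> D \<in> ring_hom (K\<lparr>carrier := R D\<rparr>) P" if "fst D \<in> carrier A" for D using that by (rule \<rho>_hom)
  show "\<exists>n::nat. c x [^]\<^bsub>K\<^esub> n \<otimes>\<^bsub>K\<^esub> y \<in> R D" if "fst D \<in> carrier A" "y \<in> carrier K" for D y
    using that by (rule denom)
  show "\<exists>z\<in>R D. y = c x \<otimes>\<^bsub>K\<^esub> z" if "fst D \<in> carrier A" "y \<in> R D" "\<rho> D y = \<zero>\<^bsub>P\<^esub>" for D y
    using that by (rule \<rho>_ker)
  show "snd D \<le> snd D' \<and> fst D \<ominus>\<^bsub>A\<^esub> fst D' \<in> PIdl\<^bsub>A\<^esub> (x [^]\<^bsub>A\<^esub> snd D)"
    if "fst D \<in> carrier A" "fst D' \<in> carrier A" "\<tau> D \<in> R D'" for D D'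
    using that by (rule \<tau>_memD)
  show "R D \<subseteq> M" if "fst D \<in> carrier A" "\<zero>\<^bsub>K\<^esub> \<in> M"
    "\<And>a q. a \<in> carrier A \<Longrightarrow> q \<in> M \<Longrightarrow> q \<in> R D \<Longrightarrow> c a \<oplus>\<^bsub>K\<^esub> \<tau> D \<otimes>\<^bsub>K\<^esub> q \<in> M" for D M
    using that by (rule R_gen)
qed simp_all

end

section \<open>Surfaces as rings of functions on families of discs\<close>

context dfs_base
begin

text \<open>Recording the embedding \<open>j\<close> instead of demanding that the ring be
  \<open>B F\<close> lets surfaces on different types be compared inside \<open>K\<close>.\<close>

definition model :: "('a, 'b, 'n) aff_scheme \<Rightarrow> ('a \<times> nat) set \<Rightarrow> ('b \<Rightarrow> nat \<Rightarrow> ('a \<times> 'a) set) \<Rightarrow> bool" where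
  "model S F j \<longleftrightarrow> fam F \<and> affine_over A S \<and> j \<in> ring_hom (Coord S) K \<and> inj_on j (carrier (Coord S)) \<and>
     (\<forall>a\<in>carrier A. j (str S a) = c a) \<and> j ` carrier (Coord S) = B F"

context
  fixes S :: "('a, 'b, 'n) aff_scheme" and F j
  assumes m: "model S F j"
begin

lemma model_fam: "fam F" and model_affine: "affine_over A S" and model_hom: "j \<in> ring_hom (Coord S) K"
  and model_inj: "inj_on j (carrier (Coord S))" and model_image: "j ` carrier (Coord S) = B F"
  using m unfolding model_def by blast+

lemma model_str: "a \<in> carrier A \<Longrightarrow> j (str S a) = c a"
  using m unfolding model_def by blast

lemma model_cring: "cring (Coord S)" and model_str_hom: "str S \<in> ring_hom A (Coord S)"
  using model_affine unfolding affine_over_def by blast+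

lemma model_str_closed: "a \<in> carrier A \<Longrightarrow> str S a \<in> carrier (Coord S)"
  by (rule ring_hom_closed[OF model_str_hom])

lemma model_ring_hom_cring: "ring_hom_cring (Coord S) K j"
  by (rule UnivPoly.ring_hom_cringI[OF model_cring K.P.is_cring model_hom])

lemma model_closed: "b \<in> carrier (Coord S) \<Longrightarrow> j b \<in> B F"
  using model_image by blast

lemma model_closedK: "b \<in> carrier (Coord S) \<Longrightarrow> j b \<in> carrier K"
  by (rule ring_hom_closed[OF model_hom])

lemma model_memR: "b \<in> carrier (Coord S) \<Longrightarrow> D \<in> F \<Longrightarrow> j b \<in> R D"
  by (rule B_memD[OF model_closed])

lemma model_preimage: "y \<in> B F \<Longrightarrow> \<exists>b\<in>carrier (Coord S). j b = y"
  using model_image by (metis imageE)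

lemma model_eqI: "b \<in> carrier (Coord S) \<Longrightarrow> b' \<in> carrier (Coord S) \<Longrightarrow> j b = j b' \<Longrightarrow> b = b'"
  by (rule inj_onD[OF model_inj])

lemma model_domain: "domain (Coord S)"
proof -
  interpret j: ring_hom_cring "Coord S" K j by (rule model_ring_hom_cring)
  show ?thesis
  proof (rule domainI)
    show "cring (Coord S)" by (rule model_cring)
    show "\<one>\<^bsub>Coord S\<^esub> \<noteq> \<zero>\<^bsub>Coord S\<^esub>"
    proof
      assume "\<one>\<^bsub>Coord S\<^esub> = \<zero>\<^bsub>Coord S\<^esub>"
      then have "j \<one>\<^bsub>Coord S\<^esub> = j \<zero>\<^bsub>Coord S\<^esub>" by simp
      then show False by simp
    qed
    fix a b assume ab: "a \<otimes>\<^bsub>Coord S\<^esub> b = \<zero>\<^bsub>Coord S\<^esub>" "a \<in> carrier (Coord S)" "b \<in> carrier (Coord S)"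
    then have "j a \<otimes>\<^bsub>K\<^esub> j b = \<zero>\<^bsub>K\<^esub>" by (metis j.hom_mult j.hom_zero)
    then have "j a = \<zero>\<^bsub>K\<^esub> \<or> j b = \<zero>\<^bsub>K\<^esub>" using ab K.UP_integral model_closedK by simp
    then show "a = \<zero>\<^bsub>Coord S\<^esub> \<or> b = \<zero>\<^bsub>Coord S\<^esub>"
      using model_eqI[of a "\<zero>\<^bsub>Coord S\<^esub>"] model_eqI[of b "\<zero>\<^bsub>Coord S\<^esub>"] ab by auto
  qed
qed

lemma model_strx_nz: "str S x \<noteq> \<zero>\<^bsub>Coord S\<^esub>"
proof
  interpret j: ring_hom_cring "Coord S" K j by (rule model_ring_hom_cring)
  assume "str S x = \<zero>\<^bsub>Coord S\<^esub>"
  then have "c x = \<zero>\<^bsub>K\<^esub>" using model_str[of x] j.hom_zero by simp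
  then show False using \<xi>_pow_nz[of 1] by simp
qed

lemma model_denom:
  assumes y: "y \<in> carrier K"
  shows "\<exists>n::nat. \<exists>b\<in>carrier (Coord S). c x [^]\<^bsub>K\<^esub> n \<otimes>\<^bsub>K\<^esub> y = j b"
  using denom_B[OF model_fam y] model_preimage by metis

lemma model_div:
  assumes b: "b \<in> carrier (Coord S)" "\<And>D. D \<in> F \<Longrightarrow> \<rho> D (j b) = \<zero>\<^bsub>P\<^esub>"
  shows "\<exists>d\<in>carrier (Coord S). b = str S x \<otimes>\<^bsub>Coord S\<^esub> d"
proof -
  interpret j: ring_hom_cring "Coord S" K j by (rule model_ring_hom_cring)
  obtain z where z: "z \<in> B F" "j b = c x \<otimes>\<^bsub>K\<^esub> z" using B_div[OF model_fam model_closed[OF b(1)] b(2)] by blast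
  obtain d where d: "d \<in> carrier (Coord S)" "j d = z" using model_preimage[OF z(1)] by blast
  have "j b = j (str S x \<otimes>\<^bsub>Coord S\<^esub> d)"
    using z(2) d model_str[of x] model_str_closed[of x] by simp
  then have "b = str S x \<otimes>\<^bsub>Coord S\<^esub> d" using model_eqI b(1) d(1) model_str_closed[of x] j.R.m_closed by simp
  then show ?thesis using d(1) by blast
qed

lemma model_\<rho>_strx:
  assumes "d \<in> carrier (Coord S)" "D \<in> F"
  shows "\<rho> D (j (str S x \<otimes>\<^bsub>Coord S\<^esub> d)) = \<zero>\<^bsub>P\<^esub>"
proof -
  interpret j: ring_hom_cring "Coord S" K j by (rule model_ring_hom_cring)
  have "j (str S x \<otimes>\<^bsub>Coord S\<^esub> d) = c x \<otimes>\<^bsub>K\<^esub> j d"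
    using assms(1) model_str[of x] model_str_closed[of x] by simp
  then show ?thesis using \<rho>_\<xi>_mult[OF famD[OF model_fam assms(2)] model_memR[OF assms]] by simp
qed

lemma mem_PIdl_strx_iff:
  assumes b: "b \<in> carrier (Coord S)"
  shows "b \<in> PIdl\<^bsub>Coord S\<^esub> (str S x) \<longleftrightarrow> (\<forall>D\<in>F. \<rho> D (j b) = \<zero>\<^bsub>P\<^esub>)"
proof -
  interpret j: ring_hom_cring "Coord S" K j by (rule model_ring_hom_cring)
  have "b \<in> PIdl\<^bsub>Coord S\<^esub> (str S x) \<longleftrightarrow> (\<exists>d\<in>carrier (Coord S). b = str S x \<otimes>\<^bsub>Coord S\<^esub> d)"
    unfolding cgenideal_def using j.R.m_comm model_str_closed[of x] by auto
  also have "\<dots> \<longleftrightarrow> (\<forall>D\<in>F. \<rho> D (j b) = \<zero>\<^bsub>P\<^esub>)"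
    using model_div[OF b] model_\<rho>_strx by blast
  finally show ?thesis .
qed

lemma model_chart_hom:
  assumes D: "D \<in> F" shows "(\<lambda>b. coord D (j b)) \<in> ring_hom (Coord S) (UP A)"
proof -
  interpret j: ring_hom_cring "Coord S" K j by (rule model_ring_hom_cring)
  note DA = famD[OF model_fam D]
  have cl: "coord D y \<in> carrier (UP A)" if "y \<in> R D" for y by (rule coord_closed[OF DA that])
  have eq: "p = coord D y" if "p \<in> carrier (UP A)" "\<Phi> D p = y" for p y
    using coord_\<Phi>[OF DA that(1)] that(2) by simp
  show ?thesis
  proof (rule ring_hom_memI)
    fix b d assume bd: "b \<in> carrier (Coord S)" "d \<in> carrier (Coord S)"
    note R = model_memR[OF bd(1) D] model_memR[OF bd(2) D]
    show "coord D (j b) \<in> carrier (UP A)" by (rule cl[OF R(1)])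
    show "coord D (j (b \<otimes>\<^bsub>Coord S\<^esub> d)) = coord D (j b) \<otimes>\<^bsub>UP A\<^esub> coord D (j d)"
      by (rule eq[symmetric]) (use R cl bd in \<open>simp_all add: ring_hom_mult[OF \<Phi>_hom[OF DA]] \<Phi>_coord[OF DA]\<close>)
    show "coord D (j (b \<oplus>\<^bsub>Coord S\<^esub> d)) = coord D (j b) \<oplus>\<^bsub>UP A\<^esub> coord D (j d)"
      by (rule eq[symmetric]) (use R cl bd in \<open>simp_all add: ring_hom_add[OF \<Phi>_hom[OF DA]] \<Phi>_coord[OF DA]\<close>)
  next
    show "coord D (j \<one>\<^bsub>Coord S\<^esub>) = \<one>\<^bsub>UP A\<^esub>"
      by (rule eq[symmetric]) (simp_all add: ring_hom_one[OF \<Phi>_hom[OF DA]])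
  qed
qed

text \<open>The common source of the open immersions: a chart is the case of a single disc, the last
  map of the factorization the case of the discs that are kept. Away from the fiber the two rings
  agree by \<open>denom_B\<close>, along the components in \<open>G\<close> by
  \<open>denom_idempotent\<close>.\<close>

lemma model_localizing:
  assumes G: "G \<subseteq> F" "G \<noteq> {}"
    and C: "domain C" "g \<in> ring_hom C K" "inj_on g (carrier C)" "g ` carrier C = B G"
    and f: "f \<in> ring_hom (Coord S) C" "\<And>b. b \<in> carrier (Coord S) \<Longrightarrow> g (f b) = j b"
    and e: "e \<in> carrier (Coord S)" "\<And>D. D \<in> F \<Longrightarrow> \<rho> D (j e) = (if D \<in> G then \<one>\<^bsub>P\<^esub> else \<zero>\<^bsub>P\<^esub>)"
  shows "open_immersion (Coord S) C f"
    and "comap (Coord S) f ` prime_spec C = {Q \<in> prime_spec (Coord S). \<not> {str S x, e} \<subseteq> Q}"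
proof -
  interpret C: domain C by fact
  interpret S: domain "Coord S" by (rule model_domain)
  interpret j: ring_hom_cring "Coord S" K j by (rule model_ring_hom_cring)
  interpret g: ring_hom_cring C K g by (rule UnivPoly.ring_hom_cringI[OF C.is_cring K.P.is_cring C(2)])
  interpret f: ring_hom_cring "Coord S" C f by (rule UnivPoly.ring_hom_cringI[OF S.is_cring C.is_cring f(1)])
  note xS = model_str_closed[OF x_closed]
  have famG: "fam G" by (rule fam_subset[OF model_fam G])
  have gx: "g (f (str S x)) = c x" using f(2)[OF xS] model_str[of x] by simp
  interpret loc: localizing_hom "Coord S" C f "{str S x, e}"
  proof (intro localizing_hom.intro localizing_hom_axioms.intro S.domain_axioms C.domain_axioms f(1))
    show "inj_on f (carrier (Coord S))"
      by (rule inj_onI) (metis f(2) model_eqI)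
    show "{str S x, e} \<subseteq> carrier (Coord S)" using xS e(1) by simp
    fix u d assume u: "u \<in> {str S x, e}" and d: "d \<in> carrier C"
    then have uS: "u \<in> carrier (Coord S)" using xS e(1) by auto
    have gd: "g d \<in> B G" "g d \<in> carrier K" using C(4) d by auto
    have "\<exists>n::nat. j u [^]\<^bsub>K\<^esub> n \<otimes>\<^bsub>K\<^esub> g d \<in> B F"
    proof (cases "u = str S x")
      case True
      then show ?thesis using denom_B[OF model_fam gd(2)] model_str[of x] by simp
    next
      case False
      then have "u = e" using u by simp
      then show ?thesis using denom_idempotent[OF model_fam G model_closed[OF e(1)] e(2) gd(1)] by simp
    qed
    then obtain n :: nat and b where b: "b \<in> carrier (Coord S)" "j u [^]\<^bsub>K\<^esub> n \<otimes>\<^bsub>K\<^esub> g d = j b"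
      using model_preimage by metis
    have "g (f u [^]\<^bsub>C\<^esub> n \<otimes>\<^bsub>C\<^esub> d) = g (f b)" using uS d b f(2) by simp
    then have "f u [^]\<^bsub>C\<^esub> n \<otimes>\<^bsub>C\<^esub> d = f b"
      by (rule inj_onD[OF C(3)]) (use uS d b in auto)
    then show "\<exists>n::nat. \<exists>b\<in>carrier (Coord S). f u [^]\<^bsub>C\<^esub> n \<otimes>\<^bsub>C\<^esub> d = f b" using b(1) by blast
  qed
  \<comment> \<open>On \<open>G\<close> the element \<open>e\<close> is 1 modulo \<open>x\<close>,
    so \<open>1 = e + x w\<close> in \<open>C\<close>, and no prime contains both \<open>e\<close>
    and \<open>x\<close>.\<close>
  have cover: "\<exists>u\<in>{str S x, e}. f u \<notin> Q" if Q: "primeideal Q C" for Q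
  proof (rule ccontr)
    interpret Q: primeideal Q C by fact
    assume "\<not> ?thesis"
    then have mem: "f (str S x) \<in> Q" "f e \<in> Q" by auto
    have je: "j e \<in> B G" "\<one>\<^bsub>K\<^esub> \<in> B G"
      using model_closed[OF e(1)] G B_one[OF famG] unfolding B_def by auto
    have "\<rho> D (\<one>\<^bsub>K\<^esub> \<ominus>\<^bsub>K\<^esub> j e) = \<zero>\<^bsub>P\<^esub>" if D: "D \<in> G" for D
      using e(2)[of D] D G(1) B_memD[OF je(1) D] \<rho>_minus[OF famD[OF famG D] R_one[OF famD[OF famG D]], of "j e"]
        \<rho>_one[OF famD[OF famG D]] by (auto simp: P.P.r_right_minus_eq)
    then obtain z where z: "z \<in> B G" "\<one>\<^bsub>K\<^esub> \<ominus>\<^bsub>K\<^esub> j e = c x \<otimes>\<^bsub>K\<^esub> z"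
      using B_div[OF famG B_minus[OF famG je(2,1)]] by blast
    obtain w where w: "w \<in> carrier C" "g w = z" using z(1) unfolding C(4)[symmetric] by auto
    have "j e \<in> carrier K" "\<one>\<^bsub>K\<^esub> \<in> carrier K" using e(1) by auto
    then have "\<one>\<^bsub>K\<^esub> = j e \<oplus>\<^bsub>K\<^esub> (\<one>\<^bsub>K\<^esub> \<ominus>\<^bsub>K\<^esub> j e)" by algebra
    then have "g \<one>\<^bsub>C\<^esub> = g (f e \<oplus>\<^bsub>C\<^esub> f (str S x) \<otimes>\<^bsub>C\<^esub> w)"
      using z(2) w e(1) xS f(2) gx by simp
    then have "\<one>\<^bsub>C\<^esub> = f e \<oplus>\<^bsub>C\<^esub> f (str S x) \<otimes>\<^bsub>C\<^esub> w"
      by (rule inj_onD[OF C(3)]) (use w e(1) xS in auto)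
    also have "\<dots> \<in> Q" using mem w by (intro Q.a_closed Q.I_r_closed)
    finally show False using Q.one_imp_carrier Q.I_notcarr by blast
  qed
  show "open_immersion (Coord S) C f" "comap (Coord S) f ` prime_spec C = {Q \<in> prime_spec (Coord S). \<not> {str S x, e} \<subseteq> Q}"
    by (rule loc.open_immersion_localizing[OF cover], assumption)+
qed

lemma model_finite_type: "finite_type A S"
proof -
  interpret S: domain "Coord S" by (rule model_domain)
  interpret j: ring_hom_cring "Coord S" K j by (rule model_ring_hom_cring)
  obtain X where X: "finite X" "X \<subseteq> B F"
    "\<And>C. subring C K \<Longrightarrow> c ` carrier A \<subseteq> C \<Longrightarrow> X \<subseteq> C \<Longrightarrow> B F \<subseteq> C"
    using finitely_generated[OF model_fam] by blast
  obtain Y where Y: "Y \<subseteq> carrier (Coord S)" "finite Y" "X = j ` Y"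
    using finite_subset_image[OF X(1), of j "carrier (Coord S)"] X(2) model_image by auto
  let ?H = "str S ` carrier A \<union> Y"
  let ?C = "generate_ring (Coord S) ?H"
  have H: "?H \<subseteq> carrier (Coord S)" using Y(1) model_str_closed by auto
  have sub: "subring ?C (Coord S)" by (rule S.generate_ring_is_subring[OF H])
  have HC: "?H \<subseteq> ?C" by (rule subsetI) (rule generate_ring.incl)
  have CS: "?C \<subseteq> carrier (Coord S)" by (rule S.generate_ring_incl[OF H])
  have "B F \<subseteq> j ` ?C"
  proof (rule X(3))
    show "subring (j ` ?C) K" by (rule j.ring.img_is_subring[OF sub])
    show "X \<subseteq> j ` ?C" using HC unfolding Y(3) by blast
    show "c ` carrier A \<subseteq> j ` ?C"
    proof
      fix y assume "y \<in> c ` carrier A"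
      then obtain a where "a \<in> carrier A" "y = j (str S a)" using model_str by auto
      then show "y \<in> j ` ?C" using HC by blast
    qed
  qed
  have "carrier (Coord S) \<subseteq> ?C"
  proof
    fix b assume b: "b \<in> carrier (Coord S)"
    then have "j b \<in> j ` ?C" using \<open>B F \<subseteq> j ` ?C\<close> model_closed by blast
    then obtain b' where "b' \<in> ?C" "j b = j b'" by blast
    then show "b \<in> ?C" using model_eqI[OF b, of b'] CS by auto
  qed
  then have "generate_ring (Coord S) ?H = carrier (Coord S)" using CS by blast
  then show ?thesis unfolding finite_type_def using Y(1,2) by blast
qed

end

section \<open>The restriction to the punctured base\<close>

context
  fixes S :: "('a, 'b, 'n) aff_scheme" and F j
  assumes m: "model S F j"
begin

abbreviation (input) M where "M \<equiv> powers (Coord S) (str S x)"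

lemma model_frac: "frac (Coord S) M"
  by (rule domain.frac_powers[OF model_domain[OF m] model_str_closed[OF m x_closed] model_strx_nz[OF m]])

lemma model_pow_mem: "str S x [^]\<^bsub>Coord S\<^esub> (n::nat) \<in> M"
  unfolding powers_def by blast

lemma str_loc_map: 
  assumes "r \<in> carrier A" "s \<in> powers A x"
  shows "loc_map (Coord S) M (str S) (fr r s) = loc_frac (Coord S) M (str S r) (str S s)"
proof (rule loc_map_frac[OF loc.frac_axioms model_frac model_str_hom[OF m] _ assms])
  interpret str: ring_hom_cring A "Coord S" "str S"
    by (rule UnivPoly.ring_hom_cringI[OF A.is_cring model_cring[OF m] model_str_hom[OF m]])
  show "str S ` powers A x \<subseteq> M" unfolding powers_def by auto
qed

text \<open>The isomorphism from \<open>K\<close> to the localization of the coordinate ring at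
  \<open>x\<close>: a power of \<open>x\<close> is multiplied in to reach the image of
  \<open>j\<close> and put back as denominator. By \<open>from_K_eq\<close> the choice of the
  exponent is immaterial.\<close>

definition from_K :: "(nat \<Rightarrow> ('a \<times> 'a) set) \<Rightarrow> ('b \<times> 'b) set" where
  "from_K y = (let n = (SOME n::nat. c x [^]\<^bsub>K\<^esub> n \<otimes>\<^bsub>K\<^esub> y \<in> j ` carrier (Coord S)) in
     loc_frac (Coord S) M (inv_into (carrier (Coord S)) j (c x [^]\<^bsub>K\<^esub> n \<otimes>\<^bsub>K\<^esub> y)) (str S x [^]\<^bsub>Coord S\<^esub> n))"

lemma from_K_eq:
  assumes y: "y \<in> carrier K" and b: "b \<in> carrier (Coord S)" "c x [^]\<^bsub>K\<^esub> (n::nat) \<otimes>\<^bsub>K\<^esub> y = j b"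
  shows "from_K y = loc_frac (Coord S) M b (str S x [^]\<^bsub>Coord S\<^esub> n)"
proof -
  interpret l: frac "Coord S" M by (rule model_frac)
  interpret j: ring_hom_cring "Coord S" K j by (rule model_ring_hom_cring[OF m])
  note xS = model_str_closed[OF m x_closed]
  define k where "k = (SOME n::nat. c x [^]\<^bsub>K\<^esub> n \<otimes>\<^bsub>K\<^esub> y \<in> j ` carrier (Coord S))"
  have "c x [^]\<^bsub>K\<^esub> n \<otimes>\<^bsub>K\<^esub> y \<in> j ` carrier (Coord S)" using b by simp
  then have k: "c x [^]\<^bsub>K\<^esub> k \<otimes>\<^bsub>K\<^esub> y \<in> j ` carrier (Coord S)" unfolding k_def by (rule someI)
  define b' where "b' = inv_into (carrier (Coord S)) j (c x [^]\<^bsub>K\<^esub> k \<otimes>\<^bsub>K\<^esub> y)"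
  have b': "b' \<in> carrier (Coord S)" "j b' = c x [^]\<^bsub>K\<^esub> k \<otimes>\<^bsub>K\<^esub> y"
    unfolding b'_def using k by (rule inv_into_into, rule f_inv_into_f)
  have "j (b' \<otimes>\<^bsub>Coord S\<^esub> str S x [^]\<^bsub>Coord S\<^esub> n) = (c x [^]\<^bsub>K\<^esub> k \<otimes>\<^bsub>K\<^esub> y) \<otimes>\<^bsub>K\<^esub> c x [^]\<^bsub>K\<^esub> n"
    using b' xS model_str[OF m x_closed] by simp
  also have "\<dots> = (c x [^]\<^bsub>K\<^esub> n \<otimes>\<^bsub>K\<^esub> y) \<otimes>\<^bsub>K\<^esub> c x [^]\<^bsub>K\<^esub> k"
    using y by (simp add: K.P.m_ac)
  also have "\<dots> = j (b \<otimes>\<^bsub>Coord S\<^esub> str S x [^]\<^bsub>Coord S\<^esub> k)"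
    unfolding b(2) using b(1) xS model_str[OF m x_closed] by simp
  finally have "b' \<otimes>\<^bsub>Coord S\<^esub> str S x [^]\<^bsub>Coord S\<^esub> n = b \<otimes>\<^bsub>Coord S\<^esub> str S x [^]\<^bsub>Coord S\<^esub> k"
    by (rule model_eqI[OF m, rotated 2]) (use b b' xS in auto)
  then have "loc_frac (Coord S) M b' (str S x [^]\<^bsub>Coord S\<^esub> k) = loc_frac (Coord S) M b (str S x [^]\<^bsub>Coord S\<^esub> n)"
    using l.frac_eq_iff[OF b'(1) b(1) model_pow_mem model_pow_mem] by simp
  then show ?thesis unfolding from_K_def Let_def k_def[symmetric] b'_def[symmetric] .
qed

lemma from_K_iso: "from_K \<in> ring_iso K (loc_at (Coord S) (str S x))"
proof -
  interpret l: frac "Coord S" M by (rule model_frac)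
  interpret j: ring_hom_cring "Coord S" K j by (rule model_ring_hom_cring[OF m])
  note xS = model_str_closed[OF m x_closed] and jx = model_str[OF m x_closed]
  have rep: "\<exists>n::nat. \<exists>b\<in>carrier (Coord S). c x [^]\<^bsub>K\<^esub> n \<otimes>\<^bsub>K\<^esub> y = j b" if "y \<in> carrier K" for y
    by (rule model_denom[OF m that])
  have xx: "c x [^]\<^bsub>K\<^esub> (n::nat) \<in> carrier K" for n by simp
  have hom: "from_K \<in> ring_hom K (loc_at (Coord S) (str S x))"
  proof (rule ring_hom_memI)
    fix y assume y: "y \<in> carrier K"
    obtain n :: nat and b where b: "b \<in> carrier (Coord S)" "c x [^]\<^bsub>K\<^esub> n \<otimes>\<^bsub>K\<^esub> y = j b" using rep[OF y] by blast
    then show "from_K y \<in> carrier (loc_at (Coord S) (str S x))"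
      using from_K_eq[OF y b] l.frac_closed[OF b(1) model_pow_mem] by simp
    fix z assume z: "z \<in> carrier K"
    obtain k :: nat and d where d: "d \<in> carrier (Coord S)" "c x [^]\<^bsub>K\<^esub> k \<otimes>\<^bsub>K\<^esub> z = j d" using rep[OF z] by blast
    have "c x [^]\<^bsub>K\<^esub> (n + k) \<otimes>\<^bsub>K\<^esub> (y \<otimes>\<^bsub>K\<^esub> z) = (c x [^]\<^bsub>K\<^esub> n \<otimes>\<^bsub>K\<^esub> y) \<otimes>\<^bsub>K\<^esub> (c x [^]\<^bsub>K\<^esub> k \<otimes>\<^bsub>K\<^esub> z)"
      using y z by (simp add: K.P.m_ac flip: K.P.nat_pow_mult)
    also have "\<dots> = j (b \<otimes>\<^bsub>Coord S\<^esub> d)" unfolding b(2) d(2) using b(1) d(1) by simp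
    finally have yz: "c x [^]\<^bsub>K\<^esub> (n + k) \<otimes>\<^bsub>K\<^esub> (y \<otimes>\<^bsub>K\<^esub> z) = j (b \<otimes>\<^bsub>Coord S\<^esub> d)" .
    show "from_K (y \<otimes>\<^bsub>K\<^esub> z) = from_K y \<otimes>\<^bsub>loc_at (Coord S) (str S x)\<^esub> from_K z"
      unfolding from_K_eq[OF y b] from_K_eq[OF z d] from_K_eq[OF K.P.m_closed[OF y z] l.m_closed[OF b(1) d(1)] yz]
      using b(1) d(1) model_pow_mem xS by (simp add: l.nat_pow_mult)
    have "c x [^]\<^bsub>K\<^esub> (n + k) \<otimes>\<^bsub>K\<^esub> (y \<oplus>\<^bsub>K\<^esub> z) =
        (c x [^]\<^bsub>K\<^esub> n \<otimes>\<^bsub>K\<^esub> y) \<otimes>\<^bsub>K\<^esub> c x [^]\<^bsub>K\<^esub> k \<oplus>\<^bsub>K\<^esub> (c x [^]\<^bsub>K\<^esub> k \<otimes>\<^bsub>K\<^esub> z) \<otimes>\<^bsub>K\<^esub> c x [^]\<^bsub>K\<^esub> n"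
      unfolding K.P.nat_pow_mult[OF c.hom_closed[OF x_closed], symmetric]
      using y z xx[of n] xx[of k] by algebra
    also have "\<dots> = j (b \<otimes>\<^bsub>Coord S\<^esub> str S x [^]\<^bsub>Coord S\<^esub> k \<oplus>\<^bsub>Coord S\<^esub> d \<otimes>\<^bsub>Coord S\<^esub> str S x [^]\<^bsub>Coord S\<^esub> n)"
      unfolding b(2) d(2) using b(1) d(1) xS jx by simp
    finally have yz: "c x [^]\<^bsub>K\<^esub> (n + k) \<otimes>\<^bsub>K\<^esub> (y \<oplus>\<^bsub>K\<^esub> z) =
      j (b \<otimes>\<^bsub>Coord S\<^esub> str S x [^]\<^bsub>Coord S\<^esub> k \<oplus>\<^bsub>Coord S\<^esub> d \<otimes>\<^bsub>Coord S\<^esub> str S x [^]\<^bsub>Coord S\<^esub> n)" .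
    have cl: "b \<otimes>\<^bsub>Coord S\<^esub> str S x [^]\<^bsub>Coord S\<^esub> k \<oplus>\<^bsub>Coord S\<^esub> d \<otimes>\<^bsub>Coord S\<^esub> str S x [^]\<^bsub>Coord S\<^esub> n \<in> carrier (Coord S)"
      using b(1) d(1) xS by simp
    show "from_K (y \<oplus>\<^bsub>K\<^esub> z) = from_K y \<oplus>\<^bsub>loc_at (Coord S) (str S x)\<^esub> from_K z"
      unfolding from_K_eq[OF y b] from_K_eq[OF z d] from_K_eq[OF K.P.a_closed[OF y z] cl yz]
      using b(1) d(1) model_pow_mem xS by (simp add: l.nat_pow_mult)
  next
    have "from_K \<one>\<^bsub>K\<^esub> = loc_frac (Coord S) M \<one>\<^bsub>Coord S\<^esub> (str S x [^]\<^bsub>Coord S\<^esub> (0::nat))"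
      by (rule from_K_eq) simp_all
    then show "from_K \<one>\<^bsub>K\<^esub> = \<one>\<^bsub>loc_at (Coord S) (str S x)\<^esub>" by (simp add: l.loc_one)
  qed
  have inj: "inj_on from_K (carrier K)"
  proof (rule inj_onI)
    fix y z assume y: "y \<in> carrier K" and z: "z \<in> carrier K" and eq: "from_K y = from_K z"
    obtain n :: nat and b where b: "b \<in> carrier (Coord S)" "c x [^]\<^bsub>K\<^esub> n \<otimes>\<^bsub>K\<^esub> y = j b" using rep[OF y] by blast
    obtain k :: nat and d where d: "d \<in> carrier (Coord S)" "c x [^]\<^bsub>K\<^esub> k \<otimes>\<^bsub>K\<^esub> z = j d" using rep[OF z] by blast
    have "b \<otimes>\<^bsub>Coord S\<^esub> str S x [^]\<^bsub>Coord S\<^esub> k = d \<otimes>\<^bsub>Coord S\<^esub> str S x [^]\<^bsub>Coord S\<^esub> n"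
      using eq l.frac_eq_iff[OF b(1) d(1) model_pow_mem model_pow_mem]
      unfolding from_K_eq[OF y b] from_K_eq[OF z d] by simp
    then have "j (b \<otimes>\<^bsub>Coord S\<^esub> str S x [^]\<^bsub>Coord S\<^esub> k) = j (d \<otimes>\<^bsub>Coord S\<^esub> str S x [^]\<^bsub>Coord S\<^esub> n)" by simp
    then have "(c x [^]\<^bsub>K\<^esub> n \<otimes>\<^bsub>K\<^esub> y) \<otimes>\<^bsub>K\<^esub> c x [^]\<^bsub>K\<^esub> k = (c x [^]\<^bsub>K\<^esub> k \<otimes>\<^bsub>K\<^esub> z) \<otimes>\<^bsub>K\<^esub> c x [^]\<^bsub>K\<^esub> n"
      unfolding b(2) d(2) using b(1) d(1) xS jx by simp
    then have "c x [^]\<^bsub>K\<^esub> (n + k) \<otimes>\<^bsub>K\<^esub> y = c x [^]\<^bsub>K\<^esub> (n + k) \<otimes>\<^bsub>K\<^esub> z"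
      using y z by (simp add: K.P.m_ac flip: K.P.nat_pow_mult)
    then show "y = z" by (rule \<xi>_pow_cancel[OF y z])
  qed
  have surj: "p \<in> from_K ` carrier K" if "p \<in> carrier (loc_at (Coord S) (str S x))" for p
    using that
  proof (rule l.frac_cases)
    fix b s assume bs: "b \<in> carrier (Coord S)" "s \<in> M" "p = loc_frac (Coord S) M b s"
    obtain n :: nat where n: "s = str S x [^]\<^bsub>Coord S\<^esub> n" using bs(2) unfolding powers_def by blast
    let ?u = "c x [^]\<^bsub>K\<^esub> n"
    have u: "?u \<in> Units K" by (rule \<xi>_pow_unit)
    let ?y = "inv\<^bsub>K\<^esub> ?u \<otimes>\<^bsub>K\<^esub> j b"
    have y: "?y \<in> carrier K" using u bs(1) by simp
    have "?u \<otimes>\<^bsub>K\<^esub> ?y = (?u \<otimes>\<^bsub>K\<^esub> inv\<^bsub>K\<^esub> ?u) \<otimes>\<^bsub>K\<^esub> j b"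
      using bs(1) K.P.Units_inv_closed[OF u] by (simp only: K.P.m_assoc j.hom_closed xx)
    then have "?u \<otimes>\<^bsub>K\<^esub> ?y = j b" using u bs(1) by (simp add: K.P.Units_r_inv)
    then have "from_K ?y = p" using from_K_eq[OF y bs(1)] bs(3) n by simp
    then show ?thesis using y by blast
  qed
  have "from_K ` carrier K = carrier (loc_at (Coord S) (str S x))"
    using surj ring_hom_closed[OF hom] by blast
  then show ?thesis using hom inj unfolding ring_iso_def bij_betw_def by simp
qed

lemma model_restriction:
  "isomorphic_over (loc_at A x) (restriction x S) (affine_line (loc_at A x))"
  unfolding isomorphic_over_def isomorphism_over_def morphism_over_def
proof (intro exI[of _ from_K] conjI ballI)
  interpret str: ring_hom_cring A "Coord S" "str S"
    by (rule UnivPoly.ring_hom_cringI[OF A.is_cring model_cring[OF m] model_str_hom[OF m]])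
  show "from_K \<in> ring_iso (Coord (affine_line Ax)) (Coord (restriction x S))"
    using from_K_iso by (simp add: affine_line_def restriction_def)
  then show "from_K \<in> ring_hom (Coord (affine_line Ax)) (Coord (restriction x S))"
    unfolding ring_iso_def by blast
  fix a assume a: "a \<in> carrier Ax"
  obtain r s where rs: "r \<in> carrier A" "s \<in> powers A x" "a = fr r s" using a by (rule loc.frac_cases)
  obtain n :: nat where n: "s = x [^]\<^bsub>A\<^esub> n" using rs(2) unfolding powers_def by blast
  have "c s \<otimes>\<^bsub>K\<^esub> monom K a 0 = c r" unfolding rs(3) using c_frac[OF rs(2,1)] by (simp add: c_def)
  then have "c x [^]\<^bsub>K\<^esub> n \<otimes>\<^bsub>K\<^esub> monom K a 0 = j (str S r)" using n model_str[OF m rs(1)] by simp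
  then have "from_K (monom K a 0) = loc_frac (Coord S) M (str S r) (str S x [^]\<^bsub>Coord S\<^esub> n)"
    by (intro from_K_eq) (use a rs(1) in auto)
  then show "from_K (str (affine_line Ax) a) = str (restriction x S) a"
    using str_loc_map[OF rs(1,2)] rs(3) n by (simp add: affine_line_def restriction_def)
qed

end

end

lemma (in domain) zero_primeideal: "primeideal {\<zero>} R"
proof (rule primeidealI)
  show "ideal {\<zero>} R" by (rule zeroideal)
  show "cring R" by (rule is_cring)
  show "carrier R \<noteq> {\<zero>}" using one_not_zero one_closed by blast
  fix a b assume "a \<in> carrier R" "b \<in> carrier R" "a \<otimes> b \<in> {\<zero>}"
  then show "a \<in> {\<zero>} \<or> b \<in> {\<zero>}" using integral by simp
qed

section \<open>The special fiber of a model\<close>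

context dfs_base
begin

text \<open>Elements of one coset of \<open>x A\<close> have the same image modulo \<open>x\<close>,
  so the set to which \<open>the_elem\<close> is applied is a singleton.\<close>

lemma special_fiber_str:
  assumes S: "affine_over A S" and a: "a \<in> carrier A"
  shows "str (special_fiber x S) ((PIdl\<^bsub>A\<^esub> x) +>\<^bsub>A\<^esub> a) = (PIdl\<^bsub>Coord S\<^esub> (str S x)) +>\<^bsub>Coord S\<^esub> str S a"
proof -
  let ?xB = "PIdl\<^bsub>Coord S\<^esub> (str S x)"
  interpret str: ring_hom_cring A "Coord S" "str S"
    by (rule UnivPoly.ring_hom_cringI[OF A.is_cring]) (use S in \<open>simp_all add: affine_over_def\<close>)
  interpret J: ideal ?xB "Coord S" by (rule str.S.cgenideal_ideal) simp
  have "?xB +>\<^bsub>Coord S\<^esub> str S a' = ?xB +>\<^bsub>Coord S\<^esub> str S a" if a': "a' \<in> (PIdl\<^bsub>A\<^esub> x) +>\<^bsub>A\<^esub> a" for a'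
  proof -
    obtain y where y: "y \<in> PIdl\<^bsub>A\<^esub> x" "a' = y \<oplus>\<^bsub>A\<^esub> a" using a' unfolding a_r_coset_def' by blast
    then obtain r where r: "r \<in> carrier A" "y = r \<otimes>\<^bsub>A\<^esub> x" unfolding cgenideal_def by blast
    have "str S y \<in> ?xB" unfolding r(2) cgenideal_def using r(1) by auto
    moreover have "str S a' = str S y \<oplus>\<^bsub>Coord S\<^esub> str S a" unfolding y(2) r(2) using r(1) a by simp
    ultimately have "str S a' \<in> ?xB +>\<^bsub>Coord S\<^esub> str S a" unfolding a_r_coset_def' by blast
    then show ?thesis using J.a_repr_independence'[OF _ str.hom_closed[OF a]] by simp
  qed
  moreover have "a \<in> (PIdl\<^bsub>A\<^esub> x) +>\<^bsub>A\<^esub> a" by (rule I.a_rcos_self[OF a])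
  ultimately have "(\<lambda>a. ?xB +>\<^bsub>Coord S\<^esub> str S a) ` ((PIdl\<^bsub>A\<^esub> x) +>\<^bsub>A\<^esub> a) = {?xB +>\<^bsub>Coord S\<^esub> str S a}" by blast
  then show ?thesis unfolding special_fiber_def by simp
qed

definition DU where "DU n = Coord (disjoint_union n (\<lambda>_. affine_line k))"

lemma DU_simps:
  "carrier (DU n) = (\<Pi>\<^sub>E i\<in>{..<n}. carrier P)" "u \<otimes>\<^bsub>DU n\<^esub> v = (\<lambda>i\<in>{..<n}. u i \<otimes>\<^bsub>P\<^esub> v i)"
  "u \<oplus>\<^bsub>DU n\<^esub> v = (\<lambda>i\<in>{..<n}. u i \<oplus>\<^bsub>P\<^esub> v i)" "\<one>\<^bsub>DU n\<^esub> = (\<lambda>i\<in>{..<n}. \<one>\<^bsub>P\<^esub>)" "\<zero>\<^bsub>DU n\<^esub> = (\<lambda>i\<in>{..<n}. \<zero>\<^bsub>P\<^esub>)"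
  unfolding DU_def disjoint_union_def affine_line_def by simp_all

context
  fixes S :: "('a, 'b, 'n) aff_scheme" and F j
  assumes m: "model S F j"
begin

abbreviation (input) xB where "xB \<equiv> PIdl\<^bsub>Coord S\<^esub> (str S x)"

lemma ideal_xB: "ideal xB (Coord S)"
  by (rule cring.cgenideal_ideal[OF model_cring[OF m] model_str_closed[OF m x_closed]])

context
  fixes n :: nat and d :: "nat \<Rightarrow> 'a \<times> nat"
  assumes d: "bij_betw d {..<n} F"
begin

definition fib where "fib b = (\<lambda>i\<in>{..<n}. \<rho> (d i) (j b))"

lemma dF: "i < n \<Longrightarrow> d i \<in> F"
  using bij_betwE[OF d] by auto

lemma fib_hom: "fib \<in> ring_hom (Coord S) (DU n)"
proof -
  interpret j: ring_hom_cring "Coord S" K j by (rule model_ring_hom_cring[OF m])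
  have DA: "fst (d i) \<in> carrier A" if "i < n" for i using famD[OF model_fam[OF m] dF[OF that]] .
  have R: "j b \<in> R (d i)" if "b \<in> carrier (Coord S)" "i < n" for b i
    by (rule model_memR[OF m that(1) dF[OF that(2)]])
  show ?thesis
  proof (rule ring_hom_memI)
    fix a b assume ab: "a \<in> carrier (Coord S)" "b \<in> carrier (Coord S)"
    show "fib a \<in> carrier (DU n)" unfolding DU_simps fib_def
      by (rule restrict_PiE_iff[THEN iffD2]) (use \<rho>_closed DA R ab in auto)
    show "fib (a \<otimes>\<^bsub>Coord S\<^esub> b) = fib a \<otimes>\<^bsub>DU n\<^esub> fib b" unfolding DU_simps fib_def
      by (rule restrict_ext) (use \<rho>_mult DA R ab in simp)
    show "fib (a \<oplus>\<^bsub>Coord S\<^esub> b) = fib a \<oplus>\<^bsub>DU n\<^esub> fib b" unfolding DU_simps fib_def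
      by (rule restrict_ext) (use \<rho>_add DA R ab in simp)
  next
    show "fib \<one>\<^bsub>Coord S\<^esub> = \<one>\<^bsub>DU n\<^esub>" unfolding DU_simps fib_def
      by (rule restrict_ext) (use \<rho>_one DA in simp)
  qed
qed

lemma fib_zero: "fib \<zero>\<^bsub>Coord S\<^esub> = \<zero>\<^bsub>DU n\<^esub>"
proof -
  interpret j: ring_hom_cring "Coord S" K j by (rule model_ring_hom_cring[OF m])
  show ?thesis unfolding DU_simps fib_def
    by (rule restrict_ext) (use \<rho>_zero famD[OF model_fam[OF m] dF] in simp)
qed

text \<open>This is \<open>density\<close>, transported along the numbering \<open>d\<close> of the
  discs.\<close>

lemma fib_surj: "fib ` carrier (Coord S) = carrier (DU n)"
proof
  show "fib ` carrier (Coord S) \<subseteq> carrier (DU n)" using ring_hom_closed[OF fib_hom] by blast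
  show "carrier (DU n) \<subseteq> fib ` carrier (Coord S)"
  proof
    fix u assume u: "u \<in> carrier (DU n)"
    define v where "v D = u (inv_into {..<n} d D)" for D
    have inv: "inv_into {..<n} d (d i) = i" if "i < n" for i
      using that d by (intro inv_into_f_f) (auto simp: bij_betw_def)
    have "v D \<in> carrier P" if D: "D \<in> F" for D
    proof -
      obtain i where "i < n" "D = d i" using D d unfolding bij_betw_def by auto
      then show ?thesis unfolding v_def using inv u unfolding DU_simps by auto
    qed
    then obtain y where y: "y \<in> B F" "\<And>D. D \<in> F \<Longrightarrow> \<rho> D y = v D"
      using denseD[OF density[OF model_fam[OF m]], of v] by blast
    obtain b where b: "b \<in> carrier (Coord S)" "j b = y" using model_preimage[OF m y(1)] by blast
    have "fib b = u"
    proof (rule extensionalityI[of _ "{..<n}"])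
      show "fib b \<in> extensional {..<n}" unfolding fib_def by simp
      show "u \<in> extensional {..<n}" using u unfolding DU_simps PiE_def by blast
      fix i assume "i \<in> {..<n}"
      then show "fib b i = u i" using b y(2)[OF dF, of i] inv[of i] unfolding fib_def v_def by simp
    qed
    then show "u \<in> fib ` carrier (Coord S)" using b(1) by blast
  qed
qed

text \<open>The ring axioms are inherited from the coordinate ring through the surjection
  \<open>fib\<close>, instead of being checked componentwise.\<close>

lemma DU_ring: "ring (DU n)"
proof -
  have "ring ((DU n)\<lparr>carrier := fib ` carrier (Coord S), zero := fib \<zero>\<^bsub>Coord S\<^esub>\<rparr>)"
    by (rule ring.ring_hom_imp_img_ring[OF _ fib_hom]) (use model_cring[OF m] in \<open>simp add: cring_def\<close>)
  also have "(DU n)\<lparr>carrier := fib ` carrier (Coord S), zero := fib \<zero>\<^bsub>Coord S\<^esub>\<rparr> = (DU n)"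
    unfolding fib_surj fib_zero by simp
  finally show ?thesis .
qed

lemma fib_kernel: "a_kernel (Coord S) (DU n) fib = xB"
proof -
  have "fib b = \<zero>\<^bsub>DU n\<^esub> \<longleftrightarrow> (\<forall>D\<in>F. \<rho> D (j b) = \<zero>\<^bsub>P\<^esub>)" for b
  proof -
    have "fib b = \<zero>\<^bsub>DU n\<^esub> \<longleftrightarrow> (\<forall>i<n. \<rho> (d i) (j b) = \<zero>\<^bsub>P\<^esub>)"
    proof
      assume eq: "fib b = \<zero>\<^bsub>DU n\<^esub>"
      show "\<forall>i<n. \<rho> (d i) (j b) = \<zero>\<^bsub>P\<^esub>"
      proof (intro allI impI)
        fix i assume "i < n"
        then show "\<rho> (d i) (j b) = \<zero>\<^bsub>P\<^esub>"
          using fun_cong[OF eq[unfolded DU_simps fib_def], of i] by simp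
      qed
    next
      assume "\<forall>i<n. \<rho> (d i) (j b) = \<zero>\<^bsub>P\<^esub>"
      then show "fib b = \<zero>\<^bsub>DU n\<^esub>" unfolding DU_simps fib_def by (intro restrict_ext) simp
    qed
    also have "\<dots> \<longleftrightarrow> (\<forall>D\<in>F. \<rho> D (j b) = \<zero>\<^bsub>P\<^esub>)"
      using d unfolding bij_betw_def by auto
    finally show ?thesis .
  qed
  moreover have "xB \<subseteq> carrier (Coord S)"
    using ideal.Icarr[OF ideal_xB] by blast
  ultimately show ?thesis
    unfolding a_kernel_def' using mem_PIdl_strx_iff[OF m] by auto
qed

definition fib_iso where "fib_iso = (\<lambda>X. the_elem (fib ` X))"

lemma fib_iso: "fib_iso \<in> ring_iso (Coord S Quot xB) (DU n)"
proof -
  interpret fib: ring_hom_ring "Coord S" "DU n" fib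
    by (rule ring_hom_ringI2[OF _ DU_ring fib_hom]) (use model_cring[OF m] in \<open>simp add: cring_def\<close>)
  show ?thesis using fib.FactRing_iso_set[OF fib_surj] unfolding fib_kernel fib_iso_def .
qed

lemma fib_iso_coset: "b \<in> carrier (Coord S) \<Longrightarrow> fib_iso (xB +>\<^bsub>Coord S\<^esub> b) = fib b"
proof -
  assume b: "b \<in> carrier (Coord S)"
  interpret fib: ring_hom_ring "Coord S" "DU n" fib
    by (rule ring_hom_ringI2[OF _ DU_ring fib_hom]) (use model_cring[OF m] in \<open>simp add: cring_def\<close>)
  show ?thesis unfolding fib_iso_def using fib.the_elem_simp[OF b] unfolding fib_kernel .
qed

lemma special_fiber_iso:
  "isomorphic_over k (special_fiber x S) (disjoint_union n (\<lambda>_. affine_line k))"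
proof -
  let ?g = "inv_into (carrier (Coord S Quot xB)) fib_iso"
  have g: "?g \<in> ring_iso (DU n) (Coord S Quot xB)"
    by (rule ring_iso_set_sym[OF ideal.quotient_is_ring[OF ideal_xB] fib_iso])
  have "?g (str (disjoint_union n (\<lambda>_. affine_line k)) a) = str (special_fiber x S) a" if ak: "a \<in> carrier k" for a
  proof -
    obtain r where r: "r \<in> carrier A" "a = (PIdl\<^bsub>A\<^esub> x) +>\<^bsub>A\<^esub> r" using ak unfolding k_carrier by auto
    note sr = model_str_closed[OF m r(1)]
    have "\<rho> (d i) (j (str S r)) = monom P a 0" if "i < n" for i
      using \<rho>_c[OF famD[OF model_fam[OF m] dF[OF that]] r(1)] unfolding model_str[OF m r(1)] r(2) \<kappa>_def .
    then have "fib (str S r) = str (disjoint_union n (\<lambda>_. affine_line k)) a"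
      unfolding fib_def disjoint_union_def affine_line_def by (simp cong: restrict_cong)
    then have eq: "str (disjoint_union n (\<lambda>_. affine_line k)) a = fib_iso (xB +>\<^bsub>Coord S\<^esub> str S r)"
      using fib_iso_coset[OF sr] by simp
    have "xB +>\<^bsub>Coord S\<^esub> str S r \<in> carrier (Coord S Quot xB)"
      using sr unfolding FactRing_def A_RCOSETS_def' by auto
    moreover have "inj_on fib_iso (carrier (Coord S Quot xB))"
      using fib_iso unfolding ring_iso_def bij_betw_def by blast
    ultimately show ?thesis unfolding eq special_fiber_str[OF model_affine[OF m] r(1), folded r(2)] by (rule inv_into_f_f[rotated])
  qed
  moreover have "Coord (special_fiber x S) = Coord S Quot xB" unfolding special_fiber_def by simp
  ultimately show ?thesis
    using g ring_iso_memE(1)[OF g]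
    unfolding isomorphic_over_def isomorphism_over_def morphism_over_def DU_def[symmetric]
    by (intro exI[of _ ?g]) (auto simp: ring_iso_def)
qed

end

text \<open>The functions vanishing on one component form a prime of the coordinate ring that
  contains \<open>xB\<close>; its image is a prime of the quotient.\<close>

lemma special_fiber_nonempty: "nonempty_scheme (special_fiber x S)"
proof -
  obtain D where D: "D \<in> F" using model_fam[OF m] unfolding fam_def by blast
  note DA = famD[OF model_fam[OF m] D]
  interpret B: cring "Coord S" by (rule model_cring[OF m])
  interpret j: ring_hom_cring "Coord S" K j by (rule model_ring_hom_cring[OF m])
  have hom: "(\<lambda>b. \<rho> D (j b)) \<in> ring_hom (Coord S) P"
    by (rule ring_hom_memI) (simp_all add: \<rho>_closed[OF DA] \<rho>_mult[OF DA] \<rho>_add[OF DA] \<rho>_one[OF DA] model_memR[OF m _ D])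
  let ?Q = "comap (Coord S) (\<lambda>b. \<rho> D (j b)) {\<zero>\<^bsub>P\<^esub>}"
  have Q: "primeideal ?Q (Coord S)"
    by (rule comap_primeideal[OF B.is_cring P.P.is_cring hom domain.zero_primeideal[OF P.UP_domain]])
  have sub: "xB \<subseteq> ?Q"
    using mem_PIdl_strx_iff[OF m] ideal.Icarr[OF ideal_xB] D unfolding comap_def by blast
  interpret J: ideal xB "Coord S" by (rule ideal_xB)
  interpret Q: primeideal ?Q "Coord S" by (rule Q)
  let ?R = "Coord S Quot xB"
  interpret q: ring_hom_cring "Coord S" ?R "(+>\<^bsub>Coord S\<^esub>) xB"
    by (rule UnivPoly.ring_hom_cringI[OF B.is_cring J.quotient_is_cring[OF B.is_cring] J.rcos_ring_hom])
  let ?q = "(+>\<^bsub>Coord S\<^esub>) xB"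
  have onto: "carrier ?R = ?q ` carrier (Coord S)" unfolding FactRing_def A_RCOSETS_def' by auto
  let ?I = "?q ` ?Q"
  have mem: "?q b \<in> ?I \<longleftrightarrow> b \<in> ?Q" if b: "b \<in> carrier (Coord S)" for b
  proof
    assume "?q b \<in> ?I"
    then obtain b' where b': "b' \<in> ?Q" "?q b = ?q b'" by blast
    have b'B: "b' \<in> carrier (Coord S)" using b'(1) unfolding comap_def by blast
    have "b \<in> ?q b'" using J.a_rcos_self[OF b] b'(2) by simp
    then obtain y where "y \<in> xB" "b = y \<oplus>\<^bsub>Coord S\<^esub> b'" unfolding a_r_coset_def' by blast
    then show "b \<in> ?Q" using sub b'(1) Q.a_closed by blast
  qed blast
  have QB: "?Q \<subseteq> carrier (Coord S)" unfolding comap_def by blast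
  have "ideal ?I ?R"
  proof (rule idealI)
    show "ring ?R" by (rule J.quotient_is_ring)
    show "subgroup ?I (add_monoid ?R)"
      using q.ring.img_is_add_subgroup[OF Q.a_subgroup] by simp
    fix u v assume "u \<in> ?I" and v: "v \<in> carrier ?R"
    then obtain a where a: "a \<in> ?Q" "u = ?q a" by blast
    obtain b where b: "b \<in> carrier (Coord S)" "v = ?q b" using v onto by auto
    have "a \<in> carrier (Coord S)" using a QB by blast
    then have "v \<otimes>\<^bsub>?R\<^esub> u = ?q (b \<otimes>\<^bsub>Coord S\<^esub> a)" "u \<otimes>\<^bsub>?R\<^esub> v = ?q (a \<otimes>\<^bsub>Coord S\<^esub> b)" using a b by simp_all
    then show "v \<otimes>\<^bsub>?R\<^esub> u \<in> ?I" "u \<otimes>\<^bsub>?R\<^esub> v \<in> ?I"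
      using Q.I_l_closed[OF a(1) b(1)] Q.I_r_closed[OF a(1) b(1)] by blast+
  qed
  then have "primeideal ?I ?R"
  proof (rule primeidealI)
    show "cring ?R" by (rule J.quotient_is_cring[OF B.is_cring])
    have "\<one>\<^bsub>Coord S\<^esub> \<notin> ?Q" using Q.one_imp_carrier Q.I_notcarr by blast
    then have "?q \<one>\<^bsub>Coord S\<^esub> \<notin> ?I" using mem[OF B.one_closed] by blast
    moreover have "?q \<one>\<^bsub>Coord S\<^esub> \<in> carrier ?R" by (rule q.hom_closed[OF B.one_closed])
    ultimately show "carrier ?R \<noteq> ?I" by blast
    fix u v assume uv: "u \<in> carrier ?R" "v \<in> carrier ?R" "u \<otimes>\<^bsub>?R\<^esub> v \<in> ?I"
    obtain a where a: "a \<in> carrier (Coord S)" "u = ?q a" using uv(1) onto by auto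
    obtain b where b: "b \<in> carrier (Coord S)" "v = ?q b" using uv(2) onto by auto
    have "?q (a \<otimes>\<^bsub>Coord S\<^esub> b) = u \<otimes>\<^bsub>?R\<^esub> v" unfolding a(2) b(2) by (rule q.hom_mult[OF a(1) b(1)])
    then have "?q (a \<otimes>\<^bsub>Coord S\<^esub> b) \<in> ?I" using uv(3) by simp
    then have "a \<otimes>\<^bsub>Coord S\<^esub> b \<in> ?Q" using mem[OF B.m_closed[OF a(1) b(1)]] by blast
    then show "u \<in> ?I \<or> v \<in> ?I" using Q.I_prime[OF a(1) b(1)] a b by blast
  qed
  then show ?thesis unfolding nonempty_scheme_def special_fiber_def prime_spec_def by auto
qed

text \<open>If a power of an element lies in \<open>xB\<close>, it vanishes on every component; the
  reductions take values in the domain \<open>P\<close>, so the element vanishes there too and lies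
  in \<open>xB\<close>.\<close>

lemma special_fiber_reduced: "reduced_scheme (special_fiber x S)"
proof -
  interpret B: cring "Coord S" by (rule model_cring[OF m])
  interpret j: ring_hom_cring "Coord S" K j by (rule model_ring_hom_cring[OF m])
  interpret J: ideal xB "Coord S" by (rule ideal_xB)
  let ?R = "Coord S Quot xB" and ?q = "(+>\<^bsub>Coord S\<^esub>) xB"
  interpret q: ring_hom_cring "Coord S" ?R ?q
    by (rule UnivPoly.ring_hom_cringI[OF B.is_cring J.quotient_is_cring[OF B.is_cring] J.rcos_ring_hom])
  have onto: "carrier ?R = ?q ` carrier (Coord S)" unfolding FactRing_def A_RCOSETS_def' by auto
  have zero: "?q b = \<zero>\<^bsub>?R\<^esub> \<longleftrightarrow> b \<in> xB" if "b \<in> carrier (Coord S)" for b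
    unfolding FactRing_def using J.rcos_const_imp_mem[OF that] B.a_coset_join2[OF that J.a_subgroup] by auto
  have "u = \<zero>\<^bsub>?R\<^esub>" if u: "u \<in> carrier ?R" "u [^]\<^bsub>?R\<^esub> (i::nat) = \<zero>\<^bsub>?R\<^esub>" for u i
  proof -
    obtain b where b: "b \<in> carrier (Coord S)" "u = ?q b" using u(1) onto by auto
    have "b [^]\<^bsub>Coord S\<^esub> i \<in> xB" using u(2) b zero[of "b [^]\<^bsub>Coord S\<^esub> i"] by simp
    then have "\<rho> D (j b [^]\<^bsub>K\<^esub> i) = \<zero>\<^bsub>P\<^esub>" if "D \<in> F" for D
      using mem_PIdl_strx_iff[OF m, of "b [^]\<^bsub>Coord S\<^esub> i"] b(1) that by simp
    then have "\<rho> D (j b) [^]\<^bsub>P\<^esub> i = \<zero>\<^bsub>P\<^esub>" if "D \<in> F" for D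
      using \<rho>_pow[OF famD[OF model_fam[OF m] that] model_memR[OF m b(1) that], of i] that by simp
    moreover have "p = \<zero>\<^bsub>P\<^esub>" if "p \<in> carrier P" "p [^]\<^bsub>P\<^esub> i = \<zero>\<^bsub>P\<^esub>" for p
      using that(2)
    proof (induct i)
      case 0
      then show ?case using P.UP_one_not_zero by simp
    next
      case (Suc i)
      then show ?case using P.UP_integral[of "p [^]\<^bsub>P\<^esub> i" p] that(1) by auto
    qed
    ultimately have "\<rho> D (j b) = \<zero>\<^bsub>P\<^esub>" if "D \<in> F" for D
      using \<rho>_closed[OF famD[OF model_fam[OF m] that] model_memR[OF m b(1) that]] that by blast
    then show ?thesis using mem_PIdl_strx_iff[OF m b(1)] zero[OF b(1)] b(2) by blast
  qed
  then show ?thesis unfolding reduced_scheme_def special_fiber_def by simp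
qed

theorem model_DFS: "DFS A x S"
proof -
  have "finite F" by (rule fam_finite[OF model_fam[OF m]])
  then obtain d where "bij_betw d {..<card F} F"
    using ex_bij_betw_nat_finite[of F] by (auto simp: atLeast0LessThan)
  then show ?thesis
    unfolding DFS_def integral_scheme_def
    using model_affine[OF m] model_domain[OF m] model_finite_type[OF m] model_restriction[OF m]
      special_fiber_nonempty special_fiber_reduced special_fiber_iso[of d "card F"] by blast
qed

end

text \<open>Both rings become \<open>K\<close> after inverting \<open>x\<close>, so \<open>x\<close>
  alone satisfies the denominator condition. Applied to the zero ideal, this is what gives
  birationality.\<close>

lemma model_localizing_x:
  assumes m': "model S' F' j'" and m: "model S F j"
    and f: "f \<in> ring_hom (Coord S) (Coord S')" "\<And>b. b \<in> carrier (Coord S) \<Longrightarrow> j' (f b) = j b"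
  shows "localizing_hom (Coord S) (Coord S') f {str S x}" and "f (str S x) = str S' x"
    and "inj_on f (carrier (Coord S))"
proof -
  interpret j: ring_hom_cring "Coord S" K j by (rule model_ring_hom_cring[OF m])
  interpret j': ring_hom_cring "Coord S'" K j' by (rule model_ring_hom_cring[OF m'])
  have fc: "f b \<in> carrier (Coord S')" if "b \<in> carrier (Coord S)" for b by (rule ring_hom_closed[OF f(1) that])
  note xS = model_str_closed[OF m x_closed] and xS' = model_str_closed[OF m' x_closed]
  show fx: "f (str S x) = str S' x"
    by (rule model_eqI[OF m' fc[OF xS] xS']) (simp add: f(2)[OF xS] model_str[OF m] model_str[OF m'])
  show inj: "inj_on f (carrier (Coord S))"
    by (rule inj_onI) (metis f(2) model_eqI[OF m])
  show "localizing_hom (Coord S) (Coord S') f {str S x}"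
  proof (intro localizing_hom.intro localizing_hom_axioms.intro model_domain[OF m] model_domain[OF m'] f(1) inj)
    show "{str S x} \<subseteq> carrier (Coord S)" using xS by simp
    fix u d assume u: "u \<in> {str S x}" and d: "d \<in> carrier (Coord S')"
    obtain n :: nat and b where b: "b \<in> carrier (Coord S)" "c x [^]\<^bsub>K\<^esub> n \<otimes>\<^bsub>K\<^esub> j' d = j b"
      using model_denom[OF m model_closedK[OF m' d]] by blast
    have "j' (str S' x [^]\<^bsub>Coord S'\<^esub> n \<otimes>\<^bsub>Coord S'\<^esub> d) = j' (f b)"
      using xS' d b f(2)[OF b(1)] model_str[OF m' x_closed] by simp
    then have "str S' x [^]\<^bsub>Coord S'\<^esub> n \<otimes>\<^bsub>Coord S'\<^esub> d = f b"
      by (rule model_eqI[OF m', rotated 2]) (use xS' d fc[OF b(1)] in auto)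
    then show "\<exists>n::nat. \<exists>b\<in>carrier (Coord S). f u [^]\<^bsub>Coord S'\<^esub> n \<otimes>\<^bsub>Coord S'\<^esub> d = f b"
      using u fx b(1) by auto
  qed
qed

text \<open>Compatibility with the embeddings into \<open>K\<close> is all that has to be checked:
  it makes the comorphism injective, forces it to respect the structure maps, and makes it an
  isomorphism once \<open>x\<close> is inverted.\<close>

theorem models_morphism:
  assumes m': "model S' F' j'" and m: "model S F j"
    and f: "f \<in> ring_hom (Coord S) (Coord S')" "\<And>b. b \<in> carrier (Coord S) \<Longrightarrow> j' (f b) = j b"
  shows "DFS_morphism A x S' S f"
proof -
  interpret l: localizing_hom "Coord S" "Coord S'" f "{str S x}" by (rule model_localizing_x[OF assms])
  note fx = model_localizing_x(2)[OF assms] and f_inj = model_localizing_x(3)[OF assms]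
  interpret j: ring_hom_cring "Coord S" K j by (rule model_ring_hom_cring[OF m])
  interpret j': ring_hom_cring "Coord S'" K j' by (rule model_ring_hom_cring[OF m'])
  have str: "f (str S a) = str S' a" if a: "a \<in> carrier A" for a
    by (rule model_eqI[OF m'])
      (simp_all add: a f(2) model_str_closed[OF m] model_str_closed[OF m'] model_str[OF m] model_str[OF m'])
  note xS = model_str_closed[OF m x_closed] and xS' = model_str_closed[OF m' x_closed]
  have zero: "comap (Coord S) f {\<zero>\<^bsub>Coord S'\<^esub>} = {\<zero>\<^bsub>Coord S\<^esub>}"
    unfolding comap_def using inj_onD[OF f_inj, of _ "\<zero>\<^bsub>Coord S\<^esub>"] by auto
  have "stalk_iso (Coord S) (Coord S') f {\<zero>\<^bsub>Coord S'\<^esub>}"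
    by (rule l.stalk_isoI[OF domain.zero_primeideal[OF model_domain[OF m']], of "str S x"])
      (use fx model_strx_nz[OF m'] in auto)
  then have bir: "birational S' S f" unfolding birational_def using zero by simp
  let ?M = "powers (Coord S) (str S x)" and ?M' = "powers (Coord S') (str S' x)"
  let ?lf = "loc_map (Coord S') ?M' f"
  have fM: "f ` ?M \<subseteq> ?M'" unfolding powers_def using xS by (auto simp: fx)
  have iso: "?lf \<in> ring_iso (loc_at (Coord S) (str S x)) (loc_at (Coord S') (str S' x))"
  proof (rule loc_map_iso[OF model_frac[OF m] model_frac[OF m'] f(1) fM f_inj])
    fix d s assume d: "d \<in> carrier (Coord S')" and s: "s \<in> ?M'"
    obtain k :: nat where k: "s = str S' x [^]\<^bsub>Coord S'\<^esub> k" using s unfolding powers_def by blast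
    obtain n :: nat and b where b: "b \<in> carrier (Coord S)" "f (str S x) [^]\<^bsub>Coord S'\<^esub> n \<otimes>\<^bsub>Coord S'\<^esub> d = f b"
      using l.denom[of "str S x", OF _ d] by auto
    have "d \<otimes>\<^bsub>Coord S'\<^esub> f (str S x [^]\<^bsub>Coord S\<^esub> (n + k)) = (str S' x [^]\<^bsub>Coord S'\<^esub> n \<otimes>\<^bsub>Coord S'\<^esub> d) \<otimes>\<^bsub>Coord S'\<^esub> s"
      unfolding k using xS xS' d by (simp add: fx l.C.m_ac flip: l.C.nat_pow_mult)
    also have "\<dots> = f b \<otimes>\<^bsub>Coord S'\<^esub> s" using b(2) fx by simp
    finally show "\<exists>b\<in>carrier (Coord S). \<exists>t\<in>?M. d \<otimes>\<^bsub>Coord S'\<^esub> f t = f b \<otimes>\<^bsub>Coord S'\<^esub> s"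
      using b(1) model_pow_mem[OF m] by blast
  qed
  have lstr: "?lf (str (restriction x S) a) = str (restriction x S') a" if a: "a \<in> carrier Ax" for a
  proof -
    obtain r s where rs: "r \<in> carrier A" "s \<in> powers A x" "a = fr r s" using a by (rule loc.frac_cases)
    have sM: "str S s \<in> ?M"
    proof -
      interpret s: ring_hom_cring A "Coord S" "str S"
        by (rule UnivPoly.ring_hom_cringI[OF A.is_cring model_cring[OF m] model_str_hom[OF m]])
      show ?thesis using rs(2) unfolding powers_def by auto
    qed
    have "?lf (loc_frac (Coord S) ?M (str S r) (str S s)) = loc_frac (Coord S') ?M' (f (str S r)) (f (str S s))"
      by (rule loc_map_frac[OF model_frac[OF m] model_frac[OF m'] f(1) fM model_str_closed[OF m rs(1)] sM])
    then show ?thesis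
      using str_loc_map[OF m rs(1,2)] str_loc_map[OF m' rs(1,2)] str rs loc.M_closed[OF rs(2)]
      by (simp add: restriction_def)
  qed
  have "isomorphism_over Ax (restriction x S') (restriction x S) ?lf"
    unfolding isomorphism_over_def morphism_over_def
    using iso lstr by (auto simp: ring_iso_def restriction_def)
  then show ?thesis
    unfolding DFS_morphism_def morphism_over_def
    using model_DFS[OF m] model_DFS[OF m'] f(1) str bir by blast
qed

text \<open>The projections of the fiber, as a disjoint union of lines, to its components provide
  the maps \<open>h i\<close> required by \<open>disc_covered\<close>; \<open>classification\<close>
  then finds the discs.\<close>

lemma DFS_is_model:
  assumes S: "DFS A x S" and j: "j \<in> ring_hom (Coord S) K" "inj_on j (carrier (Coord S))"
    "\<And>a. a \<in> carrier A \<Longrightarrow> j (str S a) = c a"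
    and den: "\<And>y. y \<in> carrier K \<Longrightarrow> \<exists>n::nat. c x [^]\<^bsub>K\<^esub> n \<otimes>\<^bsub>K\<^esub> y \<in> j ` carrier (Coord S)"
    and T: "T \<in> j ` carrier (Coord S)"
  shows "\<exists>F. model S F j"
proof -
  have aff: "affine_over A S" using S unfolding DFS_def by blast
  interpret B: cring "Coord S" using aff by (simp add: affine_over_def)
  interpret j: ring_hom_cring "Coord S" K j by (rule UnivPoly.ring_hom_cringI[OF B.is_cring K.P.is_cring j(1)])
  have strB: "str S a \<in> carrier (Coord S)" if "a \<in> carrier A" for a
    using aff that ring_hom_closed unfolding affine_over_def by metis
  let ?xB = "PIdl\<^bsub>Coord S\<^esub> (str S x)"
  let ?Q = "Coord S Quot ?xB" and ?q = "(+>\<^bsub>Coord S\<^esub>) ?xB"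
  interpret J: ideal ?xB "Coord S" by (rule B.cgenideal_ideal) (simp add: strB)
  interpret q: ring_hom_cring "Coord S" ?Q ?q
    by (rule UnivPoly.ring_hom_cringI[OF B.is_cring J.quotient_is_cring[OF B.is_cring] J.rcos_ring_hom])
  have onto: "carrier ?Q = ?q ` carrier (Coord S)" unfolding FactRing_def A_RCOSETS_def' by auto
  have zero: "?q b = \<zero>\<^bsub>?Q\<^esub> \<longleftrightarrow> b \<in> ?xB" if "b \<in> carrier (Coord S)" for b
    unfolding FactRing_def using J.rcos_const_imp_mem[OF that] B.a_coset_join2[OF that J.a_subgroup] by auto
  obtain n \<phi> where phi: "isomorphism_over k (special_fiber x S) (disjoint_union n (\<lambda>_. affine_line k)) \<phi>"
    using S unfolding DFS_def isomorphic_over_def by blast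
  have Q: "Coord (special_fiber x S) = ?Q" unfolding special_fiber_def by simp
  have iso: "\<phi> \<in> ring_iso (DU n) ?Q" and phi_str: "\<And>a. a \<in> carrier k \<Longrightarrow>
      \<phi> (str (disjoint_union n (\<lambda>_. affine_line k)) a) = str (special_fiber x S) a"
    using phi unfolding isomorphism_over_def morphism_over_def Q DU_def by blast+
  have inj: "inj_on \<phi> (carrier (DU n))" and img: "\<phi> ` carrier (DU n) = carrier ?Q"
    and hom: "\<phi> \<in> ring_hom (DU n) ?Q" using iso unfolding ring_iso_def bij_betw_def by blast+
  note simps = DU_simps
  \<comment> \<open>As a comorphism, \<open>\<phi>\<close> goes from the product ring to the
    quotient; restriction to the lines is given by the components of its inverse
    \<open>g\<close>.\<close>
  define g where "g X = inv_into (carrier (DU n)) \<phi> X" for X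
  have g: "g X \<in> carrier (DU n)" "\<phi> (g X) = X" if "X \<in> carrier ?Q" for X
    using that unfolding g_def img[symmetric] by (rule inv_into_into, rule f_inv_into_f)
  have g_eq: "g (\<phi> u) = u" if "u \<in> carrier (DU n)" for u
    unfolding g_def by (rule inv_into_f_f[OF inj that])
  have DU_closed: "u \<otimes>\<^bsub>DU n\<^esub> v \<in> carrier (DU n)" "u \<oplus>\<^bsub>DU n\<^esub> v \<in> carrier (DU n)"
    if "u \<in> carrier (DU n)" "v \<in> carrier (DU n)" for u v
    using that unfolding simps by (auto simp: PiE_iff)
  have g_mult: "g (X \<otimes>\<^bsub>?Q\<^esub> Y) = g X \<otimes>\<^bsub>DU n\<^esub> g Y" and g_add: "g (X \<oplus>\<^bsub>?Q\<^esub> Y) = g X \<oplus>\<^bsub>DU n\<^esub> g Y"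
    if X: "X \<in> carrier ?Q" and Y: "Y \<in> carrier ?Q" for X Y
    using g_eq[OF DU_closed(1)[OF g(1)[OF X] g(1)[OF Y]]] g_eq[OF DU_closed(2)[OF g(1)[OF X] g(1)[OF Y]]]
      ring_hom_mult[OF hom g(1)[OF X] g(1)[OF Y]] ring_hom_add[OF hom g(1)[OF X] g(1)[OF Y]] g(2)[OF X] g(2)[OF Y]
    by simp_all
  have one_DU: "\<one>\<^bsub>DU n\<^esub> \<in> carrier (DU n)" unfolding simps by auto
  have g_one: "g \<one>\<^bsub>?Q\<^esub> = \<one>\<^bsub>DU n\<^esub>" using g_eq[OF one_DU] ring_hom_one[OF hom] by simp
  define hb where "hb i b = g (?q b) i" for i b
  have hb_hom: "hb i \<in> ring_hom (Coord S) P" if i: "i < n" for i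
  proof (rule ring_hom_memI)
    fix a b assume ab: "a \<in> carrier (Coord S)" "b \<in> carrier (Coord S)"
    note qa = q.hom_closed[OF ab(1)] and qb = q.hom_closed[OF ab(2)]
    show "hb i a \<in> carrier P" using g(1)[OF qa] i unfolding hb_def simps by auto
    show "hb i (a \<otimes>\<^bsub>Coord S\<^esub> b) = hb i a \<otimes>\<^bsub>P\<^esub> hb i b"
      unfolding hb_def q.hom_mult[OF ab] g_mult[OF qa qb] simps using i by simp
    show "hb i (a \<oplus>\<^bsub>Coord S\<^esub> b) = hb i a \<oplus>\<^bsub>P\<^esub> hb i b"
      unfolding hb_def q.hom_add[OF ab] g_add[OF qa qb] simps using i by simp
  next
    show "hb i \<one>\<^bsub>Coord S\<^esub> = \<one>\<^bsub>P\<^esub>" unfolding hb_def q.hom_one g_one simps using i by simp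
  qed
  have hb_str: "hb i (str S a) = \<kappa> a" if i: "i < n" and a: "a \<in> carrier A" for i a
  proof -
    have ak: "(PIdl\<^bsub>A\<^esub> x) +>\<^bsub>A\<^esub> a \<in> carrier k" using a unfolding k_carrier by blast
    let ?u = "str (disjoint_union n (\<lambda>_. affine_line k)) ((PIdl\<^bsub>A\<^esub> x) +>\<^bsub>A\<^esub> a)"
    have u: "?u = (\<lambda>i\<in>{..<n}. \<kappa> a)" unfolding disjoint_union_def affine_line_def \<kappa>_def by simp
    have "?u \<in> carrier (DU n)" unfolding u simps using a by auto
    moreover have "\<phi> ?u = ?q (str S a)" using phi_str[OF ak] special_fiber_str[OF aff a] by simp
    ultimately have "g (?q (str S a)) = ?u" using g_eq by metis
    then show ?thesis unfolding hb_def u using i by simp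
  qed
  have hb_surj: "\<exists>b\<in>carrier (Coord S). \<forall>i<n. hb i b = v i" if v: "\<And>i. i < n \<Longrightarrow> v i \<in> carrier P" for v
  proof -
    let ?u = "\<lambda>i\<in>{..<n}. v i"
    have u: "?u \<in> carrier (DU n)" unfolding simps using v by auto
    then have "\<phi> ?u \<in> ?q ` carrier (Coord S)" using img onto by blast
    then obtain b where b: "b \<in> carrier (Coord S)" "\<phi> ?u = ?q b" by blast
    have "g (?q b) = ?u" using g_eq[OF u] b(2) by simp
    then have "\<forall>i<n. hb i b = v i" unfolding hb_def by simp
    then show ?thesis using b(1) by blast
  qed
  have hb_ker: "\<exists>d\<in>carrier (Coord S). b = str S x \<otimes>\<^bsub>Coord S\<^esub> d"
    if b: "b \<in> carrier (Coord S)" "\<And>i. i < n \<Longrightarrow> hb i b = \<zero>\<^bsub>P\<^esub>" for b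
  proof -
    have gz: "g (?q d) = (\<lambda>i\<in>{..<n}. hb i d)" if "d \<in> carrier (Coord S)" for d
      using g(1)[OF q.hom_closed[OF that]] unfolding hb_def simps by (auto simp: PiE_iff extensional_restrict)
    have z: "hb i \<zero>\<^bsub>Coord S\<^esub> = \<zero>\<^bsub>P\<^esub>" if i: "i < n" for i
    proof -
      interpret hb: ring_hom_cring "Coord S" P "hb i"
        by (rule UnivPoly.ring_hom_cringI[OF B.is_cring P.P.is_cring hb_hom[OF i]])
      show ?thesis by (rule hb.hom_zero)
    qed
    have "g (?q b) = g (?q \<zero>\<^bsub>Coord S\<^esub>)" unfolding gz[OF b(1)] gz[OF B.zero_closed]
      by (rule restrict_ext) (simp add: b(2) z)
    then have "?q b = ?q \<zero>\<^bsub>Coord S\<^esub>" using g(2)[OF q.hom_closed[OF b(1)]] g(2)[OF q.hom_closed[OF B.zero_closed]] by simp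
    then have "b \<in> ?xB" using zero[OF b(1)] q.hom_zero by simp
    then show ?thesis unfolding cgenideal_def using B.m_comm strB[OF x_closed] by auto
  qed
  \<comment> \<open>Without any line the quotient would be the zero ring, which has no prime,
    against the nonemptiness of the fiber.\<close>
  have n: "n > 0"
  proof (rule ccontr)
    assume "\<not> n > 0"
    then have "carrier (DU n) = {\<lambda>i. undefined}" unfolding simps by simp
    then have "carrier ?Q = {\<phi> (\<lambda>i. undefined)}" using img by (metis image_insert image_empty)
    then have triv: "carrier ?Q = {\<zero>\<^bsub>?Q\<^esub>}" using q.S.zero_closed by (metis singletonD)
    obtain I where "primeideal I ?Q"
      using S unfolding DFS_def nonempty_scheme_def Q prime_spec_def by blast
    then interpret I: primeideal I ?Q .
    show False using I.I_notcarr triv I.a_subset I.zero_closed by auto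
  qed
  let ?J = "j ` carrier (Coord S)"
  define h where "h i y = hb i (inv_into (carrier (Coord S)) j y)" for i y
  have h: "h i (j b) = hb i b" if "b \<in> carrier (Coord S)" for i b
    unfolding h_def by (simp add: inv_into_f_f[OF j(2) that])
  interpret dc: disc_covered A K P x c T \<kappa> t \<tau> R \<rho> ?J n h
  proof (intro disc_covered.intro disc_covered_axioms.intro disc_system_axioms n den T)
    show "subring ?J K" by (rule j.ring.img_is_subring[OF B.carrier_is_subring])
    show "c ` carrier A \<subseteq> ?J"
    proof
      fix y assume "y \<in> c ` carrier A"
      then obtain a where "a \<in> carrier A" "y = j (str S a)" using j(3) by auto
      then show "y \<in> ?J" using strB by blast
    qed
    fix i assume i: "i < n"
    show "h i \<in> ring_hom (K\<lparr>carrier := ?J\<rparr>) P"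
    proof (rule ring_hom_memI)
      fix y z assume "y \<in> carrier (K\<lparr>carrier := ?J\<rparr>)" "z \<in> carrier (K\<lparr>carrier := ?J\<rparr>)"
      then obtain a b where ab: "a \<in> carrier (Coord S)" "y = j a" "b \<in> carrier (Coord S)" "z = j b" by auto
      have "y \<otimes>\<^bsub>K\<^esub> z = j (a \<otimes>\<^bsub>Coord S\<^esub> b)" "y \<oplus>\<^bsub>K\<^esub> z = j (a \<oplus>\<^bsub>Coord S\<^esub> b)" using ab by simp_all
      then show "h i (y \<otimes>\<^bsub>K\<lparr>carrier := ?J\<rparr>\<^esub> z) = h i y \<otimes>\<^bsub>P\<^esub> h i z"
        "h i (y \<oplus>\<^bsub>K\<lparr>carrier := ?J\<rparr>\<^esub> z) = h i y \<oplus>\<^bsub>P\<^esub> h i z"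
        using ring_hom_mult[OF hb_hom[OF i] ab(1,3)] ring_hom_add[OF hb_hom[OF i] ab(1,3)] ab
        by (simp_all add: h del: j.hom_mult j.hom_add)
    next
      fix y assume "y \<in> carrier (K\<lparr>carrier := ?J\<rparr>)"
      then obtain a where "a \<in> carrier (Coord S)" "y = j a" by auto
      then show "h i y \<in> carrier P" using ring_hom_closed[OF hb_hom[OF i]] by (simp add: h)
    next
      show "h i \<one>\<^bsub>K\<lparr>carrier := ?J\<rparr>\<^esub> = \<one>\<^bsub>P\<^esub>"
        using h[OF B.one_closed] ring_hom_one[OF hb_hom[OF i]] by simp
    qed
    show "h i (c a) = \<kappa> a" if "a \<in> carrier A" for a
      using h[OF strB[OF that]] hb_str[OF i that] j(3)[OF that] by simp
  next
    show "\<exists>b\<in>?J. \<forall>i<n. h i b = v i" if v: "\<And>i. i < n \<Longrightarrow> v i \<in> carrier P" for v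
      using hb_surj[OF v] h by auto
    fix y assume y: "y \<in> ?J" "\<And>i. i < n \<Longrightarrow> h i y = \<zero>\<^bsub>P\<^esub>"
    obtain b where b: "b \<in> carrier (Coord S)" "y = j b" using y(1) by blast
    obtain d where d: "d \<in> carrier (Coord S)" "b = str S x \<otimes>\<^bsub>Coord S\<^esub> d"
      using hb_ker[OF b(1)] y(2) h[OF b(1)] b(2) by metis
    have "y = c x \<otimes>\<^bsub>K\<^esub> j d" unfolding b(2) d(2) using d(1) strB[OF x_closed] j(3)[OF x_closed] by simp
    then show "\<exists>b'\<in>?J. y = c x \<otimes>\<^bsub>K\<^esub> b'" using d(1) by blast
  qed
  obtain F where "fam F" "?J = B F" using dc.classification by blast
  then show ?thesis unfolding model_def using aff j by blast
qed

text \<open>If \<open>x\<close> became zero, all fractions of the restriction would coincide, since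
  \<open>loc_rel\<close> could use the multiplier 0; but the restriction is isomorphic to the
  nonzero ring \<open>K\<close>.\<close>

lemma DFS_strx_nz:
  assumes S: "DFS A x S" shows "str S x \<noteq> \<zero>\<^bsub>Coord S\<^esub>"
proof
  assume z: "str S x = \<zero>\<^bsub>Coord S\<^esub>"
  interpret B: domain "Coord S" using S by (simp add: DFS_def integral_scheme_def)
  let ?M = "powers (Coord S) (str S x)"
  obtain \<theta> where \<theta>: "\<theta> \<in> ring_iso K (loc_at (Coord S) (str S x))"
    using S unfolding DFS_def isomorphic_over_def isomorphism_over_def affine_line_def restriction_def by auto
  have M: "\<zero>\<^bsub>Coord S\<^esub> \<in> ?M" unfolding powers_def using z by (auto intro!: exI[of _ "1::nat"])
  have MB: "?M \<subseteq> carrier (Coord S)" unfolding powers_def z by auto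
  have rel: "loc_rel (Coord S) ?M = (carrier (Coord S) \<times> ?M) \<times> (carrier (Coord S) \<times> ?M)"
  proof -
    have "\<exists>t\<in>?M. t \<otimes>\<^bsub>Coord S\<^esub> (r \<otimes>\<^bsub>Coord S\<^esub> s' \<ominus>\<^bsub>Coord S\<^esub> r' \<otimes>\<^bsub>Coord S\<^esub> s) = \<zero>\<^bsub>Coord S\<^esub>"
      if "r \<in> carrier (Coord S)" "r' \<in> carrier (Coord S)" "s \<in> ?M" "s' \<in> ?M" for r r' s s'
      using that MB M by (intro bexI[of _ "\<zero>\<^bsub>Coord S\<^esub>"]) (auto simp: subset_iff)
    then show ?thesis unfolding loc_rel_def by auto
  qed
  have "p = q" if "p \<in> carrier (loc_at (Coord S) (str S x))" "q \<in> carrier (loc_at (Coord S) (str S x))" for p q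
    using that unfolding loc_ring_def rel by (auto elim!: quotientE)
  then have "\<theta> \<one>\<^bsub>K\<^esub> = \<theta> \<zero>\<^bsub>K\<^esub>"
    using ring_iso_memE(1)[OF \<theta>] by blast
  then have "\<one>\<^bsub>K\<^esub> = \<zero>\<^bsub>K\<^esub>"
    using ring_iso_memE(5)[OF \<theta>] by (auto simp: bij_betw_def dest: inj_onD)
  then show False using K.UP_one_not_zero by simp
qed

text \<open>\<open>j\<close> is the localization map followed by the inverse of the trivialization;
  every element of \<open>K\<close> is a fraction whose denominator is a power of
  \<open>x\<close>.\<close>

lemma DFS_localization:
  assumes S: "DFS A x S"
  obtains j where "j \<in> ring_hom (Coord S) K" "inj_on j (carrier (Coord S))"
    "\<And>a. a \<in> carrier A \<Longrightarrow> j (str S a) = c a"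
    "\<And>y. y \<in> carrier K \<Longrightarrow> \<exists>n::nat. \<exists>b\<in>carrier (Coord S). c x [^]\<^bsub>K\<^esub> n \<otimes>\<^bsub>K\<^esub> y = j b"
proof -
  interpret B: domain "Coord S" using S by (simp add: DFS_def integral_scheme_def)
  have aff: "affine_over A S" using S unfolding DFS_def by blast
  interpret str: ring_hom_cring A "Coord S" "str S"
    by (rule UnivPoly.ring_hom_cringI[OF A.is_cring B.is_cring]) (use aff in \<open>simp add: affine_over_def\<close>)
  let ?M = "powers (Coord S) (str S x)" and ?L = "loc_at (Coord S) (str S x)"
  interpret l: frac "Coord S" ?M
    by (rule B.frac_powers[OF str.hom_closed[OF x_closed] DFS_strx_nz[OF S]])
  interpret L: domain ?L by (rule l.loc_domain)
  obtain \<theta> where "isomorphism_over Ax (restriction x S) (affine_line Ax) \<theta>"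
    using S unfolding DFS_def isomorphic_over_def by blast
  then have \<theta>: "\<theta> \<in> ring_iso K ?L"
    and \<theta>_str: "\<And>a. a \<in> carrier Ax \<Longrightarrow> \<theta> (monom K a 0) = loc_map (Coord S) ?M (str S) a"
    unfolding isomorphism_over_def morphism_over_def affine_line_def restriction_def by simp_all
  have \<theta>_inj: "inj_on \<theta> (carrier K)" and \<theta>_img: "\<theta> ` carrier K = carrier ?L" and \<theta>_hom: "\<theta> \<in> ring_hom K ?L"
    using \<theta> unfolding ring_iso_def bij_betw_def by auto
  interpret \<theta>: ring_hom_cring K ?L \<theta>
    by (rule UnivPoly.ring_hom_cringI[OF K.P.is_cring L.is_cring \<theta>_hom])
  define \<psi> where "\<psi> = inv_into (carrier K) \<theta>"
  have \<psi>: "\<psi> \<in> ring_iso ?L K" unfolding \<psi>_def by (rule ring_iso_set_sym[OF K.P.ring_axioms \<theta>])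
  have \<psi>_\<theta>: "\<psi> (\<theta> y) = y" if "y \<in> carrier K" for y
    unfolding \<psi>_def by (rule inv_into_f_f[OF \<theta>_inj that])
  have \<psi>_hom: "\<psi> \<in> ring_hom ?L K" and \<psi>_inj: "inj_on \<psi> (carrier ?L)"
    using \<psi> unfolding ring_iso_def bij_betw_def by auto
  define j where "j b = \<psi> (loc_frac (Coord S) ?M b \<one>\<^bsub>Coord S\<^esub>)" for b
  have "\<psi> \<circ> (\<lambda>b. loc_frac (Coord S) ?M b \<one>\<^bsub>Coord S\<^esub>) \<in> ring_hom (Coord S) K"
    by (rule ring_hom_trans[OF l.frac_hom \<psi>_hom])
  moreover have "\<psi> \<circ> (\<lambda>b. loc_frac (Coord S) ?M b \<one>\<^bsub>Coord S\<^esub>) = j" by (rule ext) (simp add: j_def)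
  ultimately have j_hom: "j \<in> ring_hom (Coord S) K" by simp
  have j_inj: "inj_on j (carrier (Coord S))"
  proof (rule inj_onI)
    fix a b assume ab: "a \<in> carrier (Coord S)" "b \<in> carrier (Coord S)" "j a = j b"
    then have "loc_frac (Coord S) ?M a \<one>\<^bsub>Coord S\<^esub> = loc_frac (Coord S) ?M b \<one>\<^bsub>Coord S\<^esub>"
      unfolding j_def by (intro inj_onD[OF \<psi>_inj]) (use l.M_one in auto)
    then show "a = b" by (rule inj_onD[OF l.frac_inj _ ab(1,2)])
  qed
  have strM: "str S ` powers A x \<subseteq> ?M" unfolding powers_def by auto
  have \<theta>c: "\<theta> (c a) = loc_frac (Coord S) ?M (str S a) \<one>\<^bsub>Coord S\<^esub>" if a: "a \<in> carrier A" for a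
    unfolding c_def using \<theta>_str[of "fr a \<one>\<^bsub>A\<^esub>"] a loc.M_one
      loc_map_frac[OF loc.frac_axioms l.frac_axioms str.homh strM a loc.M_one] by simp
  have j_str: "j (str S a) = c a" if a: "a \<in> carrier A" for a
    unfolding j_def \<theta>c[OF a, symmetric] by (rule \<psi>_\<theta>) (simp add: a)
  have den: "\<exists>n::nat. \<exists>b\<in>carrier (Coord S). c x [^]\<^bsub>K\<^esub> n \<otimes>\<^bsub>K\<^esub> y = j b" if y: "y \<in> carrier K" for y
  proof -
    have "\<theta> y \<in> carrier ?L" using y by simp
    then obtain b s where bs: "b \<in> carrier (Coord S)" "s \<in> ?M" "\<theta> y = loc_frac (Coord S) ?M b s"
      by (rule l.frac_cases)
    obtain n :: nat where n: "s = str S x [^]\<^bsub>Coord S\<^esub> n" using bs(2) unfolding powers_def by blast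
    have sB: "s \<in> carrier (Coord S)" using bs(2) by simp
    have "\<theta> (c (x [^]\<^bsub>A\<^esub> n) \<otimes>\<^bsub>K\<^esub> y) = loc_frac (Coord S) ?M s \<one>\<^bsub>Coord S\<^esub> \<otimes>\<^bsub>?L\<^esub> loc_frac (Coord S) ?M b s"
      using \<theta>.hom_mult[OF c.hom_closed[OF A.nat_pow_closed[OF x_closed, of n]] y] bs(3) n
        \<theta>c[OF A.nat_pow_closed[OF x_closed, of n]] by simp
    also have "\<dots> = loc_frac (Coord S) ?M b \<one>\<^bsub>Coord S\<^esub>"
      using sB bs(1,2) l.M_one by (simp add: B.m_ac)
    finally have "\<psi> (\<theta> (c (x [^]\<^bsub>A\<^esub> n) \<otimes>\<^bsub>K\<^esub> y)) = j b" unfolding j_def by simp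
    then have "c (x [^]\<^bsub>A\<^esub> n) \<otimes>\<^bsub>K\<^esub> y = j b" using \<psi>_\<theta>[of "c (x [^]\<^bsub>A\<^esub> n) \<otimes>\<^bsub>K\<^esub> y"] y by simp
    then show ?thesis using bs(1) by auto
  qed
  show ?thesis by (rule that[OF j_hom j_inj j_str den])
qed

text \<open>One embedding serves both surfaces, that of \<open>S\<close> being the one of
  \<open>S'\<close> after \<open>\<beta>\<close>; this is what turns the morphism into an inclusion
  of subrings of \<open>K\<close>.\<close>

theorem DFS_morphism_models:
  assumes "DFS_morphism A x S' S \<beta>"
  obtains j' F' F where "model S' F' j'" "model S F (\<lambda>b. j' (\<beta> b))"
proof -
  have S': "DFS A x S'" and S: "DFS A x S" and \<beta>: "\<beta> \<in> ring_hom (Coord S) (Coord S')"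
    and \<beta>_str: "\<And>a. a \<in> carrier A \<Longrightarrow> \<beta> (str S a) = str S' a"
    and zero: "comap (Coord S) \<beta> {\<zero>\<^bsub>Coord S'\<^esub>} = {\<zero>\<^bsub>Coord S\<^esub>}"
    and loc_iso: "loc_map (Coord S') (powers (Coord S') (str S' x)) \<beta> \<in>
        ring_iso (loc_at (Coord S) (str S x)) (loc_at (Coord S') (str S' x))"
    using assms unfolding DFS_morphism_def morphism_over_def birational_def isomorphism_over_def restriction_def
    by auto
  interpret B: domain "Coord S" using S by (simp add: DFS_def integral_scheme_def)
  interpret B': domain "Coord S'" using S' by (simp add: DFS_def integral_scheme_def)
  interpret \<beta>: ring_hom_cring "Coord S" "Coord S'" \<beta>
    by (rule UnivPoly.ring_hom_cringI[OF B.is_cring B'.is_cring \<beta>])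
  have strB: "str S a \<in> carrier (Coord S)" and strB': "str S' a \<in> carrier (Coord S')" if "a \<in> carrier A" for a
    using S S' that ring_hom_closed unfolding DFS_def affine_over_def by metis+
  let ?M = "powers (Coord S) (str S x)" and ?M' = "powers (Coord S') (str S' x)"
  interpret l: frac "Coord S" ?M by (rule B.frac_powers[OF strB[OF x_closed] DFS_strx_nz[OF S]])
  interpret l': frac "Coord S'" ?M' by (rule B'.frac_powers[OF strB'[OF x_closed] DFS_strx_nz[OF S']])
  have \<beta>_inj: "inj_on \<beta> (carrier (Coord S))"
  proof (rule \<beta>.ring.trivial_ker_imp_inj)
    show "a_kernel (Coord S) (Coord S') \<beta> = {\<zero>\<^bsub>Coord S\<^esub>}"
      using zero unfolding a_kernel_def' comap_def by auto
  qed
  have \<beta>M: "\<beta> ` ?M \<subseteq> ?M'" unfolding powers_def using strB[OF x_closed] by (auto simp: \<beta>_str)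
  \<comment> \<open>Surjectivity of the isomorphism over the punctured base: some power of
    \<open>x\<close> moves any function on \<open>S'\<close> into the image of
    \<open>\<beta>\<close>.\<close>
  have clear: "\<exists>n::nat. \<exists>b\<in>carrier (Coord S). str S' x [^]\<^bsub>Coord S'\<^esub> n \<otimes>\<^bsub>Coord S'\<^esub> b' = \<beta> b"
    if b': "b' \<in> carrier (Coord S')" for b'
  proof -
    have "loc_frac (Coord S') ?M' b' \<one>\<^bsub>Coord S'\<^esub> \<in> carrier (loc_at (Coord S') (str S' x))"
      by (rule l'.frac_closed[OF b' l'.M_one])
    then have "loc_frac (Coord S') ?M' b' \<one>\<^bsub>Coord S'\<^esub> \<in>
        loc_map (Coord S') ?M' \<beta> ` carrier (loc_at (Coord S) (str S x))"
      using loc_iso unfolding ring_iso_def bij_betw_def by simp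
    then obtain p where p: "p \<in> carrier (loc_at (Coord S) (str S x))"
      "loc_frac (Coord S') ?M' b' \<one>\<^bsub>Coord S'\<^esub> = loc_map (Coord S') ?M' \<beta> p" by blast
    obtain b s where bs: "b \<in> carrier (Coord S)" "s \<in> ?M" "p = loc_frac (Coord S) ?M b s"
      using p(1) by (rule l.frac_cases)
    have sM': "\<beta> s \<in> ?M'" using \<beta>M bs(2) by blast
    have "loc_frac (Coord S') ?M' b' \<one>\<^bsub>Coord S'\<^esub> = loc_frac (Coord S') ?M' (\<beta> b) (\<beta> s)"
      unfolding p(2) bs(3) by (rule loc_map_frac[OF l.frac_axioms l'.frac_axioms \<beta> \<beta>M bs(1,2)])
    then have eq: "b' \<otimes>\<^bsub>Coord S'\<^esub> \<beta> s = \<beta> b \<otimes>\<^bsub>Coord S'\<^esub> \<one>\<^bsub>Coord S'\<^esub>"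
      using l'.frac_eq_iff[OF b' \<beta>.hom_closed[OF bs(1)] l'.M_one sM'] by simp
    obtain n :: nat where n: "s = str S x [^]\<^bsub>Coord S\<^esub> n" using bs(2) unfolding powers_def by blast
    have "\<beta> s = str S' x [^]\<^bsub>Coord S'\<^esub> n" unfolding n using strB[OF x_closed] by (simp add: \<beta>_str)
    then have "str S' x [^]\<^bsub>Coord S'\<^esub> n \<otimes>\<^bsub>Coord S'\<^esub> b' = \<beta> b"
      using eq bs(1) b' strB'[OF x_closed] by (simp add: B'.m_comm)
    then show ?thesis using bs(1) by blast
  qed
  obtain j0 where j0: "j0 \<in> ring_hom (Coord S') K" "inj_on j0 (carrier (Coord S'))"
    "\<And>a. a \<in> carrier A \<Longrightarrow> j0 (str S' a) = c a"
    "\<And>y. y \<in> carrier K \<Longrightarrow> \<exists>n::nat. \<exists>b\<in>carrier (Coord S'). c x [^]\<^bsub>K\<^esub> n \<otimes>\<^bsub>K\<^esub> y = j0 b"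
    by (rule DFS_localization[OF S']) (rule that)
  interpret j0: ring_hom_cring "Coord S'" K j0 by (rule UnivPoly.ring_hom_cringI[OF B'.is_cring K.P.is_cring j0(1)])
  have den: "\<exists>n::nat. \<exists>b\<in>carrier (Coord S). c x [^]\<^bsub>K\<^esub> n \<otimes>\<^bsub>K\<^esub> y = j0 (\<beta> b)" if y: "y \<in> carrier K" for y
  proof -
    obtain n :: nat and b' where b': "b' \<in> carrier (Coord S')" "c x [^]\<^bsub>K\<^esub> n \<otimes>\<^bsub>K\<^esub> y = j0 b'"
      using j0(4)[OF y] by blast
    obtain k :: nat and b where b: "b \<in> carrier (Coord S)" "str S' x [^]\<^bsub>Coord S'\<^esub> k \<otimes>\<^bsub>Coord S'\<^esub> b' = \<beta> b"
      using clear[OF b'(1)] by blast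
    have "j0 (\<beta> b) = c x [^]\<^bsub>K\<^esub> k \<otimes>\<^bsub>K\<^esub> j0 b'"
      unfolding b(2)[symmetric] using b'(1) strB'[OF x_closed] j0(3)[OF x_closed] by simp
    then have "c x [^]\<^bsub>K\<^esub> (k + n) \<otimes>\<^bsub>K\<^esub> y = j0 (\<beta> b)"
      unfolding b'(2)[symmetric] using y by (simp add: K.P.m_assoc flip: K.P.nat_pow_mult)
    then show ?thesis using b(1) by blast
  qed
  \<comment> \<open>The coordinate \<open>T\<close> of the trivialization need not be regular on
    \<open>S\<close>, but \<open>x^N T\<close> is. The automorphism \<open>?f\<close> of
    \<open>K\<close>, which sends \<open>T\<close> to \<open>x^(-N) T\<close>, makes this function
    the new \<open>T\<close>, as \<open>DFS_is_model\<close> requires.\<close>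
  obtain N :: nat and b0 where b0: "b0 \<in> carrier (Coord S)" "c x [^]\<^bsub>K\<^esub> N \<otimes>\<^bsub>K\<^esub> T = j0 (\<beta> b0)"
    using den[OF T_closed] by blast
  let ?z = "\<zero>\<^bsub>A\<^esub>"
  have z: "?z \<in> carrier A" by simp
  let ?f = "\<chi> N ?z 0 ?z" and ?g = "\<chi> 0 ?z N ?z"
  interpret f: ring_hom_cring K K ?f by (rule UnivPoly.ring_hom_cringI[OF K.P.is_cring K.P.is_cring \<chi>_hom[OF z z]])
  have fg: "?f (?g y) = y" "?g (?f y) = y" if "y \<in> carrier K" for y
    using \<chi>_trans[OF z z z that] \<chi>_refl[OF z that] by simp_all
  have fc: "?f (c a) = c a" if "a \<in> carrier A" for a by (rule \<chi>_c[OF z z that])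
  have fT: "?f (c x [^]\<^bsub>K\<^esub> N \<otimes>\<^bsub>K\<^esub> T) = T"
  proof -
    have "?f (c x [^]\<^bsub>K\<^esub> N \<otimes>\<^bsub>K\<^esub> T) = c x [^]\<^bsub>K\<^esub> N \<otimes>\<^bsub>K\<^esub> \<theta> N ?z 0 ?z"
      using fc[OF x_closed] \<chi>_T[OF z z] by simp
    also have "\<dots> = T" unfolding \<theta>_eq[OF z z] by (simp add: A.minus_eq)
    finally show ?thesis .
  qed
  define j' where "j' b = ?f (j0 b)" for b
  have j'_hom: "j' \<in> ring_hom (Coord S') K"
    by (rule ring_hom_memI) (simp_all add: j'_def)
  have j'_inj: "inj_on j' (carrier (Coord S'))"
  proof (rule inj_onI)
    fix a b assume ab: "a \<in> carrier (Coord S')" "b \<in> carrier (Coord S')" "j' a = j' b"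
    then have "?g (?f (j0 a)) = ?g (?f (j0 b))" unfolding j'_def by simp
    then have "j0 a = j0 b" using fg(2)[OF j0.hom_closed[OF ab(1)]] fg(2)[OF j0.hom_closed[OF ab(2)]] by simp
    then show "a = b" by (rule inj_onD[OF j0(2) _ ab(1,2)])
  qed
  have j'_str: "j' (str S' a) = c a" if "a \<in> carrier A" for a
    unfolding j'_def using j0(3)[OF that] fc[OF that] by simp
  have j'_den: "\<exists>n::nat. \<exists>b\<in>carrier (Coord S). c x [^]\<^bsub>K\<^esub> n \<otimes>\<^bsub>K\<^esub> y = j' (\<beta> b)" if y: "y \<in> carrier K" for y
  proof -
    have gy: "?g y \<in> carrier K" by (rule \<chi>_closed[OF z z y])
    obtain n :: nat and b where b: "b \<in> carrier (Coord S)" "c x [^]\<^bsub>K\<^esub> n \<otimes>\<^bsub>K\<^esub> ?g y = j0 (\<beta> b)"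
      using den[OF gy] by blast
    have "j' (\<beta> b) = c x [^]\<^bsub>K\<^esub> n \<otimes>\<^bsub>K\<^esub> y"
      unfolding j'_def b(2)[symmetric] using gy fc[OF x_closed] fg(1)[OF y] by simp
    then show ?thesis using b(1) by metis
  qed
  have T: "T = j' (\<beta> b0)" unfolding j'_def b0(2)[symmetric] fT ..
  have "\<exists>F'. model S' F' j'"
  proof (rule DFS_is_model[OF S' j'_hom j'_inj j'_str])
    show "T \<in> j' ` carrier (Coord S')" unfolding T using b0(1) by simp
    show "\<exists>n::nat. c x [^]\<^bsub>K\<^esub> n \<otimes>\<^bsub>K\<^esub> y \<in> j' ` carrier (Coord S')" if "y \<in> carrier K" for y
      using j'_den[OF that] \<beta>.hom_closed by (metis imageI)
  qed
  moreover have "\<exists>F. model S F (\<lambda>b. j' (\<beta> b))"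
  proof (rule DFS_is_model[OF S])
    interpret j': ring_hom_cring "Coord S'" K j' by (rule UnivPoly.ring_hom_cringI[OF B'.is_cring K.P.is_cring j'_hom])
    show "(\<lambda>b. j' (\<beta> b)) \<in> ring_hom (Coord S) K"
      by (rule ring_hom_memI) simp_all
    show "inj_on (\<lambda>b. j' (\<beta> b)) (carrier (Coord S))"
      by (rule inj_onI) (use inj_onD[OF j'_inj] inj_onD[OF \<beta>_inj] in simp)
    show "j' (\<beta> (str S a)) = c a" if "a \<in> carrier A" for a using \<beta>_str[OF that] j'_str[OF that] by simp
    show "T \<in> (\<lambda>b. j' (\<beta> b)) ` carrier (Coord S)" using T b0(1) by (rule image_eqI)
    show "\<exists>n::nat. c x [^]\<^bsub>K\<^esub> n \<otimes>\<^bsub>K\<^esub> y \<in> (\<lambda>b. j' (\<beta> b)) ` carrier (Coord S)" if "y \<in> carrier K" for y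
      using j'_den[OF that] by (metis (no_types, lifting) imageI)
  qed
  ultimately show ?thesis using that by blast
qed

end

section \<open>The tree of a family of discs\<close>

context disc_system
begin

text \<open>The nodes of the tree of \<open>F\<close> are the discs \<open>(s, l)\<close> containing a member of \<open>F\<close>, up to equality of
  cosets; \<open>nd\<close> codes them by natural numbers.\<close>

definition coding :: "('a \<times> nat) set \<Rightarrow> ('a \<Rightarrow> nat \<Rightarrow> nat) \<Rightarrow> bool" where
  "coding F nd \<longleftrightarrow> (\<forall>D\<in>F. \<forall>D'\<in>F. \<forall>l\<le>snd D. \<forall>l'\<le>snd D'.
     nd (fst D) l = nd (fst D') l' \<longleftrightarrow> l = l' \<and> near l (fst D) (fst D'))"

text \<open>The cosets themselves, paired with their levels, are numbered injectively, which is
  possible because only finitely many of them occur.\<close>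

lemma ex_coding: "fam F \<Longrightarrow> \<exists>nd. coding F nd"
proof -
  assume F: "fam F"
  define node where "node s l = ({a \<in> carrier A. near l a s}, l)" for s l
  have eq: "node s l = node s' l' \<longleftrightarrow> l = l' \<and> near l s s'" if s: "s \<in> carrier A" "s' \<in> carrier A" for s l s' l'
  proof
    assume "node s l = node s' l'"
    then have "l = l'" "{a \<in> carrier A. near l a s} = {a \<in> carrier A. near l a s'}" by (auto simp: node_def)
    then show "l = l' \<and> near l s s'" using s near_refl[OF s(1)] by blast
  next
    assume a: "l = l' \<and> near l s s'"
    then have "near l a s \<longleftrightarrow> near l a s'" if "a \<in> carrier A" for a
      using near_trans[of l a s s'] near_trans[of l a s' s] near_sym[of l s s'] s that by blast
    then show "node s l = node s' l'" using a by (auto simp: node_def)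
  qed
  let ?N = "(\<lambda>(D, l). node (fst D) l) ` (SIGMA D:F. {..snd D})"
  have "finite ?N" using fam_finite[OF F] by auto
  then have "\<exists>g :: _ \<Rightarrow> nat. inj_on g ?N"
    by (elim finite_imp_inj_to_nat_seg[THEN exE] exE conjE) (rule exI)
  then obtain g :: "_ \<Rightarrow> nat" where g: "inj_on g ?N" by (elim exE) (rule that)
  have "coding F (\<lambda>s l. g (node s l))"
    unfolding coding_def
  proof (intro ballI allI impI)
    fix D D' l l' assume a: "D \<in> F" "D' \<in> F" "l \<le> snd D" "l' \<le> snd D'"
    have "node (fst D) l \<in> ?N" "node (fst D') l' \<in> ?N" using a by force+
    then have "g (node (fst D) l) = g (node (fst D') l') \<longleftrightarrow> node (fst D) l = node (fst D') l'"
      using inj_on_eq_iff[OF g] by blast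
    then show "g (node (fst D) l) = g (node (fst D') l') \<longleftrightarrow> l = l' \<and> near l (fst D) (fst D')"
      using eq[OF famD[OF F a(1)] famD[OF F a(2)]] by simp
  qed
  then show ?thesis by blast
qed

definition tree :: "('a \<times> nat) set \<Rightarrow> ('a \<Rightarrow> nat \<Rightarrow> nat) \<Rightarrow> nat rel" where
  "tree F nd = {(nd (fst D) l, nd (fst D') l') | D D' l l'.
     D \<in> F \<and> D' \<in> F \<and> l \<le> snd D \<and> l' \<le> snd D' \<and> l \<le> l' \<and> near l (fst D) (fst D')}"

definition lf :: "('a \<Rightarrow> nat \<Rightarrow> nat) \<Rightarrow> 'a \<times> nat \<Rightarrow> nat" where
  "lf nd D = nd (fst D) (snd D)"

text \<open>Meaningful at leaves, where \<open>lf_inj\<close> makes the inverse well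
  defined.\<close>

definition label :: "('a \<times> nat) set \<Rightarrow> ('a \<Rightarrow> nat \<Rightarrow> nat) \<Rightarrow> nat \<Rightarrow> 'a" where
  "label F nd i = fst (inv_into F (lf nd) i)"

context
  fixes F nd assumes F: "fam F" and cod: "coding F nd"
begin

lemma nd_eq: "D \<in> F \<Longrightarrow> D' \<in> F \<Longrightarrow> l \<le> snd D \<Longrightarrow> l' \<le> snd D' \<Longrightarrow>
    nd (fst D) l = nd (fst D') l' \<longleftrightarrow> l = l' \<and> near l (fst D) (fst D')"
  using cod unfolding coding_def by blast

lemma near_F_sym: "D \<in> F \<Longrightarrow> D' \<in> F \<Longrightarrow> near l (fst D) (fst D') \<Longrightarrow> near l (fst D') (fst D)"
  by (rule near_sym[OF _ famD[OF F] famD[OF F]])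

lemma near_F_trans: "D \<in> F \<Longrightarrow> D' \<in> F \<Longrightarrow> D'' \<in> F \<Longrightarrow> near l (fst D) (fst D') \<Longrightarrow> near l (fst D') (fst D'') \<Longrightarrow>
    near l (fst D) (fst D'')"
  using near_trans[OF _ _ famD[OF F] famD[OF F] famD[OF F]] by metis

lemma near_F_refl: "D \<in> F \<Longrightarrow> near l (fst D) (fst D)"
  using famD[OF F] by simp

text \<open>The relation quantifies over representatives of the two nodes; by \<open>nd_eq\<close>
  other representatives differ only by congruent centres, along which \<open>near\<close> can be
  transported.\<close>

lemma tree_iff:
  assumes "D \<in> F" "D' \<in> F" "l \<le> snd D" "l' \<le> snd D'"
  shows "(nd (fst D) l, nd (fst D') l') \<in> tree F nd \<longleftrightarrow> l \<le> l' \<and> near l (fst D) (fst D')"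
proof
  assume "(nd (fst D) l, nd (fst D') l') \<in> tree F nd"
  then obtain E E' i i' where E: "E \<in> F" "E' \<in> F" "i \<le> snd E" "i' \<le> snd E'" "i \<le> i'" "near i (fst E) (fst E')"
    "nd (fst D) l = nd (fst E) i" "nd (fst D') l' = nd (fst E') i'" unfolding tree_def by blast
  have 1: "l = i" "near l (fst D) (fst E)" using nd_eq[OF assms(1) E(1) assms(3) E(3)] E(7) by auto
  have 2: "l' = i'" "near l' (fst D') (fst E')" using nd_eq[OF assms(2) E(2) assms(4) E(4)] E(8) by auto
  have le: "l \<le> l'" using 1(1) 2(1) E(5) by simp
  have "near l (fst D) (fst E')" using near_F_trans[OF assms(1) E(1,2) 1(2)] E(6) 1(1) by simp
  moreover have "near l (fst E') (fst D')"
    using near_F_sym[OF assms(2) E(2) near_mono[OF 2(2) le]] .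
  ultimately show "l \<le> l' \<and> near l (fst D) (fst D')"
    using near_F_trans[OF assms(1) E(2) assms(2)] le by blast
next
  assume "l \<le> l' \<and> near l (fst D) (fst D')"
  then show "(nd (fst D) l, nd (fst D') l') \<in> tree F nd" unfolding tree_def using assms by blast
qed

lemma tree_Field: "Field (tree F nd) = {nd (fst D) l | D l. D \<in> F \<and> l \<le> snd D}"
proof
  show "Field (tree F nd) \<subseteq> {nd (fst D) l | D l. D \<in> F \<and> l \<le> snd D}"
    unfolding Field_def tree_def by blast
  have "nd (fst D) l \<in> Field (tree F nd)" if "D \<in> F" "l \<le> snd D" for D l
    using tree_iff[OF that(1,1) that(2,2)] near_F_refl[OF that(1)] by (auto simp: Field_def)
  then show "{nd (fst D) l | D l. D \<in> F \<and> l \<le> snd D} \<subseteq> Field (tree F nd)" by blast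
qed

lemma tree_FieldI: "D \<in> F \<Longrightarrow> l \<le> snd D \<Longrightarrow> nd (fst D) l \<in> Field (tree F nd)"
  unfolding tree_Field by blast

lemma tree_FieldE:
  assumes "p \<in> Field (tree F nd)"
  obtains D l where "D \<in> F" "l \<le> snd D" "p = nd (fst D) l"
  using assms unfolding tree_Field by blast

text \<open>A disc containing another can be recentred at the centre of the smaller one. The
  ancestors of a node are therefore its own centre taken at lower levels, and its down-set is a copy
  of \<open>{..l}\<close>.\<close>

lemma below_nd:
  assumes D: "D \<in> F" "l \<le> snd D"
  shows "(p, nd (fst D) l) \<in> tree F nd \<longleftrightarrow> (\<exists>i\<le>l. p = nd (fst D) i)"
proof
  assume p: "(p, nd (fst D) l) \<in> tree F nd"
  then have "p \<in> Field (tree F nd)" by (auto simp: Field_def)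
  then obtain E i where E: "E \<in> F" "i \<le> snd E" "p = nd (fst E) i" by (rule tree_FieldE)
  then have "i \<le> l" "near i (fst E) (fst D)" using p tree_iff[OF E(1) D(1) E(2) D(2)] by auto
  then have "p = nd (fst D) i" using nd_eq[OF E(1) D(1) E(2), of i] E(3) D(2) by simp
  then show "\<exists>i\<le>l. p = nd (fst D) i" using \<open>i \<le> l\<close> by blast
next
  assume "\<exists>i\<le>l. p = nd (fst D) i"
  then show "(p, nd (fst D) l) \<in> tree F nd" using tree_iff[OF D(1,1) _ D(2)] D(2) near_F_refl[OF D(1)] by auto
qed

lemma under_nd:
  assumes D: "D \<in> F" "l \<le> snd D"
  shows "under (tree F nd) (nd (fst D) l) = nd (fst D) ` {..l}"
  unfolding under_def using below_nd[OF D] by auto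

lemma nd_level_eq: "D \<in> F \<Longrightarrow> i \<le> snd D \<Longrightarrow> i' \<le> snd D \<Longrightarrow> nd (fst D) i = nd (fst D) i' \<longleftrightarrow> i = i'"
  using nd_eq[of D D i i'] near_F_refl[of D] by auto

lemma underS_nd:
  assumes D: "D \<in> F" "l \<le> snd D"
  shows "underS (tree F nd) (nd (fst D) l) = nd (fst D) ` {..<l}"
  unfolding underS_def using below_nd[OF D] nd_level_eq[OF D(1)] D(2) by (fastforce simp: less_le)

lemma level_nd:
  assumes D: "D \<in> F" "l \<le> snd D"
  shows "level (tree F nd) (nd (fst D) l) = l"
proof -
  have "inj_on (nd (fst D)) {..l}" by (rule inj_onI) (use nd_level_eq[OF D(1)] D(2) in auto)
  then show ?thesis unfolding level_def under_nd[OF D] by (simp add: card_image)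
qed

lemma tree_rooted: "rooted_tree (tree F nd)"
  unfolding rooted_tree_def
proof (intro conjI ballI)
  obtain D0 where D0: "D0 \<in> F" using F unfolding fam_def by blast
  have "Field (tree F nd) = (\<Union>D\<in>F. nd (fst D) ` {..snd D})"
    unfolding tree_Field image_def atMost_def by blast
  then show "finite (Field (tree F nd))" using fam_finite[OF F] by simp
  show "Field (tree F nd) \<noteq> {}" using tree_FieldI[OF D0, of 0] by auto
  show "Partial_order (tree F nd)"
    unfolding partial_order_on_def preorder_on_def
  proof (intro conjI)
    show "tree F nd \<subseteq> Field (tree F nd) \<times> Field (tree F nd)" by (auto simp: Field_def)
    show "refl_on (Field (tree F nd)) (tree F nd)"
    proof (rule refl_onI)
      fix p assume "p \<in> Field (tree F nd)"
      then obtain D l where "D \<in> F" "l \<le> snd D" "p = nd (fst D) l" by (rule tree_FieldE)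
      then show "(p, p) \<in> tree F nd" using below_nd by blast
    qed
    show "trans (tree F nd)"
    proof (rule transI)
      fix p q r assume pq: "(p, q) \<in> tree F nd" and qr: "(q, r) \<in> tree F nd"
      have "r \<in> Field (tree F nd)" using qr by (auto simp: Field_def)
      then obtain D l where D: "D \<in> F" "l \<le> snd D" "r = nd (fst D) l" by (rule tree_FieldE)
      obtain i where i: "i \<le> l" "q = nd (fst D) i" using qr below_nd[OF D(1,2)] D(3) by auto
      obtain i' where "i' \<le> i" "p = nd (fst D) i'" using pq below_nd[OF D(1), of i p] i D(2) by auto
      then show "(p, r) \<in> tree F nd" unfolding D(3) below_nd[OF D(1,2)] using i(1) le_trans by blast
    qed
    show "antisym (tree F nd)"
    proof (rule antisymI)
      fix p q assume pq: "(p, q) \<in> tree F nd" and qp: "(q, p) \<in> tree F nd"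
      have "q \<in> Field (tree F nd)" using pq by (auto simp: Field_def)
      then obtain D l where D: "D \<in> F" "l \<le> snd D" "q = nd (fst D) l" by (rule tree_FieldE)
      obtain i where i: "i \<le> l" "p = nd (fst D) i" using pq below_nd[OF D(1,2)] D(3) by auto
      have "l \<le> i" using qp tree_iff[OF D(1,1,2), of i] i D by auto
      then show "p = q" using i D by simp
    qed
  qed
  show "\<exists>!e. e \<in> Field (tree F nd) \<and> underS (tree F nd) e = {}"
  proof (rule ex1I[of _ "nd (fst D0) 0"])
    show "nd (fst D0) 0 \<in> Field (tree F nd) \<and> underS (tree F nd) (nd (fst D0) 0) = {}"
      using tree_FieldI[OF D0, of 0] underS_nd[OF D0, of 0] by simp
    fix e assume e: "e \<in> Field (tree F nd) \<and> underS (tree F nd) e = {}"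
    then obtain D l where D: "D \<in> F" "l \<le> snd D" "e = nd (fst D) l" using tree_FieldE by blast
    have "l = 0" using e underS_nd[OF D(1,2)] D(3) by auto
    then show "e = nd (fst D0) 0"
      using nd_eq[OF D(1) D0, of 0 0] near_zero[OF famD[OF F D(1)] famD[OF F D0]] D(3) by simp
  qed
  fix e assume "e \<in> Field (tree F nd)"
  then obtain D l where D: "D \<in> F" "l \<le> snd D" "e = nd (fst D) l" by (rule tree_FieldE)
  have "(nd (fst D) i, nd (fst D) i') \<in> tree F nd \<or> (nd (fst D) i', nd (fst D) i) \<in> tree F nd"
    if "i \<le> l" "i' \<le> l" for i i'
    using tree_iff[OF D(1,1), of i i'] tree_iff[OF D(1,1), of i' i] that D(2) near_F_refl[OF D(1)] by auto
  then show "under (tree F nd) e \<in> Chains (tree F nd)"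
    unfolding D(3) under_nd[OF D(1,2)] Chains_def by blast
qed

lemma lf_Field: "D \<in> F \<Longrightarrow> lf nd D \<in> Field (tree F nd)"
  unfolding lf_def by (rule tree_FieldI) simp_all

text \<open>A node above the leaf would be a disc inside \<open>D\<close> that contains a member of
  \<open>F\<close>; by disjointness this member is \<open>D\<close> itself.\<close>

lemma above_lf:
  assumes D: "D \<in> F" and p: "(lf nd D, p) \<in> tree F nd"
  shows "p = lf nd D"
proof -
  have "p \<in> Field (tree F nd)" using p by (auto simp: Field_def)
  then obtain E i where E: "E \<in> F" "i \<le> snd E" "p = nd (fst E) i" by (rule tree_FieldE)
  have i: "snd D \<le> i" "near (snd D) (fst D) (fst E)"
    using p tree_iff[OF D E(1) order_refl E(2)] E(3) unfolding lf_def by auto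
  then have "D = E" using fam_disjoint[OF F D E(1)] E(2) by (simp add: min_def)
  then show ?thesis using i E unfolding lf_def by simp
qed

lemma lf_inj: "inj_on (lf nd) F"
proof (rule inj_onI)
  fix D E assume a: "D \<in> F" "E \<in> F" "lf nd D = lf nd E"
  then have "snd D = snd E" "near (snd D) (fst D) (fst E)"
    using nd_eq[OF a(1,2) order_refl order_refl] unfolding lf_def by auto
  then show "D = E" using fam_disjoint[OF F a(1,2)] by simp
qed

lemma label_lf: "D \<in> F \<Longrightarrow> label F nd (lf nd D) = fst D"
  unfolding label_def by (simp add: inv_into_f_f[OF lf_inj])

lemma level_lf: "D \<in> F \<Longrightarrow> level (tree F nd) (lf nd D) = snd D"
  unfolding lf_def by (rule level_nd) simp_all

lemma leaves_tree: "leaves (tree F nd) = lf nd ` F"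
proof
  show "leaves (tree F nd) \<subseteq> lf nd ` F"
  proof
    fix p assume p: "p \<in> leaves (tree F nd)"
    then have "p \<in> Field (tree F nd)" unfolding leaves_def by blast
    then obtain D l where D: "D \<in> F" "l \<le> snd D" "p = nd (fst D) l" by (rule tree_FieldE)
    have "(p, lf nd D) \<in> tree F nd" unfolding lf_def D(3) using below_nd[OF D(1) order_refl] D(2) by blast
    then have "p = lf nd D" using p unfolding leaves_def aboveS_def by auto
    then show "p \<in> lf nd ` F" using D(1) by blast
  qed
  show "lf nd ` F \<subseteq> leaves (tree F nd)"
    unfolding leaves_def aboveS_def using lf_Field above_lf by auto
qed

text \<open>Common ancestors are the levels, below both leaves, at which the centres agree;
  \<open>d\<close> is the largest. At level \<open>Suc d\<close> the centres differ, by maximality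
  or, if \<open>Suc d\<close> is the smaller of the two leaf levels, by disjointness.\<close>

lemma label_near:
  assumes D: "D \<in> F" "E \<in> F" "D \<noteq> E"
  defines "d \<equiv> level (tree F nd) (first_common_ancestor (tree F nd) (lf nd D) (lf nd E))"
  shows "near d (fst E) (fst D) \<and> \<not> near (Suc d) (fst E) (fst D)"
proof -
  let ?m = "min (snd D) (snd E)"
  let ?S = "{l. l < ?m \<and> near l (fst D) (fst E)}"
  have nm: "\<not> near ?m (fst D) (fst E)" using fam_disjoint[OF F D(1,2)] D(3) by blast
  have "?m \<noteq> 0" using nm near_zero[OF famD[OF F D(1)] famD[OF F D(2)]] by metis
  then have ne: "0 \<in> ?S" unfolding mem_Collect_eq neq0_conv using near_zero[OF famD[OF F D(1)] famD[OF F D(2)]] by blast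
  have fin: "finite ?S" by simp
  define k where "k = Max ?S"
  have kS: "k \<in> ?S" unfolding k_def using Max_in[OF fin] ne by blast
  have kmax: "l \<le> k" if "l \<in> ?S" for l unfolding k_def using fin that by simp
  have nSk: "\<not> near (Suc k) (fst D) (fst E)"
  proof (cases "Suc k < ?m")
    case True
    then show ?thesis using kmax[of "Suc k"] by auto
  next
    case False
    then have "Suc k = ?m" using kS by auto
    then show ?thesis using nm by simp
  qed
  have int: "underS (tree F nd) (lf nd D) \<inter> underS (tree F nd) (lf nd E) = nd (fst D) ` ?S"
  proof (intro Set.set_eqI iffI)
    fix p assume p: "p \<in> underS (tree F nd) (lf nd D) \<inter> underS (tree F nd) (lf nd E)"
    then obtain i where i: "i < snd D" "p = nd (fst D) i"
      using underS_nd[OF D(1) order_refl] unfolding lf_def by auto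
    from p obtain i' where i': "i' < snd E" "p = nd (fst E) i'"
      using underS_nd[OF D(2) order_refl] unfolding lf_def by auto
    have "i = i'" "near i (fst D) (fst E)" using nd_eq[OF D(1,2), of i i'] i i' by auto
    then show "p \<in> nd (fst D) ` ?S" using i i' by auto
  next
    fix p assume "p \<in> nd (fst D) ` ?S"
    then obtain i where i: "i < ?m" "near i (fst D) (fst E)" "p = nd (fst D) i" by blast
    then have "p = nd (fst E) i" using nd_eq[OF D(1,2), of i i] by simp
    moreover have "i < snd D" "i < snd E" using i(1) by auto
    ultimately show "p \<in> underS (tree F nd) (lf nd D) \<inter> underS (tree F nd) (lf nd E)"
      unfolding lf_def underS_nd[OF D(1) order_refl] underS_nd[OF D(2) order_refl] using i(3) by blast
  qed
  have cmp: "(nd (fst D) i, nd (fst D) i') \<in> tree F nd \<longleftrightarrow> i \<le> i'" if "i \<in> ?S" "i' \<in> ?S" for i i'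
    using tree_iff[OF D(1,1), of i i'] that near_F_refl[OF D(1)] by auto
  have "first_common_ancestor (tree F nd) (lf nd D) (lf nd E) = nd (fst D) k"
    unfolding first_common_ancestor_def int
  proof (rule the_equality)
    show "nd (fst D) k \<in> nd (fst D) ` ?S \<and> (\<forall>b\<in>nd (fst D) ` ?S. (nd (fst D) k, b) \<in> tree F nd \<longrightarrow> b = nd (fst D) k)"
      using kS cmp[OF kS] kmax by fastforce
    fix p assume p: "p \<in> nd (fst D) ` ?S \<and> (\<forall>b\<in>nd (fst D) ` ?S. (p, b) \<in> tree F nd \<longrightarrow> b = p)"
    then obtain i where i: "i \<in> ?S" "p = nd (fst D) i" by blast
    have "(p, nd (fst D) k) \<in> tree F nd" using cmp[OF i(1) kS] kmax[OF i(1)] i(2) by simp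
    then show "p = nd (fst D) k" using p kS by auto
  qed
  then have "d = k" unfolding d_def using level_nd[OF D(1), of k] kS by simp
  then show ?thesis using kS nSk near_F_sym[OF D(1,2), of k] near_F_sym[OF D(2,1), of "Suc k"] by auto
qed

lemma tree_labelled: "labelled_tree A x (tree F nd, label F nd)"
  unfolding labelled_tree_def case_prod_conv Let_def
proof (intro conjI ballI impI)
  show "rooted_tree (tree F nd)" by (rule tree_rooted)
  show "label F nd ` leaves (tree F nd) \<subseteq> carrier A"
    unfolding leaves_tree using label_lf famD[OF F] by auto
  fix p q assume "p \<in> leaves (tree F nd)" "q \<in> leaves (tree F nd)" "p \<noteq> q"
  then obtain D E where DE: "D \<in> F" "E \<in> F" "p = lf nd D" "q = lf nd E" "D \<noteq> E"
    unfolding leaves_tree by auto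
  show "label F nd q \<ominus>\<^bsub>A\<^esub> label F nd p
      \<in> PIdl\<^bsub>A\<^esub> (x [^]\<^bsub>A\<^esub> level (tree F nd) (first_common_ancestor (tree F nd) p q)) -
        PIdl\<^bsub>A\<^esub> (x [^]\<^bsub>A\<^esub> (level (tree F nd) (first_common_ancestor (tree F nd) p q) + 1))"
    using label_near[OF DE(1,2,5)] unfolding near_def DE(3,4) label_lf[OF DE(1)] label_lf[OF DE(2)] by simp
qed

text \<open>Maximal chains are the paths from the root to a leaf: a finite nonempty chain has a top
  node, and the path to any leaf above that node contains the chain.\<close>

lemma maximal_chain_tree: "maximal_chain (tree F nd) C \<longleftrightarrow> (\<exists>D\<in>F. C = nd (fst D) ` {..snd D})"
proof -
  have chain: "nd (fst D) ` {..snd D} \<in> Chains (tree F nd)" if D: "D \<in> F" for D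
    using tree_rooted lf_Field[OF D] under_nd[OF D order_refl] unfolding rooted_tree_def lf_def by auto
  have sub: "C \<subseteq> nd (fst D) ` {..snd D}" if D: "D \<in> F" and C: "C \<in> Chains (tree F nd)" "lf nd D \<in> C" for C D
  proof
    fix p assume p: "p \<in> C"
    then have "(p, lf nd D) \<in> tree F nd \<or> (lf nd D, p) \<in> tree F nd" using C unfolding Chains_def by blast
    then have "(p, lf nd D) \<in> tree F nd"
    proof
      assume "(lf nd D, p) \<in> tree F nd"
      then show ?thesis using above_lf[OF D] by metis
    qed
    then show "p \<in> nd (fst D) ` {..snd D}" using below_nd[OF D order_refl] unfolding lf_def by auto
  qed
  have max: "maximal_chain (tree F nd) (nd (fst D) ` {..snd D})" if D: "D \<in> F" for D
    unfolding maximal_chain_def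
  proof (intro conjI ballI impI)
    show "nd (fst D) ` {..snd D} \<in> Chains (tree F nd)" by (rule chain[OF D])
    fix C assume C: "C \<in> Chains (tree F nd)" "nd (fst D) ` {..snd D} \<subseteq> C"
    then have "lf nd D \<in> C" unfolding lf_def by auto
    then show "C = nd (fst D) ` {..snd D}" using sub[OF D C(1)] C(2) by blast
  qed
  have conv: "\<exists>D\<in>F. C = nd (fst D) ` {..snd D}" if C: "maximal_chain (tree F nd) C" for C
  proof -
    have ch: "C \<in> Chains (tree F nd)" using C unfolding maximal_chain_def by blast
    then have CF: "C \<subseteq> Field (tree F nd)" unfolding Chains_def Field_def by blast
    have fin: "finite C" using CF tree_rooted finite_subset unfolding rooted_tree_def by blast
    obtain D0 where D0: "D0 \<in> F" using F unfolding fam_def by blast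
    have "C \<noteq> {}"
    proof
      assume "C = {}"
      then have "nd (fst D0) ` {..snd D0} = C"
        using C chain[OF D0] unfolding maximal_chain_def by (metis empty_subsetI)
      then show False using \<open>C = {}\<close> by simp
    qed
    have trans: "trans (tree F nd)"
      using tree_rooted unfolding rooted_tree_def partial_order_on_def preorder_on_def by blast
    have top: "\<exists>p\<in>X. \<forall>q\<in>X. (q, p) \<in> tree F nd" if "finite X" "X \<noteq> {}" "X \<subseteq> C" for X
      using that
    proof (induct X rule: finite_ne_induct)
      case (singleton p)
      then show ?case using ch unfolding Chains_def by blast
    next
      case (insert p X)
      then obtain r where r: "r \<in> X" "\<forall>q\<in>X. (q, r) \<in> tree F nd" by auto
      have "(p, r) \<in> tree F nd \<or> (r, p) \<in> tree F nd" "(p, p) \<in> tree F nd"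
        using ch insert.prems r(1) unfolding Chains_def by blast+
      then show ?case using r transD[OF trans] by blast
    qed
    obtain p where p: "p \<in> C" "\<forall>q\<in>C. (q, p) \<in> tree F nd" using top[OF fin \<open>C \<noteq> {}\<close>] by blast
    obtain D l where D: "D \<in> F" "l \<le> snd D" "p = nd (fst D) l" using p(1) CF tree_FieldE by blast
    have "C \<subseteq> nd (fst D) ` {..snd D}"
    proof
      fix q assume "q \<in> C"
      then obtain i where "i \<le> l" "q = nd (fst D) i" using p(2) below_nd[OF D(1,2)] D(3) by blast
      then show "q \<in> nd (fst D) ` {..snd D}" using D(2) by auto
    qed
    then have "nd (fst D) ` {..snd D} = C" using C chain[OF D(1)] unfolding maximal_chain_def by metis
    then show ?thesis using D(1) by blast
  qed
  show ?thesis using max conv by blast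
qed

end

text \<open>The new member \<open>(s, l)\<close> shares its centre with \<open>(s, Suc l)\<close>,
  so every node of the coarser tree is coded already. Keeping \<open>nd\<close> makes the coarser
  tree a literal restriction, as \<open>blow_down\<close> demands.\<close>

lemma coding_coarsen:
  assumes "coding F nd" "lowest s l F"
  shows "coding (coarsen s l F) nd"
proof -
  have ex: "\<exists>E\<in>F. fst E = fst D \<and> snd D \<le> snd E" if "D \<in> coarsen s l F" for D
    using that assms(2) unfolding coarsen_def lowest_def by force
  show ?thesis
    unfolding coding_def
  proof (intro ballI allI impI)
    fix D D' i i' assume D: "D \<in> coarsen s l F" "D' \<in> coarsen s l F" and i: "i \<le> snd D" "i' \<le> snd D'"
    obtain E where E: "E \<in> F" "fst E = fst D" "snd D \<le> snd E" using ex[OF D(1)] by blast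
    obtain E' where E': "E' \<in> F" "fst E' = fst D'" "snd D' \<le> snd E'" using ex[OF D(2)] by blast
    have "i \<le> snd E" "i' \<le> snd E'" using i E(3) E'(3) by simp_all
    then show "nd (fst D) i = nd (fst D') i' \<longleftrightarrow> i = i' \<and> near i (fst D) (fst D')"
      using assms(1) E(1) E'(1) unfolding coding_def E(2)[symmetric] E'(2)[symmetric] by blast
  qed
qed

section \<open>Coarsening as a blow-down of leaves\<close>

context
  fixes F nd s l
  assumes low: "lowest s l F" and cod: "coding F nd"
begin

lemma lowest_fam: "fam F" and lowest_mem: "(s, Suc l) \<in> F"
  using low unfolding lowest_def by auto

lemma lowest_closed: "s \<in> carrier A"
  using famD[OF lowest_fam lowest_mem] by simp

lemma kidsD:
  assumes "D \<in> kids s l F"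
  shows "D \<in> F" "snd D = Suc l" "near l (fst D) s"
  using assms unfolding kids_def by auto

lemma kids_lowest: "D \<in> F \<Longrightarrow> near l (fst D) s \<Longrightarrow> Suc l \<le> snd D \<Longrightarrow> D \<in> kids s l F"
  using low unfolding lowest_def kids_def by force

lemma parent_nd: "D \<in> kids s l F \<Longrightarrow> i \<le> l \<Longrightarrow> nd (fst D) i = nd s i"
  using nd_eq[OF lowest_fam cod kidsD(1) lowest_mem, of D i i] kidsD[of D] near_mono[of l "fst D" s i] by simp

lemma parent_Field: "nd s l \<in> Field (tree F nd)"
  using tree_FieldI[OF lowest_fam cod lowest_mem, of l] by simp

text \<open>A node strictly above the parent has level greater than \<open>l\<close> and contains a
  member inside \<open>(s, l)\<close>; by \<open>lowest\<close> that member has level exactly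
  \<open>Suc l\<close>, so the node is its leaf.\<close>

lemma aboveS_parent: "aboveS (tree F nd) (nd s l) = lf nd ` kids s l F"
proof (intro Set.set_eqI iffI)
  fix p assume p: "p \<in> aboveS (tree F nd) (nd s l)"
  then have pe: "p \<noteq> nd s l" "(nd s l, p) \<in> tree F nd" unfolding aboveS_def by auto
  have "p \<in> Field (tree F nd)" using pe(2) by (auto simp: Field_def)
  then obtain D i where D: "D \<in> F" "i \<le> snd D" "p = nd (fst D) i" by (rule tree_FieldE[OF lowest_fam cod])
  have i: "l \<le> i" "near l s (fst D)"
    using pe(2) tree_iff[OF lowest_fam cod lowest_mem D(1) _ D(2), of l] D(3) by simp_all
  have sym: "near l (fst D) s" by (rule near_sym[OF i(2) lowest_closed famD[OF lowest_fam D(1)]])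
  have "i \<noteq> l" using nd_eq[OF lowest_fam cod lowest_mem D(1) _ D(2), of l] pe(1) D(3) i(2) by auto
  then have "D \<in> kids s l F" using kids_lowest[OF D(1) sym] i(1) D(2) by simp
  moreover from this have "i = snd D" using kidsD(2)[of D] D(2) i(1) \<open>i \<noteq> l\<close> by simp
  ultimately show "p \<in> lf nd ` kids s l F" unfolding lf_def D(3) by simp
next
  fix p assume "p \<in> lf nd ` kids s l F"
  then obtain D where D: "D \<in> kids s l F" "p = nd (fst D) (Suc l)" unfolding lf_def using kidsD(2) by auto
  note k = kidsD[OF D(1)]
  have "near l s (fst D)" by (rule near_sym[OF k(3) famD[OF lowest_fam k(1)] lowest_closed])
  then have "(nd s l, p) \<in> tree F nd"
    using tree_iff[OF lowest_fam cod lowest_mem k(1), of l "Suc l"] k(2) D(2) by simp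
  moreover have "p \<noteq> nd s l" using nd_eq[OF lowest_fam cod k(1) lowest_mem, of "Suc l" l] k(2) D(2) by simp
  ultimately show "p \<in> aboveS (tree F nd) (nd s l)" unfolding aboveS_def by simp
qed

lemma children_parent: "children (tree F nd) (nd s l) = lf nd ` kids s l F"
proof -
  have "p = q" if pq: "p \<in> lf nd ` kids s l F" "q \<in> lf nd ` kids s l F" "(p, q) \<in> tree F nd" for p q
  proof -
    obtain D where D: "D \<in> kids s l F" "p = lf nd D" using pq(1) by blast
    then show ?thesis using above_lf[OF lowest_fam cod kidsD(1)[OF D(1)] pq(3)[unfolded D(2)]] by simp
  qed
  then show ?thesis unfolding children_def aboveS_parent by blast
qed

lemma above_parent: "above (tree F nd) (nd s l) = insert (nd s l) (lf nd ` kids s l F)"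
proof -
  have "(nd s l, nd s l) \<in> tree F nd"
    using tree_iff[OF lowest_fam cod lowest_mem lowest_mem, of l l] near_refl[OF lowest_closed] by simp
  then show ?thesis unfolding aboveS_parent[symmetric] above_def aboveS_def by auto
qed

lemma parent_not_kid: "nd s l \<notin> lf nd ` kids s l F"
  unfolding aboveS_parent[symmetric] aboveS_def by simp

text \<open>A child's leaf cannot survive: a remaining member with this node on its path would lie
  in \<open>(s, l)\<close> at level at least \<open>Suc l\<close> and so be a child itself.\<close>

lemma coarsen_nd:
  assumes D: "D \<in> coarsen s l F" "i \<le> snd D"
  shows "\<exists>E\<in>F. fst E = fst D \<and> i \<le> snd E" and "nd (fst D) i \<notin> lf nd ` kids s l F"
proof -
  show ex: "\<exists>E\<in>F. fst E = fst D \<and> i \<le> snd E"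
    using D lowest_mem unfolding coarsen_def by force
  show "nd (fst D) i \<notin> lf nd ` kids s l F"
  proof
    assume "nd (fst D) i \<in> lf nd ` kids s l F"
    then obtain D' where D': "D' \<in> kids s l F" "nd (fst D) i = nd (fst D') (Suc l)"
      unfolding lf_def using kidsD(2) by auto
    note k = kidsD[OF D'(1)]
    obtain E where E: "E \<in> F" "fst E = fst D" "i \<le> snd E" using ex by blast
    have "nd (fst E) i = nd (fst D') (Suc l)" "Suc l \<le> snd D'" using D'(2) E(2) k(2) by simp_all
    then have "i = Suc l \<and> near i (fst E) (fst D')"
      using nd_eq[OF lowest_fam cod E(1) k(1) E(3)] by blast
    then have i: "i = Suc l" "near i (fst D) (fst D')" unfolding E(2) by blast+
    have DA: "fst D \<in> carrier A" using famD[OF lowest_fam E(1)] E(2) by simp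
    have nr: "near l (fst D) s"
      using near_trans[OF near_mono[OF i(2)] k(3) DA famD[OF lowest_fam k(1)] lowest_closed] i(1) by simp
    have "D \<noteq> (s, l)" using D(2) i(1) by auto
    then have "D \<in> F" "D \<notin> kids s l F" using D(1) unfolding coarsen_def by auto
    then show False using kids_lowest[OF _ nr] D(2) i(1) by simp
  qed
qed

lemma coarsen_nd_iff:
  assumes D: "D \<in> coarsen s l F" "D' \<in> coarsen s l F" "i \<le> snd D" "i' \<le> snd D'"
  shows "(nd (fst D) i, nd (fst D') i') \<in> tree (coarsen s l F) nd \<longleftrightarrow> (nd (fst D) i, nd (fst D') i') \<in> tree F nd"
proof -
  obtain E where E: "E \<in> F" "fst E = fst D" "i \<le> snd E" using coarsen_nd(1)[OF D(1,3)] by blast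
  obtain E' where E': "E' \<in> F" "fst E' = fst D'" "i' \<le> snd E'" using coarsen_nd(1)[OF D(2,4)] by blast
  show ?thesis
    using tree_iff[OF lowest_fam cod E(1) E'(1) E(3) E'(3)] E(2) E'(2)
      tree_iff[OF fam_coarsen[OF low] coding_coarsen[OF cod low] D] by simp
qed

lemma Field_coarsen: "Field (tree (coarsen s l F) nd) = Field (tree F nd) - lf nd ` kids s l F"
proof (intro Set.set_eqI iffI)
  fix p assume "p \<in> Field (tree (coarsen s l F) nd)"
  then obtain D i where D: "D \<in> coarsen s l F" "i \<le> snd D" "p = nd (fst D) i"
    by (rule tree_FieldE[OF fam_coarsen[OF low] coding_coarsen[OF cod low]])
  obtain E where "E \<in> F" "fst E = fst D" "i \<le> snd E" using coarsen_nd(1)[OF D(1,2)] by blast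
  then show "p \<in> Field (tree F nd) - lf nd ` kids s l F"
    using tree_FieldI[OF lowest_fam cod, of E i] coarsen_nd(2)[OF D(1,2)] D(3) by simp
next
  fix p assume p: "p \<in> Field (tree F nd) - lf nd ` kids s l F"
  then have "p \<in> Field (tree F nd)" by blast
  then obtain D i where D: "D \<in> F" "i \<le> snd D" "p = nd (fst D) i" by (rule tree_FieldE[OF lowest_fam cod])
  note FI = tree_FieldI[OF fam_coarsen[OF low] coding_coarsen[OF cod low]]
  show "p \<in> Field (tree (coarsen s l F) nd)"
  proof (cases "D \<in> kids s l F")
    case True
    have "i \<noteq> snd D" using p True D(3) unfolding lf_def by blast
    then have "i \<le> l" using kidsD(2)[OF True] D(2) by simp
    then show ?thesis using FI[of "(s, l)" i] parent_nd[OF True] D(3) by (simp add: coarsen_def)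
  next
    case False
    then show ?thesis using FI[of D i] D by (simp add: coarsen_def)
  qed
qed

lemma tree_coarsen: "tree (coarsen s l F) nd = Restr (tree F nd) (Field (tree F nd) - lf nd ` kids s l F)"
proof -
  let ?X = "Field (tree (coarsen s l F) nd)"
  have iff: "pq \<in> tree (coarsen s l F) nd \<longleftrightarrow> pq \<in> tree F nd" if pq: "pq \<in> ?X \<times> ?X" for pq
  proof -
    note FE = tree_FieldE[OF fam_coarsen[OF low] coding_coarsen[OF cod low]]
    obtain p q where e: "pq = (p, q)" "p \<in> ?X" "q \<in> ?X" using pq by blast
    obtain D i where D: "D \<in> coarsen s l F" "i \<le> snd D" "p = nd (fst D) i" using e(2) by (rule FE)
    obtain D' i' where D': "D' \<in> coarsen s l F" "i' \<le> snd D'" "q = nd (fst D') i'" using e(3) by (rule FE)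
    show ?thesis unfolding e(1) D(3) D'(3) by (rule coarsen_nd_iff[OF D(1) D'(1) D(2) D'(2)])
  qed
  have "tree (coarsen s l F) nd \<subseteq> ?X \<times> ?X" by (auto simp: Field_def)
  then have "tree (coarsen s l F) nd = Restr (tree F nd) ?X"
    using iff by blast
  then show ?thesis unfolding Field_coarsen .
qed

abbreviation blow :: "nat \<Rightarrow> nat" where
  "blow p \<equiv> (if p \<in> lf nd ` kids s l F then nd s l else p)"

lemma blow_lf:
  assumes D: "D \<in> F"
  shows "\<exists>E\<in>coarsen s l F. blow (lf nd D) = lf nd E \<and> le D E"
proof (cases "D \<in> kids s l F")
  case True
  then have "blow (lf nd D) = lf nd (s, l)" unfolding lf_def by simp
  then show ?thesis using kids_le[OF low True] unfolding coarsen_def by blast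
next
  case False
  then have DF: "D \<in> coarsen s l F" using D unfolding coarsen_def by simp
  then have "blow (lf nd D) = lf nd D" using coarsen_nd(2)[OF DF order_refl] unfolding lf_def by simp
  then show ?thesis using DF near_refl[OF famD[OF lowest_fam D]] unfolding le_def by blast
qed

text \<open>The one fiber with several nodes is that of the parent; by \<open>above_parent\<close>
  the parent and its children form a whole subtree. A path ending in a child is mapped onto the path
  ending in the parent.\<close>

lemma blow_tree_morphism: "tree_morphism (tree F nd) (tree (coarsen s l F) nd) blow"
  unfolding tree_morphism_def Let_def
proof (intro conjI allI impI ballI)
  note F2 = fam_coarsen[OF low] coding_coarsen[OF cod low]
  have sl: "(s, l) \<in> coarsen s l F" by (simp add: coarsen_def)
  have ee: "(nd s l, nd s l) \<in> tree (coarsen s l F) nd"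
    using tree_iff[OF F2 sl sl, of l l] near_refl[OF lowest_closed] by simp
  show "blow ` Field (tree F nd) \<subseteq> Field (tree (coarsen s l F) nd)"
    unfolding Field_coarsen using parent_Field parent_not_kid by auto
  {
    fix p q assume pq: "(p, q) \<in> tree F nd"
    show "(blow p, blow q) \<in> tree (coarsen s l F) nd"
    proof (cases "p \<in> lf nd ` kids s l F")
      case True
      then have "q = p" using above_lf[OF lowest_fam cod kidsD(1)] pq by blast
      then show ?thesis using True ee by simp
    next
      case False
      note p = this
      show ?thesis
      proof (cases "q \<in> lf nd ` kids s l F")
        case True
        then obtain D where D: "D \<in> kids s l F" "q = lf nd D" by blast
        note k = kidsD[OF D(1)]
        obtain i where i: "i \<le> snd D" "p = nd (fst D) i"
          using pq below_nd[OF lowest_fam cod k(1) order_refl] D(2) unfolding lf_def by blast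
        have "i \<noteq> snd D" using p D(1) i(2) unfolding lf_def by blast
        then have "i \<le> l" using i(1) k(2) by simp
        then have "(p, nd s l) \<in> tree (coarsen s l F) nd"
          using below_nd[OF F2 sl, of l p] parent_nd[OF D(1)] i(2) by auto
        then show ?thesis using True p by simp
      next
        case False
        have "p \<in> Field (tree F nd)" "q \<in> Field (tree F nd)" using pq by (auto simp: Field_def)
        then show ?thesis using pq p False unfolding tree_coarsen by simp
      qed
    qed
  }
  {
    fix C assume "maximal_chain (tree F nd) C"
    then obtain D where D: "D \<in> F" "C = nd (fst D) ` {..snd D}"
      using maximal_chain_tree[OF lowest_fam cod] by blast
    have id: "blow ` nd (fst E) ` {..i} = nd (fst E) ` {..i}" if "E \<in> coarsen s l F" "i \<le> snd E" for E i
    proof -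
      have "blow (nd (fst E) i') = nd (fst E) i'" if "i' \<le> i" for i'
        using coarsen_nd(2)[OF \<open>E \<in> coarsen s l F\<close> order_trans[OF that \<open>i \<le> snd E\<close>]] by simp
      then show ?thesis unfolding image_image by (intro image_cong) simp_all
    qed
    have "\<exists>E\<in>coarsen s l F. blow ` C = nd (fst E) ` {..snd E}"
    proof (cases "D \<in> kids s l F")
      case True
      have "C = insert (lf nd D) (nd (fst D) ` {..l})"
        unfolding D(2) lf_def kidsD(2)[OF True] atMost_Suc by simp
      also have "nd (fst D) ` {..l} = nd s ` {..l}" using parent_nd[OF True] by (intro image_cong) auto
      finally have "blow ` C = insert (blow (lf nd D)) (blow ` nd s ` {..l})" by simp
      also have "blow ` nd s ` {..l} = nd s ` {..l}" using id[OF sl, of l] by simp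
      also have "insert (blow (lf nd D)) (nd s ` {..l}) = nd s ` {..l}" using True by auto
      finally have eq: "blow ` C = nd s ` {..l}" .
      show ?thesis by (rule bexI[OF _ sl]) (simp only: eq fst_conv snd_conv)
    next
      case False
      then have "D \<in> coarsen s l F" using D(1) unfolding coarsen_def by simp
      then show ?thesis using id[of D "snd D"] D(2) by blast
    qed
    then show "maximal_chain (tree (coarsen s l F) nd) (blow ` C)"
      unfolding maximal_chain_tree[OF F2] .
  }
  {
    fix e' assume e': "e' \<in> Field (tree F nd)"
    show "{p \<in> Field (tree F nd). blow p = blow e'} = {e'} \<or>
        maximal_subtree (tree F nd) {p \<in> Field (tree F nd). blow p = blow e'}"
    proof (cases "blow e' = nd s l")
      case True
      have "{p \<in> Field (tree F nd). blow p = nd s l} = insert (nd s l) (lf nd ` kids s l F)"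
        using parent_Field lf_Field[OF lowest_fam cod kidsD(1)] by auto
      then show ?thesis unfolding True above_parent[symmetric] maximal_subtree_def using parent_Field by auto
    next
      case False
      then have "{p \<in> Field (tree F nd). blow p = blow e'} = {e'}" using e' by (auto split: if_splits)
      then show ?thesis by blast
    qed
  }
qed

text \<open>The congruence required of the labels at a leaf is containment of its disc in the disc
  of its image, supplied by \<open>blow_lf\<close>.\<close>

lemma blow_down_coarsen:
  "blow_down A x (tree F nd, label F nd) (tree (coarsen s l F) nd, label (coarsen s l F) nd) (nd s l) blow"
proof -
  note F2 = fam_coarsen[OF low] coding_coarsen[OF cod low]
  have "label F nd p \<ominus>\<^bsub>A\<^esub> label (coarsen s l F) nd (blow p)
      \<in> PIdl\<^bsub>A\<^esub> (x [^]\<^bsub>A\<^esub> level (tree (coarsen s l F) nd) (blow p))"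
    if p: "p \<in> leaves (tree F nd)" for p
  proof -
    obtain D where D: "D \<in> F" "p = lf nd D" using p leaves_tree[OF lowest_fam cod] by blast
    obtain E where E: "E \<in> coarsen s l F" "blow p = lf nd E" "le D E" using blow_lf[OF D(1)] D(2) by blast
    show ?thesis
      using E(3) unfolding E(2) unfolding level_lf[OF F2 E(1)] label_lf[OF F2 E(1)] D(2) label_lf[OF lowest_fam cod D(1)]
        le_def near_def by blast
  qed
  moreover have "nd s l \<notin> leaves (tree F nd)"
  proof -
    have "(s, Suc l) \<in> kids s l F" using lowest_mem near_refl[OF lowest_closed] unfolding kids_def by simp
    then have "aboveS (tree F nd) (nd s l) \<noteq> {}" unfolding aboveS_parent by blast
    then show ?thesis unfolding leaves_def by simp
  qed
  moreover have "lf nd ` kids s l F \<subseteq> leaves (tree F nd)"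
    unfolding leaves_tree[OF lowest_fam cod] using kidsD(1) by blast
  ultimately show ?thesis
    unfolding blow_down_def ltree_morphism_def case_prod_conv children_parent
    using blow_tree_morphism tree_labelled[OF lowest_fam cod] tree_labelled[OF F2] parent_Field tree_coarsen
    by (intro conjI ballI impI) (simp_all add: subset_iff)
qed

end

end

section \<open>Charts and gluing\<close>

context dfs_base
begin

context
  fixes S :: "('a, 'b, 'n) aff_scheme" and F j
  assumes m: "model S F j"
begin

lemma model_idempotents:
  obtains e where "\<And>D. e D \<in> carrier (Coord S)"
    and "\<And>D E. E \<in> F \<Longrightarrow> \<rho> E (j (e D)) = (if E = D then \<one>\<^bsub>P\<^esub> else \<zero>\<^bsub>P\<^esub>)"
proof -
  have "\<exists>e\<in>carrier (Coord S). \<forall>E\<in>F. \<rho> E (j e) = (if E = D then \<one>\<^bsub>P\<^esub> else \<zero>\<^bsub>P\<^esub>)" for D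
  proof -
    obtain y where y: "y \<in> B F" "\<And>E. E \<in> F \<Longrightarrow> \<rho> E y = (if E \<in> {D} then \<one>\<^bsub>P\<^esub> else \<zero>\<^bsub>P\<^esub>)"
      by (rule idempotent[OF model_fam[OF m], of "{D}"]) (rule that)
    obtain e where "e \<in> carrier (Coord S)" "j e = y" using model_preimage[OF m y(1)] by blast
    then show ?thesis using y(2) by (intro bexI[of _ e] ballI) simp_all
  qed
  then obtain e where e: "\<forall>D. e D \<in> carrier (Coord S) \<and> (\<forall>E\<in>F. \<rho> E (j (e D)) = (if E = D then \<one>\<^bsub>P\<^esub> else \<zero>\<^bsub>P\<^esub>))"
    by metis
  show thesis by (rule that[of e]) (use e in blast)+
qed

lemma model_chart:
  assumes D: "D \<in> F"
    and e: "e \<in> carrier (Coord S)" "\<And>E. E \<in> F \<Longrightarrow> \<rho> E (j e) = (if E = D then \<one>\<^bsub>P\<^esub> else \<zero>\<^bsub>P\<^esub>)"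
  shows "open_immersion (Coord S) (UP A) (\<lambda>b. coord D (j b))"
    and "comap (Coord S) (\<lambda>b. coord D (j b)) ` prime_spec (UP A) = {Q \<in> prime_spec (Coord S). \<not> {str S x, e} \<subseteq> Q}"
proof -
  note DA = famD[OF model_fam[OF m] D]
  have G: "{D} \<subseteq> F" "{D} \<noteq> {}" using D by simp_all
  have im: "\<Phi> D ` carrier (UP A) = B {D}" unfolding B_single R_def ..
  have e': "\<rho> E (j e) = (if E \<in> {D} then \<one>\<^bsub>P\<^esub> else \<zero>\<^bsub>P\<^esub>)" if "E \<in> F" for E using e(2)[OF that] by simp
  have f: "\<Phi> D (coord D (j b)) = j b" if "b \<in> carrier (Coord S)" for b
    by (rule \<Phi>_coord[OF DA model_memR[OF m that D]])
  note loc = model_localizing[OF m G, where C = "UP A" and g = "\<Phi> D" and f = "\<lambda>b. coord D (j b)",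
      OF UA.domain_axioms \<Phi>_hom[OF DA] \<Phi>_inj[OF DA] im model_chart_hom[OF m D] f e(1) e']
  show "open_immersion (Coord S) (UP A) (\<lambda>b. coord D (j b))" by (rule loc(1))
  show "comap (Coord S) (\<lambda>b. coord D (j b)) ` prime_spec (UP A) = {Q \<in> prime_spec (Coord S). \<not> {str S x, e} \<subseteq> Q}"
    by (rule loc(2))
qed

lemma model_chart_str:
  assumes D: "D \<in> F" and a: "a \<in> carrier A"
  shows "coord D (j (str S a)) = mon a 0"
  using coord_\<Phi>[OF famD[OF model_fam[OF m] D], of "mon a 0"] \<Phi>_const[OF famD[OF model_fam[OF m] D] a]
    model_str[OF m a] a by simp

lemma model_chart_punctured:
  assumes D: "D \<in> F"
  shows "comap (Coord S) (\<lambda>b. coord D (j b)) ` {Q \<in> prime_spec (UP A). mon x 0 \<notin> Q} =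
    {Q \<in> prime_spec (Coord S). str S x \<notin> Q}"
proof -
  obtain e where e: "\<And>D. e D \<in> carrier (Coord S)"
    "\<And>D E. E \<in> F \<Longrightarrow> \<rho> E (j (e D)) = (if E = D then \<one>\<^bsub>P\<^esub> else \<zero>\<^bsub>P\<^esub>)" by (rule model_idempotents) (rule that)
  let ?h = "comap (Coord S) (\<lambda>b. coord D (j b))"
  have x: "str S x \<in> ?h Q \<longleftrightarrow> mon x 0 \<in> Q" for Q
    unfolding comap_def using model_chart_str[OF D x_closed] model_str_closed[OF m x_closed] by simp
  have "?h ` {Q \<in> prime_spec (UP A). mon x 0 \<notin> Q} = {Q \<in> ?h ` prime_spec (UP A). str S x \<notin> Q}"
    using x by blast
  also have "\<dots> = {Q \<in> prime_spec (Coord S). str S x \<notin> Q}"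
    by (subst model_chart(2)[OF D e(1)[of D] e(2)]) blast+
  finally show ?thesis .
qed

text \<open>A prime containing \<open>x\<close> and all \<open>e D\<close> would contain the sum of
  the \<open>e D\<close>, which is 1 modulo \<open>x\<close>, and hence 1.\<close>

lemma model_charts_cover:
  assumes e: "\<And>D. e D \<in> carrier (Coord S)"
    "\<And>D E. E \<in> F \<Longrightarrow> \<rho> E (j (e D)) = (if E = D then \<one>\<^bsub>P\<^esub> else \<zero>\<^bsub>P\<^esub>)"
    and Q: "primeideal Q (Coord S)"
  shows "\<exists>D\<in>F. \<not> {str S x, e D} \<subseteq> Q"
proof (rule ccontr)
  interpret j: ring_hom_cring "Coord S" K j by (rule model_ring_hom_cring[OF m])
  interpret Q: primeideal Q "Coord S" by fact
  note fam = model_fam[OF m]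
  assume neg: "\<not> ?thesis"
  have "F \<noteq> {}" using fam unfolding fam_def by blast
  then have xQ: "str S x \<in> Q" using neg by blast
  have "\<exists>u\<in>Q. \<forall>E\<in>F. \<rho> E (j u) = (if E \<in> G then \<one>\<^bsub>P\<^esub> else \<zero>\<^bsub>P\<^esub>)" if "finite G" "G \<subseteq> F" for G
    using that
  proof (induct G)
    case empty
    have "\<forall>E\<in>F. \<rho> E (j \<zero>\<^bsub>Coord S\<^esub>) = \<zero>\<^bsub>P\<^esub>" using \<rho>_zero[OF famD[OF fam]] by simp
    then show ?case by (intro bexI[OF _ Q.zero_closed]) simp
  next
    case (insert D G)
    then obtain u where u: "u \<in> Q" "\<forall>E\<in>F. \<rho> E (j u) = (if E \<in> G then \<one>\<^bsub>P\<^esub> else \<zero>\<^bsub>P\<^esub>)" by auto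
    have eD: "e D \<in> Q" using neg insert.prems by blast
    have uS: "u \<in> carrier (Coord S)" using u(1) Q.a_subset by blast
    have "\<rho> E (j (u \<oplus>\<^bsub>Coord S\<^esub> e D)) = (if E \<in> insert D G then \<one>\<^bsub>P\<^esub> else \<zero>\<^bsub>P\<^esub>)" if E: "E \<in> F" for E
    proof -
      have "\<rho> E (j (u \<oplus>\<^bsub>Coord S\<^esub> e D)) = \<rho> E (j u) \<oplus>\<^bsub>P\<^esub> \<rho> E (j (e D))"
        using \<rho>_add[OF famD[OF fam E] model_memR[OF m uS E] model_memR[OF m e(1) E]] uS e(1) by simp
      then show ?thesis using u(2) E e(2)[OF E] insert.hyps(2) by auto
    qed
    then show ?case using Q.a_closed[OF u(1) eD] by blast
  qed
  then obtain u where u: "u \<in> Q" "\<forall>E\<in>F. \<rho> E (j u) = \<one>\<^bsub>P\<^esub>" using fam_finite[OF fam] by force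
  have uS: "u \<in> carrier (Coord S)" using u(1) Q.a_subset by blast
  have "\<one>\<^bsub>Coord S\<^esub> \<ominus>\<^bsub>Coord S\<^esub> u \<in> PIdl\<^bsub>Coord S\<^esub> (str S x)"
  proof -
    have "\<rho> E (j (\<one>\<^bsub>Coord S\<^esub> \<ominus>\<^bsub>Coord S\<^esub> u)) = \<zero>\<^bsub>P\<^esub>" if E: "E \<in> F" for E
    proof -
      note EA = famD[OF fam E]
      have "j (\<one>\<^bsub>Coord S\<^esub> \<ominus>\<^bsub>Coord S\<^esub> u) = \<one>\<^bsub>K\<^esub> \<ominus>\<^bsub>K\<^esub> j u" using uS by (simp add: j.R.minus_eq K.P.minus_eq)
      then show ?thesis
        using \<rho>_minus[OF EA R_one[OF EA] model_memR[OF m uS E]] \<rho>_one[OF EA] u(2) E by (simp add: P.P.r_right_minus_eq)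
    qed
    then show ?thesis using mem_PIdl_strx_iff[OF m] uS by simp
  qed
  moreover have "PIdl\<^bsub>Coord S\<^esub> (str S x) \<subseteq> Q" by (rule j.R.cgenideal_minimal[OF Q.is_ideal xQ])
  ultimately have "\<one>\<^bsub>Coord S\<^esub> \<ominus>\<^bsub>Coord S\<^esub> u \<in> Q" by blast
  then have "u \<oplus>\<^bsub>Coord S\<^esub> (\<one>\<^bsub>Coord S\<^esub> \<ominus>\<^bsub>Coord S\<^esub> u) \<in> Q" by (rule Q.a_closed[OF u(1)])
  moreover have "u \<oplus>\<^bsub>Coord S\<^esub> (\<one>\<^bsub>Coord S\<^esub> \<ominus>\<^bsub>Coord S\<^esub> u) = \<one>\<^bsub>Coord S\<^esub>" using uS j.R.one_closed by algebra
  ultimately show False using Q.one_imp_carrier Q.I_notcarr by metis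
qed

text \<open>The product of \<open>e D\<close> and \<open>e E\<close> vanishes on every component, so
  it is a multiple of \<open>x\<close>.\<close>

lemma model_charts_disjoint:
  assumes e: "\<And>D. e D \<in> carrier (Coord S)"
    "\<And>D E. E \<in> F \<Longrightarrow> \<rho> E (j (e D)) = (if E = D then \<one>\<^bsub>P\<^esub> else \<zero>\<^bsub>P\<^esub>)"
    and Q: "primeideal Q (Coord S)" and DE: "D \<noteq> E" and x: "str S x \<in> Q"
  shows "e D \<in> Q \<or> e E \<in> Q"
proof -
  interpret j: ring_hom_cring "Coord S" K j by (rule model_ring_hom_cring[OF m])
  interpret Q: primeideal Q "Coord S" by fact
  have "\<rho> G (j (e D \<otimes>\<^bsub>Coord S\<^esub> e E)) = \<zero>\<^bsub>P\<^esub>" if G: "G \<in> F" for G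
  proof -
    have "\<rho> G (j (e D \<otimes>\<^bsub>Coord S\<^esub> e E)) = \<rho> G (j (e D)) \<otimes>\<^bsub>P\<^esub> \<rho> G (j (e E))"
      using \<rho>_mult[OF famD[OF model_fam[OF m] G] model_memR[OF m e(1) G] model_memR[OF m e(1) G]] e(1) by simp
    then show ?thesis using e(2)[OF G] DE by auto
  qed
  then have "e D \<otimes>\<^bsub>Coord S\<^esub> e E \<in> PIdl\<^bsub>Coord S\<^esub> (str S x)" using mem_PIdl_strx_iff[OF m] e(1) by simp
  then have "e D \<otimes>\<^bsub>Coord S\<^esub> e E \<in> Q" using j.R.cgenideal_minimal[OF Q.is_ideal x] by blast
  then show ?thesis using Q.I_prime e(1) by blast
qed

definition charts :: "('a \<Rightarrow> nat \<Rightarrow> nat) \<Rightarrow> nat \<Rightarrow> 'b \<Rightarrow> nat \<Rightarrow> 'a" where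
  "charts nd i b = coord (inv_into F (lf nd) i) (j b)"

lemma charts_lf: "coding F nd \<Longrightarrow> D \<in> F \<Longrightarrow> charts nd (lf nd D) = (\<lambda>b. coord D (j b))"
  unfolding charts_def by (rule ext) (simp add: inv_into_f_f[OF lf_inj[OF model_fam[OF m]]])

text \<open>The chart of \<open>D\<close> reads an element \<open>y\<close> of \<open>K\<close> as
  \<open>\<Psi> D y\<close>, a transition from the origin chart; the gluing formula between two
  leaves is thus the cocycle rule through the origin.\<close>

lemma model_glued:
  assumes cod: "coding F nd"
  shows "glued_surface A x (tree F nd, label F nd) S (charts nd)"
proof -
  note fam = model_fam[OF m]
  note lv = leaves_tree[OF fam cod]
  obtain e where e: "\<And>D. e D \<in> carrier (Coord S)"
    "\<And>D E. E \<in> F \<Longrightarrow> \<rho> E (j (e D)) = (if E = D then \<one>\<^bsub>P\<^esub> else \<zero>\<^bsub>P\<^esub>)" by (rule model_idempotents) (rule that)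
  have im: "comap (Coord S) (charts nd (lf nd D)) ` prime_spec (UP A) =
      {Q \<in> prime_spec (Coord S). \<not> {str S x, e D} \<subseteq> Q}" if "D \<in> F" for D
    unfolding charts_lf[OF cod that] by (rule model_chart(2)[OF that e])
  show ?thesis
    unfolding glued_surface_def case_prod_conv lv ball_simps
  proof (intro conjI ballI impI)
    show "affine_over A S" by (rule model_affine[OF m])
    fix D assume D: "D \<in> F"
    show "morphism_over A (affine_line A) S (charts nd (lf nd D))"
      unfolding morphism_over_def charts_lf[OF cod D] affine_line_def
      using model_chart_hom[OF m D] model_chart_str[OF D] by simp
    show "open_embedding (affine_line A) S (charts nd (lf nd D))"
      unfolding open_embedding_def charts_lf[OF cod D] affine_line_def
      using model_chart(1)[OF D e] by simp
  next
    have "(\<Union>D\<in>F. {Q \<in> prime_spec (Coord S). \<not> {str S x, e D} \<subseteq> Q}) = prime_spec (Coord S)"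
      using model_charts_cover[OF e] unfolding prime_spec_def by blast
    then show "(\<Union>i\<in>lf nd ` F. comap (Coord S) (charts nd i) ` prime_spec (UP A)) = prime_spec (Coord S)"
      unfolding UN_simps using im by simp
  next
    fix D E assume DE: "D \<in> F" "E \<in> F" "lf nd D \<noteq> lf nd E"
    then have ne: "D \<noteq> E" by blast
    have "{Q \<in> prime_spec (Coord S). \<not> {str S x, e D} \<subseteq> Q} \<inter> {Q \<in> prime_spec (Coord S). \<not> {str S x, e E} \<subseteq> Q}
        = {Q \<in> prime_spec (Coord S). str S x \<notin> Q}"
      using model_charts_disjoint[OF e _ ne] unfolding prime_spec_def by blast
    then show "comap (Coord S) (charts nd (lf nd D)) ` prime_spec (UP A) \<inter>
        comap (Coord S) (charts nd (lf nd E)) ` prime_spec (UP A) =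
      comap (Coord S) (charts nd (lf nd D)) ` {Q \<in> prime_spec (UP A). str (affine_line A) x \<notin> Q}"
      unfolding im[OF DE(1)] im[OF DE(2)] unfolding charts_lf[OF cod DE(1)] affine_line_def
      using model_chart_punctured[OF DE(1)] by simp
    fix g assume g: "g \<in> carrier (Coord S)"
    note gD = model_memR[OF m g DE(1)] and gE = model_memR[OF m g DE(2)]
    show "\<chi> (level (tree F nd) (lf nd D)) (label F nd (lf nd D)) (level (tree F nd) (lf nd E)) (label F nd (lf nd E))
        (\<Lambda> (charts nd (lf nd D) g)) = \<Lambda> (charts nd (lf nd E) g)"
      unfolding charts_lf[OF cod DE(1)] charts_lf[OF cod DE(2)] level_lf[OF fam cod DE(1)] level_lf[OF fam cod DE(2)]
        label_lf[OF fam cod DE(1)] label_lf[OF fam cod DE(2)]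
        \<Lambda>_coord[OF famD[OF fam DE(1)] gD] \<Lambda>_coord[OF famD[OF fam DE(2)] gE] \<Psi>_def
      by (rule \<chi>_trans[OF A.zero_closed famD[OF fam DE(1)] famD[OF fam DE(2)] model_closedK[OF m g]])
  qed
qed

end

end

section \<open>Descent from a family to a coarser one\<close>

context disc_system
begin

definition covers :: "('a \<times> nat) set \<Rightarrow> ('a \<times> nat) set \<Rightarrow> bool" where
  "covers G F \<longleftrightarrow> (\<forall>D\<in>G. \<exists>E\<in>F. le D E) \<and> (\<forall>E\<in>F. \<exists>D\<in>G. le D E)"

text \<open>Containment at equal levels is equality of cosets. The rings coincide although the
  families may still differ in the chosen centres.\<close>

lemma covers_same_level:
  assumes G: "fam G" and F: "fam F" and cov: "covers G F"
    and lev: "\<And>D E. D \<in> G \<Longrightarrow> E \<in> F \<Longrightarrow> le D E \<Longrightarrow> snd D \<le> snd E"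
  shows "B G = B F"
proof -
  have R: "R D = R E" if "D \<in> G" "E \<in> F" "le D E" for D E
  proof -
    note DA = famD[OF G that(1)] and EA = famD[OF F that(2)]
    have "snd D = snd E" using lev[OF that] that(3) unfolding le_def by simp
    moreover have "near (snd E) (fst E) (fst D)" by (rule near_sym[OF _ DA EA]) (use that(3) in \<open>simp add: le_def\<close>)
    ultimately have "le E D" unfolding le_def by simp
    then show ?thesis using le_imp_subset[OF EA DA that(3)] le_imp_subset[OF DA EA] by blast
  qed
  show ?thesis
  proof
    show "B G \<subseteq> B F"
    proof
      fix y assume y: "y \<in> B G"
      have "y \<in> R E" if E: "E \<in> F" for E
      proof -
        obtain D where D: "D \<in> G" "le D E" using cov E unfolding covers_def by blast
        show ?thesis using B_memD[OF y D(1)] R[OF D(1) E D(2)] by simp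
      qed
      then show "y \<in> B F" unfolding B_def by blast
    qed
    show "B F \<subseteq> B G"
    proof
      fix y assume y: "y \<in> B F"
      have "y \<in> R D" if D: "D \<in> G" for D
      proof -
        obtain E where E: "E \<in> F" "le D E" using cov D unfolding covers_def by blast
        show ?thesis using B_memD[OF y E(1)] R[OF D E] by simp
      qed
      then show "y \<in> B G" unfolding B_def by blast
    qed
  qed
qed

text \<open>Among the discs of \<open>G\<close> that are strictly smaller than a disc of
  \<open>F\<close> around them, one of maximal level is taken. Its parent still lies in the disc of
  \<open>F\<close>, and maximality leaves nothing deeper than its children inside the
  parent.\<close>

lemma covers_lowest:
  assumes G: "fam G" and F: "fam F" and cov: "covers G F" and neq: "B G \<noteq> B F"
  obtains s l where "lowest s l G" "covers (coarsen s l G) F"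
proof -
  let ?X = "{D \<in> G. \<exists>E\<in>F. le D E \<and> snd E < snd D}"
  have "?X \<noteq> {}"
  proof
    assume empty: "?X = {}"
    have "snd D \<le> snd E" if "D \<in> G" "E \<in> F" "le D E" for D E
      using empty that not_le by blast
    then show False using covers_same_level[OF G F cov] neq by blast
  qed
  have fin: "finite (snd ` ?X)" using fam_finite[OF G] by simp
  have "Max (snd ` ?X) \<in> snd ` ?X" by (rule Max_in[OF fin]) (use \<open>?X \<noteq> {}\<close> in simp)
  then obtain D where DX: "D \<in> ?X" "Max (snd ` ?X) = snd D" by (rule imageE) (rule that)
  have Dmax: "snd D' \<le> snd D" if "D' \<in> ?X" for D'
    unfolding DX(2)[symmetric] by (rule Max_ge[OF fin imageI[OF that]])
  obtain E where E: "E \<in> F" "le D E" "snd E < snd D" using DX(1) by blast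
  obtain s l where D: "D = (s, Suc l)" using E(3) by (cases D) (metis not_less0 old.nat.exhaust snd_conv)
  have DG: "(s, Suc l) \<in> G" using DX(1) D by blast
  have sA: "s \<in> carrier A" using famD[OF G DG] by simp
  note EA = famD[OF F E(1)]
  have El: "snd E \<le> l" "near (snd E) s (fst E)" using E(2,3) D unfolding le_def by simp_all
  \<comment> \<open>Members of \<open>G\<close> with centre in the parent all lie in the same
    \<open>E\<close>, because discs of \<open>F\<close> that meet coincide. So replacing the
    children by the parent keeps the cover intact.\<close>
  have same: "E' = E" if D': "D' \<in> G" "near l (fst D') s" and E': "E' \<in> F" "le D' E'" for D' E'
  proof -
    note D'A = famD[OF G D'(1)] and E'A = famD[OF F E'(1)]
    let ?i = "min (snd E') (snd E)"
    have "near ?i (fst E') (fst D')"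
      using near_mono[OF near_sym[OF _ D'A E'A], of "snd E'"] E'(2) by (simp add: le_def)
    moreover have "near ?i (fst D') s" by (rule near_mono[OF D'(2)]) (use El(1) in simp)
    ultimately have "near ?i (fst E') s" by (rule near_trans[OF _ _ E'A D'A sA])
    moreover have "near ?i s (fst E)" by (rule near_mono[OF El(2)]) simp
    ultimately have "near ?i (fst E') (fst E)" by (rule near_trans[OF _ _ E'A sA EA])
    then show ?thesis by (rule fam_disjoint[OF F E'(1) E(1)])
  qed
  have low: "lowest s l G"
    unfolding lowest_def
  proof (intro conjI ballI impI)
    show "fam G" "(s, Suc l) \<in> G" by (rule G, rule DG)
    fix D' assume D': "D' \<in> G" "near l (fst D') s"
    obtain E' where E': "E' \<in> F" "le D' E'" using cov D'(1) unfolding covers_def by blast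
    then have le: "le D' E" using same[OF D'] by blast
    show "snd D' \<le> Suc l"
    proof (rule ccontr)
      assume "\<not> snd D' \<le> Suc l"
      then have "D' \<in> ?X" using D'(1) E(1) le El(1) by auto
      then show False using Dmax[of D'] D \<open>\<not> snd D' \<le> Suc l\<close> by simp
    qed
  qed
  have slE: "le (s, l) E" using El unfolding le_def by simp
  have "covers (coarsen s l G) F"
    unfolding covers_def
  proof (intro conjI ballI)
    fix D' assume D': "D' \<in> coarsen s l G"
    show "\<exists>E\<in>F. le D' E"
    proof (cases "D' = (s, l)")
      case True
      then show ?thesis using slE E(1) by blast
    next
      case False
      then show ?thesis using D' cov unfolding coarsen_def covers_def by blast
    qed
  next
    fix E' assume E': "E' \<in> F"
    then obtain D' where D': "D' \<in> G" "le D' E'" using cov unfolding covers_def by blast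
    show "\<exists>D\<in>coarsen s l G. le D E'"
    proof (cases "D' \<in> kids s l G")
      case True
      then have "E' = E" using same[OF D'(1) _ E' D'(2)] unfolding kids_def by blast
      then show ?thesis using slE unfolding coarsen_def by blast
    next
      case False
      then show ?thesis using D' unfolding coarsen_def by blast
    qed
  qed
  then show thesis by (rule that[OF low])
qed

end

lemma isomorphism_over_id: "isomorphism_over A S S id"
  unfolding isomorphism_over_def morphism_over_def ring_iso_def by (auto intro!: ring_hom_memI)

context dfs_base
begin

text \<open>The two trees share one coding, and the surfaces themselves serve as the glued surfaces,
  so both isomorphisms are identities. The chart formula of the induced morphism is once more the
  cocycle rule.\<close>

lemma coarsen_fibered_modification:
  fixes S' :: "('a, 'c) aff" and S :: "('a, 'b) aff"
  assumes m': "model S' F j'" and m: "model S (coarsen s l F) j" and low: "lowest s l F"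
    and f: "f \<in> ring_hom (Coord S) (Coord S')" "\<And>b. b \<in> carrier (Coord S) \<Longrightarrow> j' (f b) = j b"
  shows "fibered_modification A x S' S f"
proof -
  obtain nd where cod: "coding F nd" using ex_coding[OF model_fam[OF m']] by blast
  note cod2 = coding_coarsen[OF cod low]
  note F = model_fam[OF m'] and F2 = model_fam[OF m]
  let ?G = "(tree F nd, label F nd)" and ?G2 = "(tree (coarsen s l F) nd, label (coarsen s l F) nd)"
  let ?b = "\<lambda>p. if p \<in> lf nd ` kids s l F then nd s l else p"
  have mor: "DFS_morphism A x S' S f" by (rule models_morphism[OF m' m f])
  have blow: "blow_down A x ?G ?G2 (nd s l) ?b" by (rule blow_down_coarsen[OF low cod])
  have ind: "induced_morphism A x ?G ?G2 ?b S' (charts F j' nd) S (charts (coarsen s l F) j nd) f"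
    unfolding induced_morphism_def case_prod_conv leaves_tree[OF F cod] ball_simps
  proof (intro conjI ballI)
    show "morphism_over A S' S f" using mor unfolding DFS_morphism_def by blast
    fix D g assume D: "D \<in> F" and g: "g \<in> carrier (Coord S)"
    obtain E where E: "E \<in> coarsen s l F" "?b (lf nd D) = lf nd E" using blow_lf[OF low cod D] by blast
    note DA = famD[OF F D] and EA = famD[OF F2 E(1)]
    have fg: "f g \<in> carrier (Coord S')" by (rule ring_hom_closed[OF f(1) g])
    have "j g \<in> R D" using model_memR[OF m' fg D] f(2)[OF g] by simp
    then have "\<Lambda> (charts F j' nd (lf nd D) (f g)) = \<Psi> D (j g)"
      using \<Lambda>_coord[OF DA] f(2)[OF g] unfolding charts_lf[OF m' cod D] by simp
    moreover have "\<Lambda> (charts (coarsen s l F) j nd (lf nd E) g) = \<Psi> E (j g)"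
      using \<Lambda>_coord[OF EA model_memR[OF m g E(1)]] unfolding charts_lf[OF m cod2 E(1)] .
    ultimately show "\<Lambda> (charts F j' nd (lf nd D) (f g)) =
        \<chi> (level (tree (coarsen s l F) nd) (?b (lf nd D))) (label (coarsen s l F) nd (?b (lf nd D)))
          (level (tree F nd) (lf nd D)) (label F nd (lf nd D))
          (\<Lambda> (charts (coarsen s l F) j nd (?b (lf nd D)) g))"
      unfolding E(2) unfolding level_lf[OF F cod D] label_lf[OF F cod D] level_lf[OF F2 cod2 E(1)]
        label_lf[OF F2 cod2 E(1)] \<Psi>_def
      using \<chi>_trans[OF A.zero_closed EA DA model_closedK[OF m g]] by simp
  qed
  show ?thesis
    unfolding fibered_modification_def
    by (intro conjI exI ballI, rule mor, rule blow, rule model_glued[OF m' cod], rule model_glued[OF m cod2],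
        rule ind, rule isomorphism_over_id, rule isomorphism_over_id, simp)
qed

text \<open>Only the carrier changes while the operations stay those of \<open>S\<close>, so
  inclusions between such rings have \<open>id\<close> as comorphism and everything stays on one
  type.\<close>

definition subsurface :: "('a, 'b) aff \<Rightarrow> ('b \<Rightarrow> nat \<Rightarrow> ('a \<times> 'a) set) \<Rightarrow> ('a \<times> nat) set \<Rightarrow> ('a, 'b) aff" where
  "subsurface S j G = S\<lparr>Coord := (Coord S)\<lparr>carrier := {b \<in> carrier (Coord S). j b \<in> B G}\<rparr>\<rparr>"

lemma subsurface_self: "model S F j \<Longrightarrow> subsurface S j F = S"
proof -
  assume m: "model S F j"
  have "{b \<in> carrier (Coord S). j b \<in> B F} = carrier (Coord S)" using model_closed[OF m] by blast
  then show ?thesis unfolding subsurface_def by simp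
qed

lemma subsurface_model:
  assumes m: "model S F j" and G: "fam G" "B G \<subseteq> B F"
  shows "model (subsurface S j G) G j"
proof -
  interpret j: ring_hom_cring "Coord S" K j by (rule model_ring_hom_cring[OF m])
  let ?H = "{b \<in> carrier (Coord S). j b \<in> B G}"
  have sub: "subring ?H (Coord S)"
  proof (rule j.R.subringI)
    show "\<one>\<^bsub>Coord S\<^esub> \<in> ?H" using B_one[OF G(1)] by simp
  qed (auto simp: B_neg[OF G(1)] B_mult[OF G(1)] B_add[OF G(1)])
  have str: "str S a \<in> ?H" if "a \<in> carrier A" for a
    using that model_str_closed[OF m] model_str[OF m] c_B[OF G(1)] by simp
  have im: "j ` ?H = B G"
  proof
    show "B G \<subseteq> j ` ?H"
    proof
      fix y assume y: "y \<in> B G"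
      then obtain b where "b \<in> carrier (Coord S)" "j b = y" using model_preimage[OF m] G(2) by blast
      then show "y \<in> j ` ?H" using y by blast
    qed
  qed blast
  have "cring ((Coord S)\<lparr>carrier := ?H\<rparr>)"
    using j.R.subcring_iff[of ?H] j.R.subcringI'[OF sub] by blast
  moreover have "str S \<in> ring_hom A ((Coord S)\<lparr>carrier := ?H\<rparr>)"
    using model_str_hom[OF m] str by (auto simp: ring_hom_def)
  moreover have "j \<in> ring_hom ((Coord S)\<lparr>carrier := ?H\<rparr>) K"
    using model_hom[OF m] by (auto simp: ring_hom_def)
  moreover have "inj_on j ?H" by (rule inj_on_subset[OF model_inj[OF m]]) blast
  ultimately show ?thesis
    unfolding model_def subsurface_def affine_over_def using G(1) im model_str[OF m] by simp
qed

text \<open>Induction on the sum of the levels, with one merge inside a disc of \<open>F\<close> per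
  step. It stops when the rings agree, not the families: \<open>subsurface\<close> depends on the
  family only through its ring.\<close>

lemma subsurface_chain:
  fixes S' :: "('a, 'c) aff"
  assumes m': "model S' F' j'" and F: "fam F"
  shows "fam G \<Longrightarrow> B G \<subseteq> B F' \<Longrightarrow> covers G F \<Longrightarrow> fibered_modifications A x S' (subsurface S' j' G) id \<Longrightarrow>
    fibered_modifications A x S' (subsurface S' j' F) id"
proof (induct "sum snd G" arbitrary: G rule: less_induct)
  case less
  show ?case
  proof (cases "B G = B F")
    case True
    then show ?thesis using less.prems(4) unfolding subsurface_def by simp
  next
    case False
    obtain s l where sl: "lowest s l G" "covers (coarsen s l G) F"
      by (rule covers_lowest[OF less.prems(1) F less.prems(3) False])
    note fam = fam_coarsen[OF sl(1)] and sub = B_coarsen_subset[OF sl(1)]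
    have subF: "B (coarsen s l G) \<subseteq> B F'" using sub less.prems(2) by blast
    note m1 = subsurface_model[OF m' less.prems(1,2)] and m2 = subsurface_model[OF m' fam subF]
    have "id \<in> ring_hom (Coord (subsurface S' j' (coarsen s l G))) (Coord (subsurface S' j' G))"
      unfolding subsurface_def using sub by (auto simp: ring_hom_def)
    then have "fibered_modification A x (subsurface S' j' G) (subsurface S' j' (coarsen s l G)) id"
      by (rule coarsen_fibered_modification[OF m1 m2 sl(1)]) simp
    then have "fibered_modifications A x S' (subsurface S' j' (coarsen s l G)) (id \<circ> id)"
      by (rule fibered_modifications.step[OF less.prems(4)])
    then show ?thesis
      using less.hyps[OF sum_levels_coarsen[OF sl(1)] fam subF sl(2)] by simp
  qed
qed

theorem DFS_morphism_factorization:
  fixes S' :: "('a, 'c) aff" and S :: "('a, 'b) aff"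
  assumes "DFS_morphism A x S' S \<beta>"
  shows "\<exists>(S'' :: ('a, 'c) aff) f u. fibered_modifications A x S' S'' f \<and>
    DFS_morphism A x S'' S u \<and> open_embedding S'' S u \<and> (\<forall>b \<in> carrier (Coord S). \<beta> b = f (u b))"
proof -
  obtain j' F' F where m': "model S' F' j'" and m: "model S F (\<lambda>b. j' (\<beta> b))"
    by (rule DFS_morphism_models[OF assms]) (rule that)
  have \<beta>: "\<beta> \<in> ring_hom (Coord S) (Coord S')"
    using assms unfolding DFS_morphism_def morphism_over_def by blast
  note fam' = model_fam[OF m'] and fam = model_fam[OF m]
  have sub: "B F \<subseteq> B F'"
  proof
    fix y assume "y \<in> B F"
    then obtain b where "b \<in> carrier (Coord S)" "j' (\<beta> b) = y" using model_preimage[OF m] by blast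
    then show "y \<in> B F'" using model_closed[OF m' ring_hom_closed[OF \<beta>]] by blast
  qed
  define G where "G = {E \<in> F. \<exists>D\<in>F'. le D E}"
  have ref: "\<exists>E\<in>F. le D E" if "D \<in> F'" for D by (rule refines[OF fam fam' sub that])
  have GF: "G \<subseteq> F" unfolding G_def by blast
  have "F' \<noteq> {}" using fam' unfolding fam_def by blast
  then have "G \<noteq> {}" using ref unfolding G_def by blast
  then have famG: "fam G" by (rule fam_subset[OF fam GF])
  have cov: "covers F' G" unfolding covers_def G_def using ref by blast
  have BG: "B G \<subseteq> B F'"
  proof
    fix y assume y: "y \<in> B G"
    have "y \<in> R D" if D: "D \<in> F'" for D
    proof -
      obtain E where E: "E \<in> G" "le D E" using cov D unfolding covers_def by blast
      show ?thesis using le_imp_subset[OF famD[OF famG E(1)] famD[OF fam' D] E(2)] B_memD[OF y E(1)] by blast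
    qed
    then show "y \<in> B F'" unfolding B_def by blast
  qed
  let ?S = "subsurface S' j' G"
  have "fibered_modifications A x S' (subsurface S' j' F') id"
    unfolding subsurface_self[OF m'] by (rule fibered_modifications.none)
  then have chain: "fibered_modifications A x S' ?S id"
    by (rule subsurface_chain[OF m' famG fam' order_refl cov])
  have mG: "model ?S G j'" by (rule subsurface_model[OF m' famG BG])
  \<comment> \<open>The comorphism of the open embedding is \<open>\<beta>\<close> itself with a
    smaller target: fewer discs mean a larger intersection, so \<open>B F\<close> is contained in
    \<open>B G\<close>.\<close>
  have "j' (\<beta> b) \<in> B G" if "b \<in> carrier (Coord S)" for b
    using model_closed[OF m that] GF unfolding B_def by blast
  then have \<beta>G: "\<beta> \<in> ring_hom (Coord S) (Coord ?S)"
    using \<beta> unfolding subsurface_def by (auto simp: ring_hom_def)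
  have mor: "DFS_morphism A x ?S S \<beta>" by (rule models_morphism[OF mG m \<beta>G refl])
  obtain y where y: "y \<in> B F" "\<And>D. D \<in> F \<Longrightarrow> \<rho> D y = (if D \<in> G then \<one>\<^bsub>P\<^esub> else \<zero>\<^bsub>P\<^esub>)"
    by (rule idempotent[OF fam, of G]) (rule that)
  obtain e where e: "e \<in> carrier (Coord S)" "j' (\<beta> e) = y" using model_preimage[OF m y(1)] by blast
  have "open_immersion (Coord S) (Coord ?S) \<beta>"
    by (rule model_localizing(1)[OF m GF \<open>G \<noteq> {}\<close> model_domain[OF mG] model_hom[OF mG] model_inj[OF mG]
        model_image[OF mG] \<beta>G refl e(1)]) (use y(2) e(2) in simp)
  then have "open_embedding ?S S \<beta>" unfolding open_embedding_def .
  then show ?thesis using chain mor by (intro exI[of _ ?S] exI[of _ id] exI[of _ \<beta>]) simp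
qed

end

section \<open>The two kinds of base\<close>

lemma dfs_base_dvr:
  assumes "discrete_valuation_ring A" "uniformizing_parameter A x"
  shows "dfs_base A x"
proof -
  have "principal_domain A" and nf: "\<not> field A" using assms(1) unfolding discrete_valuation_ring_def by blast+
  then interpret A: principal_domain A by blast
  have x: "x \<in> carrier A" "maximalideal (PIdl\<^bsub>A\<^esub> x) A" using assms(2) unfolding uniformizing_parameter_def by blast+
  show ?thesis
  proof (intro dfs_base.intro dfs_base_axioms.intro A.domain_axioms x)
    show "x \<noteq> \<zero>\<^bsub>A\<^esub>"
    proof
      assume "x = \<zero>\<^bsub>A\<^esub>"
      then have "PIdl\<^bsub>A\<^esub> x = {\<zero>\<^bsub>A\<^esub>}" unfolding cgenideal_def by (auto intro!: exI[of _ "\<zero>\<^bsub>A\<^esub>"])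
      then show False using x(2) A.zeromaximalideal_eq_field nf by simp
    qed
  qed
qed

text \<open>Modulo the variable every polynomial is a constant, so an ideal strictly larger than the
  one generated by the variable contains a nonzero constant, which is a unit.\<close>

lemma dfs_base_polynomial:
  assumes "field k" "cring A" and h: "h \<in> ring_iso (UP k) A"
  shows "dfs_base A (h (up_ring.monom (UP k) \<one>\<^bsub>k\<^esub> 1))"
proof -
  interpret k: field k by fact
  interpret A: cring A by fact
  interpret Q: UP_domain k "UP k" by unfold_locales simp
  have hom: "h \<in> ring_hom (UP k) A" and bij: "bij_betw h (carrier (UP k)) (carrier A)"
    using h unfolding ring_iso_def by blast+
  interpret h: ring_hom_cring "UP k" A h by (rule UnivPoly.ring_hom_cringI[OF Q.P.is_cring A.is_cring hom])
  define X where "X = up_ring.monom (UP k) \<one>\<^bsub>k\<^esub> 1"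
  have X: "X \<in> carrier (UP k)" unfolding X_def by simp
  have inj: "p = q" if "h p = h q" "p \<in> carrier (UP k)" "q \<in> carrier (UP k)" for p q
    using bij that unfolding bij_betw_def inj_on_def by blast
  have surj: "\<exists>p\<in>carrier (UP k). a = h p" if "a \<in> carrier A" for a
    using bij that unfolding bij_betw_def by blast
  have dom: "domain A"
    using domain.ring_iso_imp_img_domain[OF Q.UP_domain h] h.hom_zero by simp
  have coeff1: "X \<noteq> monom (UP k) a 0" if "a \<in> carrier k" for a
  proof
    assume "X = monom (UP k) a 0"
    then have "coeff (UP k) X 1 = coeff (UP k) (monom (UP k) a 0) 1" by simp
    then show False unfolding X_def using that by simp
  qed
  have nz: "h X \<noteq> \<zero>\<^bsub>A\<^esub>"
  proof
    assume "h X = \<zero>\<^bsub>A\<^esub>"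
    then have "X = \<zero>\<^bsub>UP k\<^esub>" using inj[of X "\<zero>\<^bsub>UP k\<^esub>"] X by simp
    then show False using coeff1[of "\<zero>\<^bsub>k\<^esub>"] by simp
  qed
  have decomp: "\<exists>a\<in>carrier k. \<exists>q\<in>carrier (UP k). p = monom (UP k) a 0 \<oplus>\<^bsub>UP k\<^esub> X \<otimes>\<^bsub>UP k\<^esub> q"
    if "p \<in> carrier (UP k)" for p
    using that
  proof (induct rule: Q.UP_Horner_induct)
    case zero
    show ?case by (intro bexI[of _ "\<zero>\<^bsub>k\<^esub>"] bexI[of _ "\<zero>\<^bsub>UP k\<^esub>"]) (simp_all add: X)
  next
    case (step a q)
    then show ?case unfolding X_def by blast
  qed
  have max: "maximalideal (PIdl\<^bsub>A\<^esub> (h X)) A"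
  proof (rule maximalidealI)
    show "ideal (PIdl\<^bsub>A\<^esub> (h X)) A" by (rule A.cgenideal_ideal) (simp add: X)
    show "carrier A \<noteq> PIdl\<^bsub>A\<^esub> (h X)"
    proof
      assume "carrier A = PIdl\<^bsub>A\<^esub> (h X)"
      then have "\<one>\<^bsub>A\<^esub> \<in> PIdl\<^bsub>A\<^esub> (h X)" using A.one_closed by blast
      then obtain a where a: "a \<in> carrier A" "\<one>\<^bsub>A\<^esub> = a \<otimes>\<^bsub>A\<^esub> h X" unfolding cgenideal_def by blast
      obtain q where q: "q \<in> carrier (UP k)" "a = h q" using surj[OF a(1)] by blast
      have "h (X \<otimes>\<^bsub>UP k\<^esub> q) = h \<one>\<^bsub>UP k\<^esub>" using a(2) q X A.m_comm by simp
      then have "X \<otimes>\<^bsub>UP k\<^esub> q = \<one>\<^bsub>UP k\<^esub>" by (rule inj) (simp_all add: X q)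
      then show False using Q.UP_unit_const[OF X q(1)] coeff1 by blast
    qed
    fix J assume J: "ideal J A" "PIdl\<^bsub>A\<^esub> (h X) \<subseteq> J" "J \<subseteq> carrier A"
    interpret J: ideal J A by fact
    show "J = PIdl\<^bsub>A\<^esub> (h X) \<or> J = carrier A"
    proof (cases "J \<subseteq> PIdl\<^bsub>A\<^esub> (h X)")
      case True
      then show ?thesis using J(2) by blast
    next
      case False
      then obtain b where b: "b \<in> J" "b \<notin> PIdl\<^bsub>A\<^esub> (h X)" by blast
      obtain p where p: "p \<in> carrier (UP k)" "b = h p" using surj b(1) J(3) by blast
      obtain a q where aq: "a \<in> carrier k" "q \<in> carrier (UP k)" "p = monom (UP k) a 0 \<oplus>\<^bsub>UP k\<^esub> X \<otimes>\<^bsub>UP k\<^esub> q"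
        using decomp[OF p(1)] by blast
      let ?a = "h (monom (UP k) a 0)"
      have ac: "?a \<in> carrier A" "h X \<in> carrier A" "h q \<in> carrier A" using aq X by simp_all
      have b_eq: "b = ?a \<oplus>\<^bsub>A\<^esub> h q \<otimes>\<^bsub>A\<^esub> h X" unfolding p(2) aq(3) using aq X A.m_comm by simp
      have hq: "h q \<otimes>\<^bsub>A\<^esub> h X \<in> PIdl\<^bsub>A\<^esub> (h X)" unfolding cgenideal_def using ac by blast
      have "a \<noteq> \<zero>\<^bsub>k\<^esub>"
      proof
        assume "a = \<zero>\<^bsub>k\<^esub>"
        then have "b = h q \<otimes>\<^bsub>A\<^esub> h X" using b_eq ac by simp
        then show False using b(2) hq by simp
      qed
      then have inv: "inv\<^bsub>k\<^esub> a \<in> carrier k" "inv\<^bsub>k\<^esub> a \<otimes>\<^bsub>k\<^esub> a = \<one>\<^bsub>k\<^esub>" using aq(1) k.field_Units by auto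
      have "?a = b \<ominus>\<^bsub>A\<^esub> h q \<otimes>\<^bsub>A\<^esub> h X" unfolding b_eq using ac by algebra
      also have "\<dots> \<in> J" unfolding A.minus_eq using b(1) hq J(2) by (intro J.a_closed J.a_inv_closed) blast+
      finally have "h (monom (UP k) (inv\<^bsub>k\<^esub> a) 0) \<otimes>\<^bsub>A\<^esub> ?a \<in> J" using inv(1) by (intro J.I_l_closed) simp_all
      moreover have "h (monom (UP k) (inv\<^bsub>k\<^esub> a) 0) \<otimes>\<^bsub>A\<^esub> ?a = \<one>\<^bsub>A\<^esub>"
      proof -
        have "monom (UP k) (inv\<^bsub>k\<^esub> a) 0 \<otimes>\<^bsub>UP k\<^esub> monom (UP k) a 0 = \<one>\<^bsub>UP k\<^esub>"
          using Q.monom_mult[OF inv(1) aq(1), of 0 0] inv(2) by (simp add: Q.monom_one)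
        then show ?thesis using inv(1) aq(1) h.hom_mult[of "monom (UP k) (inv\<^bsub>k\<^esub> a) 0" "monom (UP k) a 0"] by simp
      qed
      ultimately have "\<one>\<^bsub>A\<^esub> \<in> J" by simp
      then show ?thesis using J.one_imp_carrier by blast
    qed
  qed
  show ?thesis
    unfolding X_def[symmetric]
    by (intro dfs_base.intro dfs_base_axioms.intro dom nz max) (simp add: X)
qed

lemma base_pair_dfs_base: "field k \<Longrightarrow> base_pair k A x \<Longrightarrow> dfs_base A x"
  unfolding base_pair_def using dfs_base_dvr dfs_base_polynomial by metis

theorem theorem4p5:
  fixes k :: "('k, 'l) ring_scheme" and A :: "('a, 'm) ring_scheme" and x :: 'a
    and S' :: "('a, 'c) aff" and S :: "('a, 'b) aff" and \<beta> :: "'b \<Rightarrow> 'c"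
  assumes "field_char_zero k"
    and "base_pair k A x"
    and "DFS_morphism A x S' S \<beta>"
  shows "\<exists>(S'' :: ('a, 'c) aff) f u.
    fibered_modifications A x S' S'' f \<and>
    DFS_morphism A x S'' S u \<and> open_embedding S'' S u \<and>
    (\<forall>b \<in> carrier (Coord S). \<beta> b = f (u b))"
proof -
  have "field k" using assms(1) unfolding field_char_zero_def by blast
  then interpret dfs_base A x by (rule base_pair_dfs_base[OF _ assms(2)])
  show ?thesis by (rule DFS_morphism_factorization[OF assms(3)])
qed

end
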